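(* Let $p$ be a prime, $n\ge1$, and let $f(x)=\sum_\alpha f_\alpha x^\alpha$ be a nonzero power series in $x=(x_1,\dots,x_n)$ with integer coefficients that converges on a neighborhood of the origin when viewed as a power series on $\mathbb{Q}_p^n$, with $f(0)=0$. For $a=(a_1,\dots,a_n)$ with each $a_i$ an integer, let $f_a(x_1,\dots,x_n)=f(p^{a_1}x_1,\dots,p^{a_n}x_n)$. With $N(f)$, $d(f)$, the central face of $N(f)$, $f_F$ and $o(F)$ as defined in the context (for the field $K=\mathbb{Q}_p$), let $h$ be the dimension of the central face of $N(f)$. There exists a constant $M>0$ depending on $f$ such that if $a_i>M$ for all $i$, then there is a constant $C>0$ depending on $a$, $f$ and $p$ such that the following hold for every positive integer $l$. (a) If $o(F)\le d(f)$ for all compact faces $F$ of $N(f)$, with $o(F)<d(f)$ whenever $F$ is a subset of the central face of $N(f)$, then $$\frac{1}{p^{ln}}\left|\sum_{x\in\{0,\dots,p^l-1\}^n}e^{2\pi i\frac{f_a(x)}{p^l}}\right|\le C\,l^{n-h-1}p^{-\frac{l}{d(f)}}.$$ (b) If $o(F)\le d(f)$ for all compact faces $F$ of $N(f)$, with $o(F)=d(f)$ for at least one compact face $F$ contained in the central face of $N(f)$, then $$\frac{1}{p^{ln}}\left|\sum_{x\in\{0,\dots,p^l-1\}^n}e^{2\pi i\frac{f_a(x)}{p^l}}\right|\le C\,l^{n-h}p^{-\frac{l}{d(f)}}.$$ (c) If $o(F)>d(f)$ for at least one compact face $F$ of $N(f)$, let $s(f)=\sup_F o(F)$ over all compact faces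 $F$ of $N(f)$. Then $$\frac{1}{p^{ln}}\left|\sum_{x\in\{0,\dots,p^l-1\}^n}e^{2\pi i\frac{f_a(x)}{p^l}}\right|\le C\,p^{-\frac{l}{s(f)}}.$$
   Context: Newton polyhedron: for each multi-index $\alpha$ with $f_\alpha\neq 0$ let $Q_\alpha=\{t\in\mathbb{R}^n: t_i\ge\alpha_i \text{ for all } i\}$. The Newton polyhedron $N(f)$ is the convex hull of the union of all these $Q_\alpha$. Its faces have various dimensions and may be compact or unbounded; a vertex is considered a compact face of dimension $0$. For a compact face $F$ of $N(f)$, $f_F(x)=\sum_{\alpha\in F} f_\alpha x^\alpha$ (a polynomial). $o(F)$ denotes the maximum order of any zero of $f_F$ in $(\mathbb{Q}_p\setminus\{0\})^n$ (the order of a zero is the smallest order of a partial derivative of $f_F$ that does not vanish at that point; $o(F)=0$ if $f_F$ has no zero there). Newton distance: $d(f)=\inf\{t: (t,t,\dots,t)\in N(f)\}$. Central face: the face of $N(f)$ of minimal dimension intersecting the line $t_1=t_2=\dots=t_n$ (it is the intersection of all faces of $N(f)$ meeting this line). For integer $x$, the value $f_a(x)$ is the sum of the series in $\mathbb{Q}_p$, which is an element of $\mathbb{Z}_p$; $e^{2\pi i f_a(x)/p^l}$ means $e^{2\pi i c/p^l}$ for any integer $c$ with $c\equiv f_a(x)$ modulo $p^l\mathbb{Z}_p$ (the ordinary exponential when $f$ is a polynomial). *)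

theory Defs
  imports
    "HOL-Analysis.Analysis"
    "Berlekamp_Zassenhaus.Finite_Field"
begin

section \<open>The field of p-adic numbers\<close>

text \<open>
  The prime is carried by a type \<^typ>\<open>'p\<close> of class \<^class>\<open>prime_card\<close>: it is \<open>p = CARD('p)\<close>.
  The field of p-adic numbers is the completion of the rationals: rational sequences that are
  Cauchy for the p-adic absolute value, modulo those that tend to \<open>0\<close>.
\<close>

definition padic_abs_int :: "nat \<Rightarrow> int \<Rightarrow> real" where
  "padic_abs_int p a = (if a = 0 then 0 else 1 / real p ^ multiplicity (int p) a)"

definition padic_abs :: "nat \<Rightarrow> rat \<Rightarrow> real" where
  "padic_abs p q = (case quotient_of q of (a, b) \<Rightarrow> padic_abs_int p a / padic_abs_int p b)"

context
  fixes p :: nat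
  assumes p: "prime p"
begin

lemma padic_abs_int_mult: "padic_abs_int p (a * b) = padic_abs_int p a * padic_abs_int p b"
  using p by (auto simp: padic_abs_int_def prime_elem_multiplicity_mult_distrib power_add)

lemma padic_abs_int_eq_0_iff: "padic_abs_int p a = 0 \<longleftrightarrow> a = 0"
  using p by (auto simp: padic_abs_int_def prime_gt_0_nat)

lemma padic_abs_int_nonneg: "padic_abs_int p a \<ge> 0"
  by (auto simp: padic_abs_int_def)

lemma padic_abs_int_le_iff: "padic_abs_int p a \<le> 1 / real p ^ k \<longleftrightarrow> int p ^ k dvd a"
proof (cases "a = 0")
  case False
  have "p > 1" using p prime_gt_1_nat by blast
  hence "padic_abs_int p a \<le> 1 / real p ^ k \<longleftrightarrow> k \<le> multiplicity (int p) a"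
    using False by (simp add: padic_abs_int_def field_simps)
  also have "\<dots> \<longleftrightarrow> int p ^ k dvd a"
    using False \<open>p > 1\<close> by (subst power_dvd_iff_le_multiplicity) auto
  finally show ?thesis .
qed (auto simp: padic_abs_int_def)

lemma padic_abs_int_add: "padic_abs_int p (a + b) \<le> max (padic_abs_int p a) (padic_abs_int p b)"
proof -
  have *: "padic_abs_int p (a + b) \<le> padic_abs_int p b"
    if "padic_abs_int p a \<le> padic_abs_int p b" for a b
  proof (cases "b = 0")
    case True
    thus ?thesis using that padic_abs_int_nonneg[of a] padic_abs_int_eq_0_iff[of a]
      by (auto simp: padic_abs_int_def)
  next
    case False
    define k where "k = multiplicity (int p) b"
    have b: "padic_abs_int p b = 1 / real p ^ k" using False by (simp add: padic_abs_int_def k_def)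
    have "int p ^ k dvd a + b"
      using that padic_abs_int_le_iff[of a k] padic_abs_int_le_iff[of b k] by (auto simp: b)
    thus ?thesis using padic_abs_int_le_iff[of "a + b" k] by (simp add: b)
  qed
  show ?thesis
    using *[of a b] *[of b a] by (cases "padic_abs_int p a \<le> padic_abs_int p b") (auto simp: add_ac)
qed

lemma padic_abs_of_int_divide:
  assumes "b \<noteq> 0"
  shows "padic_abs p (of_int a / of_int b) = padic_abs_int p a / padic_abs_int p b"
proof -
  obtain c d where cd: "quotient_of (of_int a / of_int b) = (c, d)" by fastforce
  have "d > 0" using quotient_of_denom_pos[OF cd] .
  have "rat_of_int a / of_int b = of_int c / of_int d" by (rule quotient_of_div[OF cd])
  hence "rat_of_int (a * d) = of_int (c * b)" using assms \<open>d > 0\<close> by (simp add: field_simps)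
  hence "a * d = c * b" by (simp only: of_int_eq_iff)
  hence "padic_abs_int p a * padic_abs_int p d = padic_abs_int p c * padic_abs_int p b"
    by (metis padic_abs_int_mult)
  thus ?thesis using assms \<open>d > 0\<close>
    by (simp add: padic_abs_def cd field_simps padic_abs_int_eq_0_iff)
qed

lemma padic_abs_of_int: "padic_abs p (of_int a) = padic_abs_int p a"
  using padic_abs_of_int_divide[of 1 a] by (simp add: padic_abs_int_def)

lemma rat_fraction: obtains a b :: int where "b \<noteq> 0" "q = rat_of_int a / of_int b"
  by (metis quotient_of_denom_pos quotient_of_div less_irrefl surj_pair)

lemma rat_fraction2:
  obtains a b c :: int where "c \<noteq> 0" "q = rat_of_int a / of_int c" "r = rat_of_int b / of_int c"
proof -
  obtain a b where q: "b \<noteq> 0" "q = rat_of_int a / of_int b" by (rule rat_fraction)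
  obtain c d where r: "d \<noteq> 0" "r = rat_of_int c / of_int d" by (rule rat_fraction)
  show ?thesis
    by (rule that[of "b * d" "a * d" "c * b"]) (use q r in \<open>auto simp: field_simps\<close>)
qed

lemma padic_abs_nonneg: "padic_abs p q \<ge> 0"
  by (auto simp: padic_abs_def padic_abs_int_nonneg split: prod.splits)

lemma padic_abs_0: "padic_abs p 0 = 0"
  by (simp add: padic_abs_def padic_abs_int_def)

lemma padic_abs_1: "padic_abs p 1 = 1"
  by (simp add: padic_abs_def padic_abs_int_def)

lemma padic_abs_mult: "padic_abs p (q * r) = padic_abs p q * padic_abs p r"
proof -
  obtain a b where q: "b \<noteq> 0" "q = rat_of_int a / of_int b" by (rule rat_fraction)
  obtain c d where r: "d \<noteq> 0" "r = rat_of_int c / of_int d" by (rule rat_fraction)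
  have "q * r = of_int (a * c) / of_int (b * d)" by (simp add: q r)
  thus ?thesis using q r
    by (metis (no_types, opaque_lifting) mult_eq_0_iff padic_abs_int_mult padic_abs_of_int_divide
        times_divide_times_eq)
qed

lemma padic_abs_add: "padic_abs p (q + r) \<le> max (padic_abs p q) (padic_abs p r)"
proof -
  obtain a b c where *: "c \<noteq> 0" "q = rat_of_int a / of_int c" "r = rat_of_int b / of_int c"
    by (rule rat_fraction2)
  have "q + r = of_int (a + b) / of_int c" by (simp add: * add_divide_distrib)
  hence "padic_abs p (q + r) = padic_abs_int p (a + b) / padic_abs_int p c"
    using * padic_abs_of_int_divide by metis
  also have "\<dots> \<le> max (padic_abs_int p a) (padic_abs_int p b) / padic_abs_int p c"
    by (intro divide_right_mono padic_abs_int_add padic_abs_int_nonneg)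
  also have "\<dots> = max (padic_abs p q) (padic_abs p r)"
    using padic_abs_int_nonneg[of c] *
    by (auto simp: padic_abs_of_int_divide max_def divide_right_mono
        padic_abs_int_eq_0_iff divide_le_cancel)
  finally show ?thesis .
qed

lemma padic_abs_eq_0_iff: "padic_abs p q = 0 \<longleftrightarrow> q = 0"
proof -
  obtain a b where "b \<noteq> 0" "q = rat_of_int a / of_int b" by (rule rat_fraction)
  thus ?thesis by (simp add: padic_abs_of_int_divide padic_abs_int_eq_0_iff)
qed

lemma padic_abs_minus: "padic_abs p (- q) = padic_abs p q"
proof -
  have "padic_abs p (-1) * padic_abs p (-1) = 1"
    using padic_abs_mult[of "-1" "-1"] by (simp add: padic_abs_1)
  hence "padic_abs p (-1) = 1"
    using padic_abs_nonneg[of "-1"] by (auto simp: square_eq_1_iff)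
  thus ?thesis using padic_abs_mult[of "-1" q] by simp
qed

lemma padic_abs_inverse: "padic_abs p (inverse q) = inverse (padic_abs p q)"
  by (metis inverse_unique inverse_zero padic_abs_0 padic_abs_1 padic_abs_mult right_inverse)

lemma padic_abs_triangle: "padic_abs p (q + r) \<le> padic_abs p q + padic_abs p r"
  using padic_abs_add[of q r] padic_abs_nonneg[of q] padic_abs_nonneg[of r] by linarith

lemma padic_abs_diff_commute: "padic_abs p (q - r) = padic_abs p (r - q)"
  by (metis minus_diff_eq padic_abs_minus)

lemma padic_abs_triangle_rev: "\<bar>padic_abs p q - padic_abs p r\<bar> \<le> padic_abs p (q - r)"
  using padic_abs_triangle[of "q - r" r] padic_abs_triangle[of "r - q" q]
  by (simp add: padic_abs_diff_commute[of r q] abs_le_iff)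

end

definition padic_Cauchy :: "nat \<Rightarrow> (nat \<Rightarrow> rat) \<Rightarrow> bool" where
  "padic_Cauchy p X \<longleftrightarrow>
     (\<forall>e>0. \<exists>N. \<forall>m\<ge>N. \<forall>n\<ge>N. padic_abs p (X m - X n) < e)"

definition padic_null :: "nat \<Rightarrow> (nat \<Rightarrow> rat) \<Rightarrow> bool" where
  "padic_null p X \<longleftrightarrow> (\<lambda>n. padic_abs p (X n)) \<longlonglongrightarrow> 0"

lemma padic_Cauchy_altdef:
  assumes "prime p"
  shows "padic_Cauchy p X \<longleftrightarrow>
    ((\<lambda>(m, n). padic_abs p (X m - X n)) \<longlongrightarrow> 0) (sequentially \<times>\<^sub>F sequentially)"
  by (simp add: padic_Cauchy_def tendsto_iff eventually_prod_sequentially dist_real_def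
      abs_of_nonneg padic_abs_nonneg[OF assms]) blast

context
  fixes p :: nat
  assumes p: "prime p"
begin

lemma padic_CauchyI:
  assumes "\<And>m n. padic_abs p (X m - X n) \<le> f (m, n)"
  assumes "(f \<longlongrightarrow> 0) (sequentially \<times>\<^sub>F sequentially)"
  shows "padic_Cauchy p X"
  unfolding padic_Cauchy_altdef[OF p]
  by (rule tendsto_sandwich[OF _ _ tendsto_const assms(2)])
     (auto simp: padic_abs_nonneg[OF p] intro!: always_eventually assms(1))

lemma padic_CauchyD:
  "padic_Cauchy p X \<Longrightarrow>
    ((\<lambda>(m, n). padic_abs p (X m - X n)) \<longlongrightarrow> 0) (sequentially \<times>\<^sub>F sequentially)"
  by (simp add: padic_Cauchy_altdef[OF p])

lemma padic_nullI:
  assumes "eventually (\<lambda>n. padic_abs p (X n) \<le> f n) sequentially" "f \<longlonglongrightarrow> 0"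
  shows "padic_null p X"
  unfolding padic_null_def
  by (rule tendsto_sandwich[OF _ _ tendsto_const assms(2)])
     (use assms(1) padic_abs_nonneg[OF p] in auto)

lemma padic_Cauchy_const: "padic_Cauchy p (\<lambda>_. q)"
  by (simp add: padic_Cauchy_def padic_abs_0[OF p])

lemma padic_Cauchy_minus: "padic_Cauchy p X \<Longrightarrow> padic_Cauchy p (\<lambda>n. - X n)"
proof -
  have "- a - - b = - (a - b)" for a b :: rat by simp
  thus "padic_Cauchy p X \<Longrightarrow> padic_Cauchy p (\<lambda>n. - X n)"
    unfolding padic_Cauchy_def by (simp only: padic_abs_minus[OF p])
qed

lemma padic_Cauchy_add:
  assumes "padic_Cauchy p X" "padic_Cauchy p Y"
  shows "padic_Cauchy p (\<lambda>n. X n + Y n)"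
proof (rule padic_CauchyI)
  show "padic_abs p ((X m + Y m) - (X n + Y n)) \<le>
    (\<lambda>z. (case z of (m, n) \<Rightarrow> padic_abs p (X m - X n)) + (case z of (m, n) \<Rightarrow> padic_abs p (Y m - Y n))) (m, n)"
    for m n using padic_abs_triangle[OF p, of "X m - X n" "Y m - Y n"] by (simp add: algebra_simps)
qed (rule tendsto_add_zero[OF padic_CauchyD[OF assms(1)] padic_CauchyD[OF assms(2)]])

lemma padic_Cauchy_convergent:
  assumes "padic_Cauchy p X"
  shows "convergent (\<lambda>n. padic_abs p (X n))"
  unfolding Cauchy_convergent_iff[symmetric] Cauchy_def dist_real_def
  using assms padic_abs_triangle_rev[OF p] unfolding padic_Cauchy_def by (meson le_less_trans)

lemma padic_Cauchy_bounded:
  assumes "padic_Cauchy p X"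
  shows "\<exists>B>0. \<forall>n. padic_abs p (X n) \<le> B"
proof -
  have "Bseq (\<lambda>n. padic_abs p (X n))"
    using padic_Cauchy_convergent[OF assms] by (rule convergent_imp_Bseq)
  thus ?thesis by (simp add: Bseq_def abs_of_nonneg padic_abs_nonneg[OF p])
qed

lemma padic_Cauchy_mult:
  assumes X: "padic_Cauchy p X" and Y: "padic_Cauchy p Y"
  shows "padic_Cauchy p (\<lambda>n. X n * Y n)"
proof -
  obtain A where A: "A > 0" "\<And>n. padic_abs p (X n) \<le> A" using padic_Cauchy_bounded[OF X] by blast
  obtain B where B: "B > 0" "\<And>n. padic_abs p (Y n) \<le> B" using padic_Cauchy_bounded[OF Y] by blast
  define g where "g = (\<lambda>z. B * (case z of (m, n) \<Rightarrow> padic_abs p (X m - X n))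
     + A * (case z of (m, n) \<Rightarrow> padic_abs p (Y m - Y n)))"
  have "padic_abs p (X m * Y m - X n * Y n) \<le> g (m, n)" for m n
  proof -
    have "X m * Y m - X n * Y n = Y m * (X m - X n) + X n * (Y m - Y n)"
      by (simp add: algebra_simps)
    also have "padic_abs p \<dots> \<le> padic_abs p (Y m) * padic_abs p (X m - X n)
        + padic_abs p (X n) * padic_abs p (Y m - Y n)"
      using padic_abs_triangle[OF p] by (simp add: padic_abs_mult[OF p] flip: padic_abs_mult[OF p])
    also have "\<dots> \<le> g (m, n)"
      unfolding g_def
      using A B by (simp add: add_mono mult_right_mono padic_abs_nonneg[OF p])
    finally show ?thesis .
  qed
  moreover have "(g \<longlongrightarrow> 0) (sequentially \<times>\<^sub>F sequentially)"
    unfolding g_def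
    by (intro tendsto_add_zero tendsto_mult_right_zero padic_CauchyD X Y)
  ultimately show ?thesis by (rule padic_CauchyI)
qed

lemma padic_null_add:
  assumes "padic_null p X" "padic_null p Y"
  shows "padic_null p (\<lambda>n. X n + Y n)"
  by (rule padic_nullI[of _ "\<lambda>n. padic_abs p (X n) + padic_abs p (Y n)"])
     (use assms padic_abs_triangle[OF p] in
        \<open>auto simp: padic_null_def intro: tendsto_add_zero\<close>)

lemma padic_null_minus: "padic_null p X \<Longrightarrow> padic_null p (\<lambda>n. - X n)"
  by (simp add: padic_null_def padic_abs_minus[OF p])

lemma padic_null_mult:
  assumes X: "padic_Cauchy p X" and Y: "padic_null p Y"
  shows "padic_null p (\<lambda>n. X n * Y n)"
proof -
  obtain A where A: "A > 0" "\<And>n. padic_abs p (X n) \<le> A" using padic_Cauchy_bounded[OF X] by blast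
  show ?thesis
  proof (rule padic_nullI)
    show "\<forall>\<^sub>F n in sequentially. padic_abs p (X n * Y n) \<le> A * padic_abs p (Y n)"
      using A by (simp add: padic_abs_mult[OF p] mult_right_mono padic_abs_nonneg[OF p])
    show "(\<lambda>n. A * padic_abs p (Y n)) \<longlonglongrightarrow> 0"
      using Y by (auto simp: padic_null_def intro: tendsto_mult_right_zero)
  qed
qed

lemma padic_not_null:
  assumes X: "padic_Cauchy p X" and "\<not> padic_null p X"
  obtains r where "r > 0" "eventually (\<lambda>n. padic_abs p (X n) \<ge> r) sequentially"
proof -
  obtain L where L: "(\<lambda>n. padic_abs p (X n)) \<longlonglongrightarrow> L"
    using padic_Cauchy_convergent[OF X] by (auto simp: convergent_def)
  have "L \<ge> 0" using L by (rule LIMSEQ_le_const) (use padic_abs_nonneg[OF p] in auto)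
  moreover have "L \<noteq> 0" using assms(2) L by (auto simp: padic_null_def)
  ultimately have "L > 0" by simp
  hence "eventually (\<lambda>n. padic_abs p (X n) > L / 2) sequentially"
    by (intro order_tendstoD(1)[OF L]) auto
  hence "eventually (\<lambda>n. padic_abs p (X n) \<ge> L / 2) sequentially"
    by (rule eventually_mono) simp
  thus ?thesis using \<open>L > 0\<close> by (intro that[of "L / 2"]) auto
qed

lemma padic_Cauchy_inverse:
  assumes X: "padic_Cauchy p X" and nn: "\<not> padic_null p X"
  shows "padic_Cauchy p (\<lambda>n. inverse (X n))"
  unfolding padic_Cauchy_def
proof (intro allI impI)
  fix e :: real assume e: "e > 0"
  obtain r where r: "r > 0" "eventually (\<lambda>n. padic_abs p (X n) \<ge> r) sequentially"
    using padic_not_null[OF X nn] .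
  then obtain N where N: "\<And>n. n \<ge> N \<Longrightarrow> padic_abs p (X n) \<ge> r"
    by (auto simp: eventually_sequentially)
  have "e * r * r > 0" using e r by simp
  then obtain M where M: "\<And>m n. m \<ge> M \<Longrightarrow> n \<ge> M \<Longrightarrow> padic_abs p (X m - X n) < e * r * r"
    using X unfolding padic_Cauchy_def by meson
  have "padic_abs p (inverse (X m) - inverse (X n)) < e" if "m \<ge> max M N" "n \<ge> max M N" for m n
  proof -
    have ge: "padic_abs p (X m) \<ge> r" "padic_abs p (X n) \<ge> r" using N that by auto
    hence nz: "X m \<noteq> 0" "X n \<noteq> 0" using r padic_abs_0[OF p] by force+
    have "inverse (X m) - inverse (X n) = (X n - X m) * inverse (X m) * inverse (X n)"
      using nz by (simp add: field_simps)
    hence "padic_abs p (inverse (X m) - inverse (X n)) =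
        padic_abs p (X n - X m) / (padic_abs p (X m) * padic_abs p (X n))"
      by (simp only: padic_abs_mult[OF p] padic_abs_inverse[OF p]) (simp add: field_simps)
    also have "\<dots> \<le> padic_abs p (X n - X m) / (r * r)"
      using ge r by (intro divide_left_mono mult_mono padic_abs_nonneg[OF p] mult_pos_pos) auto
    also have "\<dots> < e"
      using M[of n m] that r by (simp add: field_simps)
    finally show ?thesis .
  qed
  thus "\<exists>N. \<forall>m\<ge>N. \<forall>n\<ge>N. padic_abs p (inverse (X m) - inverse (X n)) < e" by blast
qed

end

definition padic_equiv :: "'p::prime_card itself \<Rightarrow> ((nat \<Rightarrow> rat) \<times> (nat \<Rightarrow> rat)) set" where
  "padic_equiv P = {(X, Y). padic_Cauchy CARD('p) X \<and> padic_Cauchy CARD('p) Y \<and>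
     padic_null CARD('p) (\<lambda>n. X n - Y n)}"

lemma equiv_padic:
  "equiv {X. padic_Cauchy CARD('p) X} (padic_equiv TYPE('p::prime_card))"
proof (rule equivI)
  note pr = prime_card[where 'a = 'p]
  show "padic_equiv TYPE('p) \<subseteq> {X. padic_Cauchy CARD('p) X} \<times> {X. padic_Cauchy CARD('p) X}"
    by (auto simp: padic_equiv_def)
  show "refl_on {X. padic_Cauchy CARD('p) X} (padic_equiv TYPE('p))"
    by (auto simp: refl_on_def padic_equiv_def padic_null_def padic_abs_0[OF pr])
  show "sym (padic_equiv TYPE('p))"
  proof (rule symI)
    fix X Y assume "(X, Y) \<in> padic_equiv TYPE('p)"
    thus "(Y, X) \<in> padic_equiv TYPE('p)"
      using padic_null_minus[OF pr, of "\<lambda>n. X n - Y n"] by (simp add: padic_equiv_def)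
  qed
  show "trans (padic_equiv TYPE('p))"
  proof (rule transI)
    fix X Y Z assume "(X, Y) \<in> padic_equiv TYPE('p)" "(Y, Z) \<in> padic_equiv TYPE('p)"
    thus "(X, Z) \<in> padic_equiv TYPE('p)"
      using padic_null_add[OF pr, of "\<lambda>n. X n - Y n" "\<lambda>n. Y n - Z n"] by (simp add: padic_equiv_def)
  qed
qed

typedef (overloaded) 'p padic =
  "{X. padic_Cauchy CARD('p::prime_card) X} // padic_equiv TYPE('p)"
  morphisms padic_class Abs_padic
proof -
  have "padic_Cauchy CARD('p) (\<lambda>_. 0)" by (rule padic_Cauchy_const[OF prime_card])
  thus ?thesis by (blast intro: quotientI)
qed

definition padic_of_seq :: "(nat \<Rightarrow> rat) \<Rightarrow> 'p::prime_card padic" where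
  "padic_of_seq X = Abs_padic (padic_equiv TYPE('p) `` {X})"

definition padic_rep :: "'p::prime_card padic \<Rightarrow> (nat \<Rightarrow> rat)" where
  "padic_rep x = (SOME X. X \<in> padic_class x)"

lemma
  fixes x :: "'p::prime_card padic"
  shows padic_rep_Cauchy: "padic_Cauchy CARD('p) (padic_rep x)"
    and padic_of_seq_rep: "padic_of_seq (padic_rep x) = x"
proof -
  obtain X where X: "padic_Cauchy CARD('p) X" "padic_class x = padic_equiv TYPE('p) `` {X}"
    using padic_class[of x] by (auto elim: quotientE)
  hence "X \<in> padic_class x"
    using equiv_class_self[OF equiv_padic] by blast
  hence "padic_rep x \<in> padic_class x" unfolding padic_rep_def by (rule someI[of "\<lambda>X. X \<in> padic_class x"])
  hence *: "(X, padic_rep x) \<in> padic_equiv TYPE('p)" using X by blast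
  thus "padic_Cauchy CARD('p) (padic_rep x)" by (simp add: padic_equiv_def)
  have "padic_class x = padic_equiv TYPE('p) `` {padic_rep x}"
    using X(2) equiv_class_eq[OF equiv_padic *] by simp
  thus "padic_of_seq (padic_rep x) = x" by (metis padic_of_seq_def padic_class_inverse)
qed

lemma padic_of_seq_eq_iff:
  assumes "padic_Cauchy CARD('p::prime_card) X" "padic_Cauchy CARD('p) Y"
  shows "padic_of_seq X = (padic_of_seq Y :: 'p padic) \<longleftrightarrow> padic_null CARD('p) (\<lambda>n. X n - Y n)"
proof -
  have "padic_of_seq X = (padic_of_seq Y :: 'p padic) \<longleftrightarrow>
      padic_equiv TYPE('p) `` {X} = padic_equiv TYPE('p) `` {Y}"
    unfolding padic_of_seq_def using assms by (intro Abs_padic_inject) (auto intro: quotientI)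
  also have "\<dots> \<longleftrightarrow> (X, Y) \<in> padic_equiv TYPE('p)"
    using assms by (intro eq_equiv_class_iff[OF equiv_padic]) auto
  finally show ?thesis using assms by (simp add: padic_equiv_def)
qed

lemma padic_rep_of_seq:
  assumes "padic_Cauchy CARD('p::prime_card) X"
  shows "padic_null CARD('p) (\<lambda>n. padic_rep (padic_of_seq X :: 'p padic) n - X n)"
  using padic_of_seq_eq_iff[OF padic_rep_Cauchy[of "padic_of_seq X"] assms]
  by (simp add: padic_of_seq_rep)

lemma padic_cases:
  obtains X where "padic_Cauchy CARD('p::prime_card) X" "x = (padic_of_seq X :: 'p padic)"
  by (metis padic_rep_Cauchy padic_of_seq_rep)

instantiation padic :: (prime_card) field
begin

definition "0 = (padic_of_seq (\<lambda>_. 0) :: 'a padic)"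

definition "1 = (padic_of_seq (\<lambda>_. 1) :: 'a padic)"

definition "x + y = padic_of_seq (\<lambda>n. padic_rep x n + padic_rep y n)" for x y :: "'a padic"

definition "- x = padic_of_seq (\<lambda>n. - padic_rep x n)" for x :: "'a padic"

definition "x - y = x + - y" for x y :: "'a padic"

definition "x * y = padic_of_seq (\<lambda>n. padic_rep x n * padic_rep y n)" for x y :: "'a padic"

definition "inverse x = (if x = 0 then 0 else padic_of_seq (\<lambda>n. inverse (padic_rep x n)))"
  for x :: "'a padic"

definition "x div y = x * inverse y" for x y :: "'a padic"

lemma padic_of_seq_add:
  assumes X: "padic_Cauchy CARD('a) X" and Y: "padic_Cauchy CARD('a) Y"
  shows "padic_of_seq X + padic_of_seq Y = (padic_of_seq (\<lambda>n. X n + Y n) :: 'a padic)"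
proof -
  note pr = prime_card[where 'a = 'a]
  show ?thesis
    unfolding plus_padic_def
    by (subst padic_of_seq_eq_iff)
       (use padic_null_add[OF pr padic_rep_of_seq[OF X] padic_rep_of_seq[OF Y]] in
         \<open>simp_all add: padic_Cauchy_add[OF pr] padic_rep_Cauchy X Y algebra_simps\<close>)
qed

lemma padic_of_seq_minus:
  assumes X: "padic_Cauchy CARD('a) X"
  shows "- padic_of_seq X = (padic_of_seq (\<lambda>n. - X n) :: 'a padic)"
proof -
  note pr = prime_card[where 'a = 'a]
  show ?thesis
    unfolding uminus_padic_def
    by (subst padic_of_seq_eq_iff)
       (use padic_null_minus[OF pr padic_rep_of_seq[OF X]] in
         \<open>simp_all add: padic_Cauchy_minus[OF pr] padic_rep_Cauchy X algebra_simps\<close>)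
qed

lemma padic_of_seq_mult:
  assumes X: "padic_Cauchy CARD('a) X" and Y: "padic_Cauchy CARD('a) Y"
  shows "padic_of_seq X * padic_of_seq Y = (padic_of_seq (\<lambda>n. X n * Y n) :: 'a padic)"
proof -
  note pr = prime_card[where 'a = 'a]
  define U V where "U = padic_rep (padic_of_seq X :: 'a padic)" and "V = padic_rep (padic_of_seq Y :: 'a padic)"
  have U: "padic_Cauchy CARD('a) U" "padic_null CARD('a) (\<lambda>n. U n - X n)"
    and V: "padic_Cauchy CARD('a) V" "padic_null CARD('a) (\<lambda>n. V n - Y n)"
    unfolding U_def V_def using X Y by (auto intro: padic_rep_Cauchy padic_rep_of_seq)
  have "padic_null CARD('a) (\<lambda>n. U n * (V n - Y n) + Y n * (U n - X n))"
    by (intro padic_null_add[OF pr] padic_null_mult[OF pr] U V Y)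
  hence "padic_null CARD('a) (\<lambda>n. U n * V n - X n * Y n)"
    by (simp add: algebra_simps)
  thus ?thesis
    unfolding times_padic_def U_def[symmetric] V_def[symmetric]
    by (subst padic_of_seq_eq_iff) (simp_all add: padic_Cauchy_mult[OF pr] U V X Y)
qed

instance
proof
  note pr = prime_card[where 'a = 'a]
  note ops = padic_of_seq_add padic_of_seq_minus padic_of_seq_mult zero_padic_def one_padic_def
    padic_Cauchy_add[OF pr] padic_Cauchy_mult[OF pr] padic_Cauchy_minus[OF pr]
    padic_Cauchy_const[OF pr]
  fix a b c :: "'a padic"
  obtain X where X: "padic_Cauchy CARD('a) X" "a = padic_of_seq X" by (rule padic_cases)
  obtain Y where Y: "padic_Cauchy CARD('a) Y" "b = padic_of_seq Y" by (rule padic_cases)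
  obtain Z where Z: "padic_Cauchy CARD('a) Z" "c = padic_of_seq Z" by (rule padic_cases)
  show "a + b = b + a"
    using X Y by (simp add: ops add.commute)
  show "(a + b) + c = a + (b + c)"
    using X Y Z by (simp add: ops add.assoc)
  show "0 + a = a"
    using X by (simp add: ops)
  show "- a + a = 0"
    using X by (simp add: ops)
  show "a - b = a + - b"
    by (rule minus_padic_def)
  show "(a * b) * c = a * (b * c)"
    using X Y Z by (simp add: ops mult.assoc)
  show "a * b = b * a"
    using X Y by (simp add: ops mult.commute)
  show "1 * a = a"
    using X by (simp add: ops)
  show "(a + b) * c = a * c + b * c"
    using X Y Z by (simp add: ops distrib_right)
  show "(0::'a padic) \<noteq> 1"
    unfolding zero_padic_def one_padic_def
    by (subst padic_of_seq_eq_iff)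
       (simp_all add: ops padic_null_def padic_abs_minus[OF pr] padic_abs_1[OF pr] LIMSEQ_const_iff)
  show "inverse a * a = 1" if "a \<noteq> 0"
  proof -
    define U where "U = padic_rep a"
    have U: "padic_Cauchy CARD('a) U" "a = padic_of_seq U"
      by (simp_all add: U_def padic_rep_Cauchy padic_of_seq_rep)
    have nn: "\<not> padic_null CARD('a) U"
      using that padic_of_seq_eq_iff[OF U(1) padic_Cauchy_const[OF pr, of 0]] U
      by (simp add: zero_padic_def)
    note inv = padic_Cauchy_inverse[OF pr U(1) nn]
    obtain r where r: "r > 0" "eventually (\<lambda>n. padic_abs CARD('a) (U n) \<ge> r) sequentially"
      using padic_not_null[OF pr U(1) nn] .
    have "eventually (\<lambda>n. padic_abs CARD('a) (inverse (U n) * U n - 1) \<le> 0) sequentially"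
      using r(2)
    proof eventually_elim
      case (elim n)
      hence "U n \<noteq> 0" using r(1) padic_abs_0[OF pr] by force
      thus ?case by (simp add: padic_abs_0[OF pr])
    qed
    hence null: "padic_null CARD('a) (\<lambda>n. inverse (U n) * U n - 1)"
      by (rule padic_nullI[OF pr]) simp
    have "inverse a * a = padic_of_seq (\<lambda>n. inverse (U n)) * padic_of_seq U"
      using that by (simp add: inverse_padic_def U_def padic_of_seq_rep)
    also have "\<dots> = padic_of_seq (\<lambda>n. inverse (U n) * U n)"
      by (rule padic_of_seq_mult[OF inv U(1)])
    also have "\<dots> = 1"
      unfolding one_padic_def using null inv U
      by (subst padic_of_seq_eq_iff) (simp_all add: ops)
    finally show ?thesis .
  qed
  show "a div b = a * inverse b"
    by (rule divide_padic_def)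
  show "inverse (0::'a padic) = 0"
    by (simp add: inverse_padic_def)
qed

end

definition padic_of_rat :: "rat \<Rightarrow> 'p::prime_card padic" where
  "padic_of_rat q = padic_of_seq (\<lambda>_. q)"

lemma padic_of_rat_add: "padic_of_rat (q + r) = padic_of_rat q + padic_of_rat r"
  by (simp add: padic_of_rat_def padic_of_seq_add padic_Cauchy_const[OF prime_card])

lemma padic_of_rat_minus: "padic_of_rat (- q) = - padic_of_rat q"
  by (simp add: padic_of_rat_def padic_of_seq_minus padic_Cauchy_const[OF prime_card])

lemma padic_of_rat_diff: "padic_of_rat (q - r) = padic_of_rat q - padic_of_rat r"
  using padic_of_rat_add[of q "- r"] by (simp add: padic_of_rat_minus)

lemma padic_of_rat_of_nat: "padic_of_rat (of_nat n) = of_nat n"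
proof (induction n)
  case 0
  show ?case by (simp add: padic_of_rat_def zero_padic_def)
next
  case (Suc n)
  have "padic_of_rat 1 = (1 :: 'a padic)" by (simp add: padic_of_rat_def one_padic_def)
  thus ?case using Suc by (simp add: padic_of_rat_add)
qed

lemma padic_of_rat_of_int: "padic_of_rat (of_int c) = of_int c"
  by (cases c rule: int_diff_cases) (simp add: padic_of_rat_diff padic_of_rat_of_nat)

definition padic_norm :: "'p::prime_card padic \<Rightarrow> real" where
  "padic_norm x = lim (\<lambda>n. padic_abs CARD('p) (padic_rep x n))"

lemma padic_norm_LIMSEQ:
  assumes X: "padic_Cauchy CARD('p::prime_card) X"
  shows "(\<lambda>n. padic_abs CARD('p) (X n)) \<longlonglongrightarrow> padic_norm (padic_of_seq X :: 'p padic)"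
proof -
  note pr = prime_card[where 'a = 'p]
  define U where "U = padic_rep (padic_of_seq X :: 'p padic)"
  have "convergent (\<lambda>n. padic_abs CARD('p) (U n))"
    unfolding U_def by (rule padic_Cauchy_convergent[OF pr padic_rep_Cauchy])
  hence U: "(\<lambda>n. padic_abs CARD('p) (U n)) \<longlonglongrightarrow> padic_norm (padic_of_seq X :: 'p padic)"
    by (simp add: padic_norm_def U_def convergent_LIMSEQ_iff)
  have "padic_null CARD('p) (\<lambda>n. U n - X n)"
    unfolding U_def by (rule padic_rep_of_seq[OF X])
  hence "(\<lambda>n. padic_abs CARD('p) (U n) - padic_abs CARD('p) (X n)) \<longlonglongrightarrow> 0"
    unfolding padic_null_def
    by (rule Lim_null_comparison[rotated]) (simp add: padic_abs_triangle_rev[OF pr])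
  from tendsto_diff[OF U this] show ?thesis by simp
qed

lemma padic_norm_eq_0_iff: "padic_norm x = 0 \<longleftrightarrow> x = 0" for x :: "'p::prime_card padic"
proof -
  note c = padic_Cauchy_const[OF prime_card[where 'a = 'p]]
  obtain X where X: "padic_Cauchy CARD('p) X" "x = padic_of_seq X" by (rule padic_cases)
  have "x = 0 \<longleftrightarrow> padic_null CARD('p) X"
    using padic_of_seq_eq_iff[OF X(1) c[of 0]] X(2) by (simp add: zero_padic_def)
  also have "\<dots> \<longleftrightarrow> padic_norm x = 0"
    using padic_norm_LIMSEQ[OF X(1)] X(2) unfolding padic_null_def
    by (auto intro: LIMSEQ_unique)
  finally show ?thesis by simp
qed

lemma padic_norm_nonneg: "padic_norm x \<ge> 0" for x :: "'p::prime_card padic"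
proof -
  obtain X where X: "padic_Cauchy CARD('p) X" "x = padic_of_seq X" by (rule padic_cases)
  show ?thesis
    unfolding X(2) by (rule LIMSEQ_le_const[OF padic_norm_LIMSEQ[OF X(1)]])
      (simp add: padic_abs_nonneg[OF prime_card])
qed

lemma padic_norm_mult: "padic_norm (x * y) = padic_norm x * padic_norm y" for x y :: "'p::prime_card padic"
proof -
  note pr = prime_card[where 'a = 'p]
  obtain X where X: "padic_Cauchy CARD('p) X" "x = padic_of_seq X" by (rule padic_cases)
  obtain Y where Y: "padic_Cauchy CARD('p) Y" "y = padic_of_seq Y" by (rule padic_cases)
  have "(\<lambda>n. padic_abs CARD('p) (X n * Y n)) \<longlonglongrightarrow> padic_norm (x * y)"
    using padic_norm_LIMSEQ[OF padic_Cauchy_mult[OF pr X(1) Y(1)]] X Y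
    by (simp add: padic_of_seq_mult)
  moreover have "(\<lambda>n. padic_abs CARD('p) (X n * Y n)) \<longlonglongrightarrow> padic_norm x * padic_norm y"
    unfolding padic_abs_mult[OF pr] X(2) Y(2) by (intro tendsto_mult padic_norm_LIMSEQ X Y)
  ultimately show ?thesis by (rule LIMSEQ_unique)
qed

lemma padic_norm_add: "padic_norm (x + y) \<le> max (padic_norm x) (padic_norm y)" for x y :: "'p::prime_card padic"
proof -
  note pr = prime_card[where 'a = 'p]
  obtain X where X: "padic_Cauchy CARD('p) X" "x = padic_of_seq X" by (rule padic_cases)
  obtain Y where Y: "padic_Cauchy CARD('p) Y" "y = padic_of_seq Y" by (rule padic_cases)
  have "(\<lambda>n. padic_abs CARD('p) (X n + Y n)) \<longlonglongrightarrow> padic_norm (x + y)"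
    using padic_norm_LIMSEQ[OF padic_Cauchy_add[OF pr X(1) Y(1)]] X Y
    by (simp add: padic_of_seq_add)
  moreover have "(\<lambda>n. max (padic_abs CARD('p) (X n)) (padic_abs CARD('p) (Y n))) \<longlonglongrightarrow> max (padic_norm x) (padic_norm y)"
    unfolding X(2) Y(2) by (intro tendsto_max padic_norm_LIMSEQ X Y)
  ultimately show ?thesis
    by (rule LIMSEQ_le) (use padic_abs_add[OF pr] in blast)
qed

lemma padic_norm_minus: "padic_norm (- x) = padic_norm x" for x :: "'p::prime_card padic"
proof -
  note pr = prime_card[where 'a = 'p]
  obtain X where X: "padic_Cauchy CARD('p) X" "x = padic_of_seq X" by (rule padic_cases)
  have "(\<lambda>n. padic_abs CARD('p) (X n)) \<longlonglongrightarrow> padic_norm (- x)"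
    using padic_norm_LIMSEQ[OF padic_Cauchy_minus[OF pr X(1)]] X
    by (simp add: padic_of_seq_minus padic_abs_minus[OF pr])
  thus ?thesis using padic_norm_LIMSEQ[OF X(1)] X(2) by (auto intro: LIMSEQ_unique)
qed

lemma padic_norm_minus_commute: "padic_norm (x - y) = padic_norm (y - x)" for x y :: "'p::prime_card padic"
  by (metis minus_diff_eq padic_norm_minus)

lemma padic_norm_of_rat: "padic_norm (padic_of_rat q :: 'p padic) = padic_abs CARD('p::prime_card) q"
  using padic_norm_LIMSEQ[OF padic_Cauchy_const[OF prime_card[where 'a = 'p]], of q]
  by (simp add: padic_of_rat_def LIMSEQ_const_iff)

lemma padic_norm_of_int: "padic_norm (of_int c :: 'p padic) = padic_abs_int CARD('p::prime_card) c"
  by (simp add: padic_norm_of_rat padic_abs_of_int[OF prime_card] flip: padic_of_rat_of_int)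

lemma padic_norm_prime_power: "padic_norm (of_nat CARD('p) ^ l :: 'p::prime_card padic) = 1 / real CARD('p) ^ l"
proof -
  have "padic_norm (of_nat CARD('p) ^ l :: 'p padic) = padic_norm (of_int (int CARD('p) ^ l) :: 'p padic)"
    by simp
  also have "\<dots> = 1 / real CARD('p) ^ l"
    unfolding padic_norm_of_int using prime_card_int[where 'a = 'p]
    by (auto simp: padic_abs_int_def multiplicity_same_power)
  finally show ?thesis .
qed

lemma padic_of_rat_dense:
  fixes x :: "'p::prime_card padic"
  assumes "e > 0"
  obtains q where "padic_norm (x - padic_of_rat q) < e"
proof -
  note pr = prime_card[where 'a = 'p]
  obtain X where X: "padic_Cauchy CARD('p) X" "x = padic_of_seq X" by (rule padic_cases)
  obtain N where N: "\<And>n. n \<ge> N \<Longrightarrow> padic_abs CARD('p) (X n - X N) < e / 2"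
    using X(1) half_gt_zero[OF assms] unfolding padic_Cauchy_def by (meson order_refl)
  have eq: "x - padic_of_rat (X N) = padic_of_seq (\<lambda>n. X n + - X N)"
    using X by (simp add: minus_padic_def padic_of_rat_def padic_of_seq_minus padic_of_seq_add
        padic_Cauchy_const[OF pr] del: add_uminus_conv_diff)
  have "padic_Cauchy CARD('p) (\<lambda>n. X n + - X N)"
    by (intro padic_Cauchy_add[OF pr] X padic_Cauchy_const[OF pr])
  from padic_norm_LIMSEQ[OF this] have "padic_norm (x - padic_of_rat (X N)) \<le> e / 2"
    unfolding eq by (rule LIMSEQ_le_const2) (use N in \<open>auto intro!: exI[of _ N] less_imp_le\<close>)
  thus ?thesis using assms by (intro that[of "X N"]) simp
qed

instantiation padic :: (prime_card) metric_space
begin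

definition dist_padic :: "'a padic \<Rightarrow> 'a padic \<Rightarrow> real" where
  "dist_padic x y = padic_norm (x - y)"

definition uniformity_padic :: "('a padic \<times> 'a padic) filter" where
  "uniformity_padic = (INF e\<in>{0 <..}. principal {(x, y). dist x y < e})"

definition open_padic :: "'a padic set \<Rightarrow> bool" where
  "open_padic U \<longleftrightarrow> (\<forall>x\<in>U. eventually (\<lambda>(x', y). x' = x \<longrightarrow> y \<in> U) uniformity)"

instance
proof
  fix x y z :: "'a padic"
  show "dist x y = 0 \<longleftrightarrow> x = y"
    by (simp add: dist_padic_def padic_norm_eq_0_iff)
  show "dist x y \<le> dist x z + dist y z"
    using padic_norm_add[of "x - z" "z - y"] padic_norm_nonneg[of "x - z"] padic_norm_nonneg[of "y - z"]
    by (simp add: dist_padic_def padic_norm_minus_commute[of z y])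
qed (simp_all add: uniformity_padic_def open_padic_def)

end

definition padic_integers :: "'p::prime_card padic set" where
  "padic_integers = {z. padic_norm z \<le> 1}"

definition padic_cong_int :: "nat \<Rightarrow> 'p::prime_card padic \<Rightarrow> int \<Rightarrow> bool" where
  "padic_cong_int l z c \<longleftrightarrow> (\<exists>y\<in>padic_integers. z - of_int c = of_nat CARD('p) ^ l * y)"

text \<open>The value \<open>e\<^bsup>2\<pi>iz/p\<^sup>l\<^esup>\<close> for \<open>z\<close> a p-adic integer; see
  \<open>padic_cong_int_exists\<close> and \<open>padic_exp_eq\<close> for the independence of the choice.\<close>

definition padic_exp :: "nat \<Rightarrow> 'p::prime_card padic \<Rightarrow> complex" where
  "padic_exp l z = exp (2 * pi * \<i> * of_int (SOME c. padic_cong_int l z c) / of_nat CARD('p) ^ l)"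

lemma padic_cong_int_altdef:
  fixes z :: "'p::prime_card padic"
  shows "padic_cong_int l z c \<longleftrightarrow> padic_norm (z - of_int c) \<le> 1 / real CARD('p) ^ l"
proof -
  have p: "CARD('p) > 0" using prime_card[where 'a = 'p] prime_gt_0_nat by blast
  define P where "P = (of_nat CARD('p) ^ l :: 'p padic)"
  have P: "padic_norm P = 1 / real CARD('p) ^ l" by (simp add: P_def padic_norm_prime_power)
  hence "P \<noteq> 0" using p padic_norm_eq_0_iff[of P] by auto
  show ?thesis
    unfolding padic_cong_int_def P_def[symmetric] P[symmetric]
  proof
    assume "padic_norm (z - of_int c) \<le> padic_norm P"
    moreover have eq: "z - of_int c = P * ((z - of_int c) / P)" using \<open>P \<noteq> 0\<close> by simp
    hence "padic_norm (z - of_int c) = padic_norm P * padic_norm ((z - of_int c) / P)" by (metis padic_norm_mult)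
    ultimately have "padic_norm ((z - of_int c) / P) \<le> 1" using P p by (simp add: field_simps)
    thus "\<exists>y\<in>padic_integers. z - of_int c = P * y"
      using eq by (auto simp: padic_integers_def)
  next
    assume "\<exists>y\<in>padic_integers. z - of_int c = P * y"
    thus "padic_norm (z - of_int c) \<le> padic_norm P"
      by (auto simp: padic_integers_def padic_norm_mult mult_left_le padic_norm_nonneg)
  qed
qed

lemma padic_cong_int_exists:
  fixes z :: "'p::prime_card padic"
  assumes "z \<in> padic_integers"
  shows "\<exists>c. padic_cong_int l z c"
proof -
  note pr = prime_card[where 'a = 'p]
  have p: "CARD('p) > 1" using pr prime_gt_1_nat by blast
  obtain q where q: "padic_norm (z - padic_of_rat q) < 1 / real CARD('p) ^ l"
    by (rule padic_of_rat_dense[of "1 / real CARD('p) ^ l"]) (use p in auto)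
  have small: "1 / real CARD('p) ^ l \<le> 1" using p by simp
  have "padic_norm (padic_of_rat q :: 'p padic) \<le> max (padic_norm z) (padic_norm (z - padic_of_rat q))"
    using padic_norm_add[of z "padic_of_rat q - z"]
    by (simp add: padic_norm_minus_commute[of z])
  moreover have "max (padic_norm z) (padic_norm (z - padic_of_rat q)) \<le> 1"
    using assms order_trans[OF less_imp_le[OF q] small] by (simp add: padic_integers_def)
  ultimately have q1: "padic_abs CARD('p) q \<le> 1"
    unfolding padic_norm_of_rat by (rule order_trans)
  obtain a b where ab: "quotient_of q = (a, b)" by fastforce
  have b: "b > 0" "coprime a b" and qab: "q = of_int a / of_int b"
    using quotient_of_denom_pos[OF ab] quotient_of_coprime[OF ab] quotient_of_div[OF ab] by auto
  have cop: "coprime b (int CARD('p))"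
  proof (rule ccontr)
    assume "\<not> coprime b (int CARD('p))"
    hence dvd: "int CARD('p) dvd b"
      using prime_imp_coprime[OF prime_card_int[where 'a = 'p], of b]
      by (auto simp: coprime_commute)
    hence ndvd: "\<not> int CARD('p) dvd a"
      using b p by (metis coprime_common_divisor of_nat_1_eq_iff zdvd1_eq abs_of_nat less_irrefl)
    have "padic_abs_int CARD('p) a = 1"
      using ndvd by (auto simp: padic_abs_int_def not_dvd_imp_multiplicity_0)
    moreover have "padic_abs_int CARD('p) b \<le> 1 / real CARD('p) ^ 1"
      using dvd by (subst padic_abs_int_le_iff[OF pr]) auto
    hence "padic_abs_int CARD('p) b < 1" by (rule le_less_trans) (use p in simp)
    moreover have "padic_abs_int CARD('p) b > 0"
      using padic_abs_int_nonneg[OF pr, of b] padic_abs_int_eq_0_iff[OF pr, of b] b by linarith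
    ultimately show False using q1 by (simp add: padic_abs_def ab)
  qed
  hence "coprime b (int CARD('p) ^ l)" by simp
  then obtain c' where c': "[b * c' = 1] (mod int CARD('p) ^ l)"
    using cong_solve_coprime_int by blast
  define c where "c = c' * a"
  have "[b * c' * a = 1 * a] (mod int CARD('p) ^ l)" by (rule cong_mult[OF c' cong_refl])
  hence "int CARD('p) ^ l dvd a - b * c"
    by (metis c_def cong_iff_dvd_diff cong_sym mult.assoc mult_1)
  hence num: "padic_abs_int CARD('p) (a - b * c) \<le> 1 / real CARD('p) ^ l"
    by (simp add: padic_abs_int_le_iff[OF pr])
  have "\<not> int CARD('p) dvd b"
    using cop p by (metis coprime_common_divisor dvd_refl zdvd1_eq abs_of_nat of_nat_1_eq_iff less_irrefl)
  hence "padic_abs_int CARD('p) b = 1"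
    using b by (auto simp: padic_abs_int_def not_dvd_imp_multiplicity_0)
  moreover have "q - of_int c = of_int (a - b * c) / of_int b"
    using b by (simp add: qab field_simps)
  ultimately have "padic_abs CARD('p) (q - of_int c) \<le> 1 / real CARD('p) ^ l"
    using num b padic_abs_of_int_divide[OF pr, of b "a - b * c"] by simp
  hence "padic_norm (padic_of_rat q - of_int c :: 'p padic) \<le> 1 / real CARD('p) ^ l"
    by (simp add: padic_norm_of_rat flip: padic_of_rat_of_int padic_of_rat_diff)
  hence "padic_norm (z - of_int c) \<le> 1 / real CARD('p) ^ l"
    using q padic_norm_add[of "z - padic_of_rat q" "padic_of_rat q - of_int c"] by simp
  thus ?thesis by (auto simp: padic_cong_int_altdef)
qed

lemma padic_exp_eq:
  fixes z :: "'p::prime_card padic"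
  assumes c: "padic_cong_int l z c"
  shows "padic_exp l z = exp (2 * pi * \<i> * of_int c / of_nat CARD('p) ^ l)"
proof -
  note pr = prime_card[where 'a = 'p]
  have p: "CARD('p) > 0" using pr prime_gt_0_nat by blast
  define d where "d = (SOME c. padic_cong_int l z c)"
  have d: "padic_cong_int l z d" unfolding d_def using c by (rule someI)
  have "padic_norm (of_int (d - c) :: 'p padic) \<le> max (padic_norm (z - of_int c)) (padic_norm (of_int d - z))"
    using padic_norm_add[of "z - of_int c" "of_int d - z"] by simp
  also have "\<dots> \<le> 1 / real CARD('p) ^ l"
    using c d by (simp add: padic_cong_int_altdef padic_norm_minus_commute[of z])
  finally have "int CARD('p) ^ l dvd d - c"
    unfolding padic_norm_of_int by (simp add: padic_abs_int_le_iff[OF pr])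
  then obtain k where "d - c = int CARD('p) ^ l * k" by (elim dvdE)
  hence k: "d = c + int CARD('p) ^ l * k" by simp
  have "2 * pi * \<i> * of_int d / of_nat CARD('p) ^ l =
      2 * pi * \<i> * of_int c / of_nat CARD('p) ^ l + 2 * pi * \<i> * of_int k"
    using p by (simp add: k field_simps)
  thus ?thesis
    using exp_integer_2pi[OF Ints_of_int, of k]
    by (simp add: padic_exp_def d_def[symmetric] exp_add mult_ac)
qed

section \<open>Newton polyhedra\<close>

text \<open>
  A power series in the variables indexed by \<^typ>\<open>'n\<close> is given by its coefficient function on
  multi-indices; a polynomial is a power series with finitely many nonzero coefficients.
\<close>

definition newton_polyhedron :: "(nat ^ 'n \<Rightarrow> int) \<Rightarrow> (real ^ 'n) set" where
  "newton_polyhedron f = convex hull (\<Union>\<alpha>\<in>{\<alpha>. f \<alpha> \<noteq> 0}. {t. \<forall>i. real (\<alpha> $ i) \<le> t $ i})"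

definition newton_distance :: "(nat ^ 'n \<Rightarrow> int) \<Rightarrow> real" where
  "newton_distance f = Inf {t. (\<chi> i. t) \<in> newton_polyhedron f}"

definition diagonal_face :: "(nat ^ 'n \<Rightarrow> int) \<Rightarrow> (real ^ 'n) set \<Rightarrow> bool" where
  "diagonal_face f F \<longleftrightarrow>
     F face_of newton_polyhedron f \<and> F \<inter> range (\<lambda>t. \<chi> i. t) \<noteq> {}"

definition central_face :: "(nat ^ 'n \<Rightarrow> int) \<Rightarrow> (real ^ 'n) set" where
  "central_face f =
     (THE F. diagonal_face f F \<and> (\<forall>G. diagonal_face f G \<longrightarrow> aff_dim F \<le> aff_dim G))"

lemma diagonal_face_inter:
  fixes f :: "nat ^ 'n \<Rightarrow> int"
  assumes F: "diagonal_face f F" and G: "diagonal_face f G"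
  shows "diagonal_face f (F \<inter> G)"
proof -
  let ?N = "newton_polyhedron f"
  have conv: "convex ?N" by (simp add: newton_polyhedron_def convex_convex_hull)
  have up: "t \<in> ?N" if "s \<in> ?N" "\<And>i. s $ i \<le> t $ i" for s t :: "real ^ 'n"
  proof -
    let ?U = "\<Union>\<alpha>\<in>{\<alpha>. f \<alpha> \<noteq> 0}. {t. \<forall>i. real (\<alpha> $ i) \<le> t $ i}"
    have "(+) (t - s) ` ?N = convex hull ((+) (t - s) ` ?U)"
      unfolding newton_polyhedron_def by (rule convex_hull_translation[symmetric])
    also have "\<dots> \<subseteq> ?N"
      unfolding newton_polyhedron_def
    proof (rule hull_mono, safe)
      fix \<alpha> u assume "f \<alpha> \<noteq> 0" "\<forall>i. real (\<alpha> $ i) \<le> u $ i"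
      moreover have "u $ i \<le> (t - s + u) $ i" for i using that(2)[of i] by simp
      ultimately have "f \<alpha> \<noteq> 0" "t - s + u \<in> {t. \<forall>i. real (\<alpha> $ i) \<le> t $ i}"
        using order_trans by blast+
      thus "t - s + u \<in> ?U" by blast
    qed
    finally show ?thesis using that(1) by force
  qed
  have int: "(\<chi> i. s) \<in> interior ?N" if "(\<chi> i. t) \<in> ?N" "t < s" for s t :: real
  proof -
    have "ball (\<chi> i. s) (s - t) \<subseteq> ?N"
    proof
      fix u :: "real ^ 'n" assume "u \<in> ball (\<chi> i. s) (s - t)"
      hence "norm ((\<chi> i. s) - u) < s - t" by (simp add: dist_norm)
      hence "\<bar>((\<chi> i. s) - u) $ i\<bar> < s - t" for i
        using component_le_norm_cart[of "(\<chi> i. s) - u" i] by (rule le_less_trans[rotated])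
      hence less: "\<bar>s - u $ i\<bar> < s - t" for i by simp
      have "t < u $ i" for i using less[of i] by linarith
      thus "u \<in> ?N" using that(1) by (intro up[of "\<chi> i. t" u]) (auto intro: less_imp_le)
    qed
    thus ?thesis using that(2) by (meson centre_in_ball diff_gt_0_iff_gt interior_maximal open_ball subsetD)
  qed
  have key: "diagonal_face f (F \<inter> G)"
    if F: "diagonal_face f F" and G: "diagonal_face f G"
      and t: "(\<chi> i. t) \<in> F" and s: "(\<chi> i. s) \<in> G" and le: "t \<le> s" for F G and s t :: real
  proof (cases "t = s")
    case True
    thus ?thesis using that by (auto simp: diagonal_face_def intro: face_of_Int)
  next
    case False
    have "(\<chi> i. t) \<in> ?N" using F t face_of_imp_subset unfolding diagonal_face_def by blast
    hence "(\<chi> i. s) \<in> G \<inter> interior ?N" using int le False s by auto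
    hence "G = ?N" using G face_of_disjoint_interior unfolding diagonal_face_def by blast
    hence "F \<inter> G = F" using F face_of_imp_subset unfolding diagonal_face_def by blast
    thus ?thesis using F by simp
  qed
  obtain t s where "(\<chi> i. t) \<in> F" "(\<chi> i. s) \<in> G"
    using F G unfolding diagonal_face_def by blast
  thus ?thesis using key[OF F G, of t s] key[OF G F, of s t] by (cases "t \<le> s") (auto simp: Int_commute)
qed

lemma central_face:
  fixes f :: "nat ^ 'n \<Rightarrow> int"
  assumes "f \<alpha> \<noteq> 0"
  shows "diagonal_face f (central_face f)"
    and "\<And>G. diagonal_face f G \<Longrightarrow> central_face f \<subseteq> G"
proof -
  let ?N = "newton_polyhedron f"
  let ?P = "\<lambda>F. diagonal_face f F \<and> (\<forall>G. diagonal_face f G \<longrightarrow> aff_dim F \<le> aff_dim G)"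
  have conv: "convex ?N" by (simp add: newton_polyhedron_def convex_convex_hull)
  have "(\<chi> i. \<Sum>j\<in>UNIV. real (\<alpha> $ j)) \<in> ?N"
    unfolding newton_polyhedron_def
    by (rule hull_inc, rule UN_I[of \<alpha>]) (use assms in \<open>auto intro!: member_le_sum\<close>)
  hence "diagonal_face f ?N"
    using face_of_refl[OF conv] by (auto simp: diagonal_face_def)
  then obtain F where F: "diagonal_face f F"
      "\<And>G. diagonal_face f G \<Longrightarrow> nat (aff_dim F + 1) \<le> nat (aff_dim G + 1)"
    using ex_has_least_nat[of "diagonal_face f" _ "\<lambda>F. nat (aff_dim F + 1)"] by blast
  have PF: "?P F"
  proof (intro conjI allI impI F(1))
    fix G assume "diagonal_face f G"
    from F(2)[OF this] show "aff_dim F \<le> aff_dim G"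
      using aff_dim_geq[of F] aff_dim_geq[of G] by linarith
  qed
  have sub: "F' \<subseteq> G" if "?P F'" "diagonal_face f G" for F' G
  proof (rule ccontr)
    assume "\<not> F' \<subseteq> G"
    hence ne: "F' \<inter> G \<noteq> F'" by blast
    have d: "diagonal_face f (F' \<inter> G)" using diagonal_face_inter that by blast
    have face: "(F' \<inter> G) face_of ?N" "F' face_of ?N"
      using d that(1) unfolding diagonal_face_def by blast+
    have "(F' \<inter> G) face_of F'"
      by (rule face_of_subset[OF face(1) _ face_of_imp_subset[OF face(2)]]) blast
    from face_of_aff_dim_lt[OF face_of_imp_convex[OF face(2)] this ne]
    show False using d that(1) by (meson not_le)
  qed
  have "?P (central_face f)"
    unfolding central_face_def by (rule theI[of ?P F]) (use PF sub in blast)+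
  thus "diagonal_face f (central_face f)" "\<And>G. diagonal_face f G \<Longrightarrow> central_face f \<subseteq> G"
    using sub by blast+
qed

definition compact_face :: "(nat ^ 'n \<Rightarrow> int) \<Rightarrow> (real ^ 'n) set \<Rightarrow> bool" where
  "compact_face f F \<longleftrightarrow> F face_of newton_polyhedron f \<and> compact F \<and> F \<noteq> {}"

definition face_polynomial :: "(nat ^ 'n \<Rightarrow> int) \<Rightarrow> (real ^ 'n) set \<Rightarrow> (nat ^ 'n \<Rightarrow> int)" where
  "face_polynomial f F = (\<lambda>\<alpha>. if (\<chi> i. real (\<alpha> $ i)) \<in> F then f \<alpha> else 0)"

section \<open>Values and zeros over the p-adic numbers\<close>

definition series_term :: "(nat ^ 'n \<Rightarrow> int) \<Rightarrow> 'p::prime_card padic ^ 'n \<Rightarrow> nat ^ 'n \<Rightarrow> 'p padic" where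
  "series_term f x \<alpha> = of_int (f \<alpha>) * (\<Prod>i\<in>UNIV. (x $ i) ^ (\<alpha> $ i))"

definition series_value :: "(nat ^ 'n \<Rightarrow> int) \<Rightarrow> 'p::prime_card padic ^ 'n \<Rightarrow> 'p padic" where
  "series_value f x = (\<Sum>\<^sub>\<infinity>\<alpha>. series_term f x \<alpha>)"

lemma series_value_polynomial:
  assumes "finite {\<alpha>. f \<alpha> \<noteq> 0}"
  shows "series_value f x = (\<Sum>\<alpha> | f \<alpha> \<noteq> 0. series_term f x \<alpha>)"
proof -
  have "series_value f x = (\<Sum>\<^sub>\<infinity>\<alpha>\<in>{\<alpha>. f \<alpha> \<noteq> 0}. series_term f x \<alpha>)"
    unfolding series_value_def by (rule infsum_cong_neutral) (auto simp: series_term_def)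
  thus ?thesis using assms by simp
qed

definition formal_partial :: "'n \<Rightarrow> (nat ^ 'n \<Rightarrow> int) \<Rightarrow> (nat ^ 'n \<Rightarrow> int)" where
  "formal_partial i f = (\<lambda>\<alpha>. int (\<alpha> $ i + 1) * f (\<alpha> + axis i 1))"

definition zero_order :: "(nat ^ 'n \<Rightarrow> int) \<Rightarrow> 'p::prime_card padic ^ 'n \<Rightarrow> nat" where
  "zero_order g x =
     (LEAST k. \<exists>js. length js = k \<and> series_value (foldr formal_partial js g) x \<noteq> 0)"

text \<open>The number \<open>o(F)\<close>; inserting \<open>0\<close> gives the convention for a face polynomial without
  zeros and changes nothing otherwise, since the order of a zero is positive.\<close>

definition max_zero_order ::
    "'p::prime_card itself \<Rightarrow> (nat ^ 'n \<Rightarrow> int) \<Rightarrow> (real ^ 'n) set \<Rightarrow> nat" where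
  "max_zero_order P f F = Max (insert 0
     {zero_order (face_polynomial f F) x | x :: 'p padic ^ 'n.
        (\<forall>i. x $ i \<noteq> 0) \<and> series_value (face_polynomial f F) x = 0})"

definition sup_zero_order :: "'p::prime_card itself \<Rightarrow> (nat ^ 'n \<Rightarrow> int) \<Rightarrow> nat" where
  "sup_zero_order P f = (SUP F\<in>{F. compact_face f F}. max_zero_order P f F)"

definition converges_near_origin :: "'p::prime_card itself \<Rightarrow> (nat ^ 'n \<Rightarrow> int) \<Rightarrow> bool" where
  "converges_near_origin P f \<longleftrightarrow>
     (\<exists>U :: ('p padic ^ 'n) set. open U \<and> 0 \<in> U \<and> (\<forall>x\<in>U. series_term f x summable_on UNIV))"

text \<open>The value \<open>f\<^sub>a(x) = f(p\<^bsup>a\<^sub>1\<^esup>x\<^sub>1, \<dots>, p\<^bsup>a\<^sub>n\<^esup>x\<^sub>n)\<close> at an integer point \<open>x\<close>.\<close>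

definition scaled_value :: "(nat ^ 'n \<Rightarrow> int) \<Rightarrow> int ^ 'n \<Rightarrow> int ^ 'n \<Rightarrow> 'p::prime_card padic" where
  "scaled_value f a x = series_value f (\<chi> i. of_nat CARD('p) powi (a $ i) * of_int (x $ i))"

definition scaled_exp_sum :: "'p::prime_card itself \<Rightarrow> (nat ^ 'n \<Rightarrow> int) \<Rightarrow> int ^ 'n \<Rightarrow> nat \<Rightarrow> complex" where
  "scaled_exp_sum P f a l =
     (\<Sum>x | \<forall>i. x $ i \<in> {0..int CARD('p) ^ l - 1}. padic_exp l (scaled_value f a x :: 'p padic))"

end

theory Submission
  imports Defs
begin

hide_const (open) up_ring.coeff up_ring.monom module.smult

text \<open>
  Modulo \<open>p^l\<close> the sum only involves a polynomial with integer coefficients. Split it according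
  to the valuations \<open>k\<^sub>i\<close> of the arguments, \<open>x\<^sub>i = p^k\<^sub>i u\<^sub>i\<close> with \<open>u\<^sub>i\<close> a unit: the part belonging to \<open>k\<close>
  has weight \<open>p^(-|k|)\<close>, and on it \<open>f\<close> is \<open>p^m(k)\<close> times a polynomial in \<open>u\<close>, where \<open>m(k)\<close> is the
  minimum of \<open>k \<bullet> \<alpha>\<close> over the Newton polyhedron. A compactness argument shows that some
  derivative of order between \<open>1\<close> and \<open>max 1 o(F)\<close> of this polynomial is bounded below on the
  units, \<open>F\<close> being a compact face on which \<open>k\<close> is almost minimal; a p-adic van der Corput lemma
  then bounds the sum over \<open>u\<close> by \<open>p^(-(l - m(k)) / o(F))\<close>. It remains to sum over \<open>k\<close>. As
  \<open>z = (d, \<dots>, d)\<close> lies in the relative interior of the central face, \<open>d |k| - m(k)\<close> dominates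
  \<open>|k \<bullet> v|\<close> for every direction \<open>v\<close> of this face, which leaves \<open>n - h\<close> free dimensions for \<open>k\<close>.
  One more is lost, under the assumptions of (a), to the extra decay in \<open>l - m(k)\<close> for faces
  inside the central face, and otherwise to the near equality of \<open>k\<close> at \<open>z\<close> and at an exponent
  outside the central face.
\<close>

section \<open>Compactness of the p-adic integers\<close>

text \<open>Large \<open>a_i\<close> matter for compactness: they make all \<open>k_i\<close> large,
  so the coefficient of an exponent lying strictly above another one is divisible by a high power of
  \<open>p\<close>, and only the finitely many minimal exponents survive in the limit. The order
  \<open>o(F)\<close> counts the value of \<open>f_F\<close> as a derivative of order zero, while a
  phase needs derivatives of positive order; replacing \<open>o(F)\<close> by
  \<open>max 1 o(F)\<close> costs nothing, since a first derivative bounded below makes the sum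
  vanish outright for large \<open>l\<close>, so that order one admits every rate of decay. This is
  essential when \<open>d < 1\<close>, where \<open>1/d\<close> exceeds every \<open>1/e\<close>.
  With \<open>gap k = |k| - m(k)/d \<ge> 0\<close>, the weight \<open>p^(-|k|)\<close> and the rate
  \<open>1/d\<close> combine to \<open>p^(-l/d) p^(-gap k)\<close> as long as
  \<open>m(k) \<le> l\<close>; the power of \<open>l\<close> is then a count of lattice points of
  small gap. Under (a) a rate above \<open>1/d\<close> also confines \<open>m(k)\<close> to the
  vicinity of \<open>l\<close>, and hence, the gap being small, \<open>|k|\<close> to that of
  \<open>l/d\<close>. This is a new condition because \<open>(1, \<dots>, 1)\<close> is not a
  direction of the central face, \<open>z\<close> being the lowest point of the diagonal in the
  polyhedron.\<close>

instance padic :: (prime_card) field_char_0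
proof
  note pr = prime_card[where 'a = 'a]
  show "inj (of_nat :: nat \<Rightarrow> 'a padic)"
  proof (rule injI)
    fix m n :: nat assume "of_nat m = (of_nat n :: 'a padic)"
    hence "(of_int (int m - int n) :: 'a padic) = 0" by simp
    hence "padic_abs_int CARD('a) (int m - int n) = 0"
      by (metis padic_norm_of_int padic_norm_eq_0_iff)
    thus "m = n" by (simp add: padic_abs_int_eq_0_iff[OF pr])
  qed
qed

lemma padic_norm_0 [simp]: "padic_norm (0 :: 'p::prime_card padic) = 0"
  by (simp add: padic_norm_eq_0_iff)

lemma padic_norm_1 [simp]: "padic_norm (1 :: 'p::prime_card padic) = 1"
  using padic_norm_prime_power[of 0, where 'p = 'p] by simp

lemma padic_norm_diff: "padic_norm (x - y) \<le> max (padic_norm x) (padic_norm y)"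
  using padic_norm_add[of x "- y"] by (simp add: padic_norm_minus)

lemma padic_norm_of_int_le_iff:
  "padic_norm (of_int c :: 'p::prime_card padic) \<le> 1 / real CARD('p) ^ k \<longleftrightarrow> int CARD('p) ^ k dvd c"
  by (simp add: padic_norm_of_int padic_abs_int_le_iff[OF prime_card])

lemma padic_norm_of_int_le_1: "padic_norm (of_int c :: 'p::prime_card padic) \<le> 1"
  using padic_norm_of_int_le_iff[of c 0, where 'p = 'p] by simp

lemma padic_norm_of_nat_le_1: "padic_norm (of_nat c :: 'p::prime_card padic) \<le> 1"
  using padic_norm_of_int_le_1[of "int c", where 'p = 'p] by simp

lemma padic_norm_sum_le:
  assumes "\<And>i. i \<in> A \<Longrightarrow> padic_norm (g i) \<le> e" "e \<ge> 0"
  shows "padic_norm (\<Sum>i\<in>A. g i) \<le> e"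
  using assms(1)
proof (induction A rule: infinite_finite_induct)
  case (insert x A)
  thus ?case using padic_norm_add[of "g x" "\<Sum>i\<in>A. g i"] by fastforce
qed (use assms(2) in auto)

lemma padic_norm_power: "padic_norm (x ^ k) = padic_norm x ^ k"
  by (induction k) (auto simp: padic_norm_mult)

lemma padic_norm_prod: "padic_norm (\<Prod>i\<in>A. g i) = (\<Prod>i\<in>A. padic_norm (g i))"
  by (induction A rule: infinite_finite_induct) (auto simp: padic_norm_mult)

lemma padic_small:
  assumes "e > 0"
  obtains l where "1 / real CARD('p::prime_card) ^ l < e"
proof -
  have "real CARD('p) > 1" using prime_gt_1_nat[OF prime_card[where 'a = 'p]] by simp
  then obtain l where "inverse e < real CARD('p) ^ l" using real_arch_pow by blast
  thus ?thesis using assms by (intro that[of l]) (simp add: field_simps)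
qed

text \<open>Rationals \<open>q n\<close> within \<open>1/(n+1)\<close> of \<open>X n\<close> again
  form a Cauchy sequence, and the class of that rational sequence is the limit.\<close>

lemma Cauchy_padic_convergent:
  fixes X :: "nat \<Rightarrow> 'p::prime_card padic"
  assumes "Cauchy X"
  shows "convergent X"
proof -
  note pr = prime_card[where 'a = 'p]
  have "\<exists>q. padic_norm (X n - padic_of_rat q) < 1 / real (Suc n)" for n
    by (rule padic_of_rat_dense[of "1 / real (Suc n)" "X n"]) auto
  then obtain q where q: "\<And>n. padic_norm (X n - padic_of_rat (q n)) < 1 / real (Suc n)" by metis
  have q': "\<exists>N. \<forall>n\<ge>N. padic_norm (X n - padic_of_rat (q n)) < e" if "e > 0" for e
  proof -
    obtain N where N: "1 / real (Suc N) < e" using nat_approx_posE[OF \<open>e > 0\<close>] by metis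
    have "padic_norm (X n - padic_of_rat (q n)) < e" if "n \<ge> N" for n
    proof -
      have "1 / real (Suc n) \<le> 1 / real (Suc N)" using that by (intro divide_left_mono) auto
      thus ?thesis using q[of n] N by linarith
    qed
    thus ?thesis by blast
  qed
  have qC: "\<exists>N. \<forall>m\<ge>N. \<forall>n\<ge>N. padic_abs CARD('p) (q m - q n) < e" if e: "e > 0" for e
  proof -
    obtain N1 where N1: "\<And>n. n \<ge> N1 \<Longrightarrow> padic_norm (X n - padic_of_rat (q n)) < e" using q'[OF e] by blast
    obtain N2 where N2: "\<And>m n. m \<ge> N2 \<Longrightarrow> n \<ge> N2 \<Longrightarrow> padic_norm (X m - X n) < e"
      using assms e unfolding Cauchy_def dist_padic_def by meson
    have "padic_abs CARD('p) (q m - q n) < e" if "m \<ge> max N1 N2" "n \<ge> max N1 N2" for m n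
    proof -
      have "padic_abs CARD('p) (q m - q n) = padic_norm (padic_of_rat (q m) - padic_of_rat (q n) :: 'p padic)"
        by (simp add: padic_norm_of_rat flip: padic_of_rat_diff)
      also have "padic_of_rat (q m) - padic_of_rat (q n) =
          (X n - padic_of_rat (q n)) - ((X m - padic_of_rat (q m)) - (X m - X n))" by simp
      also have "padic_norm \<dots> < e"
        using N1[of m] N1[of n] N2[of m n] that
          padic_norm_diff[of "X n - padic_of_rat (q n)" "(X m - padic_of_rat (q m)) - (X m - X n)"]
          padic_norm_diff[of "X m - padic_of_rat (q m)" "X m - X n"] by auto
      finally show ?thesis .
    qed
    thus ?thesis by blast
  qed
  hence q_Cauchy: "padic_Cauchy CARD('p) q" by (simp add: padic_Cauchy_def)
  define L where "L = (padic_of_seq q :: 'p padic)"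
  have "\<exists>N. \<forall>n\<ge>N. padic_norm (X n - L) < e" if e: "e > 0" for e
  proof -
    obtain N1 where N1: "\<And>n. n \<ge> N1 \<Longrightarrow> padic_norm (X n - padic_of_rat (q n)) < e" using q'[OF e] by blast
    obtain N2 where N2: "\<And>m n. m \<ge> N2 \<Longrightarrow> n \<ge> N2 \<Longrightarrow> padic_abs CARD('p) (q m - q n) < e / 2"
      using qC[OF half_gt_zero[OF e]] by blast
    have L: "padic_norm (L - padic_of_rat (q n)) \<le> e / 2" if "n \<ge> N2" for n
    proof -
      have eq: "L - padic_of_rat (q n) = padic_of_seq (\<lambda>m. q m + - q n)"
        using q_Cauchy by (simp add: L_def minus_padic_def padic_of_rat_def padic_of_seq_minus padic_of_seq_add
            padic_Cauchy_const[OF pr] del: add_uminus_conv_diff)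
      have "padic_Cauchy CARD('p) (\<lambda>m. q m + - q n)"
        by (intro padic_Cauchy_add[OF pr] q_Cauchy padic_Cauchy_const[OF pr])
      from padic_norm_LIMSEQ[OF this] show ?thesis
        unfolding eq by (rule LIMSEQ_le_const2) (use N2 that in \<open>auto intro!: exI[of _ N2] less_imp_le\<close>)
    qed
    have "padic_norm (X n - L) < e" if "n \<ge> max N1 N2" for n
    proof -
      have "X n - L = (X n - padic_of_rat (q n)) - (L - padic_of_rat (q n))" by simp
      thus ?thesis using padic_norm_diff[of "X n - padic_of_rat (q n)" "L - padic_of_rat (q n)"]
        N1[of n] L[of n] that e by auto
    qed
    thus ?thesis by blast
  qed
  hence "X \<longlonglongrightarrow> L" by (simp add: LIMSEQ_def dist_padic_def)
  thus ?thesis by (auto simp: convergent_def)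
qed

text \<open>Completeness comes from the field; total boundedness holds because every p-adic integer
  is within \<open>p^(-l)\<close> of one of the finitely many residues modulo
  \<open>p^l\<close>.\<close>

lemma compact_padic_integers: "compact (padic_integers :: 'p::prime_card padic set)"
  unfolding compact_eq_totally_bounded
proof (intro conjI allI impI)
  show "complete (padic_integers :: 'p padic set)"
    unfolding complete_def
  proof (intro allI impI)
    fix X :: "nat \<Rightarrow> 'p padic" assume X: "(\<forall>n. X n \<in> padic_integers) \<and> Cauchy X"
    then obtain L where L: "X \<longlonglongrightarrow> L" using Cauchy_padic_convergent by (auto simp: convergent_def)
    then obtain n where "padic_norm (X n - L) < 1"
      unfolding LIMSEQ_def dist_padic_def by (meson order_refl zero_less_one)
    moreover have "L = X n - (X n - L)" by simp
    ultimately have "padic_norm L \<le> 1"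
      using X padic_norm_diff[of "X n" "X n - L"] by (auto simp: padic_integers_def max_def split: if_splits intro: order_trans less_imp_le)
    thus "\<exists>l\<in>padic_integers. X \<longlonglongrightarrow> l" using L by (auto simp: padic_integers_def)
  qed
next
  fix e :: real assume "e > 0"
  then obtain l where l: "1 / real CARD('p) ^ l < e" by (rule padic_small[where 'p = 'p])
  have p0: "CARD('p) > 0" using prime_gt_0_nat[OF prime_card[where 'a = 'p]] .
  let ?K = "(of_int :: int \<Rightarrow> 'p padic) ` {0..<int CARD('p) ^ l}"
  have "z \<in> (\<Union>x\<in>?K. ball x e)" if z: "z \<in> padic_integers" for z
  proof -
    obtain c where c: "padic_norm (z - of_int c) \<le> 1 / real CARD('p) ^ l"
      using padic_cong_int_exists[OF z, of l] by (auto simp: padic_cong_int_altdef)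
    define c' where "c' = c mod int CARD('p) ^ l"
    have "int CARD('p) ^ l dvd c - c'" unfolding c'_def by (rule dvd_minus_mod)
    hence "padic_norm (of_int (c - c') :: 'p padic) \<le> 1 / real CARD('p) ^ l"
      by (simp only: padic_norm_of_int_le_iff)
    moreover have "z - of_int c' = (z - of_int c) + of_int (c - c')" by simp
    ultimately have "padic_norm (z - of_int c') \<le> 1 / real CARD('p) ^ l"
      using c padic_norm_add[of "z - of_int c" "of_int (c - c')"] by auto
    hence "dist (of_int c') z < e" using l by (simp add: dist_padic_def padic_norm_minus_commute)
    moreover have "c' \<in> {0..<int CARD('p) ^ l}" using p0 by (simp add: c'_def)
    ultimately show ?thesis by auto
  qed
  thus "\<exists>k. finite k \<and> (padic_integers :: 'p padic set) \<subseteq> (\<Union>x\<in>k. ball x e)"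
    by (intro exI[of _ ?K]) auto
qed

text \<open>Extract once for each index; heredity under further extraction keeps what was gained
  before. \<open>P\<close> speaks of the sequence of indices and not of values, so one lemma serves
  both convergence in the field and monotonicity of naturals; \<open>r0\<close> allows a start from
  a subsequence already chosen.\<close>

lemma finite_common_subsequence:
  fixes P :: "'i \<Rightarrow> (nat \<Rightarrow> nat) \<Rightarrow> bool" and r0 :: "nat \<Rightarrow> nat"
  assumes "finite I"
    and "\<And>i (r::nat \<Rightarrow> nat). i \<in> I \<Longrightarrow> strict_mono r \<Longrightarrow> \<exists>s::nat \<Rightarrow> nat. strict_mono s \<and> P i (r \<circ> s)"
    and "\<And>i r (s::nat \<Rightarrow> nat). i \<in> I \<Longrightarrow> P i r \<Longrightarrow> strict_mono s \<Longrightarrow> P i (r \<circ> s)"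
    and "strict_mono r0"
  obtains r :: "nat \<Rightarrow> nat" where "strict_mono r" "\<And>i. i \<in> I \<Longrightarrow> P i (r0 \<circ> r)"
proof -
  have "\<exists>r::nat \<Rightarrow> nat. strict_mono r \<and> (\<forall>i\<in>I. P i (r0 \<circ> r))"
    using assms(1-3)
  proof (induction I rule: finite_induct)
    case empty
    have "strict_mono (\<lambda>n::nat. n)" by (simp add: strict_mono_def)
    thus ?case by blast
  next
    case (insert i I)
    then obtain r :: "nat \<Rightarrow> nat" where r: "strict_mono r" "\<forall>i\<in>I. P i (r0 \<circ> r)" by blast
    obtain s :: "nat \<Rightarrow> nat" where s: "strict_mono s" "P i (r0 \<circ> r \<circ> s)"
      using insert.prems(1)[of i "r0 \<circ> r"] strict_mono_o[OF assms(4) r(1)] by blast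
    have "P j (r0 \<circ> (r \<circ> s))" if "j \<in> insert i I" for j
    proof -
      have "P j ((r0 \<circ> r) \<circ> s)"
        using that s(2) insert.prems(2)[OF _ _ s(1), of j "r0 \<circ> r"] r(2) by (cases "j = i") blast+
      thus ?thesis by (simp only: o_assoc)
    qed
    thus ?case using strict_mono_o[OF r(1) s(1)] by blast
  qed
  thus ?thesis using that by blast
qed

lemma padic_vec_subsequence:
  fixes u :: "nat \<Rightarrow> int ^ 'n" and r0 :: "nat \<Rightarrow> nat"
  assumes "strict_mono r0"
  obtains r :: "nat \<Rightarrow> nat" and y :: "'p::prime_card padic ^ 'n"
    where "strict_mono r" "\<And>i. (\<lambda>j. of_int (u (r0 (r j)) $ i)) \<longlonglongrightarrow> y $ i"
proof -
  have sc: "seq_compact (padic_integers :: 'p padic set)"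
    by (rule compact_imp_seq_compact[OF compact_padic_integers])
  define P where "P = (\<lambda>i r. convergent (\<lambda>j::nat. of_int (u (r j) $ i) :: 'p padic))"
  obtain r :: "nat \<Rightarrow> nat" where r: "strict_mono r" "\<And>i. i \<in> UNIV \<Longrightarrow> P i (r0 \<circ> r)"
  proof (rule finite_common_subsequence[of "UNIV :: 'n set" P r0])
    fix i r assume "strict_mono (r :: nat \<Rightarrow> nat)"
    have "\<forall>j. (of_int (u (r j) $ i) :: 'p padic) \<in> padic_integers"
      by (simp add: padic_integers_def padic_norm_of_int_le_1)
    from seq_compactE[OF sc this] obtain l s where "strict_mono s"
      "((\<lambda>j. of_int (u (r j) $ i)) \<circ> s) \<longlonglongrightarrow> (l :: 'p padic)" by metis
    thus "\<exists>s. strict_mono s \<and> P i (r \<circ> s)" by (auto simp: P_def convergent_def o_def)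
  next
    fix i r s assume "P i r" "strict_mono (s :: nat \<Rightarrow> nat)"
    thus "P i (r \<circ> s)" unfolding P_def
      using convergent_subseq_convergent[of "\<lambda>j. of_int (u (r j) $ i) :: 'p padic" s] by (simp add: o_def)
  qed (use assms in auto)
  define y where "y = (\<chi> i. lim (\<lambda>j. of_int (u (r0 (r j)) $ i) :: 'p padic))"
  have "(\<lambda>j. of_int (u (r0 (r j)) $ i)) \<longlonglongrightarrow> y $ i" for i
    using r(2)[of i] by (simp add: P_def y_def convergent_LIMSEQ_iff o_def)
  thus ?thesis using that r(1) by blast
qed

text \<open>A sequence with finite range takes some value infinitely often. Otherwise every term is
  exceeded by a later one, and iterating the passage to such a term gives a strictly increasing
  subsequence.\<close>

lemma nat_subsequence:
  fixes x :: "nat \<Rightarrow> nat"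
  obtains s :: "nat \<Rightarrow> nat" where "strict_mono s" "(\<exists>c. \<forall>j. x (s j) = c) \<or> strict_mono (x \<circ> s)"
proof (cases "finite (range x)")
  case True
  have "\<exists>c\<in>range x. infinite {j. x j = c}"
  proof (rule ccontr)
    assume "\<not> ?thesis"
    hence "finite (\<Union>c\<in>range x. {j. x j = c})" using True by blast
    moreover have "(\<Union>c\<in>range x. {j. x j = c}) = UNIV" by auto
    ultimately show False by simp
  qed
  then obtain c where c: "infinite {j. x j = c}" by blast
  then obtain s :: "nat \<Rightarrow> nat" where s: "strict_mono s" "\<And>j. s j \<in> {j. x j = c}"
    using infinite_enumerate by blast
  thus ?thesis using that[of s] by blast
next
  case False
  have ex: "\<exists>m>n. x m > x n" for n
  proof (rule ccontr)
    assume "\<not> ?thesis"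
    hence "range x \<subseteq> x ` {..n} \<union> {..x n}" by (auto simp: not_less)
    thus False using False finite_subset by blast
  qed
  then obtain f where f: "\<And>n. f n > n" "\<And>n. x (f n) > x n" by metis
  define s where "s = (\<lambda>j. (f ^^ j) 0)"
  have "strict_mono s" "strict_mono (x \<circ> s)" unfolding strict_mono_Suc_iff s_def using f by auto
  thus ?thesis using that by blast
qed

lemma nat_vec_subsequence:
  fixes x :: "'i \<Rightarrow> nat \<Rightarrow> nat" and r0 :: "nat \<Rightarrow> nat"
  assumes "finite I" "strict_mono r0"
  obtains r :: "nat \<Rightarrow> nat" where "strict_mono r"
    "\<And>i. i \<in> I \<Longrightarrow> (\<exists>c. \<forall>j. x i (r0 (r j)) = c) \<or> strict_mono (\<lambda>j. x i (r0 (r j)))"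
proof -
  define P where "P = (\<lambda>i r. (\<exists>c. \<forall>j::nat. x i (r j) = c) \<or> strict_mono (\<lambda>j. x i (r j)))"
  obtain r :: "nat \<Rightarrow> nat" where "strict_mono r" "\<And>i. i \<in> I \<Longrightarrow> P i (r0 \<circ> r)"
  proof (rule finite_common_subsequence[OF assms(1), of P r0])
    fix i r assume "strict_mono (r :: nat \<Rightarrow> nat)"
    obtain s :: "nat \<Rightarrow> nat" where "strict_mono s" "(\<exists>c. \<forall>j. (x i \<circ> r) (s j) = c) \<or> strict_mono ((x i \<circ> r) \<circ> s)"
      by (rule nat_subsequence)
    thus "\<exists>s. strict_mono s \<and> P i (r \<circ> s)" unfolding P_def o_def by blast
  qed (use assms(2) in \<open>auto simp: P_def strict_mono_def\<close>)
  thus ?thesis using that by (auto simp: P_def o_def)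
qed

section \<open>Exponential sums in one variable\<close>

definition padic_char :: "nat \<Rightarrow> nat \<Rightarrow> int \<Rightarrow> complex" where
  "padic_char p l c = cis (2 * pi * real_of_int c / real p ^ l)"

lemma norm_padic_char [simp]: "cmod (padic_char p l c) = 1"
  by (simp add: padic_char_def)

lemma padic_char_add: "padic_char p l (a + b) = padic_char p l a * padic_char p l b"
  by (simp add: padic_char_def cis_mult add_divide_distrib distrib_left)

lemma padic_char_eq_1_iff:
  assumes "p > 0"
  shows "padic_char p l c = 1 \<longleftrightarrow> int p ^ l dvd c"
proof
  assume "int p ^ l dvd c"
  then obtain k where "c = int p ^ l * k" by (elim dvdE)
  hence "2 * pi * real_of_int c / real p ^ l = 2 * pi * of_int k" using assms by simp
  thus "padic_char p l c = 1" by (simp add: padic_char_def cis_multiple_2pi)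
next
  assume "padic_char p l c = 1"
  hence "cos (2 * pi * real_of_int c / real p ^ l) = 1"
    by (simp add: padic_char_def complex_eq_iff)
  then obtain k :: int where "2 * pi * real_of_int c / real p ^ l = of_int k * (2 * pi)"
    by (auto simp: cos_one_2pi_int)
  hence "real_of_int c = of_int k * real p ^ l" using assms by (simp add: field_simps)
  hence "real_of_int c = of_int (k * int p ^ l)" by simp
  hence "c = k * int p ^ l" by (simp only: of_int_eq_iff)
  thus "int p ^ l dvd c" by simp
qed

lemma padic_char_cong:
  assumes "p > 0" "int p ^ l dvd a - b"
  shows "padic_char p l a = padic_char p l b"
  using padic_char_add[of p l b "a - b"] padic_char_eq_1_iff[of p l "a - b"] assms by simp

lemma padic_char_shift:
  assumes "p > 0"
  shows "padic_char p (m + l) (int p ^ m * c) = padic_char p l c"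
  using assms by (simp add: padic_char_def power_add mult.assoc)

lemma padic_char_shift':
  assumes "p > 0" "m \<le> l"
  shows "padic_char p l (int p ^ m * c) = padic_char p (l - m) c"
  using padic_char_shift[of p m "l - m" c] assms by simp

lemma sum_residues:
  fixes a b :: int and \<phi> :: "int \<Rightarrow> 'a::comm_monoid_add"
  assumes "a > 0" "b > 0"
  shows "(\<Sum>t\<in>{0..<a * b}. \<phi> t) = (\<Sum>r\<in>{0..<a}. \<Sum>t\<in>{0..<b}. \<phi> (r + a * t))"
proof -
  have "(\<Sum>t\<in>{0..<a * b}. \<phi> t) = (\<Sum>(r, t)\<in>{0..<a} \<times> {0..<b}. \<phi> (r + a * t))"
  proof (rule sum.reindex_bij_witness[where i = "\<lambda>(r, t). r + a * t" and j = "\<lambda>t. (t mod a, t div a)"])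
    fix t assume t: "t \<in> {0..<a * b}"
    have "t div a < b"
    proof -
      have "a * (t div a) \<le> t" using assms pos_mod_sign[of a t] mult_div_mod_eq[of a t] by linarith
      hence "a * (t div a) < a * b" using t by simp
      thus ?thesis using assms by simp
    qed
    thus "(t mod a, t div a) \<in> {0..<a} \<times> {0..<b}"
      using t assms by (auto simp: pos_imp_zdiv_nonneg_iff)
  next
    fix z assume z: "z \<in> {0..<a} \<times> {0..<b}"
    obtain r t where rt: "z = (r, t)" by force
    have "r + a * t < a + a * t" using z rt by simp
    also have "\<dots> = a * (t + 1)" by (simp add: algebra_simps)
    also have "\<dots> \<le> a * b" using z rt assms by (intro mult_left_mono) auto
    finally show "(case z of (r, t) \<Rightarrow> r + a * t) \<in> {0..<a * b}" using z rt assms by auto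
  qed (use assms in auto)
  thus ?thesis by (simp add: sum.cartesian_product)
qed

section \<open>Means of periodic functions\<close>

definition per :: "int \<Rightarrow> (int \<Rightarrow> 'a) \<Rightarrow> bool" where
  "per N \<phi> \<longleftrightarrow> (\<forall>a b. N dvd a - b \<longrightarrow> \<phi> a = \<phi> b)"

lemma sum_per_shift:
  fixes \<phi> :: "int \<Rightarrow> 'a::comm_monoid_add"
  assumes "per N \<phi>" "N > 0"
  shows "(\<Sum>t\<in>{0..<N}. \<phi> (t + y)) = (\<Sum>t\<in>{0..<N}. \<phi> t)"
proof (rule sum.reindex_bij_witness[where i = "\<lambda>t. (t - y) mod N" and j = "\<lambda>t. (t + y) mod N"])
  fix t assume "t \<in> {0..<N}"
  thus "((t - y) mod N + y) mod N = t" "((t + y) mod N - y) mod N = t"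
    by (simp_all add: mod_add_left_eq mod_diff_left_eq)
  have "N dvd (t + y) mod N - (t + y)"
    by (metis dvd_minus_mod dvd_minus_iff minus_diff_eq)
  thus "\<phi> ((t + y) mod N) = \<phi> (t + y)" using assms(1) unfolding per_def by blast
qed (use assms in auto)

definition mean :: "nat \<Rightarrow> nat \<Rightarrow> (int \<Rightarrow> complex) \<Rightarrow> complex" where
  "mean p L \<phi> = (\<Sum>t\<in>{0..<int p ^ L}. \<phi> t) / of_nat p ^ L"

lemma mean_split:
  assumes "p > 0"
  shows "mean p (k + L) \<phi> = (\<Sum>r\<in>{0..<int p ^ k}. mean p L (\<lambda>t. \<phi> (r + int p ^ k * t))) / of_nat p ^ k"
  using sum_residues[of "int p ^ k" "int p ^ L" \<phi>] assms
  by (simp add: mean_def power_add flip: sum_divide_distrib)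

lemma norm_sum_int_le:
  assumes "\<And>r. r \<in> {0..<int N} \<Longrightarrow> cmod (g r) \<le> B" "N > 0"
  shows "cmod ((\<Sum>r\<in>{0..<int N}. g r) / of_nat N) \<le> B"
proof -
  have "cmod (\<Sum>r\<in>{0..<int N}. g r) \<le> of_nat (card {0..<int N}) * B"
    by (rule sum_norm_bound) (use assms in auto)
  thus ?thesis using assms(2) by (simp add: norm_divide field_simps)
qed

lemma norm_mean_le:
  assumes "\<And>t. cmod (\<phi> t) \<le> B" "p > 0"
  shows "cmod (mean p L \<phi>) \<le> B"
  using norm_sum_int_le[of "p ^ L" \<phi> B] assms by (simp add: mean_def)

lemma mean_shift:
  assumes "per (int p ^ L) \<phi>" "p > 0"
  shows "mean p L (\<lambda>t. \<phi> (t + y)) = mean p L \<phi>"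
  using sum_per_shift[OF assms(1)] assms(2) by (simp add: mean_def)

lemma mean_per:
  assumes "per (int p ^ L) \<phi>" "p > 0"
  shows "mean p (L + k) \<phi> = mean p L \<phi>"
proof -
  have "(\<Sum>t\<in>{0..<int p ^ L * int p ^ k}. \<phi> t) = (\<Sum>r\<in>{0..<int p ^ L}. \<Sum>t\<in>{0..<int p ^ k}. \<phi> (r + int p ^ L * t))"
    by (rule sum_residues) (use assms in auto)
  also have "\<dots> = (\<Sum>r\<in>{0..<int p ^ L}. \<Sum>t\<in>{0..<int p ^ k}. \<phi> r)"
    using assms(1) by (intro sum.cong refl) (auto simp: per_def)
  finally show ?thesis using assms(2) by (simp add: mean_def power_add sum_distrib_left[symmetric])
qed

lemma per_mono: "per M \<phi> \<Longrightarrow> M dvd N \<Longrightarrow> per N \<phi>"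
  unfolding per_def using dvd_trans by blast

text \<open>Decomposition into spheres around \<open>0\<close>. Each induction step separates the
  multiples of \<open>p\<close>, which make up a share \<open>1/p\<close> and lead back to the
  statement with \<open>j\<close> raised by one, from the residues prime to \<open>p\<close>. After
  \<open>J\<close> steps the remaining ball of measure \<open>p^(-J)\<close> is estimated trivially.
  The bound is assumed only on balls of relative radius \<open>p^(-\<kappa>)\<close> because the van
  der Corput condition holds only there.\<close>

lemma mean_dyadic:
  fixes p :: nat
  assumes p: "p > 1" and "\<kappa> \<ge> 1"
    and "\<And>t. cmod (\<phi> t) \<le> 1"
    and "\<And>j y L. j < J \<Longrightarrow> \<not> int p dvd y \<Longrightarrow> L \<ge> l \<Longrightarrow>
        cmod (mean p L (\<lambda>t. \<phi> (int p ^ j * (y + int p ^ \<kappa> * t)))) \<le> B j"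
    and "\<And>j. B j \<ge> 0" and "L \<ge> l + J + \<kappa>"
  shows "cmod (mean p L \<phi>) \<le> 1 / real p ^ J + (\<Sum>j<J. B j / real p ^ j)"
  using assms(3-)
proof (induction J arbitrary: \<phi> B L)
  case 0
  thus ?case using norm_mean_le[of \<phi> 1 p L] p by simp
next
  case (Suc J)
  define L' where "L' = L - 1"
  have L: "L = 1 + L'" "L' \<ge> l + J + \<kappa>" using Suc.prems(4) by (auto simp: L'_def)
  define g where "g = (\<lambda>r. mean p L' (\<lambda>t. \<phi> (r + int p * t)))"
  have split: "{0..<int p} = insert 0 {1..<int p}" using p by auto
  have "mean p L \<phi> = (\<Sum>r\<in>{0..<int p}. g r) / of_nat p"
    using mean_split[of p 1 L' \<phi>] p by (simp add: L g_def)
  also have "(\<Sum>r\<in>{0..<int p}. g r) = g 0 + (\<Sum>r\<in>{1..<int p}. g r)"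
    unfolding split by simp
  finally have eq: "mean p L \<phi> = (g 0 + (\<Sum>r\<in>{1..<int p}. g r)) / of_nat p" .
  have g0: "cmod (g 0) \<le> 1 / real p ^ J + (\<Sum>j<J. B (Suc j) / real p ^ j)"
  proof -
    have "cmod (mean p L' (\<lambda>t. \<phi> (int p * t))) \<le> 1 / real p ^ J + (\<Sum>j<J. B (Suc j) / real p ^ j)"
    proof (rule Suc.IH)
      fix j y M assume "j < J" "\<not> int p dvd y" "M \<ge> l"
      thus "cmod (mean p M (\<lambda>t. \<phi> (int p * (int p ^ j * (y + int p ^ \<kappa> * t))))) \<le> B (Suc j)"
        using Suc.prems(2)[of "Suc j" y M] by (simp add: mult_ac)
    qed (use Suc.prems L in auto)
    thus ?thesis by (simp add: g_def)
  qed
  have gr: "cmod (g r) \<le> B 0" if r: "r \<in> {1..<int p}" for r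
  proof -
    \<comment> \<open>The class of \<open>r\<close> modulo \<open>p\<close> is cut into classes
      modulo \<open>p^\<kappa>\<close>; one of the \<open>\<kappa>\<close> digits is already fixed
      by \<open>r\<close>.\<close>
    define L2 where "L2 = L' - (\<kappa> - 1)"
    have L2: "L' = (\<kappa> - 1) + L2" "L2 \<ge> l" using L assms(2) by (auto simp: L2_def)
    have ex: "int p * int p ^ (\<kappa> - 1) = int p ^ \<kappa>" using assms(2) by (simp flip: power_Suc)
    have *: "g r = (\<Sum>s\<in>{0..<int (p ^ (\<kappa> - 1))}. mean p L2 (\<lambda>t. \<phi> (r + int p * (s + int p ^ (\<kappa> - 1) * t)))) / of_nat (p ^ (\<kappa> - 1))"
      unfolding g_def L2(1) by (subst mean_split) (use p in auto)
    show ?thesis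
      unfolding *
    proof (rule norm_sum_int_le)
      fix s :: int
      have "\<not> int p dvd r" using r zdvd_imp_le[of "int p" r] by auto
      hence "\<not> int p dvd r + int p * s" by (simp add: dvd_add_left_iff)
      from Suc.prems(2)[of 0, OF _ this L2(2)]
      show "cmod (mean p L2 (\<lambda>t. \<phi> (r + int p * (s + int p ^ (\<kappa> - 1) * t)))) \<le> B 0"
        using ex by (simp add: ring_distribs add_ac flip: mult.assoc)
    qed (use p in auto)
  qed
  have "cmod (\<Sum>r\<in>{1..<int p}. g r) \<le> (\<Sum>r\<in>{1..<int p}. B 0)"
    by (intro sum_norm_le gr)
  also have "\<dots> = real (p - 1) * B 0" using p by simp
  also have "\<dots> \<le> real p * B 0" using Suc.prems(3)[of 0] by (intro mult_right_mono) auto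
  finally have s: "cmod (\<Sum>r\<in>{1..<int p}. g r) \<le> real p * B 0" .
  have "cmod (mean p L \<phi>) \<le> (cmod (g 0) + cmod (\<Sum>r\<in>{1..<int p}. g r)) / real p"
    unfolding eq norm_divide norm_of_nat by (intro divide_right_mono norm_triangle_ineq) auto
  also have "\<dots> \<le> ((1 / real p ^ J + (\<Sum>j<J. B (Suc j) / real p ^ j)) + real p * B 0) / real p"
    using g0 s by (intro divide_right_mono) auto
  also have "\<dots> = 1 / real p ^ Suc J + (\<Sum>j<Suc J. B j / real p ^ j)"
    using p by (simp add: sum.lessThan_Suc_shift add_divide_distrib sum_divide_distrib mult.commute del: sum.lessThan_Suc)
  finally show ?case .
qed

text \<open>The coefficient of order \<open>k\<close> has valuation exactly \<open>\<tau>\<close>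
  and dominates the higher ones by more than a factor \<open>k!\<close>. The factorial is a reserve
  for the descent in \<open>k\<close>: differentiating the Taylor coefficient of order
  \<open>k - 1\<close> brings in a factor \<open>k\<close>, whose valuation is paid from it, and
  \<open>(k - 1)!\<close> is left.\<close>

definition vdc_cond :: "nat \<Rightarrow> nat \<Rightarrow> nat \<Rightarrow> int poly \<Rightarrow> bool" where
  "vdc_cond p k \<tau> h \<longleftrightarrow> int p ^ \<tau> dvd coeff h k \<and> \<not> int p ^ Suc \<tau> dvd coeff h k \<and>
     (\<forall>i>k. int p ^ (\<tau> + 1 + multiplicity (int p) (fact k)) dvd coeff h i)"

section \<open>Polynomials in a shifted and rescaled variable\<close>

lemma coeff_pcompose_linear:
  fixes h :: "'a::comm_ring_1 poly"
  shows "coeff (pcompose h [:y, d:]) i =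
    (\<Sum>j\<le>degree h. coeff h j * (of_nat (j choose i) * d ^ i * y ^ (j - i)))"
proof -
  have "pcompose h [:y, d:] = (\<Sum>j\<le>degree h. smult (coeff h j) ([:y, d:] ^ j))"
    by (simp add: pcompose_altdef poly_altdef coeff_map_poly degree_map_poly)
  moreover have "coeff ([:y, d:] ^ j) i = of_nat (j choose i) * d ^ i * y ^ (j - i)" for j
  proof (cases "i \<le> j")
    case False
    have "degree ([:y, d:] ^ j) \<le> degree [:y, d:] * j" by (rule degree_power_le)
    also have "\<dots> \<le> 1 * j" by (intro mult_right_mono) auto
    finally show ?thesis using False by (simp add: coeff_eq_0 binomial_eq_0)
  qed (rule coeff_linear_poly_power)
  ultimately show ?thesis by (simp add: coeff_sum)
qed

lemma coeff_pcompose_scale: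
  fixes h :: "'a::comm_ring_1 poly"
  shows "coeff (pcompose h [:y, d:]) i = d ^ i * coeff (pcompose h [:y, 1:]) i"
  by (simp add: coeff_pcompose_linear sum_distrib_left mult_ac)

lemma poly_diff_dvd:
  fixes h :: "int poly"
  assumes "\<And>i. i > 1 \<Longrightarrow> c dvd coeff h i"
  shows "c * d dvd poly h (t + d) - poly h t - coeff h 1 * d"
proof -
  have "poly h (t + d) - poly h t = (\<Sum>i\<le>degree h. coeff h i * ((t + d) ^ i - t ^ i))"
    by (simp add: poly_altdef right_diff_distrib sum_subtractf)
  hence "poly h (t + d) - poly h t - coeff h 1 * d = (\<Sum>i\<le>degree h. coeff h i * ((t + d) ^ i - t ^ i) - (if i = 1 then coeff h 1 * d else 0))"
    by (auto simp: sum_subtractf coeff_eq_0)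
  also have "c * d dvd \<dots>"
  proof (rule dvd_sum)
    fix i :: nat
    consider "i = 0" | "i = 1" | "i > 1" by linarith
    thus "c * d dvd coeff h i * ((t + d) ^ i - t ^ i) - (if i = 1 then coeff h 1 * d else 0)"
    proof cases
      case 3
      have "d dvd (t + d) ^ i - t ^ i"
        using power_diff_sumr2[of "t + d" i t] by simp
      thus ?thesis using 3 assms[of i] by (auto intro: mult_dvd_mono)
    qed auto
  qed
  finally show ?thesis .
qed

lemma per_char_poly:
  assumes "p > 0"
  shows "per (int p ^ l) (\<lambda>t. padic_char p l (poly h t))"
  unfolding per_def
proof (intro allI impI)
  fix a b assume ab: "int p ^ l dvd a - b"
  have "a - b dvd poly h a - poly h b - coeff h 1 * (a - b)"
    using poly_diff_dvd[of 1 h "a - b" b] by simp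
  hence "a - b dvd poly h a - poly h b" by (simp add: dvd_diff_left_iff)
  with ab have "int p ^ l dvd poly h a - poly h b" by (rule dvd_trans)
  thus "padic_char p l (poly h a) = padic_char p l (poly h b)"
    by (rule padic_char_cong[OF assms])
qed

text \<open>Shifting the variable by \<open>p\<^bsup>l - \<tau> - 1\<^esup>\<close> multiplies the summand by a constant different from \<open>1\<close>.\<close>

lemma mean_nonstationary:
  assumes p: "prime p" and h: "vdc_cond p 1 \<tau> h" and l: "l > \<tau>" "L \<ge> l"
  shows "mean p L (\<lambda>t. padic_char p l (poly h t)) = 0"
proof -
  have p0: "p > 0" using p prime_gt_0_nat by blast
  let ?\<phi> = "\<lambda>t. padic_char p l (poly h t)"
  define d where "d = int p ^ (l - Suc \<tau>)"
  define z where "z = padic_char p l (coeff h 1 * d)"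
  have pl: "int p ^ Suc \<tau> * d = int p ^ l" using l(1) by (simp add: d_def flip: power_add power_Suc)
  have "?\<phi> (t + d) = z * ?\<phi> t" for t
  proof -
    have "int p ^ Suc \<tau> * d dvd poly h (t + d) - poly h t - coeff h 1 * d"
      by (rule poly_diff_dvd) (use h in \<open>auto simp: vdc_cond_def\<close>)
    hence "int p ^ l dvd poly h (t + d) - (poly h t + coeff h 1 * d)"
      unfolding pl by (simp add: algebra_simps)
    from padic_char_cong[OF p0 this] show ?thesis by (simp add: z_def padic_char_add mult.commute)
  qed
  hence "mean p L (\<lambda>t. ?\<phi> (t + d)) = z * mean p L ?\<phi>"
    by (simp add: mean_def sum_distrib_left)
  moreover have "mean p L (\<lambda>t. ?\<phi> (t + d)) = mean p L ?\<phi>"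
    by (rule mean_shift[OF per_mono[OF per_char_poly[OF p0]] p0]) (use l in \<open>simp add: le_imp_power_dvd\<close>)
  moreover have "z \<noteq> 1"
  proof
    assume "z = 1"
    hence "int p ^ Suc \<tau> * d dvd coeff h 1 * d"
      using padic_char_eq_1_iff[OF p0, of l] unfolding z_def pl by simp
    moreover have "d \<noteq> 0" using p0 by (simp add: d_def)
    ultimately have "int p ^ Suc \<tau> dvd coeff h 1" by (metis dvd_mult_cancel_right)
    thus False using h by (simp add: vdc_cond_def)
  qed
  ultimately show ?thesis by (metis mult_cancel_right1)
qed

text \<open>The cap \<open>K\<close> keeps the exponent finite: \<open>H\<close> may vanish
  somewhere, or be divisible by ever higher powers of \<open>q\<close> along a sequence of
  points.\<close>

lemma exists_dvd_max:
  fixes H :: "int \<Rightarrow> int"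
  obtains z where "\<And>y k. k \<le> K \<Longrightarrow> q ^ k dvd H y \<Longrightarrow> q ^ k dvd H z"
proof -
  define k0 where "k0 = (GREATEST k. k \<le> K \<and> (\<exists>y. q ^ k dvd H y))"
  have ex: "0 \<le> K \<and> (\<exists>y. q ^ 0 dvd H y)" by simp
  have "k0 \<le> K \<and> (\<exists>y. q ^ k0 dvd H y)"
    unfolding k0_def by (rule GreatestI_nat[where P = "\<lambda>k. k \<le> K \<and> (\<exists>y. q ^ k dvd H y)", OF ex]) auto
  then obtain z where z: "q ^ k0 dvd H z" by blast
  have "k \<le> k0" if "k \<le> K" "q ^ k dvd H y" for k y
    unfolding k0_def by (rule Greatest_le_nat[where b = K]) (use that in auto)
  hence "q ^ k dvd H z" if "k \<le> K" "q ^ k dvd H y" for k y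
    using that z by (meson dvd_trans le_imp_power_dvd)
  thus ?thesis using that by blast
qed

text \<open>To first order, the Taylor coefficient of order \<open>k\<close> moves with its base
  point at the speed \<open>(k + 1) h_(k+1)\<close>. In the remaining terms the coefficient supplies
  the factor \<open>c\<close> and the difference of powers supplies \<open>y - z\<close>.\<close>

lemma coeff_taylor_diff:
  fixes h :: "int poly"
  assumes "\<And>i. i > Suc k \<Longrightarrow> c dvd coeff h i"
  shows "c * (y - z) dvd coeff (pcompose h [:y, 1:]) k - coeff (pcompose h [:z, 1:]) k
     - of_nat (Suc k) * coeff h (Suc k) * (y - z)"
proof -
  have "coeff (pcompose h [:y, 1:]) k - coeff (pcompose h [:z, 1:]) k
     = (\<Sum>j\<le>degree h. coeff h j * (of_nat (j choose k) * (y ^ (j - k) - z ^ (j - k))))"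
    by (simp add: coeff_pcompose_linear right_diff_distrib sum_subtractf)
  hence "coeff (pcompose h [:y, 1:]) k - coeff (pcompose h [:z, 1:]) k
     - of_nat (Suc k) * coeff h (Suc k) * (y - z) =
    (\<Sum>j\<le>degree h. coeff h j * (of_nat (j choose k) * (y ^ (j - k) - z ^ (j - k)))
       - (if j = Suc k then of_nat (Suc k) * coeff h (Suc k) * (y - z) else 0))"
    by (auto simp: sum_subtractf coeff_eq_0)
  also have "c * (y - z) dvd \<dots>"
  proof (rule dvd_sum)
    fix j :: nat
    consider "j \<le> k" | "j = Suc k" | "j > Suc k" by linarith
    thus "c * (y - z) dvd coeff h j * (of_nat (j choose k) * (y ^ (j - k) - z ^ (j - k)))
       - (if j = Suc k then of_nat (Suc k) * coeff h (Suc k) * (y - z) else 0)"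
    proof cases
      case 3
      have "y - z dvd y ^ (j - k) - z ^ (j - k)"
        using power_diff_sumr2[of y "j - k" z] by simp
      hence "y - z dvd of_nat (j choose k) * (y ^ (j - k) - z ^ (j - k))" by (rule dvd_mult)
      thus ?thesis using 3 assms[of j] by (auto intro!: mult_dvd_mono)
    qed (auto simp: binomial_eq_0_iff)
  qed
  finally show ?thesis .
qed

lemma dvd_coeff_pcompose_linear:
  fixes h :: "int poly"
  assumes "\<And>j. j \<ge> i \<Longrightarrow> c dvd coeff h j"
  shows "d ^ i * c dvd coeff (pcompose h [:y, d:]) i"
  unfolding coeff_pcompose_linear
proof (rule dvd_sum)
  fix j
  show "d ^ i * c dvd coeff h j * (of_nat (j choose i) * d ^ i * y ^ (j - i))"
  proof (cases "j \<ge> i")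
    case True
    hence "c * d ^ i dvd coeff h j * (d ^ i * (of_nat (j choose i) * y ^ (j - i)))"
      by (intro mult_dvd_mono assms) auto
    thus ?thesis by (simp add: mult_ac)
  qed (auto simp: binomial_eq_0)
qed

text \<open>At \<open>x = z + p^j y\<close> with \<open>y\<close> a unit, the coefficient of order
  \<open>k\<close> differs from the one at \<open>z\<close> by a number of valuation exactly
  \<open>\<tau> + a + j\<close>. As \<open>z\<close> is a point of greatest divisibility, the
  coefficient at \<open>x\<close> cannot be divisible by a higher power: otherwise so would be the
  one at \<open>z\<close>, and then the difference.\<close>

lemma vdc_cond_restrict:
  fixes p :: nat
  assumes p: "prime p" and h: "vdc_cond p (Suc k) \<tau> h"
  defines "\<kappa> \<equiv> 1 + multiplicity (int p) (fact (Suc k))"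
    and "a \<equiv> multiplicity (int p) (int (Suc k))"
  shows "\<exists>z. \<forall>j<J. \<forall>y. \<not> int p dvd y \<longrightarrow>
     (\<exists>\<tau>' \<le> \<tau> + j * Suc k + \<kappa> * k + a. vdc_cond p k \<tau>' (pcompose h [:z + int p ^ j * y, int p ^ (j + \<kappa>):]))"
proof -
  have pp: "prime (int p)" using p by simp
  have p1: "p > 1" using p prime_gt_1_nat by blast
  define H where "H = (\<lambda>y. coeff (pcompose h [:y, 1:]) k)"
  \<comment> \<open>The cap covers the exponents \<open>\<tau> + a + j + 1\<close> for all
    \<open>j < J\<close>.\<close>
  obtain z where z: "\<And>y v. v \<le> \<tau> + a + J \<Longrightarrow> int p ^ v dvd H y \<Longrightarrow> int p ^ v dvd H z"
    using exists_dvd_max[of "\<tau> + a + J" "int p" H] by blast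
  define b where "b = multiplicity (int p) (fact k)"
  have \<kappa>: "\<kappa> = 1 + a + b"
    unfolding \<kappa>_def a_def b_def fact_Suc of_nat_id
    using pp by (subst prime_elem_multiplicity_mult_distrib) auto
  have hi: "int p ^ (\<tau> + \<kappa>) dvd coeff h i" if "i > Suc k" for i
    using h that by (simp add: vdc_cond_def \<kappa>_def add.assoc)
  have h\<tau>: "int p ^ \<tau> dvd coeff h i" if "i > k" for i
  proof (cases "i = Suc k")
    case False
    have "int p ^ \<tau> dvd int p ^ (\<tau> + \<kappa>)" by (simp add: le_imp_power_dvd)
    thus ?thesis using hi[of i] that False by (metis Suc_lessI dvd_trans)
  qed (use h in \<open>simp add: vdc_cond_def\<close>)
  obtain c where c: "coeff h (Suc k) = int p ^ \<tau> * c" using h\<tau>[of "Suc k"] by auto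
  have cp: "\<not> int p dvd c"
  proof
    assume "int p dvd c"
    hence "int p ^ Suc \<tau> dvd coeff h (Suc k)" by (auto simp: c mult_ac elim!: dvdE)
    thus False using h by (simp add: vdc_cond_def)
  qed
  obtain c' where c': "int (Suc k) = int p ^ a * c'" "\<not> int p dvd c'"
    using multiplicity_decompose'[of "int (Suc k)" "int p"] pp p1 unfolding a_def
    by (metis not_prime_unit of_nat_eq_0_iff nat.distinct(1))
  have "\<exists>\<tau>' \<le> \<tau> + j * Suc k + \<kappa> * k + a. vdc_cond p k \<tau>' (pcompose h [:z + int p ^ j * y, int p ^ (j + \<kappa>):])"
    if j: "j < J" and y: "\<not> int p dvd y" for j y
  proof -
    define x where "x = z + int p ^ j * y"
    have "int p ^ (\<tau> + \<kappa>) * (x - z) dvd H x - H z - of_nat (Suc k) * coeff h (Suc k) * (x - z)"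
      unfolding H_def by (rule coeff_taylor_diff) (use hi in auto)
    then obtain E where E: "H x - H z - of_nat (Suc k) * coeff h (Suc k) * (x - z) = int p ^ (\<tau> + \<kappa>) * (x - z) * E"
      by (elim dvdE)
    have "H x - H z = int p ^ (\<tau> + a + j) * (y * (c' * c + int p * (int p ^ b * E)))"
    proof -
      have "H x - H z = of_nat (Suc k) * coeff h (Suc k) * (x - z) + int p ^ (\<tau> + \<kappa>) * (x - z) * E"
        using E by simp
      also have "of_nat (Suc k) = int p ^ a * c'" using c'(1) by simp
      finally show ?thesis
        unfolding c \<kappa> x_def by (simp add: power_add algebra_simps)
    qed
    moreover have "\<not> int p dvd y * (c' * c + int p * (int p ^ b * E))"
      using y cp c'(2) pp by (auto simp: prime_dvd_mult_iff dvd_add_left_iff)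
    ultimately have nd: "\<not> int p ^ Suc (\<tau> + a + j) dvd H x - H z"
      using p1 by (simp add: mult.commute[of "int p"])
    have ndx: "\<not> int p ^ Suc (\<tau> + a + j) dvd H x"
    proof
      assume *: "int p ^ Suc (\<tau> + a + j) dvd H x"
      hence "int p ^ Suc (\<tau> + a + j) dvd H z" using j by (intro z[of _ x]) auto
      thus False using * nd by (simp add: dvd_diff)
    qed
    define v where "v = multiplicity (int p) (H x)"
    have "H x \<noteq> 0" using ndx by auto
    hence v: "int p ^ v dvd H x" "\<not> int p ^ Suc v dvd H x"
      using power_dvd_iff_le_multiplicity[of "H x" "int p" "Suc v"] p1
        multiplicity_dvd[of "int p" "H x"] by (auto simp: v_def simp del: power_Suc)
    have va: "v \<le> \<tau> + a + j"
      using v(1) ndx by (meson dvd_trans le_imp_power_dvd not_less_eq_eq)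
    \<comment> \<open>Rescaling by \<open>q\<close> multiplies the coefficient of order
      \<open>i\<close> by \<open>q^i\<close>, so every order above \<open>k\<close> gains at least
      \<open>j + \<kappa>\<close> over order \<open>k\<close>. Since
      \<open>\<kappa> = 1 + a + b\<close>, this pays for the excess \<open>a + j\<close> of
      \<open>v\<close> over \<open>\<tau>\<close> and for the margin \<open>1 + b\<close> that
      \<open>vdc_cond\<close> demands.\<close>
    define q where "q = int p ^ (j + \<kappa>)"
    have q: "q \<noteq> 0" using p1 by (simp add: q_def)
    define \<tau>' where "\<tau>' = (j + \<kappa>) * k + v"
    have ck: "coeff (pcompose h [:x, q:]) k = q ^ k * H x"
      unfolding H_def by (rule coeff_pcompose_scale)
    have "vdc_cond p k \<tau>' (pcompose h [:x, q:])"
      unfolding vdc_cond_def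
    proof (intro conjI allI impI)
      have pt: "int p ^ \<tau>' = q ^ k * int p ^ v" by (simp add: \<tau>'_def q_def power_add power_mult)
      have pt': "int p ^ Suc \<tau>' = q ^ k * int p ^ Suc v" using pt by simp
      show "int p ^ \<tau>' dvd coeff (pcompose h [:x, q:]) k"
        unfolding ck pt using v(1) by (intro mult_dvd_mono) auto
      show "\<not> int p ^ Suc \<tau>' dvd coeff (pcompose h [:x, q:]) k"
        unfolding ck pt' using v(2) q by (subst dvd_mult_cancel_left) auto
      fix i assume i: "i > k"
      have "q ^ i * int p ^ \<tau> dvd coeff (pcompose h [:x, q:]) i"
        by (rule dvd_coeff_pcompose_linear) (use i h\<tau> in auto)
      moreover have "q ^ i * int p ^ \<tau> = int p ^ ((j + \<kappa>) * i + \<tau>)"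
        by (simp add: q_def power_add power_mult)
      moreover have "\<tau>' + 1 + b \<le> (j + \<kappa>) * i + \<tau>"
      proof -
        have "(j + \<kappa>) * (k + 1) \<le> (j + \<kappa>) * i" using i by (intro mult_left_mono) auto
        thus ?thesis using va \<kappa> by (simp add: \<tau>'_def)
      qed
      ultimately show "int p ^ (\<tau>' + 1 + multiplicity (int p) (fact k)) dvd coeff (pcompose h [:x, q:]) i"
        by (metis b_def dvd_trans le_imp_power_dvd)
    qed
    moreover have "\<tau>' \<le> \<tau> + j * Suc k + \<kappa> * k + a"
      using va by (simp add: \<tau>'_def algebra_simps)
    ultimately show ?thesis by (auto simp: x_def q_def)
  qed
  thus ?thesis by blast
qed

text \<open>
  Induction on \<open>k\<close>: around a point where the \<open>k\<close>-th Taylor coefficient is most divisible by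
  \<open>p\<close>, that coefficient at distance \<open>p\<^bsup>-j\<^esup>\<close> is as large as the next one allows, so that the
  bound for \<open>k\<close> applies on each of the spheres of radius \<open>p\<^bsup>-j\<^esup>\<close>.
\<close>

lemma van_der_Corput_exact:
  assumes p: "prime p"
  shows "\<exists>C\<ge>1. \<forall>h \<tau> l L. vdc_cond p (Suc k) \<tau> h \<longrightarrow> l \<le> L \<longrightarrow>
    cmod (mean p L (\<lambda>t. padic_char p l (poly h t))) \<le> C * real p powr (- (real l - real \<tau>) / real (Suc k))"
proof (induction k)
  case 0
  have p1: "p > 1" using p prime_gt_1_nat by blast
  show ?case
  proof (intro exI[of _ 1] conjI allI impI)
    fix h :: "int poly" and \<tau> l L :: nat assume h: "vdc_cond p (Suc 0) \<tau> h" and L: "l \<le> L"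
    show "cmod (mean p L (\<lambda>t. padic_char p l (poly h t))) \<le> 1 * real p powr (- (real l - real \<tau>) / real (Suc 0))"
    proof (cases "l > \<tau>")
      case True
      thus ?thesis using mean_nonstationary[OF p _ True L, of h] h by simp
    next
      case False
      hence "1 \<le> real p powr (- (real l - real \<tau>) / real (Suc 0))"
        using p1 by (intro ge_one_powr_ge_zero) auto
      thus ?thesis using norm_mean_le[of "\<lambda>t. padic_char p l (poly h t)" 1 p L] p1 by simp
    qed
  qed auto
next
  case (Suc k)
  have p1: "p > 1" using p prime_gt_1_nat by blast
  define m where "m = Suc k"
  have m: "real m > 0" by (simp add: m_def)
  obtain C where C: "C \<ge> 1" and IH: "\<And>h \<tau> l L. vdc_cond p m \<tau> h \<Longrightarrow> l \<le> L \<Longrightarrow>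
    cmod (mean p L (\<lambda>t. padic_char p l (poly h t))) \<le> C * real p powr (- (real l - real \<tau>) / real m)"
    using Suc.IH unfolding m_def by blast
  define \<kappa> where "\<kappa> = 1 + multiplicity (int p) (fact (Suc m))"
  define a where "a = multiplicity (int p) (int (Suc m))"
  \<comment> \<open>The ratio of the contributions of consecutive spheres: the bound for a sphere
    grows by \<open>p^((m+1)/m)\<close> while its measure shrinks by \<open>p\<close>.\<close>
  define r where "r = real p powr (1 / real m)"
  have r: "r > 1" unfolding r_def using p1 m by (intro gr_one_powr) auto
  have rpow: "r ^ j = real p powr (real j * (1 / real m))" for j
  proof -
    have "r ^ j = r powr real j" using r by (simp add: powr_realpow)
    also have "\<dots> = real p powr (1 / real m * real j)" by (simp only: r_def powr_powr)
    finally show ?thesis by (simp add: mult.commute)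
  qed
  \<comment> \<open>The summand \<open>p\<close> pays for rounding \<open>J\<close> down; the other
    one comes from the geometric sum over the spheres.\<close>
  define C' where "C' = real p + C * real p powr ((real \<kappa> * real m + real a) / real m) / (r - 1)"
  have C'1: "C' \<ge> 1"
  proof -
    have "C * real p powr ((real \<kappa> * real m + real a) / real m) / (r - 1) \<ge> 0" using C r by simp
    thus ?thesis using p1 unfolding C'_def by simp
  qed
  show ?case
    unfolding m_def[symmetric]
  proof (intro exI[of _ C'] conjI allI impI C'1)
    fix h :: "int poly" and \<tau> l L :: nat assume h: "vdc_cond p (Suc m) \<tau> h" and L: "l \<le> L"
    show "cmod (mean p L (\<lambda>t. padic_char p l (poly h t))) \<le> C' * real p powr (- (real l - real \<tau>) / real (Suc m))"
    proof (cases "l > \<tau>")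
      case False
      hence "1 * 1 \<le> C' * real p powr (- (real l - real \<tau>) / real (Suc m))"
        using p1 C'1 by (intro mult_mono ge_one_powr_ge_zero) auto
      thus ?thesis using norm_mean_le[of "\<lambda>t. padic_char p l (poly h t)" 1 p L] p1 by simp
    next
      case l: True
      define x where "x = real l - real \<tau>"
      \<comment> \<open>The balancing radius: the trivial bound \<open>p^(-J)\<close> for the inner
        ball matches the target \<open>p^(-x/(m+1))\<close>, and the increasing geometric sum over
        the spheres is dominated by its last term, which has the same size.\<close>
      define J where "J = (l - \<tau>) div Suc m"
      have "real (J * Suc m) \<le> real (l - \<tau>)" unfolding J_def by (intro of_nat_mono) (rule div_times_less_eq_dividend)
      hence "real J * real (Suc m) \<le> x" using l by (simp add: x_def of_nat_diff distrib_left)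
      hence J1: "real J \<le> x / real (Suc m)" by (simp add: field_simps)
      have "l - \<tau> < Suc m * Suc J" unfolding J_def using dividend_less_times_div[of "Suc m" "l - \<tau>"] by simp
      hence "real (l - \<tau>) < real (Suc m * Suc J)" by (simp only: of_nat_less_iff)
      hence "x < real (Suc m) * (real J + 1)" using l by (simp add: x_def of_nat_diff algebra_simps)
      hence J2: "x / real (Suc m) - 1 \<le> real J" by (simp add: field_simps)
      obtain z where z: "\<And>j y. j < J \<Longrightarrow> \<not> int p dvd y \<Longrightarrow>
         \<exists>\<tau>' \<le> \<tau> + j * Suc m + \<kappa> * m + a. vdc_cond p m \<tau>' (pcompose h [:z + int p ^ j * y, int p ^ (j + \<kappa>):])"
        using vdc_cond_restrict[OF p h, of J] unfolding \<kappa>_def a_def by blast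
      let ?\<phi> = "\<lambda>t. padic_char p l (poly h t)"
      define B where "B = (\<lambda>j. C * real p powr (- (x - (real j * real (Suc m) + real \<kappa> * real m + real a)) / real m))"
      \<comment> \<open>Lengthening the mean by periods leaves at least \<open>l\<close> digits
        after \<open>J\<close> splittings and the refinement by \<open>\<kappa>\<close>.\<close>
      have "mean p L ?\<phi> = mean p (L + (J + \<kappa>)) ?\<phi>"
        by (rule mean_per[symmetric, OF per_mono[OF per_char_poly]]) (use p1 L in \<open>auto intro: le_imp_power_dvd\<close>)
      also have "\<dots> = mean p (L + (J + \<kappa>)) (\<lambda>t. ?\<phi> (t + z))"
        by (rule mean_shift[symmetric, OF per_mono[OF per_char_poly]]) (use p1 L in \<open>auto intro: le_imp_power_dvd\<close>)
      finally have eq: "mean p L ?\<phi> = mean p (L + (J + \<kappa>)) (\<lambda>t. ?\<phi> (t + z))" .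
      have "cmod (mean p (L + (J + \<kappa>)) (\<lambda>t. ?\<phi> (t + z))) \<le> 1 / real p ^ J + (\<Sum>j<J. B j / real p ^ j)"
      proof (rule mean_dyadic[where \<kappa> = \<kappa> and l = l])
        fix j y M assume j: "j < J" "\<not> int p dvd y" "l \<le> M"
        from z[OF j(1,2)] obtain \<tau>' where \<tau>': "\<tau>' \<le> \<tau> + j * Suc m + \<kappa> * m + a"
          "vdc_cond p m \<tau>' (pcompose h [:z + int p ^ j * y, int p ^ (j + \<kappa>):])" by blast
        have "cmod (mean p M (\<lambda>t. padic_char p l (poly (pcompose h [:z + int p ^ j * y, int p ^ (j + \<kappa>):]) t)))
          \<le> C * real p powr (- (real l - real \<tau>') / real m)"
          by (rule IH[OF \<tau>'(2) j(3)])
        also have "\<dots> \<le> B j"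
        proof -
          have "real \<tau>' \<le> real (\<tau> + j * Suc m + \<kappa> * m + a)" using \<tau>'(1) by (rule of_nat_mono)
          hence "- (real l - real \<tau>') \<le> - (x - (real j * real (Suc m) + real \<kappa> * real m + real a))"
            by (simp add: x_def distrib_left)
          thus ?thesis unfolding B_def using C p1 m
            by (intro mult_left_mono powr_mono divide_right_mono) auto
        qed
        finally show "cmod (mean p M (\<lambda>t. ?\<phi> (int p ^ j * (y + int p ^ \<kappa> * t) + z))) \<le> B j"
          by (simp add: poly_pcompose power_add algebra_simps)
      qed (use p1 C L in \<open>auto simp: \<kappa>_def B_def\<close>)
      also have "(\<Sum>j<J. B j / real p ^ j) =
          (\<Sum>j<J. C * real p powr ((real \<kappa> * real m + real a) / real m) * real p powr (- x / real m) * r ^ j)"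
      proof (rule sum.cong[OF refl])
        fix j
        have e: "- (x - (real j * real (Suc m) + real \<kappa> * real m + real a)) / real m - real j
          = (real \<kappa> * real m + real a) / real m + (- x / real m) + real j * (1 / real m)"
          using m by (simp add: field_simps)
        have "B j / real p ^ j = C * real p powr (- (x - (real j * real (Suc m) + real \<kappa> * real m + real a)) / real m - real j)"
          using p1 by (simp add: B_def powr_diff powr_realpow)
        also have "\<dots> = C * (real p powr ((real \<kappa> * real m + real a) / real m) * real p powr (- x / real m) * real p powr (real j * (1 / real m)))"
          unfolding e by (simp only: powr_add)
        also have "real p powr (real j * (1 / real m)) = r ^ j"
          by (rule rpow[symmetric])
        finally show "B j / real p ^ j = C * real p powr ((real \<kappa> * real m + real a) / real m) * real p powr (- x / real m) * r ^ j"
          by (simp add: mult_ac)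
      qed
      also have "\<dots> = C * real p powr ((real \<kappa> * real m + real a) / real m) * real p powr (- x / real m) * ((r ^ J - 1) / (r - 1))"
        using r by (simp add: geometric_sum flip: sum_distrib_left)
      also have "\<dots> \<le> C * real p powr ((real \<kappa> * real m + real a) / real m) * real p powr (- x / real m) * (real p powr (x / (real m * real (Suc m))) / (r - 1))"
      proof (intro mult_left_mono divide_right_mono)
        have "r ^ J = real p powr (real J * (1 / real m))"
          by (rule rpow)
        also have "\<dots> \<le> real p powr (x / (real m * real (Suc m)))"
        proof (rule powr_mono)
          have "real J * (1 / real m) \<le> x / real (Suc m) * (1 / real m)"
            by (rule mult_right_mono[OF J1]) simp
          thus "real J * (1 / real m) \<le> x / (real m * real (Suc m))" by (simp add: mult.commute)
        qed (use p1 in simp)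
        finally show "r ^ J - 1 \<le> real p powr (x / (real m * real (Suc m)))" by simp
      qed (use r C in auto)
      also have "\<dots> = C * real p powr ((real \<kappa> * real m + real a) / real m) / (r - 1) * real p powr (- x / real m + x / (real m * real (Suc m)))"
        by (subst powr_add) (simp add: mult_ac)
      also have "- x / real m + x / (real m * real (Suc m)) = - x / real (Suc m)"
      proof -
        have "x / real m = (real (Suc m) * x) / (real (Suc m) * real m)"
          by (rule mult_divide_mult_cancel_left[symmetric]) simp
        hence "- x / real m + x / (real m * real (Suc m)) = (- real (Suc m) * x + x) / (real m * real (Suc m))"
          by (simp only: add_divide_distrib minus_divide_left[symmetric] mult_minus_left mult.commute[of "real m"])
        also have "- real (Suc m) * x + x = real m * (- x)" by (simp add: algebra_simps)
        also have "real m * (- x) / (real m * real (Suc m)) = - x / real (Suc m)"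
          by (rule mult_divide_mult_cancel_left) (use m in simp)
        finally show ?thesis .
      qed
      also have "1 / real p ^ J \<le> real p * real p powr (- x / real (Suc m))"
      proof -
        have "1 / real p ^ J = real p powr (- real J)"
          using p1 by (simp add: powr_minus powr_realpow divide_inverse)
        also have "\<dots> \<le> real p powr (1 + - x / real (Suc m))"
          using p1 J2 by (intro powr_mono) auto
        also have "\<dots> = real p * real p powr (- x / real (Suc m))"
          using p1 by (subst powr_add) simp
        finally show ?thesis .
      qed
      finally show ?thesis unfolding eq C'_def x_def by (simp add: algebra_simps)
    qed
  qed
qed

text \<open>For \<open>l \<le> \<tau>\<close> the right-hand side is at least \<open>1\<close>. For
  \<open>l > \<tau>\<close> the mean vanishes when \<open>k = 1\<close>, whatever
  \<open>\<theta>\<close> is, and otherwise a rate not above \<open>1/k\<close> only weakens the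
  exact one.\<close>

lemma van_der_Corput:
  assumes p: "prime p" and k: "k \<ge> 1" and \<theta>: "\<theta> \<ge> 0" "k = 1 \<or> \<theta> \<le> 1 / real k"
  shows "\<exists>C\<ge>1. \<forall>h \<tau> l L. vdc_cond p k \<tau> h \<longrightarrow> l \<le> L \<longrightarrow>
    cmod (mean p L (\<lambda>t. padic_char p l (poly h t))) \<le> C * real p powr (- \<theta> * (real l - real \<tau>))"
proof -
  have p1: "p > 1" using p prime_gt_1_nat by blast
  have "Suc (k - 1) = k" using k by simp
  then obtain C where C: "C \<ge> 1" and bound: "\<And>h \<tau> l L. vdc_cond p k \<tau> h \<Longrightarrow> l \<le> L \<Longrightarrow>
    cmod (mean p L (\<lambda>t. padic_char p l (poly h t))) \<le> C * real p powr (- (real l - real \<tau>) / real k)"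
    using van_der_Corput_exact[OF p, of "k - 1"] by metis
  show ?thesis
  proof (intro exI[of _ C] conjI allI impI C)
    fix h :: "int poly" and \<tau> l L :: nat assume h: "vdc_cond p k \<tau> h" and L: "l \<le> L"
    show "cmod (mean p L (\<lambda>t. padic_char p l (poly h t))) \<le> C * real p powr (- \<theta> * (real l - real \<tau>))"
    proof (cases "l > \<tau>")
      case False
      hence "1 * 1 \<le> C * real p powr (- \<theta> * (real l - real \<tau>))"
        using p1 C \<theta> by (intro mult_mono ge_one_powr_ge_zero) (auto intro: mult_nonneg_nonpos)
      thus ?thesis using norm_mean_le[of "\<lambda>t. padic_char p l (poly h t)" 1 p L] p1 by simp
    next
      case True
      show ?thesis
      proof (cases "k = 1")
        case k1: True
        thus ?thesis using mean_nonstationary[OF p _ True L, of h] h C by simp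
      next
        case False
        hence "\<theta> * (real l - real \<tau>) \<le> 1 / real k * (real l - real \<tau>)"
          using \<theta> True by (intro mult_right_mono) auto
        hence "- (real l - real \<tau>) / real k \<le> - \<theta> * (real l - real \<tau>)"
          by (simp only: minus_divide_left[symmetric] mult_minus_left neg_le_iff_le) simp
        hence "real p powr (- (real l - real \<tau>) / real k) \<le> real p powr (- \<theta> * (real l - real \<tau>))"
          using p1 by (intro powr_mono) auto
        thus ?thesis using bound[OF h L] C by (meson mult_left_mono order_trans zero_le_one)
      qed
    qed
  qed
qed

section \<open>Taylor expansions\<close>

text \<open>The polynomial with coefficients \<open>g\<close> on \<open>A\<close>, restricted to the
  line \<open>u + t v\<close> and read as a polynomial in \<open>t\<close>. Its coefficient of
  degree \<open>k\<close> is the homogeneous part of degree \<open>k\<close> of the Taylor expansion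
  at \<open>u\<close>, evaluated at \<open>v\<close>.\<close>

definition shift_poly :: "(nat ^ 'n) set \<Rightarrow> (nat ^ 'n \<Rightarrow> 'a) \<Rightarrow> 'a ^ 'n \<Rightarrow> 'a ^ 'n \<Rightarrow> 'a::comm_ring_1 poly" where
  "shift_poly A g u v = (\<Sum>\<alpha>\<in>A. smult (g \<alpha>) (\<Prod>i\<in>UNIV. [:u $ i, v $ i:] ^ (\<alpha> $ i)))"

text \<open>The derivative divided by \<open>\<beta>!\<close>, written with binomial coefficients so
  that it makes sense over the integers. Where \<open>\<alpha> $ i < \<beta> $ i\<close> the
  binomial coefficient vanishes, which makes the truncated exponent harmless.\<close>

definition taylor :: "(nat ^ 'n) set \<Rightarrow> (nat ^ 'n \<Rightarrow> 'a) \<Rightarrow> 'a ^ 'n \<Rightarrow> nat ^ 'n \<Rightarrow> 'a::comm_ring_1" where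
  "taylor A g u \<beta> = (\<Sum>\<alpha>\<in>A. g \<alpha> * (\<Prod>i\<in>UNIV. of_nat (\<alpha> $ i choose \<beta> $ i) * u $ i ^ (\<alpha> $ i - \<beta> $ i)))"

definition exponents_of_degree :: "nat \<Rightarrow> (nat ^ 'n) set" where
  "exponents_of_degree k = {\<beta>. (\<Sum>i\<in>UNIV. \<beta> $ i) = k}"

lemma vec_component_le_sum: "(\<beta> :: nat ^ 'n) $ i \<le> (\<Sum>i\<in>UNIV. \<beta> $ i)"
  by (rule member_le_sum) auto

lemma finite_vec_box:
  assumes "\<And>i. finite (A i)"
  shows "finite {x :: 'a ^ 'n. \<forall>i. x $ i \<in> A i}"
proof -
  have "{x :: 'a ^ 'n. \<forall>i. x $ i \<in> A i} \<subseteq> vec_lambda ` (PiE UNIV A)"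
  proof
    fix x :: "'a ^ 'n" assume "x \<in> {x. \<forall>i. x $ i \<in> A i}"
    hence "x = vec_lambda (($) x)" "($) x \<in> PiE UNIV A" by auto
    thus "x \<in> vec_lambda ` (PiE UNIV A)" by blast
  qed
  moreover have "finite (PiE UNIV A)" using assms by (intro finite_PiE) auto
  ultimately show ?thesis using finite_subset by blast
qed

lemma prod_sum_vec:
  fixes f :: "'n::finite \<Rightarrow> 'b \<Rightarrow> 'a::comm_semiring_1"
  assumes "\<And>i. finite (A i)"
  shows "(\<Sum>x\<in>{x :: 'b ^ 'n. \<forall>i. x $ i \<in> A i}. \<Prod>i\<in>UNIV. f i (x $ i)) = (\<Prod>i\<in>UNIV. \<Sum>a\<in>A i. f i a)"
proof -
  have "(\<Sum>x\<in>{x :: 'b ^ 'n. \<forall>i. x $ i \<in> A i}. \<Prod>i\<in>UNIV. f i (x $ i))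
      = (\<Sum>g\<in>PiE UNIV A. \<Prod>i\<in>UNIV. f i (g i))"
    by (rule sum.reindex_bij_witness[where i = vec_lambda and j = "($)"]) auto
  also have "\<dots> = (\<Prod>i\<in>UNIV. \<Sum>a\<in>A i. f i a)"
    by (rule prod_sum_PiE[symmetric]) (use assms in auto)
  finally show ?thesis .
qed

lemma finite_exponents_of_degree: "finite (exponents_of_degree k :: (nat ^ 'n) set)"
proof (rule finite_subset)
  show "(exponents_of_degree k :: (nat ^ 'n) set) \<subseteq> {\<beta>. \<forall>i. \<beta> $ i \<in> {..k}}"
    using vec_component_le_sum by (auto simp: exponents_of_degree_def)
qed (rule finite_vec_box, simp)

lemma poly_shift_poly:
  "poly (shift_poly A g u v) t = (\<Sum>\<alpha>\<in>A. g \<alpha> * (\<Prod>i\<in>UNIV. (u $ i + t * v $ i) ^ (\<alpha> $ i)))"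
  by (simp add: shift_poly_def poly_sum poly_prod poly_power)

lemma prod_monom: "finite I \<Longrightarrow> (\<Prod>i\<in>I. monom (c i) (k i)) = monom (\<Prod>i\<in>I. c i) (\<Sum>i\<in>I. k i)"
  by (induction I rule: finite_induct) (auto simp: mult_monom one_poly_eq_simps)

lemma linear_power_monom:
  fixes u v :: "'a::comm_ring_1"
  shows "[:u, v:] ^ a = (\<Sum>b\<le>a. monom (of_nat (a choose b) * u ^ (a - b) * v ^ b) b)"
proof (rule poly_eqI)
  fix k
  show "coeff ([:u, v:] ^ a) k = coeff (\<Sum>b\<le>a. monom (of_nat (a choose b) * u ^ (a - b) * v ^ b) b) k"
  proof (cases "k \<le> a")
    case True
    thus ?thesis by (simp add: coeff_linear_poly_power coeff_sum mult_ac)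
  next
    case False
    have "degree ([:u, v:] ^ a) \<le> degree [:u, v:] * a" by (rule degree_power_le)
    also have "\<dots> \<le> 1 * a" by (intro mult_right_mono) auto
    finally show ?thesis using False by (auto simp: coeff_eq_0 coeff_sum intro!: sum.neutral)
  qed
qed

lemma coeff_shift_poly:
  fixes u v :: "'a::comm_ring_1 ^ 'n"
  shows "coeff (shift_poly A g u v) k = (\<Sum>\<beta>\<in>exponents_of_degree k. taylor A g u \<beta> * (\<Prod>i\<in>UNIV. v $ i ^ (\<beta> $ i)))"
proof -
  have *: "coeff (\<Prod>i\<in>UNIV. [:u $ i, v $ i:] ^ (\<alpha> $ i)) k =
    (\<Sum>\<beta>\<in>exponents_of_degree k. (\<Prod>i\<in>UNIV. of_nat (\<alpha> $ i choose \<beta> $ i) * u $ i ^ (\<alpha> $ i - \<beta> $ i)) * (\<Prod>i\<in>UNIV. v $ i ^ (\<beta> $ i)))"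
    for \<alpha> :: "nat ^ 'n"
  proof -
    let ?c = "\<lambda>\<beta>. (\<Prod>i\<in>UNIV. of_nat (\<alpha> $ i choose \<beta> $ i) * u $ i ^ (\<alpha> $ i - \<beta> $ i)) * (\<Prod>i\<in>UNIV. v $ i ^ (\<beta> $ i))"
    let ?B = "{\<beta> :: nat ^ 'n. \<forall>i. \<beta> $ i \<in> {..\<alpha> $ i}}"
    have finB: "finite ?B" by (rule finite_vec_box) simp
    have "(\<Prod>i\<in>UNIV. [:u $ i, v $ i:] ^ (\<alpha> $ i)) =
       (\<Sum>\<beta>\<in>?B. \<Prod>i\<in>UNIV. monom (of_nat (\<alpha> $ i choose \<beta> $ i) * u $ i ^ (\<alpha> $ i - \<beta> $ i) * v $ i ^ (\<beta> $ i)) (\<beta> $ i))"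
      unfolding linear_power_monom by (rule prod_sum_vec[symmetric]) simp
    also have "\<dots> = (\<Sum>\<beta>\<in>?B. monom (?c \<beta>) (\<Sum>i\<in>UNIV. \<beta> $ i))"
      by (simp add: prod_monom prod.distrib)
    finally have "coeff (\<Prod>i\<in>UNIV. [:u $ i, v $ i:] ^ (\<alpha> $ i)) k = (\<Sum>\<beta>\<in>?B. if (\<Sum>i\<in>UNIV. \<beta> $ i) = k then ?c \<beta> else 0)"
      by (simp add: coeff_sum)
    also have "\<dots> = (\<Sum>\<beta>\<in>?B \<inter> exponents_of_degree k. ?c \<beta>)"
      using finB by (simp add: sum.inter_restrict exponents_of_degree_def)
    also have "\<dots> = (\<Sum>\<beta>\<in>exponents_of_degree k. ?c \<beta>)"
    proof (rule sum.mono_neutral_left)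
      show "\<forall>\<beta>\<in>exponents_of_degree k - ?B \<inter> exponents_of_degree k. ?c \<beta> = 0"
      proof
        fix \<beta> :: "nat ^ 'n" assume "\<beta> \<in> exponents_of_degree k - ?B \<inter> exponents_of_degree k"
        then obtain i where "\<beta> $ i > \<alpha> $ i" by (auto simp: not_le)
        hence "of_nat (\<alpha> $ i choose \<beta> $ i) * u $ i ^ (\<alpha> $ i - \<beta> $ i) = (0 :: 'a)" by (simp add: binomial_eq_0)
        hence "(\<Prod>i\<in>UNIV. of_nat (\<alpha> $ i choose \<beta> $ i) * u $ i ^ (\<alpha> $ i - \<beta> $ i)) = (0 :: 'a)"
          by (intro prod_zero) auto
        thus "?c \<beta> = 0" by simp
      qed
    qed (use finite_exponents_of_degree in auto)
    finally show ?thesis .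
  qed
  have "coeff (shift_poly A g u v) k = (\<Sum>\<alpha>\<in>A. g \<alpha> * coeff (\<Prod>i\<in>UNIV. [:u $ i, v $ i:] ^ (\<alpha> $ i)) k)"
    by (simp add: shift_poly_def coeff_sum)
  also have "\<dots> = (\<Sum>\<beta>\<in>exponents_of_degree k. taylor A g u \<beta> * (\<Prod>i\<in>UNIV. v $ i ^ (\<beta> $ i)))"
    unfolding * taylor_def sum_distrib_left sum_distrib_right
    by (subst sum.swap) (simp add: mult_ac)
  finally show ?thesis .
qed

lemma of_int_taylor:
  "of_int (taylor A g u \<beta>) = (taylor A (\<lambda>\<alpha>. of_int (g \<alpha>)) (\<chi> i. of_int (u $ i)) \<beta> :: 'a::comm_ring_1)"
  by (simp add: taylor_def)

lemma of_int_coeff_shift_poly: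
  "of_int (coeff (shift_poly A g u v) k) =
    (coeff (shift_poly A (\<lambda>\<alpha>. of_int (g \<alpha>)) (\<chi> i. of_int (u $ i)) (\<chi> i. of_int (v $ i))) k :: 'a::comm_ring_1)"
  by (simp add: coeff_shift_poly of_int_taylor)

section \<open>Forms that vanish at all integer points\<close>

lemma base_expansion_inj:
  fixes b c :: "nat \<Rightarrow> nat"
  assumes "(\<Sum>j<n. b j * B ^ j) = (\<Sum>j<n. c j * B ^ j)" "\<And>j. j < n \<Longrightarrow> b j < B" "\<And>j. j < n \<Longrightarrow> c j < B" "j < n"
  shows "b j = c j"
  using assms
proof (induction n arbitrary: b c j)
  case (Suc n)
  have e: "(\<Sum>j<Suc n. d j * B ^ j) = d 0 + B * (\<Sum>j<n. d (Suc j) * B ^ j)" for d :: "nat \<Rightarrow> nat"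
    by (simp add: sum.lessThan_Suc_shift sum_distrib_left mult_ac del: sum.lessThan_Suc)
  have B: "B > 0" using Suc.prems(2)[of 0] by auto
  have eq: "b 0 + B * (\<Sum>j<n. b (Suc j) * B ^ j) = c 0 + B * (\<Sum>j<n. c (Suc j) * B ^ j)"
    using Suc.prems(1) unfolding e .
  have "b 0 = c 0"
    using arg_cong[OF eq, of "\<lambda>x. x mod B"] Suc.prems(2,3)[of 0] by simp
  moreover from this eq B have "(\<Sum>j<n. b (Suc j) * B ^ j) = (\<Sum>j<n. c (Suc j) * B ^ j)" by simp
  hence "b (Suc i) = c (Suc i)" if "i < n" for i
    by (rule Suc.IH[of "\<lambda>j. b (Suc j)" "\<lambda>j. c (Suc j)"]) (use Suc.prems that in auto)
  ultimately show ?case using Suc.prems(4) by (cases j) auto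
qed simp

text \<open>Kronecker's substitution \<open>v\<^sub>i = x^(B^i)\<close> separates the monomials.\<close>

lemma vanishing_form_coeffs:
  fixes c :: "nat ^ 'n \<Rightarrow> 'a::field_char_0"
  assumes "\<And>v :: int ^ 'n. (\<Sum>\<beta>\<in>exponents_of_degree k. c \<beta> * (\<Prod>i\<in>UNIV. of_int (v $ i) ^ (\<beta> $ i))) = 0"
    and "\<beta> \<in> exponents_of_degree k"
  shows "c \<beta> = 0"
proof -
  define N where "N = CARD('n)"
  obtain idx where idx: "bij_betw idx (UNIV :: 'n set) {..<N}"
    using ex_bij_betw_finite_nat[of "UNIV :: 'n set"] by (auto simp: atLeast0LessThan N_def)
  \<comment> \<open>Every entry of an exponent of degree \<open>k\<close> is a digit in base
    \<open>k + 1\<close>, so distinct exponents receive distinct weights \<open>w\<close>.\<close>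
  define B where "B = Suc k"
  define w where "w = (\<lambda>\<beta> :: nat ^ 'n. \<Sum>i\<in>UNIV. \<beta> $ i * B ^ idx i)"
  have inj: "inj_on w (exponents_of_degree k)"
  proof (rule inj_onI)
    fix \<beta> \<gamma> assume *: "\<beta> \<in> exponents_of_degree k" "\<gamma> \<in> exponents_of_degree k" "w \<beta> = w \<gamma>"
    define g where "g = inv_into UNIV idx"
    have g: "g (idx i) = i" for i using idx by (simp add: g_def bij_betw_def inv_f_f)
    have ws: "w \<beta> = (\<Sum>j<N. \<beta> $ g j * B ^ j)" for \<beta>
      unfolding w_def sum.reindex_bij_betw[OF idx, symmetric, of "\<lambda>j. \<beta> $ g j * B ^ j"] g ..
    have lt: "\<beta> $ i < B" if "\<beta> \<in> exponents_of_degree k" for \<beta> i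
      using that vec_component_le_sum[of \<beta> i] by (auto simp: B_def exponents_of_degree_def)
    have "\<beta> $ g j = \<gamma> $ g j" if "j < N" for j
      by (rule base_expansion_inj[where n = N and B = B and b = "\<lambda>j. \<beta> $ g j" and c = "\<lambda>j. \<gamma> $ g j", OF _ _ _ that])
         (use * ws lt in auto)
    moreover have "idx i < N" for i using idx by (auto simp: bij_betw_def)
    ultimately have "\<beta> $ i = \<gamma> $ i" for i using g by metis
    thus "\<beta> = \<gamma>" by (simp add: vec_eq_iff)
  qed
  define P where "P = (\<Sum>\<beta>\<in>exponents_of_degree k. monom (c \<beta>) (w \<beta>))"
  have "poly P (of_nat x) = 0" for x
  proof -
    have "(\<Prod>i\<in>UNIV. of_int ((\<chi> i. int x ^ (B ^ idx i)) $ i) ^ (\<beta> $ i)) = (of_nat x ^ w \<beta> :: 'a)" for \<beta> :: "nat ^ 'n"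
      by (simp add: w_def power_sum mult.commute flip: power_mult)
    thus ?thesis using assms(1)[of "\<chi> i. int x ^ (B ^ idx i)"] by (simp add: P_def poly_sum poly_monom)
  qed
  hence "range (of_nat :: nat \<Rightarrow> 'a) \<subseteq> {x. poly P x = 0}" by auto
  moreover have "infinite (range (of_nat :: nat \<Rightarrow> 'a))" by (simp add: finite_image_iff inj_of_nat)
  ultimately have "P = 0" using poly_roots_finite finite_subset by metis
  hence "0 = coeff P (w \<beta>)" by simp
  also have "\<dots> = (\<Sum>\<gamma>\<in>exponents_of_degree k. if \<gamma> = \<beta> then c \<beta> else 0)"
    unfolding P_def coeff_sum coeff_monom by (intro sum.cong refl) (use assms(2) inj in \<open>auto dest: inj_onD\<close>)
  also have "\<dots> = c \<beta>" by (subst sum.delta) (simp_all add: finite_exponents_of_degree assms(2))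
  finally show ?thesis by simp
qed

section \<open>Geometry of the Newton polyhedron\<close>

text \<open>The support of \<open>f\<close> may be infinite, but these exponents are finite in
  number and their orthants already contain all the others.\<close>

definition min_supp :: "(nat ^ 'n \<Rightarrow> int) \<Rightarrow> (nat ^ 'n) set" where
  "min_supp f = {\<alpha>. f \<alpha> \<noteq> 0 \<and> (\<forall>\<gamma>. f \<gamma> \<noteq> 0 \<longrightarrow> (\<forall>i. \<gamma> $ i \<le> \<alpha> $ i) \<longrightarrow> \<gamma> = \<alpha>)}"

definition pairing :: "nat ^ 'n \<Rightarrow> nat ^ 'n \<Rightarrow> nat" where
  "pairing k \<alpha> = (\<Sum>i\<in>UNIV. k $ i * \<alpha> $ i)"

text \<open>The number \<open>m(k)\<close>. As \<open>k\<close> has no negative entries, its minimum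
  over the whole polyhedron is attained at a minimal exponent.\<close>

definition weight :: "(nat ^ 'n \<Rightarrow> int) \<Rightarrow> nat ^ 'n \<Rightarrow> nat" where
  "weight f k = Min (pairing k ` min_supp f)"

definition real_vec :: "nat ^ 'n \<Rightarrow> real ^ 'n" where
  "real_vec \<alpha> = (\<chi> i. real (\<alpha> $ i))"

lemma real_vec_nth [simp]: "real_vec \<alpha> $ i = real (\<alpha> $ i)"
  by (simp add: real_vec_def)

lemma inner_real_vec: "real_vec k \<bullet> real_vec \<alpha> = real (pairing k \<alpha>)"
  by (simp add: inner_vec_def pairing_def)

lemma pairing_mono: "(\<And>i. \<gamma> $ i \<le> \<alpha> $ i) \<Longrightarrow> pairing k \<gamma> \<le> pairing k \<alpha>"
  unfolding pairing_def by (intro sum_mono mult_left_mono) auto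

lemma exists_min_supp:
  assumes "f \<alpha> \<noteq> 0"
  obtains \<gamma> where "\<gamma> \<in> min_supp f" "\<And>i. \<gamma> $ i \<le> \<alpha> $ i"
proof -
  let ?P = "\<lambda>\<gamma>. f \<gamma> \<noteq> 0 \<and> (\<forall>i. \<gamma> $ i \<le> \<alpha> $ i)"
  let ?s = "\<lambda>\<gamma> :: nat ^ 'a. \<Sum>i\<in>UNIV. \<gamma> $ i"
  obtain \<gamma> where \<gamma>: "?P \<gamma>" "\<And>\<delta>. ?P \<delta> \<Longrightarrow> ?s \<gamma> \<le> ?s \<delta>"
    using ex_has_least_nat[of ?P \<alpha> ?s] assms by auto
  have "\<delta> = \<gamma>" if \<delta>: "f \<delta> \<noteq> 0" "\<forall>i. \<delta> $ i \<le> \<gamma> $ i" for \<delta>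
  proof (rule ccontr)
    assume "\<delta> \<noteq> \<gamma>"
    then obtain i where "\<delta> $ i \<noteq> \<gamma> $ i" by (auto simp: vec_eq_iff)
    hence "\<delta> $ i < \<gamma> $ i" using \<delta>(2) by (simp add: order.not_eq_order_implies_strict)
    hence "?s \<delta> < ?s \<gamma>" using \<delta>(2) by (intro sum_strict_mono_ex1) auto
    moreover have "?P \<delta>" using \<delta> \<gamma>(1) order_trans by blast
    ultimately show False using \<gamma>(2)[of \<delta>] by simp
  qed
  hence "\<gamma> \<in> min_supp f" using \<gamma>(1) by (auto simp: min_supp_def)
  thus ?thesis using \<gamma>(1) that by blast
qed

text \<open>Dickson's lemma: an infinite sequence of exponents has a subsequence in which each
  coordinate is constant or increasing, so it contains two comparable ones, which cannot both be
  minimal and different.\<close>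

lemma finite_min_supp: "finite (min_supp f)"
proof (rule ccontr)
  assume "infinite (min_supp f)"
  then obtain s :: "nat \<Rightarrow> nat ^ 'a" where s: "inj s" "range s \<subseteq> min_supp f"
    using infinite_countable_subset by blast
  have "strict_mono (\<lambda>j::nat. j)" by (simp add: strict_mono_def)
  from nat_vec_subsequence[of "UNIV :: 'a set" "\<lambda>j. j" "\<lambda>i j. s j $ i", OF _ this]
  obtain r :: "nat \<Rightarrow> nat" where r: "strict_mono r"
    "\<And>i. (\<exists>c. \<forall>j. s (r j) $ i = c) \<or> strict_mono (\<lambda>j. s (r j) $ i)" by (metis finite UNIV_I)
  have "s (r 0) $ i \<le> s (r 1) $ i" for i
    using r(2)[of i] by (auto simp: strict_mono_def less_imp_le)
  moreover have "s (r 0) \<in> min_supp f" "s (r 1) \<in> min_supp f" using s(2) by auto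
  ultimately have "s (r 0) = s (r 1)" unfolding min_supp_def by blast
  hence "r 0 = r 1" using s(1) by (simp add: inj_eq)
  thus False using r(1) by (metis strict_mono_eq zero_neq_one)
qed

lemma min_supp_subset: "\<alpha> \<in> min_supp f \<Longrightarrow> f \<alpha> \<noteq> 0"
  by (simp add: min_supp_def)

definition total_degree :: "nat ^ 'n \<Rightarrow> nat" where
  "total_degree k = (\<Sum>i\<in>UNIV. k $ i)"

text \<open>The vanishing constant term keeps the origin out of the support; hence \<open>d\<close>
  and the weights of strictly positive vectors are positive.\<close>

locale series =
  fixes f :: "nat ^ 'n \<Rightarrow> int"
  assumes nonzero: "\<exists>\<alpha>. f \<alpha> \<noteq> 0" and f0: "f 0 = 0"
begin

lemma min_supp_nonempty: "min_supp f \<noteq> {}"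
  using nonzero exists_min_supp by blast

lemma weight_le_pairing:
  assumes "f \<alpha> \<noteq> 0"
  shows "weight f k \<le> pairing k \<alpha>"
proof -
  obtain \<gamma> where \<gamma>: "\<gamma> \<in> min_supp f" "\<And>i. \<gamma> $ i \<le> \<alpha> $ i" using exists_min_supp[of f \<alpha>, OF assms] by blast
  have "weight f k \<le> pairing k \<gamma>" unfolding weight_def using \<gamma>(1) finite_min_supp by (intro Min_le) auto
  also have "\<dots> \<le> pairing k \<alpha>" by (intro pairing_mono \<gamma>(2))
  finally show ?thesis .
qed

lemma weight_attained: obtains \<alpha> where "\<alpha> \<in> min_supp f" "pairing k \<alpha> = weight f k"
proof -
  have "weight f k \<in> pairing k ` min_supp f"
    unfolding weight_def using finite_min_supp min_supp_nonempty by (intro Min_in) auto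
  thus ?thesis using that by auto
qed

section \<open>The polyhedron and its lowest point on the diagonal\<close>

abbreviation "N \<equiv> newton_polyhedron f"
abbreviation "d \<equiv> newton_distance f"
definition "z = (\<chi> i::'n. d)"

lemma convex_N: "convex N"
  by (simp add: newton_polyhedron_def convex_convex_hull)

lemma weight_le_inner:
  assumes "t \<in> N"
  shows "real (weight f k) \<le> real_vec k \<bullet> t"
proof -
  have "N \<subseteq> {t. real_vec k \<bullet> t \<ge> real (weight f k)}"
    unfolding newton_polyhedron_def
  proof (intro hull_minimal convex_halfspace_ge subsetI)
    fix t :: "real ^ 'n" assume "t \<in> (\<Union>\<alpha>\<in>{\<alpha>. f \<alpha> \<noteq> 0}. {t. \<forall>i. real (\<alpha> $ i) \<le> t $ i})"
    then obtain \<alpha> where \<alpha>: "f \<alpha> \<noteq> 0" "\<And>i. real (\<alpha> $ i) \<le> t $ i" by blast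
    have "real (weight f k) \<le> real_vec k \<bullet> real_vec \<alpha>"
      using weight_le_pairing[OF \<alpha>(1)] by (simp add: inner_real_vec)
    also have "\<dots> \<le> real_vec k \<bullet> t"
      unfolding inner_vec_def using \<alpha>(2) by (intro sum_mono) (auto intro!: mult_left_mono)
    finally show "t \<in> {t. real_vec k \<bullet> t \<ge> real (weight f k)}" by simp
  qed
  thus ?thesis using assms by blast
qed

text \<open>As the sum of a compact polytope and the closed orthant, the polyhedron is seen to be
  closed and stable under increasing coordinates.\<close>

lemma N_eq: "N = (\<Union>x\<in>{y. \<forall>i. 0 \<le> y $ i}. \<Union>y\<in>convex hull (real_vec ` min_supp f). {x + y})"
    (is "_ = ?R")
proof
  have co: "convex {y :: real ^ 'n. \<forall>i. 0 \<le> y $ i}" by (auto simp: convex_def)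
  show "N \<subseteq> ?R"
    unfolding newton_polyhedron_def
  proof (intro hull_minimal convex_sums co convex_convex_hull subsetI)
    fix t :: "real ^ 'n" assume "t \<in> (\<Union>\<alpha>\<in>{\<alpha>. f \<alpha> \<noteq> 0}. {t. \<forall>i. real (\<alpha> $ i) \<le> t $ i})"
    then obtain \<alpha> where \<alpha>: "f \<alpha> \<noteq> 0" "\<And>i. real (\<alpha> $ i) \<le> t $ i" by blast
    obtain \<gamma> where \<gamma>: "\<gamma> \<in> min_supp f" "\<And>i. \<gamma> $ i \<le> \<alpha> $ i" using exists_min_supp[of f \<alpha>, OF \<alpha>(1)] by blast
    have "real (\<gamma> $ i) \<le> t $ i" for i using \<alpha>(2)[of i] \<gamma>(2)[of i] by linarith
    hence "t - real_vec \<gamma> \<in> {y. \<forall>i. 0 \<le> y $ i}" by simp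
    moreover have "real_vec \<gamma> \<in> convex hull (real_vec ` min_supp f)" using \<gamma>(1) by (intro hull_inc) auto
    moreover have "t = (t - real_vec \<gamma>) + real_vec \<gamma>" by simp
    ultimately show "t \<in> ?R" by blast
  qed
  show "?R \<subseteq> N"
  proof
    fix t assume "t \<in> ?R"
    then obtain x y where xy: "\<And>i. 0 \<le> x $ i" "y \<in> convex hull (real_vec ` min_supp f)" "t = x + y" by blast
    have "convex hull ((+) x ` real_vec ` min_supp f) \<subseteq> N"
      unfolding newton_polyhedron_def
      by (intro hull_mono) (use xy(1) in \<open>auto simp: min_supp_def\<close>)
    moreover have "t \<in> (+) x ` (convex hull (real_vec ` min_supp f))" using xy by blast
    ultimately show "t \<in> N" by (auto simp: convex_hull_translation)
  qed
qed

lemma N_up: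
  assumes "s \<in> N" "\<And>i. s $ i \<le> t $ i"
  shows "t \<in> N"
proof -
  obtain x y where xy: "\<And>i. 0 \<le> x $ i" "y \<in> convex hull (real_vec ` min_supp f)" "s = x + y"
    using assms(1) unfolding N_eq by blast
  have "t - y \<in> {y. \<forall>i. 0 \<le> y $ i}" using assms(2) xy by (auto intro: order_trans)
       (metis add_le_cancel_right add_0 order_trans)
  moreover have "t = (t - y) + y" by simp
  ultimately show ?thesis unfolding N_eq using xy(2) by blast
qed

lemma closed_N: "closed N"
  unfolding N_eq
proof (rule closed_compact_sums)
  have "{y :: real ^ 'n. \<forall>i. 0 \<le> y $ i} = (\<Inter>i. {y. 0 \<le> y $ i})" by auto
  also have "closed \<dots>" by (intro closed_INT ballI closed_Collect_le continuous_intros)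
  finally show "closed {y :: real ^ 'n. \<forall>i. 0 \<le> y $ i}" .
  show "compact (convex hull (real_vec ` min_supp f))"
    using finite_min_supp by (intro compact_convex_hull finite_imp_compact) auto
qed

lemma pairing_pos:
  assumes "\<And>i. k $ i > 0" "\<alpha> \<noteq> 0"
  shows "pairing k \<alpha> > 0"
proof -
  obtain i where "\<alpha> $ i \<noteq> 0" using assms(2) by (auto simp: vec_eq_iff)
  hence "0 < k $ i * \<alpha> $ i" using assms(1)[of i] by simp
  also have "\<dots> \<le> pairing k \<alpha>" unfolding pairing_def by (rule member_le_sum) auto
  finally show ?thesis .
qed

text \<open>Closedness turns the infimum into a minimum. For the lower bound, pair with
  \<open>(1, \<dots>, 1)\<close>: its weight is the least total degree of an exponent, hence at
  least \<open>1\<close>.\<close>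

lemma distance_facts:
  shows z_in_N: "z \<in> N" and distance_ge: "real CARD('n) * d \<ge> 1"
    and distance_le: "\<And>t. (\<chi> i. t) \<in> N \<Longrightarrow> d \<le> t"
proof -
  let ?T = "{t. (\<chi> i::'n. t) \<in> N}"
  have lb: "1 \<le> real CARD('n) * t" if "(\<chi> i. t) \<in> N" for t
  proof -
    obtain \<alpha> where \<alpha>: "\<alpha> \<in> min_supp f" "pairing (\<chi> i::'n. 1) \<alpha> = weight f (\<chi> i. 1)" by (rule weight_attained)
    have "\<alpha> \<noteq> 0" using \<alpha>(1) f0 by (auto simp: min_supp_def)
    hence "pairing (\<chi> i::'n. 1) \<alpha> > 0" by (intro pairing_pos) auto
    hence "1 \<le> real (weight f (\<chi> i::'n. 1))" using \<alpha>(2) by simp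
    also have "\<dots> \<le> real_vec (\<chi> i::'n. 1) \<bullet> (\<chi> i. t)" by (rule weight_le_inner[OF that])
    finally show ?thesis by (simp add: inner_vec_def)
  qed
  have bdd: "bdd_below ?T"
  proof (rule bdd_belowI[of _ 0])
    fix t assume "t \<in> ?T"
    hence "1 \<le> real CARD('n) * t" using lb by simp
    hence "0 < real CARD('n) * t" by linarith
    thus "0 \<le> t" by (simp add: zero_less_mult_iff)
  qed
  obtain \<alpha> where \<alpha>: "f \<alpha> \<noteq> 0" using nonzero by blast
  have "(\<chi> i. \<Sum>j\<in>UNIV. real (\<alpha> $ j)) \<in> N"
    unfolding newton_polyhedron_def
    by (rule hull_inc, rule UN_I[of \<alpha>]) (use \<alpha> in \<open>auto intro!: member_le_sum\<close>)
  hence ne: "?T \<noteq> {}" by blast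
  have "closed ?T"
  proof -
    have "?T = (\<lambda>t. \<chi> i::'n. t) -` N" by auto
    also have "closed \<dots>" by (intro closed_vimage closed_N continuous_intros)
    finally show ?thesis .
  qed
  hence "Inf ?T \<in> ?T" by (rule closed_contains_Inf[OF ne bdd])
  thus "z \<in> N" by (simp add: z_def newton_distance_def)
  thus "real CARD('n) * d \<ge> 1" using lb by (simp add: z_def)
  show "d \<le> t" if "(\<chi> i. t) \<in> N" for t
    unfolding newton_distance_def using that bdd by (intro cInf_lower) auto
qed

lemma distance_pos: "d > 0"
proof (rule ccontr)
  assume "\<not> d > 0"
  hence "real CARD('n) * d \<le> 0" by (intro mult_nonneg_nonpos) auto
  thus False using distance_ge by linarith
qed

lemma inner_z: "real_vec k \<bullet> z = d * real (total_degree k)"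
proof -
  have "real_vec k \<bullet> z = (\<Sum>i\<in>UNIV. real (k $ i) * d)" by (simp add: inner_vec_def z_def)
  also have "\<dots> = (\<Sum>i\<in>UNIV. real (k $ i)) * d" by (rule sum_distrib_right[symmetric])
  finally show ?thesis by (simp add: total_degree_def mult.commute)
qed

lemma weight_le_total: "real (weight f k) \<le> d * real (total_degree k)"
  using weight_le_inner[OF z_in_N] by (simp add: inner_z)

section \<open>The central face, its directions and the compact faces\<close>

abbreviation "C \<equiv> central_face f"
definition "V = span ((\<lambda>x. - z + x) ` C)"

lemma central_face_of: "C face_of N" and central_diag: "diagonal_face f C"
  and central_min: "\<And>G. diagonal_face f G \<Longrightarrow> C \<subseteq> G"
  using central_face nonzero unfolding diagonal_face_def by blast+

text \<open>If the face met the diagonal at a parameter \<open>t > d\<close>, this point would be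
  the midpoint of \<open>z\<close> and the point with parameter \<open>2 t - d\<close>, both in the
  polyhedron, and a face contains the ends of a segment whose interior it meets.\<close>

lemma z_in_C: "z \<in> C"
proof -
  obtain t where t: "(\<chi> i. t) \<in> C" using central_diag unfolding diagonal_face_def by blast
  hence tN: "(\<chi> i. t) \<in> N" using central_face_of face_of_imp_subset by blast
  show ?thesis
  proof (cases "t = d")
    case True
    thus ?thesis using t by (simp add: z_def)
  next
    case False
    hence lt: "d < t" using distance_le[OF tN] by simp
    define b where "b = (\<chi> i::'n. 2 * t - d)"
    have b: "b \<in> N" using lt by (intro N_up[OF tN]) (auto simp: b_def)
    have "(\<chi> i. t) = midpoint z b" by (simp add: vec_eq_iff midpoint_def z_def b_def)
    moreover have "z \<noteq> b" using lt by (simp add: vec_eq_iff z_def b_def)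
    ultimately have "(\<chi> i. t) \<in> open_segment z b" by simp
    thus ?thesis using face_ofD[OF central_face_of _ z_in_N b t] by blast
  qed
qed

text \<open>Otherwise a supporting hyperplane through \<open>z\<close> would cut out a proper
  subface that still meets the diagonal, against minimality.\<close>

lemma z_rel_interior: "z \<in> rel_interior C"
proof (rule ccontr)
  assume nz: "z \<notin> rel_interior C"
  have conv: "convex C" using central_face_of face_of_imp_convex by blast
  obtain a where a: "\<And>y. y \<in> C \<Longrightarrow> a \<bullet> z \<le> a \<bullet> y" "\<And>y. y \<in> rel_interior C \<Longrightarrow> a \<bullet> z < a \<bullet> y"
    using supporting_hyperplane_rel_boundary[OF conv z_in_C nz] by metis
  have "(C \<inter> {x. a \<bullet> x = a \<bullet> z}) face_of C"
    by (rule face_of_Int_supporting_hyperplane_ge[OF conv]) (use a(1) in auto)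
  hence "(C \<inter> {x. a \<bullet> x = a \<bullet> z}) face_of N" using central_face_of face_of_trans by blast
  hence "diagonal_face f (C \<inter> {x. a \<bullet> x = a \<bullet> z})"
    unfolding diagonal_face_def using z_in_C by (auto simp: z_def)
  hence "C \<subseteq> {x. a \<bullet> x = a \<bullet> z}" using central_min by blast
  moreover obtain y where "y \<in> rel_interior C" using rel_interior_eq_empty[OF conv] z_in_C by blast
  moreover from this have "y \<in> C" using rel_interior_subset by blast
  ultimately show False using a(2)[of y] by auto
qed

lemma affine_hull_C: "affine hull C = (\<lambda>x. z + x) ` V"
  unfolding V_def by (rule affine_hull_span_gen) (simp add: hull_inc z_in_C)

lemma dim_V: "aff_dim C = int (dim V)"
  unfolding V_def dim_span using aff_dim_eq_dim[of z C] by (simp add: hull_inc z_in_C)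

lemma subspace_V: "subspace V"
  by (simp add: V_def)

lemma V_direction:
  assumes "w \<in> V"
  obtains c where "c > 0" "z + c *\<^sub>R w \<in> C" "z - c *\<^sub>R w \<in> C"
proof -
  obtain e where e: "e > 0" "ball z e \<inter> affine hull C \<subseteq> C"
    using z_rel_interior by (auto simp: mem_rel_interior_ball)
  define c where "c = e / (norm w + 1)"
  have n: "norm w + 1 > 0" by (rule add_nonneg_pos) auto
  have c: "c > 0" using e n by (simp add: c_def)
  have "norm (c *\<^sub>R w) = e * (norm w / (norm w + 1))" using e n by (simp add: c_def)
  also have "\<dots> < e * 1" using e n by (intro mult_strict_left_mono) auto
  finally have nc: "norm (c *\<^sub>R w) < e" by simp
  have "c *\<^sub>R w \<in> V" "- (c *\<^sub>R w) \<in> V" using assms subspace_V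
    by (auto simp: subspace_scale subspace_neg)
  hence "z + c *\<^sub>R w \<in> affine hull C" "z + - (c *\<^sub>R w) \<in> affine hull C"
    unfolding affine_hull_C by blast+
  moreover have "z + c *\<^sub>R w \<in> ball z e" "z + - (c *\<^sub>R w) \<in> ball z e"
    using nc by (auto simp: dist_norm)
  ultimately have "z + c *\<^sub>R w \<in> C" "z + - (c *\<^sub>R w) \<in> C" using e(2) by blast+
  thus ?thesis using c that by simp
qed

text \<open>The polyhedron contains \<open>z + c w\<close> and \<open>z - c w\<close>. At both
  points \<open>k\<close> takes a value of at least \<open>m(k)\<close>, and at \<open>z\<close> the
  value \<open>d |k|\<close>.\<close>

lemma gap_bound:
  assumes "w \<in> V"
  obtains c where "c > 0" "\<And>k. c * \<bar>real_vec k \<bullet> w\<bar> \<le> d * real (total_degree k) - real (weight f k)"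
proof -
  obtain c where c: "c > 0" "z + c *\<^sub>R w \<in> C" "z - c *\<^sub>R w \<in> C" using V_direction[OF assms] by blast
  hence N: "z + c *\<^sub>R w \<in> N" "z - c *\<^sub>R w \<in> N" using central_face_of face_of_imp_subset by blast+
  have "c * \<bar>real_vec k \<bullet> w\<bar> \<le> d * real (total_degree k) - real (weight f k)" for k
    using weight_le_inner[OF N(1), of k] weight_le_inner[OF N(2), of k] c(1)
    by (auto simp: inner_add_right inner_diff_right inner_z abs_if)
  thus ?thesis using c(1) that by blast
qed

text \<open>Otherwise \<open>z\<close> could be moved down the diagonal inside the polyhedron,
  against the minimality of \<open>d\<close>.\<close>

lemma ones_notin_V: "(\<chi> i. 1) \<notin> V"
proof
  assume "(\<chi> i. 1) \<in> V"
  then obtain c where c: "c > 0" "z - c *\<^sub>R (\<chi> i. 1) \<in> C" using V_direction by metis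
  have "z - c *\<^sub>R (\<chi> i. 1) = (\<chi> i. d - c)" by (simp add: vec_eq_iff z_def)
  hence "(\<chi> i. d - c) \<in> N" using c(2) central_face_of face_of_imp_subset by (metis subsetD)
  thus False using distance_le[of "d - c"] c(1) by simp
qed

lemma supp_in_N: "f \<alpha> \<noteq> 0 \<Longrightarrow> real_vec \<alpha> \<in> N"
  unfolding newton_polyhedron_def by (rule hull_inc) auto

text \<open>A face of a convex set is its intersection with the affine hull of the face.\<close>

lemma off_central_notin_V:
  assumes "f \<alpha> \<noteq> 0" "real_vec \<alpha> \<notin> C"
  shows "real_vec \<alpha> - z \<notin> V"
proof
  assume "real_vec \<alpha> - z \<in> V"
  hence "real_vec \<alpha> \<in> affine hull C" unfolding affine_hull_C by (intro image_eqI[of _ _ "real_vec \<alpha> - z"]) auto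
  thus False using face_of_imp_eq_affine_Int[OF convex_N central_face_of] supp_in_N[OF assms(1)] assms(2) by blast
qed

text \<open>Strict positivity of \<open>k\<close> makes the face of minimal \<open>k\<close>
  compact: on an orthant \<open>\<alpha> + [0, \<infinity>)^n\<close> the minimum of
  \<open>k\<close> is attained only at \<open>\<alpha>\<close>. For the same reason only minimal
  exponents lie on the face, so that its polynomial has finitely many terms.\<close>

lemma weight_face:
  assumes k: "\<And>i. k $ i > 0"
  defines "A \<equiv> {\<alpha> \<in> min_supp f. pairing k \<alpha> = weight f k}"
  defines "F \<equiv> convex hull (real_vec ` A)"
  shows "compact_face f F" and "\<And>\<alpha>. f \<alpha> \<noteq> 0 \<Longrightarrow> real_vec \<alpha> \<in> F \<longleftrightarrow> \<alpha> \<in> A"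
proof -
  let ?m = "real (weight f k)"
  let ?k = "real_vec k"
  have FH: "F \<subseteq> {t. ?k \<bullet> t = ?m}"
    unfolding F_def by (intro hull_minimal convex_hyperplane) (auto simp: A_def inner_real_vec)
  have FN: "F \<subseteq> N"
    unfolding F_def by (intro hull_minimal convex_N) (auto simp: A_def min_supp_def intro!: supp_in_N)
  have convF: "convex F" by (simp add: F_def convex_convex_hull)
  \<comment> \<open>An open half-space stays convex when a convex part of its bounding hyperplane is
    adjoined. The set contains all generating orthants, hence the polyhedron, so no point outside
    \<open>F\<close> attains the minimum.\<close>
  have "convex ({t. ?k \<bullet> t > ?m} \<union> F)"
  proof (rule convexI)
    fix x y :: "real ^ 'n" and u v :: real
    assume xy: "x \<in> {t. ?k \<bullet> t > ?m} \<union> F" "y \<in> {t. ?k \<bullet> t > ?m} \<union> F" and uv: "0 \<le> u" "0 \<le> v" "u + v = 1"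
    have ge: "?k \<bullet> x \<ge> ?m" "?k \<bullet> y \<ge> ?m" using xy FH by auto
    have in_eq: "?k \<bullet> (u *\<^sub>R x + v *\<^sub>R y) = ?m + u * (?k \<bullet> x - ?m) + v * (?k \<bullet> y - ?m)"
    proof -
      have "?m = (u + v) * ?m" using uv by simp
      thus ?thesis by (simp add: inner_add_right algebra_simps)
    qed
    show "u *\<^sub>R x + v *\<^sub>R y \<in> {t. ?k \<bullet> t > ?m} \<union> F"
    proof (cases "x \<in> F \<and> y \<in> F")
      case True
      thus ?thesis using convF uv by (auto simp: convex_def)
    next
      case False
      consider "u = 0" | "v = 0" | "u > 0" "v > 0" using uv by linarith
      thus ?thesis
      proof cases
        case 3
        have "u * (?k \<bullet> x - ?m) + v * (?k \<bullet> y - ?m) > 0"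
          using False xy 3 ge by (auto intro: add_pos_nonneg add_nonneg_pos)
        thus ?thesis using in_eq by simp
      qed (use xy uv in auto)
    qed
  qed
  moreover have "(\<Union>\<alpha>\<in>{\<alpha>. f \<alpha> \<noteq> 0}. {t. \<forall>i. real (\<alpha> $ i) \<le> t $ i}) \<subseteq> {t. ?k \<bullet> t > ?m} \<union> F"
  proof
    fix t :: "real ^ 'n" assume "t \<in> (\<Union>\<alpha>\<in>{\<alpha>. f \<alpha> \<noteq> 0}. {t. \<forall>i. real (\<alpha> $ i) \<le> t $ i})"
    then obtain \<alpha> where \<alpha>: "f \<alpha> \<noteq> 0" "\<And>i. real (\<alpha> $ i) \<le> t $ i" by blast
    obtain \<gamma> where \<gamma>: "\<gamma> \<in> min_supp f" "\<And>i. \<gamma> $ i \<le> \<alpha> $ i" using exists_min_supp[of f \<alpha>, OF \<alpha>(1)] by blast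
    have gt: "real (\<gamma> $ i) \<le> t $ i" for i using \<alpha>(2)[of i] \<gamma>(2)[of i] by linarith
    show "t \<in> {t. ?k \<bullet> t > ?m} \<union> F"
    proof (cases "?k \<bullet> t > ?m")
      case False
      have "?m \<le> ?k \<bullet> real_vec \<gamma>" using weight_le_pairing[OF min_supp_subset[OF \<gamma>(1)]] by (simp add: inner_real_vec)
      moreover have eq: "?k \<bullet> t - ?k \<bullet> real_vec \<gamma> = (\<Sum>i\<in>UNIV. real (k $ i) * (t $ i - real (\<gamma> $ i)))"
        by (simp add: inner_vec_def right_diff_distrib sum_subtractf)
      moreover have nn: "\<And>i. real (k $ i) * (t $ i - real (\<gamma> $ i)) \<ge> 0" using gt by simp
      ultimately have "(\<Sum>i\<in>UNIV. real (k $ i) * (t $ i - real (\<gamma> $ i))) = 0"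
        using False sum_nonneg[of UNIV "\<lambda>i. real (k $ i) * (t $ i - real (\<gamma> $ i))"] by simp
      hence all0: "\<forall>i\<in>UNIV. real (k $ i) * (t $ i - real (\<gamma> $ i)) = 0"
        using nn by (subst (asm) sum_nonneg_eq_0_iff) auto
      have "t $ i = real (\<gamma> $ i)" for i
      proof -
        have "real (k $ i) * (t $ i - real (\<gamma> $ i)) = 0" using all0 by blast
        thus ?thesis using k[of i] by simp
      qed
      hence t: "t = real_vec \<gamma>" by (simp add: vec_eq_iff)
      have "real (pairing k \<gamma>) \<le> ?m" using False t by (simp add: inner_real_vec)
      hence "\<gamma> \<in> A" using \<gamma>(1) weight_le_pairing[OF min_supp_subset[OF \<gamma>(1)], of k] by (simp add: A_def)
      thus ?thesis using t by (simp add: F_def hull_inc)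
    qed simp
  qed
  ultimately have "N \<subseteq> {t. ?k \<bullet> t > ?m} \<union> F"
    unfolding newton_polyhedron_def by (intro hull_minimal)
  hence "F = N \<inter> {t. ?k \<bullet> t = ?m}" using FH FN by auto
  moreover have "(N \<inter> {t. ?k \<bullet> t = ?m}) face_of N"
    by (rule face_of_Int_supporting_hyperplane_ge[OF convex_N]) (use weight_le_inner in auto)
  ultimately have face: "F face_of N" by simp
  have "finite A" using finite_min_supp[of f] by (simp add: A_def)
  have "A \<noteq> {}" using weight_attained[of k] by (force simp: A_def)
  hence "F \<noteq> {}" by (simp add: F_def)
  moreover have "compact F"
    unfolding F_def using \<open>finite A\<close> by (intro compact_convex_hull finite_imp_compact finite_imageI)
  ultimately show "compact_face f F" using face by (simp add: compact_face_def)
  show "real_vec \<alpha> \<in> F \<longleftrightarrow> \<alpha> \<in> A" if \<alpha>: "f \<alpha> \<noteq> 0" for \<alpha>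
  proof
    assume "real_vec \<alpha> \<in> F"
    hence pa: "pairing k \<alpha> = weight f k" using FH by (auto simp: inner_real_vec)
    obtain \<gamma> where \<gamma>: "\<gamma> \<in> min_supp f" "\<And>i. \<gamma> $ i \<le> \<alpha> $ i" using exists_min_supp[of f \<alpha>, OF \<alpha>] by blast
    have "\<gamma> = \<alpha>"
    proof (rule ccontr)
      assume "\<gamma> \<noteq> \<alpha>"
      then obtain i where "\<gamma> $ i \<noteq> \<alpha> $ i" by (auto simp: vec_eq_iff)
      hence "k $ i * \<gamma> $ i < k $ i * \<alpha> $ i" using \<gamma>(2)[of i] k[of i] by simp
      hence "pairing k \<gamma> < pairing k \<alpha>"
        unfolding pairing_def using \<gamma>(2) by (intro sum_strict_mono_ex1) (auto intro: mult_left_mono)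
      thus False using weight_le_pairing[OF min_supp_subset[OF \<gamma>(1)], of k] pa by simp
    qed
    thus "\<alpha> \<in> A" using \<gamma>(1) pa by (simp add: A_def)
  qed (simp add: F_def hull_inc)
qed

end

section \<open>Sums over lattice points\<close>

text \<open>Gauss elimination by maximality: for a largest admissible set \<open>I\<close> of
  coordinates, a vector of \<open>W\<close> outside the span of the \<open>w i\<close>, once its
  coordinates in \<open>I\<close> are cleared, has a nonzero coordinate elsewhere that could be
  adjoined as a new pivot.\<close>

lemma subspace_echelon_basis:
  fixes W :: "(real ^ 'n) set"
  assumes W: "subspace W"
  obtains I :: "'n set" and w where "dim W \<le> card I" "\<And>i. i \<in> I \<Longrightarrow> w i \<in> W"
    "\<And>i j. i \<in> I \<Longrightarrow> j \<in> I \<Longrightarrow> w i $ j = (if i = j then 1 else 0)"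
proof -
  define P where "P = (\<lambda>I :: 'n set. \<exists>w. (\<forall>i\<in>I. w i \<in> W) \<and> (\<forall>i\<in>I. \<forall>j\<in>I. w i $ j = (if i = j then 1 else 0)))"
  have P0: "P {}" by (simp add: P_def)
  have bd: "\<forall>I. P I \<longrightarrow> card I < Suc CARD('n)" by (auto simp: less_Suc_eq_le intro: card_mono)
  obtain I where I: "P I" "\<And>J. P J \<Longrightarrow> card J \<le> card I"
    using ex_has_greatest_nat[of P, OF P0 bd] by blast
  from I(1) obtain w where w: "\<And>i. i \<in> I \<Longrightarrow> w i \<in> W"
    "\<And>i j. i \<in> I \<Longrightarrow> j \<in> I \<Longrightarrow> w i $ j = (if i = j then 1 else 0)" unfolding P_def by blast
  have "W \<subseteq> span (w ` I)"
  proof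
    fix x assume x: "x \<in> W"
    define y where "y = x - (\<Sum>i\<in>I. x $ i *\<^sub>R w i)"
    have yW: "y \<in> W" unfolding y_def using x w(1) W by (intro subspace_diff subspace_sum subspace_scale) auto
    have y0: "y $ j = 0" if "j \<in> I" for j
    proof -
      have "(\<Sum>i\<in>I. x $ i *\<^sub>R w i) $ j = (\<Sum>i\<in>I. if i = j then x $ j else 0)"
        unfolding sum_component by (intro sum.cong refl) (use w(2) that in auto)
      also have "\<dots> = x $ j" using that by simp
      finally show ?thesis by (simp add: y_def)
    qed
    have "y = 0"
    proof (rule ccontr)
      assume "y \<noteq> 0"
      then obtain j where j: "y $ j \<noteq> 0" by (auto simp: vec_eq_iff)
      hence jI: "j \<notin> I" using y0 by blast
      define e where "e = (1 / y $ j) *\<^sub>R y"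
      have e: "e \<in> W" "e $ j = 1" "\<And>i. i \<in> I \<Longrightarrow> e $ i = 0"
        using j y0 yW W by (auto simp: e_def subspace_scale)
      define w' where "w' = (\<lambda>i. if i = j then e else w i - (w i $ j) *\<^sub>R e)"
      have "P (insert j I)"
        unfolding P_def
      proof (intro exI[of _ w'] conjI ballI)
        fix i assume "i \<in> insert j I"
        thus "w' i \<in> W" using e(1) w(1) W by (auto simp: w'_def intro!: subspace_diff subspace_scale)
      next
        fix i k assume "i \<in> insert j I" "k \<in> insert j I"
        thus "w' i $ k = (if i = k then 1 else 0)"
          using e w(2) jI by (auto simp: w'_def)
      qed
      from I(2)[OF this] jI show False by simp
    qed
    hence "x = (\<Sum>i\<in>I. x $ i *\<^sub>R w i)" by (simp add: y_def)
    also have "\<dots> \<in> span (w ` I)" by (intro span_sum span_scale span_base) auto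
    finally show "x \<in> span (w ` I)" .
  qed
  hence "dim W \<le> card (w ` I)" by (intro dim_le_card) auto
  also have "\<dots> \<le> card I" by (intro card_image_le) auto
  finally show ?thesis using w that by blast
qed

lemma geometric_sum_le:
  fixes r :: real
  assumes "0 < r" "r < 1"
  shows "(\<Sum>a<n. r ^ a) \<le> 1 / (1 - r)"
proof -
  have "(\<Sum>a<n. r ^ a) = (1 - r ^ n) / (1 - r)"
    using assms by (simp add: sum_gp_strict)
  also have "\<dots> \<le> 1 / (1 - r)" using assms by (intro divide_right_mono) auto
  finally show ?thesis .
qed

lemma geometric_sum_int_le:
  fixes r :: real
  assumes "0 < r" "r < 1"
  shows "(\<Sum>a\<in>{- int B..int B}. r ^ nat \<bar>a\<bar>) \<le> 2 / (1 - r)"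
proof -
  have "{- int B..int B} = int ` {..<Suc B} \<union> (\<lambda>a. - int a) ` {..<Suc B}" (is "_ = ?P \<union> ?M")
  proof
    show "{- int B..int B} \<subseteq> ?P \<union> ?M"
    proof
      fix a assume a: "a \<in> {- int B..int B}"
      show "a \<in> ?P \<union> ?M"
      proof (cases "a \<ge> 0")
        case True
        hence "a = int (nat a)" "nat a < Suc B" using a by auto
        thus ?thesis by blast
      next
        case False
        hence "a = - int (nat (- a))" "nat (- a) < Suc B" using a by auto
        thus ?thesis by blast
      qed
    qed
  qed auto
  hence "(\<Sum>a\<in>{- int B..int B}. r ^ nat \<bar>a\<bar>) \<le> (\<Sum>a\<in>?P. r ^ nat \<bar>a\<bar>) + (\<Sum>a\<in>?M. r ^ nat \<bar>a\<bar>)"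
    using sum.union_inter[of ?P ?M "\<lambda>a. r ^ nat \<bar>a\<bar>"] assms
    by (simp add: add_increasing2 sum_nonneg) (metis add_increasing2 order_refl sum_nonneg zero_le_power less_imp_le)
  also have "(\<Sum>a\<in>?P. r ^ nat \<bar>a\<bar>) = (\<Sum>a<Suc B. r ^ a)"
    by (subst sum.reindex) auto
  also have "(\<Sum>a\<in>?M. r ^ nat \<bar>a\<bar>) = (\<Sum>a<Suc B. r ^ a)"
    by (subst sum.reindex) (auto simp: inj_on_def)
  also have "(\<Sum>a<Suc B. r ^ a) + (\<Sum>a<Suc B. r ^ a) \<le> 1 / (1 - r) + 1 / (1 - r)"
    by (intro add_mono geometric_sum_le assms)
  finally show ?thesis by simp
qed

lemma sum_powr_total_degree:
  fixes q c :: real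
  assumes "q > 1" "c > 0"
  obtains K where "K > 0" "\<And>X. finite (X :: (nat ^ 'n) set) \<Longrightarrow> (\<Sum>k\<in>X. q powr (- c * real (total_degree k))) \<le> K"
proof -
  define r where "r = q powr (- c)"
  have r: "0 < r" "r < 1"
    using assms by (auto simp: r_def powr_less_one)
  have "(\<Sum>k\<in>X. q powr (- c * real (total_degree k))) \<le> (1 / (1 - r)) ^ CARD('n)"
    if X: "finite X" for X :: "(nat ^ 'n) set"
  proof -
    have powr_eq: "q powr (- c * real (total_degree k)) = (\<Prod>i\<in>UNIV. r ^ (k $ i))" for k :: "nat ^ 'n"
    proof -
      have "q powr (- c * real (total_degree k)) = r powr real (total_degree k)"
        by (simp add: r_def powr_powr)
      also have "\<dots> = r ^ total_degree k" using r by (simp add: powr_realpow)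
      finally show ?thesis by (simp add: total_degree_def power_sum)
    qed
    obtain B where B: "\<And>k. k \<in> X \<Longrightarrow> total_degree k < B"
      using finite_nat_set_iff_bounded[of "total_degree ` X"] X by auto
    have le: "k $ i \<le> total_degree k" for k :: "nat ^ 'n" and i
      unfolding total_degree_def by (rule vec_component_le_sum)
    have sub: "X \<subseteq> {k :: nat ^ 'n. \<forall>i. k $ i \<in> {..<B}}" using B le by (auto intro: le_less_trans)
    have "(\<Sum>k\<in>X. q powr (- c * real (total_degree k))) \<le> (\<Sum>k\<in>{k :: nat ^ 'n. \<forall>i. k $ i \<in> {..<B}}. \<Prod>i\<in>UNIV. r ^ (k $ i))"
      unfolding powr_eq
    proof (rule sum_mono2[OF _ sub])
      show "finite {k :: nat ^ 'n. \<forall>i. k $ i \<in> {..<B}}" by (rule finite_vec_box) simp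
    qed (use r in \<open>auto intro: prod_nonneg\<close>)
    also have "\<dots> = (\<Prod>i\<in>(UNIV::'n set). \<Sum>a<B. r ^ a)" by (rule prod_sum_vec) simp
    also have "\<dots> \<le> (\<Prod>i\<in>(UNIV::'n set). 1 / (1 - r))"
      using r by (intro prod_mono conjI sum_nonneg geometric_sum_le) auto
    finally show ?thesis by simp
  qed
  moreover have "(1 / (1 - r)) ^ CARD('n) > 0" using r by simp
  ultimately show ?thesis using that by blast
qed

text \<open>
  In coordinates adapted to an echelon basis of \<open>W\<close>, rounding the \<open>W\<close>-coordinates maps lattice
  points injectively to lattice points, so the sum is dominated by a product of \<open>dim W\<close>
  convergent geometric series and \<open>n - dim W\<close> sums of length \<open>R\<close>.
\<close>

lemma lattice_sum:
  fixes W :: "(real ^ 'n) set" and q :: real and \<Phi> :: "nat \<Rightarrow> nat ^ 'n \<Rightarrow> real"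
  assumes q: "q > 1" and W: "subspace W"
    and \<Phi>0: "\<And>l k. k \<in> Q l \<Longrightarrow> \<Phi> l k \<ge> 0"
    and \<Phi>: "\<And>w. w \<in> W \<Longrightarrow> \<exists>c>0. \<exists>T. \<forall>l. \<exists>b. \<forall>k\<in>Q l. c * \<bar>real_vec k \<bullet> w + b\<bar> \<le> \<Phi> l k + T"
  shows "\<exists>K>0. \<forall>l R X. R \<ge> 1 \<longrightarrow> finite X \<longrightarrow> X \<subseteq> Q l \<longrightarrow> (\<forall>k\<in>X. \<forall>i. k $ i < R) \<longrightarrow>
     (\<Sum>k\<in>X. q powr (- \<Phi> l k)) \<le> K * real R ^ (CARD('n) - dim W)"
proof -
  obtain I :: "'n set" and w where I: "dim W \<le> card I" "\<And>i. i \<in> I \<Longrightarrow> w i \<in> W"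
    "\<And>i j. i \<in> I \<Longrightarrow> j \<in> I \<Longrightarrow> w i $ j = (if i = j then 1 else 0)"
    using subspace_echelon_basis[OF W] by blast
  have "\<exists>c T. i \<in> I \<longrightarrow> c > 0 \<and> (\<forall>l. \<exists>b. \<forall>k\<in>Q l. c * \<bar>real_vec k \<bullet> w i + b\<bar> \<le> \<Phi> l k + T)" for i
    using \<Phi>[OF I(2)] by blast
  then obtain c T where cT: "\<And>i. i \<in> I \<Longrightarrow> c i > 0"
    "\<And>i l. i \<in> I \<Longrightarrow> \<exists>b. \<forall>k\<in>Q l. c i * \<bar>real_vec k \<bullet> w i + b\<bar> \<le> \<Phi> l k + T i" by metis
  \<comment> \<open>The bounds for the \<open>card I\<close> directions are added and divided by
    \<open>s\<close>; the extra \<open>1\<close> keeps \<open>s\<close> positive when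
    \<open>I\<close> is empty and is harmless because \<open>\<Phi>\<close> is nonnegative.\<close>
  define s where "s = real (card I) + 1"
  have s: "s > 0" by (simp add: s_def)
  define e where "e = (\<lambda>i. c i / s)"
  have e: "e i > 0" if "i \<in> I" for i using that cT(1) s by (simp add: e_def)
  \<comment> \<open>The first sum collects the constants \<open>T i\<close>, the second the loss of
    at most one unit in rounding each coordinate.\<close>
  define \<tau> where "\<tau> = (\<Sum>i\<in>I. T i) / s + (\<Sum>i\<in>I. e i)"
  define r where "r = (\<lambda>i. q powr (- e i))"
  have r: "0 < r i" "r i < 1" if "i \<in> I" for i
    using e[OF that] q by (auto simp: r_def powr_less_one)
  define K where "K = q powr \<tau> * (\<Prod>i\<in>I. 2 / (1 - r i))"
  have K: "K > 0" unfolding K_def using q r by (intro mult_pos_pos prod_pos) auto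
  have "(\<Sum>k\<in>X. q powr (- \<Phi> l k)) \<le> K * real R ^ (CARD('n) - dim W)"
    if R: "R \<ge> 1" and X: "finite X" "X \<subseteq> Q l" and XR: "\<And>k i. k \<in> X \<Longrightarrow> k $ i < R"
    for l R X
  proof -
    have "\<forall>i\<in>I. \<exists>b. \<forall>k\<in>Q l. c i * \<bar>real_vec k \<bullet> w i + b\<bar> \<le> \<Phi> l k + T i" using cT(2) by blast
    then obtain b where b: "\<And>i k. i \<in> I \<Longrightarrow> k \<in> Q l \<Longrightarrow> c i * \<bar>real_vec k \<bullet> w i + b i\<bar> \<le> \<Phi> l k + T i" by metis
    \<comment> \<open>Rounding loses no information: \<open>w i\<close> has entry \<open>1\<close>
      at \<open>i\<close> and \<open>0\<close> at the other indices of \<open>I\<close>, so for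
      points that agree outside \<open>I\<close> the numbers being rounded differ exactly by the
      integer difference of their \<open>i\<close>-th entries.\<close>
    define Y :: "nat ^ 'n \<Rightarrow> int ^ 'n" where
      "Y = (\<lambda>k. \<chi> i. if i \<in> I then \<lfloor>real_vec k \<bullet> w i + b i\<rfloor> else int (k $ i))"
    have "inj_on Y X"
    proof (rule inj_onI)
      fix k k' assume "k \<in> X" "k' \<in> X" and Yk: "Y k = Y k'"
      have out: "k $ j = k' $ j" if "j \<notin> I" for j
        using arg_cong[OF Yk, of "\<lambda>v. v $ j"] that by (simp add: Y_def)
      have "k $ i = k' $ i" if i: "i \<in> I" for i
      proof -
        have "real_vec k \<bullet> w i - real_vec k' \<bullet> w i = (\<Sum>j\<in>UNIV. (real (k $ j) - real (k' $ j)) * w i $ j)"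
          by (simp add: inner_vec_def left_diff_distrib sum_subtractf)
        also have "\<dots> = (\<Sum>j\<in>UNIV. if j = i then real (k $ i) - real (k' $ i) else 0)"
        proof (intro sum.cong refl)
          fix j
          show "(real (k $ j) - real (k' $ j)) * w i $ j = (if j = i then real (k $ i) - real (k' $ i) else 0)"
            using out[of j] I(3)[OF i, of j] i by (cases "j \<in> I") auto
        qed
        also have "\<dots> = real (k $ i) - real (k' $ i)" by simp
        finally have "real_vec k \<bullet> w i + b i = (real_vec k' \<bullet> w i + b i) + of_int (int (k $ i) - int (k' $ i))" by simp
        hence "\<lfloor>real_vec k \<bullet> w i + b i\<rfloor> = \<lfloor>real_vec k' \<bullet> w i + b i\<rfloor> + (int (k $ i) - int (k' $ i))"
          by (simp only: floor_add_int)
        thus ?thesis using arg_cong[OF Yk, of "\<lambda>v. v $ i"] i by (simp add: Y_def)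
      qed
      thus "k = k'" using out by (auto simp: vec_eq_iff)
    qed
    define f where "f = (\<lambda>i a. if i \<in> I then r i ^ nat \<bar>a :: int\<bar> else 1)"
    have fpos: "f i a \<ge> 0" for i a using r(1)[of i] by (auto simp: f_def)
    have bound: "q powr (- \<Phi> l k) \<le> q powr \<tau> * (\<Prod>i\<in>UNIV. f i (Y k $ i))" if k: "k \<in> X" for k
    proof -
      have kQ: "k \<in> Q l" using k X by blast
      have "(\<Sum>i\<in>I. c i * \<bar>real_vec k \<bullet> w i + b i\<bar>) \<le> (\<Sum>i\<in>I. \<Phi> l k + T i)"
        using b kQ by (intro sum_mono) auto
      also have "\<dots> \<le> s * \<Phi> l k + (\<Sum>i\<in>I. T i)"
        using \<Phi>0[OF kQ] by (simp add: sum.distrib s_def algebra_simps)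
      finally have "(\<Sum>i\<in>I. c i * \<bar>real_vec k \<bullet> w i + b i\<bar>) / s \<le> (s * \<Phi> l k + (\<Sum>i\<in>I. T i)) / s"
        using s by (intro divide_right_mono) auto
      hence 1: "(\<Sum>i\<in>I. e i * \<bar>real_vec k \<bullet> w i + b i\<bar>) \<le> \<Phi> l k + (\<Sum>i\<in>I. T i) / s"
        using s by (simp add: e_def sum_divide_distrib add_divide_distrib)
      have "(\<Sum>i\<in>I. e i * (real_of_int \<bar>Y k $ i\<bar> - 1)) \<le> (\<Sum>i\<in>I. e i * \<bar>real_vec k \<bullet> w i + b i\<bar>)"
      proof (intro sum_mono mult_left_mono)
        fix i assume i: "i \<in> I"
        show "real_of_int \<bar>Y k $ i\<bar> - 1 \<le> \<bar>real_vec k \<bullet> w i + b i\<bar>"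
          using i by (simp add: Y_def) linarith
      qed (use e in \<open>auto intro: less_imp_le\<close>)
      hence "- \<Phi> l k \<le> \<tau> + (\<Sum>i\<in>I. - e i * real_of_int \<bar>Y k $ i\<bar>)"
        using 1 by (simp add: \<tau>_def right_diff_distrib sum_subtractf sum_negf)
      hence "q powr (- \<Phi> l k) \<le> q powr (\<tau> + (\<Sum>i\<in>I. - e i * real_of_int \<bar>Y k $ i\<bar>))"
        using q by (intro powr_mono) auto
      also have "\<dots> = q powr \<tau> * (\<Prod>i\<in>I. q powr (- e i * real_of_int \<bar>Y k $ i\<bar>))"
        using q by (simp add: powr_add powr_sum)
      also have "(\<Prod>i\<in>I. q powr (- e i * real_of_int \<bar>Y k $ i\<bar>)) = (\<Prod>i\<in>I. f i (Y k $ i))"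
      proof (intro prod.cong refl)
        fix i assume i: "i \<in> I"
        have "q powr (- e i * real_of_int \<bar>Y k $ i\<bar>) = r i powr real (nat \<bar>Y k $ i\<bar>)"
          by (simp add: r_def powr_powr)
        also have "\<dots> = r i ^ nat \<bar>Y k $ i\<bar>" using r(1)[OF i] by (rule powr_realpow)
        finally show "q powr (- e i * real_of_int \<bar>Y k $ i\<bar>) = f i (Y k $ i)" using i by (simp add: f_def)
      qed
      also have "(\<Prod>i\<in>I. f i (Y k $ i)) = (\<Prod>i\<in>UNIV. f i (Y k $ i))"
        by (rule prod.mono_neutral_left) (auto simp: f_def)
      finally show ?thesis .
    qed
    have "finite ((\<lambda>(k, i). nat \<bar>Y k $ i\<bar>) ` (X \<times> UNIV))" using X(1) by simp
    then obtain B where B0: "\<forall>m\<in>(\<lambda>(k, i). nat \<bar>Y k $ i\<bar>) ` (X \<times> UNIV). m < B"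
      unfolding finite_nat_set_iff_bounded ..
    have B: "nat \<bar>Y k $ i\<bar> < B" if "k \<in> X" for k i
      by (rule bspec[OF B0]) (use that in \<open>auto intro!: image_eqI[of _ _ "(k, i)"]\<close>)
    define A where "A = (\<lambda>i. if i \<in> I then {- int B..int B} else {0..<int R})"
    have "Y ` X \<subseteq> {y. \<forall>i. y $ i \<in> A i}"
    proof safe
      fix k i assume k: "k \<in> X"
      show "Y k $ i \<in> A i"
      proof (cases "i \<in> I")
        case True
        thus ?thesis using B[OF k, of i] by (auto simp: A_def)
      next
        case False
        thus ?thesis using XR[OF k, of i] by (simp add: A_def Y_def)
      qed
    qed
    note YA = this
    have "(\<Sum>k\<in>X. q powr (- \<Phi> l k)) \<le> (\<Sum>k\<in>X. q powr \<tau> * (\<Prod>i\<in>UNIV. f i (Y k $ i)))"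
      by (intro sum_mono bound)
    also have "\<dots> = q powr \<tau> * (\<Sum>y\<in>Y ` X. \<Prod>i\<in>UNIV. f i (y $ i))"
      using \<open>inj_on Y X\<close> by (simp add: sum.reindex sum_distrib_left)
    also have "\<dots> \<le> q powr \<tau> * (\<Sum>y\<in>{y. \<forall>i. y $ i \<in> A i}. \<Prod>i\<in>UNIV. f i (y $ i))"
      by (intro mult_left_mono sum_mono2 finite_vec_box YA prod_nonneg fpos) (auto simp: A_def)
    also have "(\<Sum>y\<in>{y. \<forall>i. y $ i \<in> A i}. \<Prod>i\<in>UNIV. f i (y $ i)) = (\<Prod>i\<in>UNIV. \<Sum>a\<in>A i. f i a)"
      by (rule prod_sum_vec) (simp add: A_def)
    also have "(\<Prod>i\<in>UNIV. \<Sum>a\<in>A i. f i a) \<le> (\<Prod>i\<in>UNIV. if i \<in> I then 2 / (1 - r i) else real R)"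
    proof (intro prod_mono conjI sum_nonneg fpos)
      fix i show "(\<Sum>a\<in>A i. f i a) \<le> (if i \<in> I then 2 / (1 - r i) else real R)"
        using geometric_sum_int_le[of "r i" B] r[of i] by (auto simp: A_def f_def)
    qed
    also have "(\<Prod>i\<in>UNIV. if i \<in> I then 2 / (1 - r i) else real R)
        = (\<Prod>i\<in>I. 2 / (1 - r i)) * real R ^ (CARD('n) - card I)"
    proof -
      have "{x. x \<notin> I} = UNIV - I" by auto
      thus ?thesis by (subst prod.If_cases) (auto simp: card_Diff_subset Compl_eq_Diff_UNIV)
    qed
    also have "q powr \<tau> * ((\<Prod>i\<in>I. 2 / (1 - r i)) * real R ^ (CARD('n) - card I)) = K * real R ^ (CARD('n) - card I)"
      by (simp add: K_def)
    also have "\<dots> \<le> K * real R ^ (CARD('n) - dim W)"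
      using K R I(1) by (intro mult_left_mono power_increasing diff_le_mono2) auto
    finally show ?thesis using q by simp
  qed
  thus ?thesis using K by (intro exI[of _ K]) simp
qed

context series
begin

text \<open>\<open>p^(-gap k)\<close> is what the weight \<open>p^(-|k|)\<close> leaves over once
  \<open>p^(-m(k)/d)\<close> has been taken out; \<open>gap\<close> vanishes where \<open>k\<close>
  attains its minimum at \<open>z\<close>.\<close>

definition "gap k = real (total_degree k) - real (weight f k) / d"

lemma gap_nonneg: "gap k \<ge> 0"
  using weight_le_total[of k] distance_pos by (simp add: gap_def field_simps)

lemma d_gap: "d * gap k = d * real (total_degree k) - real (weight f k)"
  using distance_pos by (simp add: gap_def right_diff_distrib)

text \<open>The growth of \<open>\<psi>\<close> confines the sum to \<open>d |k| \<le> 2 l\<close>.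
  Beyond that, \<open>\<epsilon> d \<le> 1\<close> lets the gap and \<open>\<psi>\<close> recombine
  to at least \<open>\<epsilon> (d |k| - l)\<close>, hence to at least
  \<open>\<epsilon> d |k| / 2\<close>, and the sum converges. Within it the coordinates are of order
  \<open>l\<close>, which is the length \<open>R\<close> in \<open>lattice_sum\<close>.\<close>

lemma weighted_lattice_sum:
  fixes q :: real
  assumes q: "q > 1" and W: "subspace W"
    and \<epsilon>: "\<epsilon> > 0" "\<epsilon> * d \<le> 1"
    and \<psi>: "\<And>l k. k \<in> Q l \<Longrightarrow> \<psi> l k \<ge> 0" "\<And>l k. k \<in> Q l \<Longrightarrow> \<psi> l k \<ge> \<epsilon> * (real (weight f k) - real l)"
    and \<Phi>: "\<And>w. w \<in> W \<Longrightarrow> \<exists>c>0. \<exists>T. \<forall>l. \<exists>b. \<forall>k\<in>Q l. c * \<bar>real_vec k \<bullet> w + b\<bar> \<le> gap k + \<psi> l k + T"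
  shows "\<exists>K>0. \<forall>l X. l > 0 \<longrightarrow> finite X \<longrightarrow> X \<subseteq> Q l \<longrightarrow>
     (\<Sum>k\<in>X. q powr (- (gap k + \<psi> l k))) \<le> K * real l ^ (CARD('n) - dim W)"
proof -
  have d: "d > 0" by (rule distance_pos)
  define \<Phi> where "\<Phi> = (\<lambda>l k. gap k + \<psi> l k)"
  have \<Phi>0: "\<Phi> l k \<ge> 0" if "k \<in> Q l" for l k using gap_nonneg \<psi>(1)[OF that] by (simp add: \<Phi>_def)
  have "\<exists>K>0. \<forall>l R X. R \<ge> 1 \<longrightarrow> finite X \<longrightarrow> X \<subseteq> Q l \<longrightarrow> (\<forall>k\<in>X. \<forall>i. k $ i < R) \<longrightarrow>
     (\<Sum>k\<in>X. q powr (- \<Phi> l k)) \<le> K * real R ^ (CARD('n) - dim W)"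
    by (rule lattice_sum[OF q W \<Phi>0]) (use assms(7) in \<open>simp_all add: \<Phi>_def\<close>)
  then obtain K1 where K1: "K1 > 0" and K1b: "\<forall>l R X. R \<ge> 1 \<longrightarrow> finite X \<longrightarrow> X \<subseteq> Q l \<longrightarrow> (\<forall>k\<in>X. \<forall>i. k $ i < R) \<longrightarrow>
     (\<Sum>k\<in>X. q powr (- \<Phi> l k)) \<le> K1 * real R ^ (CARD('n) - dim W)" by (elim exE conjE)
  obtain K2 where K2: "K2 > 0" "\<And>X. finite (X :: (nat ^ 'n) set) \<Longrightarrow> (\<Sum>k\<in>X. q powr (- (\<epsilon> * d / 2) * real (total_degree k))) \<le> K2"
    using sum_powr_total_degree[of q "\<epsilon> * d / 2", where 'n = 'n] q \<epsilon> d by auto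
  define m where "m = CARD('n) - dim W"
  define K where "K = K1 * (2 / d + 1) ^ m + K2"
  have K: "K > 0" using K1 K2(1) d by (simp add: K_def add_pos_pos)
  have "(\<Sum>k\<in>X. q powr (- \<Phi> l k)) \<le> K * real l ^ m" if l: "l > 0" and X: "finite X" "X \<subseteq> Q l" for l X
  proof -
    define X1 where "X1 = {k \<in> X. d * real (total_degree k) \<le> 2 * real l}"
    define X2 where "X2 = {k \<in> X. \<not> d * real (total_degree k) \<le> 2 * real l}"
    have split: "X = X1 \<union> X2" "X1 \<inter> X2 = {}" "finite X1" "finite X2" using X by (auto simp: X1_def X2_def)
    define R where "R = nat \<lfloor>2 * real l / d\<rfloor> + 1"
    have R2: "real R \<le> (2 / d + 1) * real l"
    proof -
      have "real R \<le> 2 * real l / d + 1" using d by (simp add: R_def)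
      also have "\<dots> \<le> 2 * real l / d + real l" using l by simp
      also have "\<dots> = (2 / d + 1) * real l" by (simp add: algebra_simps)
      finally show ?thesis .
    qed
    have "(\<Sum>k\<in>X1. q powr (- \<Phi> l k)) \<le> K1 * real R ^ m"
      unfolding m_def
    proof (rule K1b[rule_format])
      fix k i assume "k \<in> X1"
      hence "real (total_degree k) \<le> 2 * real l / d" using d by (simp add: X1_def field_simps)
      hence "int (total_degree k) \<le> \<lfloor>2 * real l / d\<rfloor>" by (simp add: le_floor_iff)
      hence "total_degree k < R" by (simp add: R_def)
      thus "k $ i < R" using vec_component_le_sum[of k i] by (simp add: total_degree_def)
    qed (use split X in \<open>auto simp: R_def X1_def\<close>)
    also have "\<dots> \<le> K1 * ((2 / d + 1) * real l) ^ m"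
      using K1 R2 by (intro mult_left_mono power_mono) auto
    finally have s1: "(\<Sum>k\<in>X1. q powr (- \<Phi> l k)) \<le> K1 * (2 / d + 1) ^ m * real l ^ m"
      by (simp add: power_mult_distrib)
    have "(\<Sum>k\<in>X2. q powr (- \<Phi> l k)) \<le> (\<Sum>k\<in>X2. q powr (- (\<epsilon> * d / 2) * real (total_degree k)))"
    proof (intro sum_mono powr_mono)
      fix k assume k: "k \<in> X2"
      have "gap k \<ge> \<epsilon> * d * gap k" using \<epsilon>(2) gap_nonneg[of k] by (intro mult_left_le_one_le) (use \<epsilon>(1) d in auto)
      moreover have "\<epsilon> * d * gap k = \<epsilon> * (d * real (total_degree k) - real (weight f k))"
        using d_gap[of k] by simp
      ultimately have "\<Phi> l k \<ge> \<epsilon> * (d * real (total_degree k) - real (weight f k)) + \<epsilon> * (real (weight f k) - real l)"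
        using \<psi>(2)[of k l] k X by (auto simp: \<Phi>_def X2_def)
      also have "\<epsilon> * (d * real (total_degree k) - real (weight f k)) + \<epsilon> * (real (weight f k) - real l)
        = \<epsilon> * (d * real (total_degree k) - real l)" by (simp add: algebra_simps)
      finally have "\<epsilon> * (d * real (total_degree k) - real l) \<le> \<Phi> l k" .
      moreover have "\<epsilon> * (d * real (total_degree k) - real l) \<ge> \<epsilon> * (d * real (total_degree k) / 2)"
        using k \<epsilon>(1) by (intro mult_left_mono) (auto simp: X2_def)
      moreover have "\<epsilon> * (d * real (total_degree k) / 2) = (\<epsilon> * d / 2) * real (total_degree k)" by simp
      ultimately show "- \<Phi> l k \<le> - (\<epsilon> * d / 2) * real (total_degree k)"
        unfolding mult_minus_left by linarith
    qed (use q in auto)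
    also have "\<dots> \<le> K2" by (rule K2(2)[OF split(4)])
    also have "\<dots> \<le> K2 * real l ^ m" using K2(1) l by simp
    finally have s2: "(\<Sum>k\<in>X2. q powr (- \<Phi> l k)) \<le> K2 * real l ^ m" .
    have "(\<Sum>k\<in>X. q powr (- \<Phi> l k)) = (\<Sum>k\<in>X1. q powr (- \<Phi> l k)) + (\<Sum>k\<in>X2. q powr (- \<Phi> l k))"
      unfolding split(1) by (rule sum.union_disjoint) (use split in auto)
    thus ?thesis using s1 s2 by (simp add: K_def algebra_simps)
  qed
  thus ?thesis using K by (intro exI[of _ K]) (simp add: \<Phi>_def m_def)
qed

end

section \<open>Derivatives of the rescaled series\<close>

lemma count_list_replicate_eq: "count_list (replicate n x) y = (if x = y then n else 0)"
  by (induction n) auto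

lemma exists_list_count:
  fixes \<alpha> :: "nat ^ 'n"
  obtains js where "\<And>i. count_list js i = \<alpha> $ i"
proof -
  have "\<exists>js. \<forall>i. count_list js i = (if i \<in> I then \<alpha> $ i else 0)" if "finite I" for I :: "'n set"
    using that
  proof (induction I rule: finite_induct)
    case empty
    show ?case by (intro exI[of _ "[]"]) simp
  next
    case (insert x I)
    then obtain js where js: "\<forall>i. count_list js i = (if i \<in> I then \<alpha> $ i else 0)" by blast
    show ?case
      by (intro exI[of _ "replicate (\<alpha> $ x) x @ js"]) (use js insert.hyps in \<open>auto simp: count_list_replicate_eq\<close>)
  qed
  from this[of UNIV] show ?thesis using that by auto
qed

lemma formal_partial_binomial: "(a + 1) * ((a + 1 + b) choose b) = (b + 1) * ((a + b + 1) choose (b + 1))"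
  using binomial_absorb_comp[of "a + b + 1" b] binomial_absorption[of b "a + b + 1"] by (simp add: add_ac)

text \<open>Only the number of times each variable occurs in the list matters. The factorials and
  binomial coefficients express the iterated derivative as \<open>\<beta>!\<close> times the divided
  derivative that \<open>taylor\<close> evaluates.\<close>

lemma foldr_formal_partial:
  fixes g :: "nat ^ 'n \<Rightarrow> int"
  shows "foldr formal_partial js g \<alpha> =
    (\<Prod>i\<in>UNIV. fact (count_list js i) * int ((\<alpha> $ i + count_list js i) choose count_list js i)) *
      g (\<alpha> + (\<chi> i. count_list js i))"
proof (induction js arbitrary: \<alpha>)
  case Nil
  have "(\<chi> i. 0) = (0 :: nat ^ 'n)" by (simp add: vec_eq_iff)
  thus ?case by simp
next
  case (Cons j js)
  let ?b = "count_list js"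
  let ?b' = "count_list (j # js)"
  let ?\<alpha> = "\<alpha> + axis j 1"
  let ?f = "\<lambda>i. fact (?b i) * int ((?\<alpha> $ i + ?b i) choose ?b i) :: int"
  let ?f' = "\<lambda>i. fact (?b' i) * int ((\<alpha> $ i + ?b' i) choose ?b' i) :: int"
  have eq: "?\<alpha> + (\<chi> i. ?b i) = \<alpha> + (\<chi> i. ?b' i)"
    by (simp add: vec_eq_iff axis_def)
  have same: "?f i = ?f' i" if "i \<noteq> j" for i using that by (simp add: axis_def)
  have j: "int (\<alpha> $ j + 1) * ?f j = ?f' j"
  proof -
    have "int (\<alpha> $ j + 1) * int ((\<alpha> $ j + 1 + ?b j) choose ?b j) = int (?b j + 1) * int ((\<alpha> $ j + ?b j + 1) choose (?b j + 1))"
      using formal_partial_binomial[of "\<alpha> $ j" "?b j"] by (simp only: of_nat_mult[symmetric])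
    hence "fact (?b j) * (int (\<alpha> $ j + 1) * int ((\<alpha> $ j + 1 + ?b j) choose ?b j)) =
      fact (?b j) * (int (?b j + 1) * int ((\<alpha> $ j + ?b j + 1) choose (?b j + 1)))" by simp
    thus ?thesis by (simp add: axis_def mult_ac add_ac)
  qed
  have "foldr formal_partial (j # js) g \<alpha> = int (\<alpha> $ j + 1) * foldr formal_partial js g ?\<alpha>"
    by (simp add: formal_partial_def)
  also have "\<dots> = int (\<alpha> $ j + 1) * (\<Prod>i\<in>UNIV. ?f i) * g (\<alpha> + (\<chi> i. ?b' i))"
    unfolding Cons.IH eq by (simp only: mult.assoc)
  also have "(\<Prod>i\<in>UNIV. ?f i) = ?f j * (\<Prod>i\<in>UNIV - {j}. ?f i)"
    by (rule prod.remove) auto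
  also have "(\<Prod>i\<in>UNIV - {j}. ?f i) = (\<Prod>i\<in>UNIV - {j}. ?f' i)"
    by (intro prod.cong refl same) auto
  also have "int (\<alpha> $ j + 1) * (?f j * (\<Prod>i\<in>UNIV - {j}. ?f' i)) = ?f' j * (\<Prod>i\<in>UNIV - {j}. ?f' i)"
    using j by (simp only: mult.assoc[symmetric])
  also have "\<dots> = (\<Prod>i\<in>UNIV. ?f' i)"
    by (rule prod.remove[symmetric]) auto
  finally show ?case .
qed

lemma series_value_derivative:
  fixes g :: "nat ^ 'n \<Rightarrow> int" and y :: "'p::prime_card padic ^ 'n"
  assumes fin: "finite {\<alpha>. g \<alpha> \<noteq> 0}"
  shows "series_value (foldr formal_partial js g) y =
    (\<Prod>i\<in>UNIV. fact (count_list js i)) * taylor {\<alpha>. g \<alpha> \<noteq> 0} (\<lambda>\<alpha>. of_int (g \<alpha>)) y (\<chi> i. count_list js i)"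
proof -
  define \<beta> where "\<beta> = (\<chi> i. count_list js i)"
  define D where "D = foldr formal_partial js g"
  have D: "D \<gamma> = (\<Prod>i\<in>UNIV. fact (\<beta> $ i) * int ((\<gamma> $ i + \<beta> $ i) choose \<beta> $ i)) * g (\<gamma> + \<beta>)" for \<gamma>
    unfolding D_def foldr_formal_partial \<beta>_def by simp
  have D0: "D \<gamma> \<noteq> 0 \<longleftrightarrow> g (\<gamma> + \<beta>) \<noteq> 0" for \<gamma> by (simp add: D)
  have "inj (\<lambda>\<gamma>. \<gamma> + \<beta>)" by (simp add: inj_def)
  moreover have "(\<lambda>\<gamma>. \<gamma> + \<beta>) ` {\<gamma>. D \<gamma> \<noteq> 0} \<subseteq> {\<alpha>. g \<alpha> \<noteq> 0}" using D0 by auto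
  ultimately have finD: "finite {\<gamma>. D \<gamma> \<noteq> 0}"
    using fin by (meson finite_imageD finite_subset inj_on_subset subset_UNIV)
  let ?t = "\<lambda>\<alpha>. of_int (g \<alpha>) * (\<Prod>i\<in>UNIV. of_nat (\<alpha> $ i choose \<beta> $ i) * y $ i ^ (\<alpha> $ i - \<beta> $ i))"
  have "series_value D y = (\<Sum>\<gamma> | D \<gamma> \<noteq> 0. series_term D y \<gamma>)"
    by (rule series_value_polynomial[OF finD])
  also have "\<dots> = (\<Sum>\<gamma> | D \<gamma> \<noteq> 0. (\<Prod>i\<in>UNIV. fact (\<beta> $ i)) * ?t (\<gamma> + \<beta>))"
    by (intro sum.cong refl) (simp add: series_term_def D prod.distrib mult_ac)
  also have "\<dots> = (\<Sum>\<alpha>\<in>{\<alpha>. g \<alpha> \<noteq> 0 \<and> (\<forall>i. \<beta> $ i \<le> \<alpha> $ i)}. (\<Prod>i\<in>UNIV. fact (\<beta> $ i)) * ?t \<alpha>)"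
  proof (rule sum.reindex_bij_witness[where i = "\<lambda>\<alpha>. \<chi> i. \<alpha> $ i - \<beta> $ i" and j = "\<lambda>\<gamma>. \<gamma> + \<beta>"])
    fix \<alpha> assume a: "\<alpha> \<in> {\<alpha>. g \<alpha> \<noteq> 0 \<and> (\<forall>i. \<beta> $ i \<le> \<alpha> $ i)}"
    show *: "(\<chi> i. \<alpha> $ i - \<beta> $ i) + \<beta> = \<alpha>" using a by (simp add: vec_eq_iff)
    show "(\<chi> i. \<alpha> $ i - \<beta> $ i) \<in> {\<gamma>. D \<gamma> \<noteq> 0}" using a by (simp add: D0 *)
  qed (auto simp: D0 vec_eq_iff)
  also have "\<dots> = (\<Sum>\<alpha>\<in>{\<alpha>. g \<alpha> \<noteq> 0}. (\<Prod>i\<in>UNIV. fact (\<beta> $ i)) * ?t \<alpha>)"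
  proof (rule sum.mono_neutral_left[OF fin])
    show "\<forall>\<alpha>\<in>{\<alpha>. g \<alpha> \<noteq> 0} - {\<alpha>. g \<alpha> \<noteq> 0 \<and> (\<forall>i. \<beta> $ i \<le> \<alpha> $ i)}. (\<Prod>i\<in>UNIV. fact (\<beta> $ i)) * ?t \<alpha> = 0"
    proof
      fix \<alpha> assume "\<alpha> \<in> {\<alpha>. g \<alpha> \<noteq> 0} - {\<alpha>. g \<alpha> \<noteq> 0 \<and> (\<forall>i. \<beta> $ i \<le> \<alpha> $ i)}"
      then obtain i where "\<alpha> $ i < \<beta> $ i" by (auto simp: not_le)
      hence "of_nat (\<alpha> $ i choose \<beta> $ i) * y $ i ^ (\<alpha> $ i - \<beta> $ i) = 0" by (simp add: binomial_eq_0)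
      hence "(\<Prod>i\<in>UNIV. of_nat (\<alpha> $ i choose \<beta> $ i) * y $ i ^ (\<alpha> $ i - \<beta> $ i)) = 0"
        by (intro prod_zero) auto
      thus "(\<Prod>i\<in>UNIV. fact (\<beta> $ i)) * ?t \<alpha> = 0" by simp
    qed
  qed auto
  finally show ?thesis by (simp add: D_def \<beta>_def taylor_def sum_distrib_left)
qed

lemma sum_count_list: "(\<Sum>i\<in>(UNIV :: 'n::finite set). count_list js i) = length js"
  by (rule sum_count_set) auto

text \<open>Summed over \<open>i\<close> with weights \<open>k $ i\<close>, the right-hand side
  acquires the factor \<open>pairing k \<alpha>\<close>, which is constant on the face where
  \<open>k\<close> is minimal.\<close>

lemma euler_identity:
  fixes y :: "'a::comm_ring_1 ^ 'n"
  shows "y $ i * taylor A g y (axis i 1) = (\<Sum>\<alpha>\<in>A. g \<alpha> * (of_nat (\<alpha> $ i) * (\<Prod>j\<in>UNIV. y $ j ^ (\<alpha> $ j))))"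
proof -
  have "y $ i * (\<Prod>j\<in>UNIV. of_nat (\<alpha> $ j choose axis i 1 $ j) * y $ j ^ (\<alpha> $ j - axis i 1 $ j))
      = of_nat (\<alpha> $ i) * (\<Prod>j\<in>UNIV. y $ j ^ (\<alpha> $ j))" for \<alpha> :: "nat ^ 'n"
  proof -
    have "(\<Prod>j\<in>UNIV. of_nat (\<alpha> $ j choose axis i 1 $ j) * y $ j ^ (\<alpha> $ j - axis i 1 $ j))
       = (of_nat (\<alpha> $ i) * y $ i ^ (\<alpha> $ i - 1)) * (\<Prod>j\<in>UNIV - {i}. y $ j ^ (\<alpha> $ j))"
      by (subst prod.remove[of _ i]) (auto simp: axis_def intro!: prod.cong)
    moreover have "(\<Prod>j\<in>UNIV. y $ j ^ (\<alpha> $ j)) = y $ i ^ (\<alpha> $ i) * (\<Prod>j\<in>UNIV - {i}. y $ j ^ (\<alpha> $ j))"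
      by (rule prod.remove) auto
    moreover have "y $ i * (of_nat (\<alpha> $ i) * y $ i ^ (\<alpha> $ i - 1)) = of_nat (\<alpha> $ i) * y $ i ^ (\<alpha> $ i)"
      by (cases "\<alpha> $ i") (auto simp: mult_ac)
    ultimately show ?thesis by (simp only: mult.assoc[symmetric])
  qed
  hence "g \<alpha> * (y $ i * (\<Prod>j\<in>UNIV. of_nat (\<alpha> $ j choose axis i 1 $ j) * y $ j ^ (\<alpha> $ j - axis i 1 $ j)))
      = g \<alpha> * (of_nat (\<alpha> $ i) * (\<Prod>j\<in>UNIV. y $ j ^ (\<alpha> $ j)))" for \<alpha> by simp
  thus ?thesis unfolding taylor_def sum_distrib_left by (intro sum.cong refl) (simp add: mult_ac)
qed

section \<open>Continuity of Taylor coefficients in the base point\<close>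

lemma padic_norm_power_diff:
  assumes "padic_norm x \<le> 1" "padic_norm y \<le> 1" "padic_norm (x - y) \<le> e"
  shows "padic_norm (x ^ k - y ^ k) \<le> e"
proof (induction k)
  case 0
  show ?case using order_trans[OF padic_norm_nonneg assms(3)] by simp
next
  case (Suc k)
  have e: "e \<ge> 0" using order_trans[OF padic_norm_nonneg assms(3)] .
  have "padic_norm (x * (x ^ k - y ^ k)) \<le> 1 * e"
    unfolding padic_norm_mult using assms(1) Suc e by (intro mult_mono padic_norm_nonneg) auto
  moreover have "padic_norm ((x - y) * y ^ k) \<le> e * 1"
    unfolding padic_norm_mult padic_norm_power using assms e
    by (intro mult_mono power_le_one padic_norm_nonneg zero_le_power) auto
  moreover have "x ^ Suc k - y ^ Suc k = x * (x ^ k - y ^ k) + (x - y) * y ^ k" by (simp add: algebra_simps)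
  ultimately show ?case using padic_norm_add[of "x * (x ^ k - y ^ k)" "(x - y) * y ^ k"] by simp
qed

lemma padic_norm_prod_diff:
  assumes "\<And>i. i \<in> I \<Longrightarrow> padic_norm (x i) \<le> 1" "\<And>i. i \<in> I \<Longrightarrow> padic_norm (y i) \<le> 1"
    "\<And>i. i \<in> I \<Longrightarrow> padic_norm (x i - y i) \<le> e" "e \<ge> 0"
  shows "padic_norm ((\<Prod>i\<in>I. x i) - (\<Prod>i\<in>I. y i)) \<le> e"
  using assms(1-3)
proof (induction I rule: infinite_finite_induct)
  case (insert i I)
  have "padic_norm (x i * ((\<Prod>i\<in>I. x i) - (\<Prod>i\<in>I. y i))) \<le> 1 * e"
    unfolding padic_norm_mult using insert assms(4) by (intro mult_mono padic_norm_nonneg) auto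
  moreover have "padic_norm ((x i - y i) * (\<Prod>i\<in>I. y i)) \<le> e * 1"
    unfolding padic_norm_mult padic_norm_prod using insert assms(4)
    by (intro mult_mono prod_le_1 conjI padic_norm_nonneg prod_nonneg) auto
  moreover have "(\<Prod>i\<in>insert i I. x i) - (\<Prod>i\<in>insert i I. y i) =
      x i * ((\<Prod>i\<in>I. x i) - (\<Prod>i\<in>I. y i)) + (x i - y i) * (\<Prod>i\<in>I. y i)"
    using insert by (simp add: algebra_simps)
  ultimately show ?case
    using padic_norm_add[of "x i * ((\<Prod>i\<in>I. x i) - (\<Prod>i\<in>I. y i))" "(x i - y i) * (\<Prod>i\<in>I. y i)"] by simp
qed (use assms(4) in auto)

lemma padic_norm_mult_le_1: "padic_norm x \<le> 1 \<Longrightarrow> padic_norm y \<le> e \<Longrightarrow> padic_norm (x * y) \<le> e"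
  unfolding padic_norm_mult
  using mult_mono[of "padic_norm x" 1 "padic_norm y" e] padic_norm_nonneg[of x] padic_norm_nonneg[of y] by simp

lemma padic_norm_taylor_diff:
  fixes u y :: "'p::prime_card padic ^ 'n"
  assumes "\<And>\<alpha>. padic_norm (g \<alpha>) \<le> 1" "\<And>i. padic_norm (u $ i) \<le> 1" "\<And>i. padic_norm (y $ i) \<le> 1"
    "\<And>i. padic_norm (u $ i - y $ i) \<le> e" "e \<ge> 0"
  shows "padic_norm (taylor A g u \<beta> - taylor A g y \<beta>) \<le> e"
proof -
  have "taylor A g u \<beta> - taylor A g y \<beta> = (\<Sum>\<alpha>\<in>A. g \<alpha> *
     ((\<Prod>i\<in>UNIV. of_nat (\<alpha> $ i choose \<beta> $ i) * u $ i ^ (\<alpha> $ i - \<beta> $ i)) - (\<Prod>i\<in>UNIV. of_nat (\<alpha> $ i choose \<beta> $ i) * y $ i ^ (\<alpha> $ i - \<beta> $ i))))"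
    by (simp add: taylor_def right_diff_distrib sum_subtractf)
  also have "padic_norm \<dots> \<le> e"
  proof (rule padic_norm_sum_le[OF padic_norm_mult_le_1[OF assms(1) padic_norm_prod_diff]])
    fix \<alpha> :: "nat ^ 'n" and i
    show "padic_norm (of_nat (\<alpha> $ i choose \<beta> $ i) * u $ i ^ (\<alpha> $ i - \<beta> $ i)) \<le> 1"
      "padic_norm (of_nat (\<alpha> $ i choose \<beta> $ i) * y $ i ^ (\<alpha> $ i - \<beta> $ i)) \<le> 1"
      using assms(2,3) by (auto intro!: padic_norm_mult_le_1 padic_norm_of_nat_le_1 power_le_one padic_norm_nonneg simp: padic_norm_power)
    have "padic_norm (of_nat (\<alpha> $ i choose \<beta> $ i) * (u $ i ^ (\<alpha> $ i - \<beta> $ i) - y $ i ^ (\<alpha> $ i - \<beta> $ i))) \<le> e"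
      by (intro padic_norm_mult_le_1 padic_norm_of_nat_le_1 padic_norm_power_diff assms)
    thus "padic_norm (of_nat (\<alpha> $ i choose \<beta> $ i) * u $ i ^ (\<alpha> $ i - \<beta> $ i) - of_nat (\<alpha> $ i choose \<beta> $ i) * y $ i ^ (\<alpha> $ i - \<beta> $ i)) \<le> e"
      by (simp add: right_diff_distrib)
  qed (rule assms(5))+
  finally show ?thesis .
qed

text \<open>Differentiating along an exponent of greatest total degree leaves the constant
  \<open>\<alpha>! g(\<alpha>)\<close>, nonzero in characteristic zero. This makes the
  \<open>LEAST\<close> in \<open>zero_order\<close> meaningful and bounds it uniformly in the
  point.\<close>

lemma derivative_nonzero:
  fixes g :: "nat ^ 'n \<Rightarrow> int" and y :: "'p::prime_card padic ^ 'n"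
  assumes fin: "finite {\<alpha>. g \<alpha> \<noteq> 0}" and \<alpha>: "g \<alpha> \<noteq> 0" "\<And>\<gamma>. g \<gamma> \<noteq> 0 \<Longrightarrow> total_degree \<gamma> \<le> total_degree \<alpha>"
  shows "\<exists>js. length js = total_degree \<alpha> \<and> series_value (foldr formal_partial js g) y \<noteq> 0"
proof -
  obtain js where js: "\<And>i. count_list js i = \<alpha> $ i" using exists_list_count[of \<alpha>] by blast
  have cnt: "(\<chi> i. count_list js i) = \<alpha>" by (simp add: vec_eq_iff js)
  have len: "length js = total_degree \<alpha>"
    unfolding total_degree_def using js by (simp flip: sum_count_list)
  have "taylor {\<alpha>. g \<alpha> \<noteq> 0} (\<lambda>\<alpha>. of_int (g \<alpha>)) y \<alpha> = (\<Sum>\<gamma>\<in>{\<alpha>. g \<alpha> \<noteq> 0}. if \<gamma> = \<alpha> then of_int (g \<alpha>) else 0)"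
    unfolding taylor_def
  proof (intro sum.cong refl)
    fix \<gamma> assume \<gamma>: "\<gamma> \<in> {\<alpha>. g \<alpha> \<noteq> 0}"
    show "of_int (g \<gamma>) * (\<Prod>i\<in>UNIV. of_nat (\<gamma> $ i choose \<alpha> $ i) * y $ i ^ (\<gamma> $ i - \<alpha> $ i)) = (if \<gamma> = \<alpha> then of_int (g \<alpha>) else 0)"
    proof (cases "\<gamma> = \<alpha>")
      case False
      have "\<exists>i. \<gamma> $ i < \<alpha> $ i"
      proof (rule ccontr)
        assume "\<not> ?thesis"
        hence le: "\<alpha> $ i \<le> \<gamma> $ i" for i by (simp add: not_less)
        obtain i where "\<gamma> $ i \<noteq> \<alpha> $ i" using False by (auto simp: vec_eq_iff)
        hence "\<alpha> $ i < \<gamma> $ i" using le[of i] by simp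
        hence "total_degree \<alpha> < total_degree \<gamma>"
          unfolding total_degree_def using le by (intro sum_strict_mono_ex1) auto
        thus False using \<alpha>(2)[of \<gamma>] \<gamma> by simp
      qed
      then obtain i where "\<gamma> $ i < \<alpha> $ i" by blast
      hence "of_nat (\<gamma> $ i choose \<alpha> $ i) * y $ i ^ (\<gamma> $ i - \<alpha> $ i) = 0" by (simp add: binomial_eq_0)
      hence "(\<Prod>i\<in>UNIV. of_nat (\<gamma> $ i choose \<alpha> $ i) * y $ i ^ (\<gamma> $ i - \<alpha> $ i)) = 0" by (intro prod_zero) auto
      thus ?thesis using False by simp
    qed simp
  qed
  also have "\<dots> = of_int (g \<alpha>)" using fin \<alpha>(1) by (subst sum.delta) auto
  finally have "series_value (foldr formal_partial js g) y \<noteq> 0"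
    unfolding series_value_derivative[OF fin] cnt using \<alpha>(1) by simp
  thus ?thesis using len by blast
qed

lemma exists_max_degree:
  fixes g :: "nat ^ 'n \<Rightarrow> int"
  assumes "finite {\<alpha>. g \<alpha> \<noteq> 0}" "g \<alpha>0 \<noteq> 0"
  obtains \<alpha> where "g \<alpha> \<noteq> 0" "\<And>\<gamma>. g \<gamma> \<noteq> 0 \<Longrightarrow> total_degree \<gamma> \<le> total_degree \<alpha>"
proof -
  have ne: "total_degree ` {\<alpha>. g \<alpha> \<noteq> 0} \<noteq> {}" using assms(2) by blast
  obtain \<alpha> where "g \<alpha> \<noteq> 0" "Max (total_degree ` {\<alpha>. g \<alpha> \<noteq> 0}) = total_degree \<alpha>"
    using Max_in[OF finite_imageI[OF assms(1)] ne] by auto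
  thus ?thesis using that[of \<alpha>] assms(1) by (metis (mono_tags, lifting) Max_ge finite_imageI imageI mem_Collect_eq)
qed

text \<open>The orders of zeros are bounded by the degree, so the set under \<open>Max\<close> is
  finite and its maximum dominates the order at \<open>y\<close>.\<close>

lemma max_zero_order_gt:
  fixes y :: "'p::prime_card padic ^ 'n"
  assumes fin: "finite {\<alpha>. face_polynomial f F \<alpha> \<noteq> 0}" and ne: "face_polynomial f F \<alpha>0 \<noteq> 0"
    and y: "\<And>i. y $ i \<noteq> 0"
    and zero: "\<And>js. length js \<le> e \<Longrightarrow> series_value (foldr formal_partial js (face_polynomial f F)) y = 0"
  shows "max_zero_order TYPE('p) f F > e"
proof -
  let ?g = "face_polynomial f F"
  obtain \<alpha> where \<alpha>: "?g \<alpha> \<noteq> 0" "\<And>\<gamma>. ?g \<gamma> \<noteq> 0 \<Longrightarrow> total_degree \<gamma> \<le> total_degree \<alpha>"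
    using exists_max_degree[OF fin ne] by blast
  let ?P = "\<lambda>x k. \<exists>js. length js = k \<and> series_value (foldr formal_partial js ?g) (x :: 'p padic ^ 'n) \<noteq> 0"
  have ex: "?P x (total_degree \<alpha>)" for x by (rule derivative_nonzero[OF fin \<alpha>])
  have "zero_order ?g x \<le> total_degree \<alpha>" for x :: "'p padic ^ 'n"
    unfolding zero_order_def by (rule Least_le[of "?P x", OF ex])
  hence finS: "finite {zero_order ?g x | x :: 'p padic ^ 'n. (\<forall>i. x $ i \<noteq> 0) \<and> series_value ?g x = 0}"
    by (intro finite_subset[OF _ finite_atMost[of "total_degree \<alpha>"]]) auto
  have "?P y (zero_order ?g y)" unfolding zero_order_def by (rule LeastI[of "?P y", OF ex])
  hence "zero_order ?g y > e" using zero by (metis not_le)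
  also have "zero_order ?g y \<le> max_zero_order TYPE('p) f F"
    unfolding max_zero_order_def
    by (rule Max_ge) (use finS y zero[of "[]"] in auto)
  finally show ?thesis .
qed

text \<open>The coefficients of \<open>p^(-m(k)) f(p^k u)\<close> as a series in \<open>u\<close>;
  on the support of \<open>f\<close> the subtraction is not truncated.\<close>

definition scaled_coeff :: "nat \<Rightarrow> (nat ^ 'n \<Rightarrow> int) \<Rightarrow> nat ^ 'n \<Rightarrow> nat ^ 'n \<Rightarrow> int" where
  "scaled_coeff p f k \<alpha> = int p ^ (pairing k \<alpha> - weight f k) * f \<alpha>"

lemma padic_norm_coeff_shift_poly_diff:
  fixes u y v :: "'p::prime_card padic ^ 'n"
  assumes "\<And>\<alpha>. padic_norm (g \<alpha>) \<le> 1" "\<And>i. padic_norm (u $ i) \<le> 1" "\<And>i. padic_norm (y $ i) \<le> 1"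
    "\<And>i. padic_norm (v $ i) \<le> 1" "\<And>i. padic_norm (u $ i - y $ i) \<le> e" "e \<ge> 0"
  shows "padic_norm (coeff (shift_poly A g u v) k - coeff (shift_poly A g y v) k) \<le> e"
proof -
  have "coeff (shift_poly A g u v) k - coeff (shift_poly A g y v) k =
     (\<Sum>\<beta>\<in>exponents_of_degree k. (\<Prod>i\<in>UNIV. v $ i ^ (\<beta> $ i)) * (taylor A g u \<beta> - taylor A g y \<beta>))"
    by (simp add: coeff_shift_poly right_diff_distrib sum_subtractf mult.commute)
  also have "padic_norm \<dots> \<le> e"
  proof (rule padic_norm_sum_le)
    fix \<beta> :: "nat ^ 'n"
    have "padic_norm (\<Prod>i\<in>UNIV. v $ i ^ (\<beta> $ i)) \<le> 1"
      unfolding padic_norm_prod padic_norm_power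
      using assms(4) by (intro prod_le_1 conjI power_le_one zero_le_power padic_norm_nonneg) auto
    thus "padic_norm ((\<Prod>i\<in>UNIV. v $ i ^ (\<beta> $ i)) * (taylor A g u \<beta> - taylor A g y \<beta>)) \<le> e"
      by (rule padic_norm_mult_le_1) (intro padic_norm_taylor_diff assms)
  qed (rule assms(6))
  finally show ?thesis .
qed

text \<open>The chain rule for a diagonal substitution, multiplied through so as to avoid negative
  powers of \<open>b\<close>.\<close>

lemma taylor_scale:
  fixes y :: "'a::comm_ring_1 ^ 'n"
  shows "(\<Prod>i\<in>UNIV. (b $ i) ^ (\<beta> $ i)) * taylor A g (\<chi> i. b $ i * y $ i) \<beta> =
    taylor A (\<lambda>\<alpha>. g \<alpha> * (\<Prod>i\<in>UNIV. (b $ i) ^ (\<alpha> $ i))) y \<beta>"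
proof -
  have "(b $ i) ^ (\<beta> $ i) * (of_nat (\<alpha> $ i choose \<beta> $ i) * (b $ i * y $ i) ^ (\<alpha> $ i - \<beta> $ i)) =
     (b $ i) ^ (\<alpha> $ i) * (of_nat (\<alpha> $ i choose \<beta> $ i) * y $ i ^ (\<alpha> $ i - \<beta> $ i))" for \<alpha> :: "nat ^ 'n" and i
  proof (cases "\<beta> $ i \<le> \<alpha> $ i")
    case True
    hence "(b $ i) ^ (\<alpha> $ i) = (b $ i) ^ (\<beta> $ i) * (b $ i) ^ (\<alpha> $ i - \<beta> $ i)" by (simp flip: power_add)
    thus ?thesis by (simp add: power_mult_distrib mult_ac)
  qed (simp add: binomial_eq_0)
  hence h: "(\<Prod>i\<in>UNIV. (b $ i) ^ (\<beta> $ i)) * (\<Prod>i\<in>UNIV. of_nat (\<alpha> $ i choose \<beta> $ i) * (b $ i * y $ i) ^ (\<alpha> $ i - \<beta> $ i)) =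
     (\<Prod>i\<in>UNIV. (b $ i) ^ (\<alpha> $ i)) * (\<Prod>i\<in>UNIV. of_nat (\<alpha> $ i choose \<beta> $ i) * y $ i ^ (\<alpha> $ i - \<beta> $ i))" for \<alpha> :: "nat ^ 'n"
    by (simp only: prod.distrib[symmetric])
  have "(\<Prod>i\<in>UNIV. (b $ i) ^ (\<beta> $ i)) * (g \<alpha> * (\<Prod>i\<in>UNIV. of_nat (\<alpha> $ i choose \<beta> $ i) * (b $ i * y $ i) ^ (\<alpha> $ i - \<beta> $ i))) =
     g \<alpha> * (\<Prod>i\<in>UNIV. (b $ i) ^ (\<alpha> $ i)) * (\<Prod>i\<in>UNIV. of_nat (\<alpha> $ i choose \<beta> $ i) * y $ i ^ (\<alpha> $ i - \<beta> $ i))" for \<alpha> :: "nat ^ 'n"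
    by (subst mult.left_commute) (simp only: h mult.assoc)
  thus ?thesis by (simp add: taylor_def sum_distrib_left)
qed

lemma taylor_cmult: "taylor A (\<lambda>\<alpha>. c * g \<alpha>) y \<beta> = c * taylor A g y \<beta>"
  by (simp add: taylor_def sum_distrib_left mult.assoc)

lemma taylor_cong: "(\<And>\<alpha>. \<alpha> \<in> A \<Longrightarrow> g \<alpha> = h \<alpha>) \<Longrightarrow> taylor A g y \<beta> = taylor A h y \<beta>"
  by (simp add: taylor_def)

lemma shift_poly_cong: "(\<And>\<alpha>. \<alpha> \<in> A \<Longrightarrow> g \<alpha> = h \<alpha>) \<Longrightarrow> shift_poly A g u v = shift_poly A h u v"
  by (simp add: shift_poly_def)

lemma dvd_coeff_shift_poly:
  fixes g :: "nat ^ 'n \<Rightarrow> int"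
  assumes "\<And>\<alpha>. \<alpha> \<in> A \<Longrightarrow> c dvd g \<alpha>"
  shows "c dvd coeff (shift_poly A g u v) k"
  unfolding shift_poly_def coeff_sum using assms by (intro dvd_sum) auto

lemma prime_power_prod: "(\<Prod>i\<in>UNIV. (c ^ (k $ i)) ^ (\<alpha> $ i)) = (c :: 'a::comm_semiring_1) ^ pairing k \<alpha>"
  by (simp add: pairing_def power_sum flip: power_mult)

context series
begin

text \<open>
  If the bound failed, a sequence of counterexamples would converge, after rescaling, to the
  polynomial \<open>f\<^sub>F\<close> of a compact face \<open>F\<close> and to a point with nonzero coordinates at which the
  derivatives of \<open>f\<^sub>F\<close> of orders \<open>1, \<dots>, e\<close> vanish. By Euler's identity for the weighted
  homogeneous polynomial \<open>f\<^sub>F\<close>, this is a zero of order greater than \<open>e\<close>.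
\<close>

lemma derivative_lower_bound:
  fixes D :: "(real ^ 'n) set"
  assumes e: "e \<ge> 1" and D: "convex D"
    and o: "\<And>F. compact_face f F \<Longrightarrow> F \<subseteq> D \<Longrightarrow> max_zero_order TYPE('p::prime_card) f F \<le> e"
  shows "\<exists>T. \<forall>k A u. (\<forall>i. k $ i \<ge> T) \<longrightarrow> finite A \<longrightarrow> min_supp f \<subseteq> A \<longrightarrow> (\<forall>\<alpha>\<in>A. f \<alpha> \<noteq> 0) \<longrightarrow>
    (\<forall>\<alpha>\<in>min_supp f. real_vec \<alpha> \<notin> D \<longrightarrow> pairing k \<alpha> - weight f k > T) \<longrightarrow>
    (\<forall>i. \<not> int CARD('p) dvd u $ i) \<longrightarrow>
    (\<exists>v. \<exists>i\<in>{1..e}. \<not> int CARD('p) ^ T dvd coeff (shift_poly A (scaled_coeff CARD('p) f k) u v) i)"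
proof (rule ccontr)
  assume neg: "\<not> ?thesis"
  define B where "B = (\<lambda>T k A u. (\<forall>i. k $ i \<ge> T) \<and> finite A \<and> min_supp f \<subseteq> A \<and> (\<forall>\<alpha>\<in>A. f \<alpha> \<noteq> 0) \<and>
    (\<forall>\<alpha>\<in>min_supp f. real_vec \<alpha> \<notin> D \<longrightarrow> pairing k \<alpha> - weight f k > T) \<and>
    (\<forall>i. \<not> int CARD('p) dvd u $ i) \<and>
    (\<forall>v. \<forall>i\<in>{1..e}. int CARD('p) ^ T dvd coeff (shift_poly A (scaled_coeff CARD('p) f k) u v) i))"
  have "\<exists>k A u. B T k A u" for T
  proof (rule ccontr)
    assume nB: "\<not> ?thesis"
    show False
      by (rule notE[OF neg], rule exI[of _ T]) (use nB in \<open>unfold B_def, blast\<close>)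
  qed
  then obtain qs As us where B: "\<And>T. B T (qs T) (As T) (us T)" by metis
  have bad:
    "\<And>T i. qs T $ i \<ge> T" "\<And>T. finite (As T)" "\<And>T. min_supp f \<subseteq> As T" "\<And>T \<alpha>. \<alpha> \<in> As T \<Longrightarrow> f \<alpha> \<noteq> 0"
    "\<And>T \<alpha>. \<alpha> \<in> min_supp f \<Longrightarrow> real_vec \<alpha> \<notin> D \<Longrightarrow> pairing (qs T) \<alpha> - weight f (qs T) > T"
    "\<And>T i. \<not> int CARD('p) dvd us T $ i"
    "\<And>T v i. i \<in> {1..e} \<Longrightarrow> int CARD('p) ^ T dvd coeff (shift_poly (As T) (scaled_coeff CARD('p) f (qs T)) (us T) v) i"
    using B unfolding B_def by blast+
  define p where "p = CARD('p)"
  have p1: "p > 1" unfolding p_def using prime_gt_1_nat[OF prime_card[where 'a = 'p]] .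
  define x where "x = (\<lambda>\<alpha> T. pairing (qs T) \<alpha> - weight f (qs T))"
  have x_eq: "pairing (qs T) \<alpha> = weight f (qs T) + x \<alpha> T" if "f \<alpha> \<noteq> 0" for \<alpha> T
    using weight_le_pairing[OF that, of "qs T"] by (simp add: x_def)
  have id: "strict_mono (\<lambda>j::nat. j)" by (simp add: strict_mono_def)
  obtain r1 :: "nat \<Rightarrow> nat" where r1: "strict_mono r1"
    "\<And>\<alpha>. \<alpha> \<in> min_supp f \<Longrightarrow> (\<exists>c. \<forall>j. x \<alpha> (r1 j) = c) \<or> strict_mono (\<lambda>j. x \<alpha> (r1 j))"
    using nat_vec_subsequence[OF finite_min_supp id, of f x] by metis
  obtain r2 :: "nat \<Rightarrow> nat" and y :: "'p padic ^ 'n" where r2: "strict_mono r2"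
    "\<And>i. (\<lambda>j. of_int (us (r1 (r2 j)) $ i)) \<longlonglongrightarrow> y $ i"
    using padic_vec_subsequence[OF r1(1), of us] by metis
  define r where "r = r1 \<circ> r2"
  have r: "strict_mono r" unfolding r_def by (rule strict_mono_o[OF r1(1) r2(1)])
  have rj: "j \<le> r j" for j using r by (rule strict_mono_imp_increasing)
  \<comment> \<open>The exponents whose excess \<open>x\<close> over the minimum stays constant.
    They carry the limit polynomial, since all other coefficients tend to \<open>0\<close>.\<close>
  define L where "L = {\<alpha> \<in> min_supp f. \<exists>c. \<forall>j. x \<alpha> (r1 j) = c}"
  have LS: "L \<subseteq> min_supp f" by (auto simp: L_def)
  have finL: "finite L" using LS finite_min_supp by (rule finite_subset)
  have Lf: "f \<alpha> \<noteq> 0" if "\<alpha> \<in> L" for \<alpha> using that LS min_supp_subset by blast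
  have xc: "x \<alpha> (r j) = x \<alpha> (r 0)" if "\<alpha> \<in> L" for \<alpha> j using that by (auto simp: L_def r_def)
  have xs: "strict_mono (\<lambda>j. x \<alpha> (r j))" if "\<alpha> \<in> min_supp f" "\<alpha> \<notin> L" for \<alpha>
  proof -
    have "strict_mono (\<lambda>j. x \<alpha> (r1 j))" using r1(2)[OF that(1)] that by (auto simp: L_def)
    from strict_mono_o[OF this r2(1)] show ?thesis by (simp add: r_def o_def)
  qed
  \<comment> \<open>An exponent that is not minimal lies above a minimal one by a unit in some
    coordinate \<open>i\<close>, so its excess is at least the \<open>i\<close>-th entry of the
    weight vector, which grows along the sequence.\<close>
  have x_ge: "x \<alpha> (r j) \<ge> j" if \<alpha>: "f \<alpha> \<noteq> 0" "\<alpha> \<notin> L" for \<alpha> j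
  proof (cases "\<alpha> \<in> min_supp f")
    case True
    thus ?thesis using strict_mono_imp_increasing[OF xs[OF True \<alpha>(2)]] by blast
  next
    case False
    obtain \<gamma> where \<gamma>: "\<gamma> \<in> min_supp f" "\<And>i. \<gamma> $ i \<le> \<alpha> $ i" using exists_min_supp[of f \<alpha>, OF \<alpha>(1)] by blast
    hence "\<gamma> \<noteq> \<alpha>" using False by blast
    then obtain i where "\<gamma> $ i \<noteq> \<alpha> $ i" by (auto simp: vec_eq_iff)
    hence i: "\<gamma> $ i + 1 \<le> \<alpha> $ i" using \<gamma>(2)[of i] by simp
    have "pairing (qs (r j)) \<alpha> \<ge> pairing (qs (r j)) \<gamma> + qs (r j) $ i"
    proof -
      have "pairing (qs (r j)) \<gamma> + qs (r j) $ i = (\<Sum>l\<in>UNIV. qs (r j) $ l * (\<gamma> $ l + (if l = i then 1 else 0)))"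
      proof -
        have "(\<Sum>l\<in>UNIV. qs (r j) $ l * (\<gamma> $ l + (if l = i then 1 else 0))) =
            (\<Sum>l\<in>UNIV. qs (r j) $ l * \<gamma> $ l + (if l = i then qs (r j) $ i else 0))"
          by (intro sum.cong refl) (auto simp: distrib_left)
        thus ?thesis by (simp add: pairing_def sum.distrib)
      qed
      also have "\<dots> \<le> pairing (qs (r j)) \<alpha>"
        unfolding pairing_def using \<gamma>(2) i by (intro sum_mono mult_left_mono) auto
      finally show ?thesis .
    qed
    moreover have "weight f (qs (r j)) \<le> pairing (qs (r j)) \<gamma>"
      using weight_le_pairing[OF min_supp_subset[OF \<gamma>(1)]] .
    ultimately show ?thesis using bad(1)[of "r j" i] rj[of j] by (simp add: x_def)
  qed
  have Lne: "L \<noteq> {}"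
  proof -
    obtain \<alpha> where \<alpha>: "\<alpha> \<in> min_supp f" "pairing (qs (r 1)) \<alpha> = weight f (qs (r 1))" by (rule weight_attained)
    hence "x \<alpha> (r 1) = 0" by (simp add: x_def)
    hence "\<alpha> \<in> L" using x_ge[OF min_supp_subset[OF \<alpha>(1)], of 1] by fastforce
    thus ?thesis by blast
  qed
  \<comment> \<open>A constant excess cannot stay above the growing threshold imposed outside
    \<open>D\<close>.\<close>
  have LD: "real_vec \<alpha> \<in> D" if "\<alpha> \<in> L" for \<alpha>
  proof (rule ccontr)
    assume nD: "real_vec \<alpha> \<notin> D"
    let ?j = "x \<alpha> (r 0)"
    have "x \<alpha> (r ?j) > r ?j" using bad(5)[OF _ nD] that LS by (auto simp: x_def)
    thus False using xc[OF that, of ?j] rj[of ?j] by simp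
  qed
  \<comment> \<open>A term of the sequence so late that it exceeds the initial one in every
    coordinate. Their difference is a strictly positive \<open>k\<close>; constant excesses cancel
    in it while increasing ones contribute a positive amount, so \<open>L\<close> is exactly the set
    of minimal exponents where \<open>k\<close> attains its weight, and \<open>weight_face\<close>
    provides the compact face.\<close>
  define j' where "j' = Suc (total_degree (qs (r 0)))"
  have gt: "qs (r 0) $ i < qs (r j') $ i" for i
  proof -
    have "qs (r 0) $ i \<le> total_degree (qs (r 0))" unfolding total_degree_def by (rule vec_component_le_sum)
    also have "\<dots> < j'" by (simp add: j'_def)
    also have "\<dots> \<le> r j'" by (rule rj)
    also have "\<dots> \<le> qs (r j') $ i" by (rule bad(1))
    finally show ?thesis .
  qed
  define k where "k = (\<chi> i. qs (r j') $ i - qs (r 0) $ i)"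
  have kpos: "k $ i > 0" for i using gt[of i] by (simp add: k_def)
  have k_add: "pairing k \<alpha> + pairing (qs (r 0)) \<alpha> = pairing (qs (r j')) \<alpha>" for \<alpha>
    unfolding pairing_def k_def using gt
    by (simp add: sum.distrib[symmetric] distrib_right[symmetric] less_imp_le)
  have pk: "pairing k \<alpha> + weight f (qs (r 0)) + x \<alpha> (r 0) = weight f (qs (r j')) + x \<alpha> (r j')" if "f \<alpha> \<noteq> 0" for \<alpha>
    using k_add[of \<alpha>] x_eq[OF that, of "r 0"] x_eq[OF that, of "r j'"] by simp
  have pkL: "pairing k \<alpha> + weight f (qs (r 0)) = weight f (qs (r j'))" if "\<alpha> \<in> L" for \<alpha>
    using pk[OF Lf[OF that]] xc[OF that, of j'] by simp
  have pkn: "pairing k \<alpha> + weight f (qs (r 0)) > weight f (qs (r j'))" if "\<alpha> \<in> min_supp f" "\<alpha> \<notin> L" for \<alpha>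
  proof -
    have "x \<alpha> (r 0) < x \<alpha> (r j')" using strict_monoD[OF xs[OF that], of 0 j'] by (simp add: j'_def)
    thus ?thesis using pk[OF min_supp_subset[OF that(1)]] by simp
  qed
  obtain \<alpha>0 where \<alpha>0: "\<alpha>0 \<in> L" using Lne by blast
  obtain \<gamma>0 where \<gamma>0: "\<gamma>0 \<in> min_supp f" "pairing k \<gamma>0 = weight f k" by (rule weight_attained)
  have wk: "weight f k + weight f (qs (r 0)) = weight f (qs (r j'))"
  proof -
    have "weight f k \<le> pairing k \<alpha>0" by (rule weight_le_pairing[OF Lf[OF \<alpha>0]])
    thus ?thesis using pkL[OF \<alpha>0] pkL[of \<gamma>0] pkn[OF \<gamma>0(1)] \<gamma>0(2) by (cases "\<gamma>0 \<in> L") auto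
  qed
  have L_eq: "{\<alpha> \<in> min_supp f. pairing k \<alpha> = weight f k} = L"
    using LS pkL pkn wk by (fastforce simp: subset_iff)
  define F where "F = convex hull (real_vec ` L)"
  have F: "compact_face f F" "\<And>\<alpha>. f \<alpha> \<noteq> 0 \<Longrightarrow> real_vec \<alpha> \<in> F \<longleftrightarrow> \<alpha> \<in> L"
    using weight_face[of k, OF kpos] unfolding L_eq F_def by blast+
  have FD: "F \<subseteq> D" unfolding F_def using LD by (intro hull_minimal D) auto
  define g where "g = face_polynomial f F"
  have g: "g \<alpha> = (if \<alpha> \<in> L then f \<alpha> else 0)" for \<alpha>
    using F(2)[of \<alpha>] Lf by (auto simp: g_def face_polynomial_def real_vec_def)
  have suppg: "{\<alpha>. g \<alpha> \<noteq> 0} = L" using Lf by (auto simp: g)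

  \<comment> \<open>The limit polynomial is not the face polynomial itself: the constant excesses
    leave powers of \<open>p\<close> in its coefficients. These are absorbed, up to a common factor,
    by the diagonal substitution \<open>b\<close>, which turns the limit point \<open>y\<close> into
    \<open>Y\<close>.\<close>
  define G where "G = (\<lambda>\<alpha>. int p ^ x \<alpha> (r 0) * f \<alpha>)"
  have y1: "padic_norm (y $ i) \<le> 1" for i
  proof -
    obtain j where "padic_norm (of_int (us (r1 (r2 j)) $ i) - y $ i) < 1"
      using r2(2)[of i] unfolding LIMSEQ_def dist_padic_def by (meson order_refl zero_less_one)
    moreover have "y $ i = of_int (us (r1 (r2 j)) $ i) - (of_int (us (r1 (r2 j)) $ i) - y $ i)" by simp
    ultimately show ?thesis
      using padic_norm_diff[of "of_int (us (r1 (r2 j)) $ i)" "of_int (us (r1 (r2 j)) $ i) - y $ i"]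
        padic_norm_of_int_le_1[of "us (r1 (r2 j)) $ i", where 'p = 'p] by auto
  qed
  have y0: "y $ i \<noteq> 0" for i
  proof
    assume "y $ i = 0"
    moreover have "1 / real CARD('p) ^ 1 > 0" using p1 by (simp add: p_def)
    ultimately obtain j where "padic_norm (of_int (us (r1 (r2 j)) $ i) :: 'p padic) < 1 / real CARD('p) ^ 1"
      using r2(2)[of i] unfolding LIMSEQ_def dist_padic_def by (metis diff_zero order_refl)
    hence "int CARD('p) ^ 1 dvd us (r1 (r2 j)) $ i" unfolding padic_norm_of_int_le_iff[symmetric, where 'p = 'p] by simp
    thus False using bad(6) by simp
  qed
  have coeff0: "coeff (shift_poly L (\<lambda>\<alpha>. of_int (G \<alpha>)) y (\<chi> i. of_int (v $ i))) i = 0" if i: "i \<in> {1..e}" for i v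
  proof -
    define c where "c = coeff (shift_poly L (\<lambda>\<alpha>. of_int (G \<alpha>)) y (\<chi> i. of_int (v $ i))) i"
    have "padic_norm c \<le> 1 / real CARD('p) ^ m" for m
    proof -
      have pos: "1 / real CARD('p) ^ m > 0" using p1 by (simp add: p_def)
      have "\<exists>J. \<forall>i\<in>UNIV. \<forall>j\<ge>J. padic_norm (of_int (us (r j) $ i) - y $ i) < 1 / real CARD('p) ^ m"
      proof -
        have "\<forall>i. \<exists>J. \<forall>j\<ge>J. padic_norm (of_int (us (r j) $ i) - y $ i) < 1 / real CARD('p) ^ m"
          using r2(2) pos unfolding LIMSEQ_def dist_padic_def r_def o_def by blast
        then obtain J where J: "\<And>i j. j \<ge> J i \<Longrightarrow> padic_norm (of_int (us (r j) $ i) - y $ i) < 1 / real CARD('p) ^ m"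
          by metis
        have "padic_norm (of_int (us (r j) $ i) - y $ i) < 1 / real CARD('p) ^ m" if "j \<ge> sum J UNIV" for i j
          by (rule J) (use that member_le_sum[of i UNIV J] in auto)
        thus ?thesis by blast
      qed
      then obtain J where J: "\<And>i j. j \<ge> J \<Longrightarrow> padic_norm (of_int (us (r j) $ i) - y $ i) < 1 / real CARD('p) ^ m" by blast
      \<comment> \<open>From this index on, three errors are of size at most \<open>p^(-m)\<close>:
        the terms outside \<open>L\<close>, the whole coefficient by the choice of the sequence, and
        the distance of the integer points from \<open>y\<close>.\<close>
      define j where "j = max J m"
      let ?g = "scaled_coeff CARD('p) f (qs (r j))"
      let ?c = "coeff (shift_poly L G (us (r j)) v) i"
      have split: "As (r j) = L \<union> (As (r j) - L)" using LS bad(3) by blast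
      have "shift_poly (As (r j)) ?g (us (r j)) v = shift_poly L ?g (us (r j)) v + shift_poly (As (r j) - L) ?g (us (r j)) v"
        unfolding shift_poly_def
        by (subst split, rule sum.union_disjoint) (use bad(2) finL in auto)
      hence "coeff (shift_poly (As (r j)) ?g (us (r j)) v) i =
         coeff (shift_poly L ?g (us (r j)) v) i + coeff (shift_poly (As (r j) - L) ?g (us (r j)) v) i" by simp
      moreover have "int p ^ m dvd coeff (shift_poly (As (r j) - L) ?g (us (r j)) v) i"
      proof (rule dvd_coeff_shift_poly)
        fix \<alpha> assume "\<alpha> \<in> As (r j) - L"
        hence "x \<alpha> (r j) \<ge> j" using x_ge bad(4) by blast
        hence "m \<le> x \<alpha> (r j)" by (simp add: j_def)
        hence "int p ^ m dvd int p ^ x \<alpha> (r j)" by (rule le_imp_power_dvd)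
        thus "int p ^ m dvd ?g \<alpha>" unfolding scaled_coeff_def x_def p_def by (rule dvd_mult2)
      qed
      moreover have "int p ^ m dvd coeff (shift_poly (As (r j)) ?g (us (r j)) v) i"
      proof -
        have "m \<le> r j" using rj[of j] by (simp add: j_def)
        hence "int p ^ m dvd int p ^ r j" by (rule le_imp_power_dvd)
        thus ?thesis using bad(7)[OF i, of "r j" v] unfolding p_def by (rule dvd_trans)
      qed
      ultimately have "int p ^ m dvd coeff (shift_poly L ?g (us (r j)) v) i"
        by (metis dvd_add_left_iff)
      also have "shift_poly L ?g (us (r j)) v = shift_poly L G (us (r j)) v"
      proof (rule shift_poly_cong)
        fix \<alpha> assume "\<alpha> \<in> L"
        from xc[OF this, of j] show "?g \<alpha> = G \<alpha>" by (simp add: scaled_coeff_def G_def x_def p_def)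
      qed
      finally have "padic_norm (of_int ?c :: 'p padic) \<le> 1 / real CARD('p) ^ m"
        by (simp only: padic_norm_of_int_le_iff p_def)
      moreover have "padic_norm (of_int ?c - c) \<le> 1 / real CARD('p) ^ m"
        unfolding c_def of_int_coeff_shift_poly
        by (rule padic_norm_coeff_shift_poly_diff)
           (use J[of j] y1 pos in \<open>auto simp: padic_norm_of_int_le_1 j_def less_imp_le\<close>)
      moreover have "c = of_int ?c - (of_int ?c - c)" by simp
      ultimately show ?thesis
        using padic_norm_diff[of "of_int ?c" "of_int ?c - c"] by auto
    qed
    hence "padic_norm c = 0"
      using padic_small[of "padic_norm c", where 'p = 'p] padic_norm_nonneg[of c] by (metis less_le not_le)
    thus ?thesis by (simp add: padic_norm_eq_0_iff c_def)
  qed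
  have taylor0: "taylor L (\<lambda>\<alpha>. of_int (G \<alpha>)) y \<beta> = 0" if "\<beta> \<in> exponents_of_degree i" "i \<in> {1..e}" for i \<beta>
    by (rule vanishing_form_coeffs[OF _ that(1)]) (use coeff0[OF that(2)] in \<open>simp add: coeff_shift_poly\<close>)
  define b where "b = (\<chi> i. (of_nat p :: 'p padic) ^ (qs (r 0) $ i))"
  define Y where "Y = (\<chi> i. b $ i * y $ i)"
  have pne: "(of_nat p :: 'p padic) \<noteq> 0" using p1 by simp
  have Y0: "Y $ i \<noteq> 0" for i using y0 pne by (simp add: Y_def b_def)
  have taylorY: "taylor L (\<lambda>\<alpha>. of_int (g \<alpha>)) Y \<beta> = 0" if \<beta>: "\<beta> \<in> exponents_of_degree i" "i \<in> {1..e}" for i \<beta>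
  proof -
    have "(\<Prod>i\<in>UNIV. (b $ i) ^ (\<beta> $ i)) * taylor L (\<lambda>\<alpha>. of_int (g \<alpha>)) Y \<beta> =
       taylor L (\<lambda>\<alpha>. of_int (g \<alpha>) * (\<Prod>i\<in>UNIV. (b $ i) ^ (\<alpha> $ i))) y \<beta>"
      unfolding Y_def by (rule taylor_scale)
    also have "\<dots> = taylor L (\<lambda>\<alpha>. of_nat p ^ weight f (qs (r 0)) * of_int (G \<alpha>)) y \<beta>"
    proof (rule taylor_cong)
      fix \<alpha> assume \<alpha>: "\<alpha> \<in> L"
      have "(\<Prod>i\<in>UNIV. (b $ i) ^ (\<alpha> $ i)) = of_nat p ^ pairing (qs (r 0)) \<alpha>"
        by (simp add: b_def prime_power_prod)
      also have "\<dots> = of_nat p ^ weight f (qs (r 0)) * of_nat p ^ x \<alpha> (r 0)"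
        unfolding x_eq[OF Lf[OF \<alpha>]] by (rule power_add)
      finally show "of_int (g \<alpha>) * (\<Prod>i\<in>UNIV. (b $ i) ^ (\<alpha> $ i)) = of_nat p ^ weight f (qs (r 0)) * of_int (G \<alpha>)"
        using \<alpha> by (simp add: g G_def)
    qed
    also have "\<dots> = 0" unfolding taylor_cmult taylor0[OF \<beta>] by simp
    finally have "(\<Prod>i\<in>UNIV. (b $ i) ^ (\<beta> $ i)) * taylor L (\<lambda>\<alpha>. of_int (g \<alpha>)) Y \<beta> = 0" .
    moreover have "(\<Prod>i\<in>UNIV. (b $ i) ^ (\<beta> $ i)) \<noteq> 0" using pne by (simp add: b_def)
    ultimately show ?thesis by simp
  qed
  have fing: "finite {\<alpha>. g \<alpha> \<noteq> 0}" using suppg finL by simp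
  have valY: "series_value (foldr formal_partial js g) Y = 0" if "length js \<le> e" for js
  proof (cases "js = []")
    case False
    hence "(\<chi> i. count_list js i) \<in> exponents_of_degree (length js)" "length js \<in> {1..e}"
      using that by (auto simp: exponents_of_degree_def sum_count_list Suc_le_eq)
    thus ?thesis using taylorY by (simp add: series_value_derivative[OF fing] suppg)
  next
    case True
    have ax: "taylor L (\<lambda>\<alpha>. of_int (g \<alpha>)) Y (axis i 1) = 0" for i
    proof (rule taylorY)
      have "(\<Sum>j\<in>UNIV. axis i (1::nat) $ j) = (\<Sum>j\<in>UNIV. if j = i then 1 else 0)"
        by (intro sum.cong refl) (auto simp: axis_def)
      thus "axis i 1 \<in> exponents_of_degree 1" by (simp add: exponents_of_degree_def)
      show "1 \<in> {1..e}" using e by simp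
    qed
    have "0 = (\<Sum>i\<in>UNIV. of_nat (k $ i) * (Y $ i * taylor L (\<lambda>\<alpha>. of_int (g \<alpha>)) Y (axis i 1)))"
      by (simp add: ax[unfolded One_nat_def])
    also have "\<dots> = (\<Sum>\<alpha>\<in>L. of_int (g \<alpha>) * (\<Prod>j\<in>UNIV. Y $ j ^ (\<alpha> $ j)) * of_nat (pairing k \<alpha>))"
      unfolding euler_identity sum_distrib_left pairing_def of_nat_sum
      by (subst sum.swap) (simp add: mult_ac)
    also have "\<dots> = (\<Sum>\<alpha>\<in>L. of_int (g \<alpha>) * (\<Prod>j\<in>UNIV. Y $ j ^ (\<alpha> $ j)) * of_nat (weight f k))"
      using L_eq by (intro sum.cong refl) auto
    also have "\<dots> = series_value g Y * of_nat (weight f k)"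
      unfolding series_value_polynomial[OF fing] suppg series_term_def by (simp add: sum_distrib_right)
    finally have "series_value g Y * of_nat (weight f k) = 0" by simp
    moreover have "weight f k > 0"
    proof -
      have "\<gamma>0 \<noteq> 0" using min_supp_subset[OF \<gamma>0(1)] f0 by auto
      thus ?thesis using pairing_pos[OF kpos] \<gamma>0(2) by metis
    qed
    ultimately show ?thesis using True by simp
  qed
  have "max_zero_order TYPE('p) f F > e"
  proof (rule max_zero_order_gt)
    show "finite {\<alpha>. face_polynomial f F \<alpha> \<noteq> 0}" using fing by (simp add: g_def)
    show "face_polynomial f F \<alpha>0 \<noteq> 0" using \<alpha>0 suppg by (auto simp: g_def)
  qed (use Y0 valY in \<open>auto simp: g_def\<close>)
  thus False using o[OF F(1) FD] by simp
qed

end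

section \<open>Exponential sums in several variables\<close>

definition vec_box :: "nat \<Rightarrow> ('n \<Rightarrow> nat) \<Rightarrow> (int ^ 'n) set" where
  "vec_box p N = {x. \<forall>i. x $ i \<in> {0..<int p ^ N i}}"

definition unit_vecs :: "nat \<Rightarrow> (int ^ 'n) set" where
  "unit_vecs p = {u. \<forall>i. \<not> int p dvd u $ i}"

definition poly_value :: "(nat ^ 'n) set \<Rightarrow> (nat ^ 'n \<Rightarrow> 'a) \<Rightarrow> 'a ^ 'n \<Rightarrow> 'a::comm_ring_1" where
  "poly_value A g x = (\<Sum>\<alpha>\<in>A. g \<alpha> * (\<Prod>i\<in>UNIV. x $ i ^ (\<alpha> $ i)))"

lemma finite_vec_box': "finite (vec_box p N)"
  unfolding vec_box_def by (rule finite_vec_box) simp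

lemma card_vec_set:
  assumes "\<And>i. finite (A i)"
  shows "card {x :: 'b ^ 'n. \<forall>i. x $ i \<in> A i} = (\<Prod>i\<in>UNIV. card (A i))"
  using prod_sum_vec[of A "\<lambda>_ _. 1 :: nat"] assms by simp

lemma card_int_interval: "card {0..<int p ^ m} = p ^ m"
  by (simp add: nat_power_eq)

lemma card_vec_box: "card (vec_box p N) = p ^ (\<Sum>i\<in>UNIV. N i)"
proof -
  have "card (vec_box p N) = (\<Prod>i\<in>UNIV. card {0..<int p ^ N i})"
    unfolding vec_box_def by (rule card_vec_set) simp
  also have "\<dots> = (\<Prod>i\<in>UNIV. p ^ N i)" by (simp only: card_int_interval)
  finally show ?thesis by (simp add: power_sum)
qed

lemma dvd_power_diff:
  fixes x y c :: "'a::comm_ring_1"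
  assumes "c dvd x - y"
  shows "c dvd x ^ k - y ^ k"
  using assms power_diff_sumr2[of x k y] by simp

lemma dvd_prod_diff:
  fixes x y :: "'i \<Rightarrow> 'a::comm_ring_1"
  assumes "\<And>i. i \<in> I \<Longrightarrow> c dvd x i - y i"
  shows "c dvd (\<Prod>i\<in>I. x i) - (\<Prod>i\<in>I. y i)"
  using assms
proof (induction I rule: infinite_finite_induct)
  case (insert i I)
  have "(\<Prod>i\<in>insert i I. x i) - (\<Prod>i\<in>insert i I. y i) =
      x i * ((\<Prod>i\<in>I. x i) - (\<Prod>i\<in>I. y i)) + (x i - y i) * (\<Prod>i\<in>I. y i)"
    using insert by (simp add: algebra_simps)
  thus ?case using insert by (auto intro!: dvd_add)
qed auto

lemma dvd_poly_value_diff: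
  assumes "\<And>i. c dvd x $ i - y $ i"
  shows "c dvd poly_value A g x - poly_value A g y"
proof -
  have "poly_value A g x - poly_value A g y =
     (\<Sum>\<alpha>\<in>A. g \<alpha> * ((\<Prod>i\<in>UNIV. x $ i ^ (\<alpha> $ i)) - (\<Prod>i\<in>UNIV. y $ i ^ (\<alpha> $ i))))"
    by (simp add: poly_value_def right_diff_distrib sum_subtractf)
  also have "c dvd \<dots>"
    by (intro dvd_sum dvd_mult dvd_prod_diff dvd_power_diff assms)
  finally show ?thesis .
qed

lemma dvd_coeff_shift_poly_diff:
  fixes u w v :: "'a::comm_ring_1 ^ 'n"
  assumes "\<And>i. c dvd u $ i - w $ i"
  shows "c dvd coeff (shift_poly A g u v) k - coeff (shift_poly A g w v) k"
proof -
  have "coeff (shift_poly A g u v) k - coeff (shift_poly A g w v) k =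
     (\<Sum>\<beta>\<in>exponents_of_degree k. (\<Sum>\<alpha>\<in>A. g \<alpha> *
        ((\<Prod>i\<in>UNIV. of_nat (\<alpha> $ i choose \<beta> $ i) * u $ i ^ (\<alpha> $ i - \<beta> $ i)) -
         (\<Prod>i\<in>UNIV. of_nat (\<alpha> $ i choose \<beta> $ i) * w $ i ^ (\<alpha> $ i - \<beta> $ i)))) * (\<Prod>i\<in>UNIV. v $ i ^ (\<beta> $ i)))"
    by (simp add: coeff_shift_poly taylor_def left_diff_distrib right_diff_distrib sum_subtractf)
  also have "c dvd \<dots>"
  proof (rule dvd_sum, rule dvd_mult2, rule dvd_sum, rule dvd_mult, rule dvd_prod_diff)
    fix \<alpha> \<beta> :: "nat ^ 'n" and i
    have "c dvd of_nat (\<alpha> $ i choose \<beta> $ i) * (u $ i ^ (\<alpha> $ i - \<beta> $ i) - w $ i ^ (\<alpha> $ i - \<beta> $ i))"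
      by (intro dvd_mult dvd_power_diff assms)
    thus "c dvd of_nat (\<alpha> $ i choose \<beta> $ i) * u $ i ^ (\<alpha> $ i - \<beta> $ i) - of_nat (\<alpha> $ i choose \<beta> $ i) * w $ i ^ (\<alpha> $ i - \<beta> $ i)"
      by (simp add: right_diff_distrib)
  qed
  finally show ?thesis .
qed

lemma coeff_shift_poly_scale:
  "coeff (shift_poly A g u (\<chi> i. c * v $ i)) k = c ^ k * coeff (shift_poly A g u v) k"
proof -
  have "(\<Prod>i\<in>UNIV. (c * v $ i) ^ (\<beta> $ i)) = c ^ k * (\<Prod>i\<in>UNIV. v $ i ^ (\<beta> $ i))" if "\<beta> \<in> exponents_of_degree k" for \<beta>
    using that by (simp add: power_mult_distrib prod.distrib exponents_of_degree_def flip: power_sum)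
  thus ?thesis by (simp add: coeff_shift_poly sum_distrib_left mult_ac cong: sum.cong)
qed

lemma poly_shift_poly': "poly (shift_poly A g u v) t = poly_value A g (\<chi> i. u $ i + t * v $ i)"
  by (simp add: poly_shift_poly poly_value_def)

text \<open>
  Averaging the summand at \<open>u\<close> over the line through \<open>u\<close> in a direction that depends only on
  \<open>u\<close> modulo \<open>p^s\<close> does not change the sum, so the one-variable bound applies on each line.
\<close>

lemma unit_sum_bound:
  fixes p :: nat
  assumes p: "prime p" and e: "e \<ge> 1" and \<theta>: "\<theta> \<ge> 0" "e = 1 \<or> \<theta> \<le> 1 / real e"
  shows "\<exists>C\<ge>1. \<exists>s. \<forall>A (g :: nat ^ 'n \<Rightarrow> int) l N.
    (\<forall>u\<in>unit_vecs p. \<exists>v. \<exists>i\<in>{1..e}. \<not> int p ^ T dvd coeff (shift_poly A g u v) i) \<longrightarrow>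
    (\<forall>i. N i \<ge> l + s) \<longrightarrow>
    cmod (\<Sum>u\<in>vec_box p N \<inter> unit_vecs p. padic_char p l (poly_value A g u))
      \<le> C * real p powr (- \<theta> * real l) * real (card (vec_box p N))"
proof -
  have p1: "p > 1" using p prime_gt_1_nat by blast
  have pp: "prime (int p)" using p by simp
  \<comment> \<open>Moving along \<open>p^s v\<close> multiplies the coefficient of order
    \<open>j\<close> by \<open>p^(s j)\<close>, so each order above \<open>k\<close> gains at least
    \<open>s\<close> over order \<open>k\<close>. This beats the valuation below \<open>T\<close> of
    the coefficient of order \<open>k\<close> together with the factorial margin of
    \<open>vdc_cond\<close>.\<close>
  define s where "s = T + 1 + multiplicity (int p) (fact e)"
  have "\<exists>C. i \<in> {1..e} \<longrightarrow> C \<ge> 1 \<and> (\<forall>h \<tau> l L. vdc_cond p i \<tau> h \<longrightarrow> l \<le> L \<longrightarrow>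
    cmod (mean p L (\<lambda>t. padic_char p l (poly h t))) \<le> C * real p powr (- \<theta> * (real l - real \<tau>)))" for i
  proof (cases "i \<in> {1..e}")
    case True
    have "i = 1 \<or> \<theta> \<le> 1 / real i"
    proof (cases "e = 1")
      case False
      have "1 / real e \<le> 1 / real i" using True by (intro divide_left_mono) auto
      thus ?thesis using False \<theta> by auto
    qed (use True in auto)
    thus ?thesis using van_der_Corput[OF p, of i \<theta>] True \<theta>(1) by auto
  qed auto
  then obtain Cv where Cv: "\<And>i. i \<in> {1..e} \<Longrightarrow> Cv i \<ge> 1"
    "\<And>i h \<tau> l L. i \<in> {1..e} \<Longrightarrow> vdc_cond p i \<tau> h \<Longrightarrow> l \<le> L \<Longrightarrow>
      cmod (mean p L (\<lambda>t. padic_char p l (poly h t))) \<le> Cv i * real p powr (- \<theta> * (real l - real \<tau>))" by metis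
  define C0 where "C0 = (\<Sum>i\<in>{1..e}. Cv i)"
  have C0: "Cv i \<le> C0" if "i \<in> {1..e}" for i
    unfolding C0_def by (rule member_le_sum) (use that Cv(1) in \<open>auto intro: order_trans[OF zero_le_one]\<close>)
  have C01: "C0 \<ge> 1" using C0[of 1] Cv(1)[of 1] e by simp
  \<comment> \<open>The valuation of the dominating coefficient on a line is at most
    \<open>s e + T\<close>, which costs this power of \<open>p\<close>.\<close>
  define C where "C = C0 * real p powr (\<theta> * real (s * e + T))"
  have "real p powr (\<theta> * real (s * e + T)) \<ge> 1" using p1 \<theta> by (intro ge_one_powr_ge_zero) auto
  hence C1: "C \<ge> 1" unfolding C_def using C01 mult_mono[of 1 C0 1] by fastforce
  have "cmod (\<Sum>u\<in>vec_box p N \<inter> unit_vecs p. padic_char p l (poly_value A g u))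
      \<le> C * real p powr (- \<theta> * real l) * real (card (vec_box p N))"
    if nd: "\<And>u. u \<in> unit_vecs p \<Longrightarrow> \<exists>v. \<exists>i\<in>{1..e}. \<not> int p ^ T dvd coeff (shift_poly A g u v) i"
      and N: "\<And>i. N i \<ge> l + s" for A and g :: "nat ^ 'n \<Rightarrow> int" and l N
  proof -
    let ?B = "vec_box p N \<inter> unit_vecs p"
    define \<phi> where "\<phi> = (\<lambda>u. padic_char p l (poly_value A g u))"
    have \<phi>_cong: "\<phi> u = \<phi> w" if "\<And>i. int p ^ l dvd u $ i - w $ i" for u w
      unfolding \<phi>_def by (rule padic_char_cong) (use p1 in simp, rule dvd_poly_value_diff, rule that)
    have "\<exists>v i. u \<in> unit_vecs p \<longrightarrow> i \<in> {1..e} \<and> \<not> int p ^ T dvd coeff (shift_poly A g u v) i" for u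
      using nd by blast
    then obtain V I where VI: "\<And>u. u \<in> unit_vecs p \<Longrightarrow> I u \<in> {1..e} \<and> \<not> int p ^ T dvd coeff (shift_poly A g u (V u)) (I u)" by metis
    define \<rho> :: "int ^ 'n \<Rightarrow> int ^ 'n" where "\<rho> = (\<lambda>u. \<chi> i. u $ i mod int p ^ s)"
    have unit_cong: "u \<in> unit_vecs p \<longleftrightarrow> w \<in> unit_vecs p" if "\<And>i. int p dvd u $ i - w $ i" for u w :: "int ^ 'n"
      unfolding unit_vecs_def using that by (simp add: dvd_diff_left_iff) (metis dvd_add_right_iff diff_add_cancel dvd_diff)
    have ps: "int p dvd int p ^ s" by (simp add: s_def)
    have \<rho>_dvd: "int p ^ s dvd u $ i - \<rho> u $ i" for u i by (simp add: \<rho>_def dvd_minus_mod)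
    have \<rho>_unit: "\<rho> u \<in> unit_vecs p" if "u \<in> unit_vecs p" for u
      using unit_cong[of u "\<rho> u"] that \<rho>_dvd ps dvd_trans by blast
    define w where "w = (\<lambda>u. V (\<rho> u))"
    define k where "k = (\<lambda>u. I (\<rho> u))"
    \<comment> \<open>The lower bound is chosen at the representative \<open>\<rho> u\<close> and
      passes to \<open>u\<close>, which is congruent to it modulo \<open>p^s\<close> with
      \<open>s > T\<close>.\<close>
    have wk: "k u \<in> {1..e}" "\<not> int p ^ T dvd coeff (shift_poly A g u (w u)) (k u)" if u: "u \<in> unit_vecs p" for u
    proof -
      show "k u \<in> {1..e}" using VI[OF \<rho>_unit[OF u]] by (simp add: k_def)
      have "int p ^ T dvd int p ^ s" by (intro le_imp_power_dvd) (simp add: s_def)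
      also have "int p ^ s dvd coeff (shift_poly A g u (w u)) (k u) - coeff (shift_poly A g (\<rho> u) (w u)) (k u)"
        by (rule dvd_coeff_shift_poly_diff) (rule \<rho>_dvd)
      finally show "\<not> int p ^ T dvd coeff (shift_poly A g u (w u)) (k u)"
        using VI[OF \<rho>_unit[OF u]] by (auto simp: k_def w_def dvd_diff_right_iff)
    qed
    have shift: "(\<Sum>u\<in>?B. \<phi> (\<chi> i. u $ i + t * (int p ^ s * w u $ i))) = (\<Sum>u\<in>?B. \<phi> u)" for t
    proof -
      define st where "st = (\<lambda>(c::int) u. \<chi> i. (u $ i + c * (int p ^ s * w u $ i)) mod int p ^ N i)"
      have pN: "int p ^ s dvd int p ^ N i" for i
        using N[of i] by (intro le_imp_power_dvd) simp
      have st_dvd: "int p ^ s dvd st c u $ i - u $ i" for c u i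
      proof -
        have "int p ^ s dvd st c u $ i - (u $ i + c * (int p ^ s * w u $ i))"
        proof -
          have "int p ^ N i dvd (u $ i + c * (int p ^ s * w u $ i)) - st c u $ i"
            unfolding st_def by (simp add: dvd_minus_mod)
          with pN have "int p ^ s dvd (u $ i + c * (int p ^ s * w u $ i)) - st c u $ i" by (rule dvd_trans)
          thus ?thesis by (simp add: dvd_diff_commute)
        qed
        moreover have "int p ^ s dvd c * (int p ^ s * w u $ i)" by simp
        ultimately have "int p ^ s dvd (st c u $ i - (u $ i + c * (int p ^ s * w u $ i))) + c * (int p ^ s * w u $ i)" by (rule dvd_add)
        thus ?thesis by simp
      qed
      have \<rho>st: "\<rho> (st c u) = \<rho> u" for c u
        using st_dvd[of c u] by (simp add: \<rho>_def vec_eq_iff mod_eq_dvd_iff)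
      hence wst: "w (st c u) = w u" for c u by (simp add: w_def)
      have stB: "st c u \<in> ?B" if "u \<in> ?B" for c u
        using unit_cong[of "st c u" u] dvd_trans[OF ps st_dvd] that p1
        by (auto simp: vec_box_def st_def)
      have inv: "st (- c) (st c u) = u" if "u \<in> ?B" for c u
      proof -
        have "st (- c) (st c u) $ i = u $ i" for i
        proof -
          have "st (- c) (st c u) $ i = ((u $ i + c * (int p ^ s * w u $ i)) mod int p ^ N i - c * (int p ^ s * w u $ i)) mod int p ^ N i"
            using wst[of c u] by (simp add: st_def)
          also have "\<dots> = u $ i mod int p ^ N i" by (simp add: mod_diff_left_eq)
          also have "\<dots> = u $ i" using that by (simp add: vec_box_def)
          finally show ?thesis .
        qed
        thus ?thesis by (simp add: vec_eq_iff)
      qed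
      show ?thesis
      proof (rule sum.reindex_bij_witness[where i = "st (- t)" and j = "st t"])
        fix u assume "u \<in> ?B"
        show "\<phi> (st t u) = \<phi> (\<chi> i. u $ i + t * (int p ^ s * w u $ i))"
        proof (rule \<phi>_cong)
          fix i
          have "int p ^ l dvd int p ^ N i" using N[of i] by (intro le_imp_power_dvd) simp
          also have "int p ^ N i dvd st t u $ i - (u $ i + t * (int p ^ s * w u $ i))"
            unfolding st_def using dvd_minus_mod[of "int p ^ N i" "u $ i + t * (int p ^ s * w u $ i)"]
            by (simp add: dvd_diff_commute)
          finally show "int p ^ l dvd st t u $ i - (\<chi> i. u $ i + t * (int p ^ s * w u $ i)) $ i" by simp
        qed
      qed (use stB inv inv[of _ "- t"] in auto)
    qed
    have line: "cmod (mean p l (\<lambda>t. \<phi> (\<chi> i. u $ i + t * (int p ^ s * w u $ i)))) \<le> C * real p powr (- \<theta> * real l)"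
      if u: "u \<in> unit_vecs p" for u
    proof -
      define h where "h = shift_poly A g u (\<chi> i. int p ^ s * w u $ i)"
      define c where "c = coeff (shift_poly A g u (w u)) (k u)"
      have nd: "\<not> int p ^ T dvd c" using wk(2)[OF u] by (simp add: c_def)
      have c0: "c \<noteq> 0" using nd by auto
      define m where "m = multiplicity (int p) c"
      have m: "int p ^ m dvd c" "\<not> int p ^ Suc m dvd c"
        using power_dvd_iff_le_multiplicity[of c "int p" "Suc m"] c0 p1
          multiplicity_dvd[of "int p" c] by (auto simp: m_def simp del: power_Suc)
      have mT: "m < T" using m(1) nd by (meson dvd_trans le_imp_power_dvd not_le)
      define \<tau> where "\<tau> = s * k u + m"
      have ch: "coeff h j = int p ^ (s * j) * coeff (shift_poly A g u (w u)) j" for j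
        by (simp add: h_def coeff_shift_poly_scale power_mult)
      have "vdc_cond p (k u) \<tau> h"
        unfolding vdc_cond_def
      proof (intro conjI allI impI)
        show "int p ^ \<tau> dvd coeff h (k u)"
          unfolding ch \<tau>_def power_add using m(1) by (intro mult_dvd_mono) (auto simp: c_def)
        have "int p ^ Suc \<tau> = int p ^ (s * k u) * int p ^ Suc m" by (simp add: \<tau>_def power_add)
        thus "\<not> int p ^ Suc \<tau> dvd coeff h (k u)"
          unfolding ch using m(2) p1 by (subst \<open>int p ^ Suc \<tau> = _\<close>, subst dvd_mult_cancel_left) (simp add: c_def)
        fix j assume j: "k u < j"
        have "fact (k u) dvd (fact e :: int)" using wk(1)[OF u] by (intro fact_dvd) simp
        hence "multiplicity (int p) (fact (k u)) \<le> multiplicity (int p) (fact e)"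
          by (intro dvd_imp_multiplicity_le) auto
        moreover have "s * (k u + 1) \<le> s * j" using j by (intro mult_left_mono) auto
        ultimately have "\<tau> + 1 + multiplicity (int p) (fact (k u)) \<le> s * j"
          using mT by (simp add: \<tau>_def s_def)
        hence "int p ^ (\<tau> + 1 + multiplicity (int p) (fact (k u))) dvd int p ^ (s * j)" by (rule le_imp_power_dvd)
        thus "int p ^ (\<tau> + 1 + multiplicity (int p) (fact (k u))) dvd coeff h j"
          unfolding ch by (rule dvd_mult2)
      qed
      hence "cmod (mean p l (\<lambda>t. padic_char p l (poly h t))) \<le> Cv (k u) * real p powr (- \<theta> * (real l - real \<tau>))"
        by (intro Cv(2) wk(1) u) auto
      also have "\<dots> \<le> C0 * real p powr (\<theta> * real (s * e + T) + - \<theta> * real l)"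
      proof (intro mult_mono C0 wk(1) u powr_mono)
        have "\<tau> \<le> s * e + T" unfolding \<tau>_def using mT wk(1)[OF u] by (intro add_mono mult_left_mono) auto
        hence "\<theta> * real \<tau> \<le> \<theta> * real (s * e + T)" using \<theta>(1) by (intro mult_left_mono of_nat_mono) auto
        thus "- \<theta> * (real l - real \<tau>) \<le> \<theta> * real (s * e + T) + - \<theta> * real l" by (simp add: algebra_simps)
      qed (use p1 C01 in auto)
      also have "\<dots> = C * real p powr (- \<theta> * real l)" unfolding C_def powr_add by simp
      also have "(\<lambda>t. padic_char p l (poly h t)) = (\<lambda>t. \<phi> (\<chi> i. u $ i + t * (int p ^ s * w u $ i)))"
        by (simp add: h_def \<phi>_def poly_shift_poly')
      finally show ?thesis .
    qed
    have fin: "finite ?B" using finite_vec_box' by blast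
    have "of_nat p ^ l * (\<Sum>u\<in>?B. \<phi> u) = (\<Sum>t\<in>{0..<int p ^ l}. \<Sum>u\<in>?B. \<phi> u)" using p1 by simp
    also have "\<dots> = (\<Sum>t\<in>{0..<int p ^ l}. \<Sum>u\<in>?B. \<phi> (\<chi> i. u $ i + t * (int p ^ s * w u $ i)))"
      unfolding shift ..
    also have "\<dots> = (\<Sum>u\<in>?B. \<Sum>t\<in>{0..<int p ^ l}. \<phi> (\<chi> i. u $ i + t * (int p ^ s * w u $ i)))" by (rule sum.swap)
    also have "\<dots> = (\<Sum>u\<in>?B. of_nat p ^ l * mean p l (\<lambda>t. \<phi> (\<chi> i. u $ i + t * (int p ^ s * w u $ i))))"
      using p1 by (simp add: mean_def)
    also have "\<dots> = of_nat p ^ l * (\<Sum>u\<in>?B. mean p l (\<lambda>t. \<phi> (\<chi> i. u $ i + t * (int p ^ s * w u $ i))))"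
      by (rule sum_distrib_left[symmetric])
    finally have "(\<Sum>u\<in>?B. \<phi> u) = (\<Sum>u\<in>?B. mean p l (\<lambda>t. \<phi> (\<chi> i. u $ i + t * (int p ^ s * w u $ i))))"
      using p1 by simp
    also have "cmod \<dots> \<le> of_nat (card ?B) * (C * real p powr (- \<theta> * real l))"
      by (rule sum_norm_bound) (use line in auto)
    also have "\<dots> \<le> of_nat (card (vec_box p N)) * (C * real p powr (- \<theta> * real l))"
      using C1 by (intro mult_right_mono of_nat_mono card_mono finite_vec_box') auto
    finally show ?thesis by (simp add: \<phi>_def mult_ac)
  qed
  thus ?thesis using C1 by blast
qed

text \<open>Repeating the sum over whole periods provides the extra digits that are used up when
  valuations are split off and when lines are shifted.\<close>

lemma sum_vec_box_per:
  fixes \<phi> :: "int ^ 'n \<Rightarrow> complex"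
  assumes p: "p > 0" and \<phi>: "\<And>x y. (\<And>i. int p ^ l dvd x $ i - y $ i) \<Longrightarrow> \<phi> x = \<phi> y"
  shows "(\<Sum>x\<in>vec_box p (\<lambda>_. l + m). \<phi> x) = of_nat p ^ (m * CARD('n)) * (\<Sum>x\<in>vec_box p (\<lambda>_. l). \<phi> x)"
proof -
  have "(\<Sum>x\<in>vec_box p (\<lambda>_. l + m). \<phi> x) = (\<Sum>(y, w)\<in>vec_box p (\<lambda>_. l) \<times> (vec_box p (\<lambda>_. m) :: (int ^ 'n) set). \<phi> y)"
  proof (rule sum.reindex_bij_witness[where
        i = "\<lambda>(y, w). \<chi> i. y $ i + int p ^ l * w $ i" and
        j = "\<lambda>x. (\<chi> i. x $ i mod int p ^ l, \<chi> i. x $ i div int p ^ l)"])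
    fix x :: "int ^ 'n" assume x: "x \<in> vec_box p (\<lambda>_. l + m)"
    show "(case (\<chi> i. x $ i mod int p ^ l, \<chi> i. x $ i div int p ^ l) of (y, w) \<Rightarrow> \<chi> i. y $ i + int p ^ l * w $ i) = x"
      by (simp add: vec_eq_iff)
    have "x $ i div int p ^ l < int p ^ m" for i
    proof -
      have "int p ^ l * (x $ i div int p ^ l) \<le> x $ i"
      proof -
        have "int p ^ l > 0" using p by simp
        from pos_mod_sign[OF this, of "x $ i"] show ?thesis
          using mult_div_mod_eq[of "int p ^ l" "x $ i"] by linarith
      qed
      also have "\<dots> < int p ^ l * int p ^ m" using x by (simp add: vec_box_def power_add)
      finally show ?thesis using p by simp
    qed
    thus "(\<chi> i. x $ i mod int p ^ l, \<chi> i. x $ i div int p ^ l) \<in> vec_box p (\<lambda>_. l) \<times> vec_box p (\<lambda>_. m)"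
      using x p by (auto simp: vec_box_def pos_imp_zdiv_nonneg_iff)
    show "(case (\<chi> i. x $ i mod int p ^ l, \<chi> i. x $ i div int p ^ l) of (y, w) \<Rightarrow> \<phi> y) = \<phi> x"
    proof -
      have "\<phi> (\<chi> i. x $ i mod int p ^ l) = \<phi> x"
      proof (rule \<phi>)
        fix i show "int p ^ l dvd (\<chi> i. x $ i mod int p ^ l) $ i - x $ i"
          using dvd_minus_mod[of "int p ^ l" "x $ i"] by (simp add: dvd_diff_commute)
      qed
      thus ?thesis by simp
    qed
  next
    fix z :: "(int ^ 'n) \<times> (int ^ 'n)" assume z: "z \<in> vec_box p (\<lambda>_. l) \<times> vec_box p (\<lambda>_. m)"
    obtain y w where yw: "z = (y, w)" by force
    have "y $ i + int p ^ l * w $ i < int p ^ (l + m)" for i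
    proof -
      have "y $ i + int p ^ l * w $ i < int p ^ l * 1 + int p ^ l * w $ i" using z yw by (simp add: vec_box_def)
      also have "\<dots> = int p ^ l * (1 + w $ i)" by (simp only: distrib_left)
      also have "\<dots> \<le> int p ^ l * int p ^ m"
      proof (intro mult_left_mono)
        have "w $ i < int p ^ m" using z yw by (simp add: vec_box_def)
        thus "1 + w $ i \<le> int p ^ m" by simp
      qed simp
      finally show ?thesis by (simp add: power_add)
    qed
    thus "(case z of (y, w) \<Rightarrow> \<chi> i. y $ i + int p ^ l * w $ i) \<in> vec_box p (\<lambda>_. l + m)"
      using z yw by (auto simp: vec_box_def)
    show "(\<lambda>x. (\<chi> i. x $ i mod int p ^ l, \<chi> i. x $ i div int p ^ l)) (case z of (y, w) \<Rightarrow> \<chi> i. y $ i + int p ^ l * w $ i) = z"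
      using z yw p by (auto simp: vec_box_def vec_eq_iff)
  qed
  also have "\<dots> = (\<Sum>y\<in>vec_box p (\<lambda>_. l). \<Sum>w\<in>(vec_box p (\<lambda>_. m) :: (int ^ 'n) set). \<phi> y)"
    by (rule sum.cartesian_product[symmetric])
  also have "\<dots> = of_nat p ^ (m * CARD('n)) * (\<Sum>x\<in>vec_box p (\<lambda>_. l). \<phi> x)"
    by (simp add: card_vec_box sum_distrib_right mult.commute)
  finally show ?thesis .
qed

lemma card_box_dvd_le:
  assumes p: "p > 0" and K: "K \<le> L"
  shows "card {x \<in> vec_box p (\<lambda>_::'n::finite. L). int p ^ K dvd x $ i} * p ^ K = p ^ (L * CARD('n))"
proof -
  have eq: "{x \<in> vec_box p (\<lambda>_::'n. L). int p ^ K dvd x $ i} =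
     {x :: int ^ 'n. \<forall>j. x $ j \<in> (if j = i then {a \<in> {0..<int p ^ L}. int p ^ K dvd a} else {0..<int p ^ L})}" (is "_ = {x. \<forall>j. x $ j \<in> ?A j}")
  proof (rule Set.set_eqI)
    fix x :: "int ^ 'n"
    show "x \<in> {x \<in> vec_box p (\<lambda>_::'n. L). int p ^ K dvd x $ i} \<longleftrightarrow> x \<in> {x :: int ^ 'n. \<forall>j. x $ j \<in> ?A j}"
      by (auto simp: vec_box_def split: if_splits)
  qed
  have LK: "int p ^ L = int p ^ K * int p ^ (L - K)" using K by (simp flip: power_add)
  have "{a \<in> {0..<int p ^ L}. int p ^ K dvd a} = (\<lambda>a. int p ^ K * a) ` {0..<int p ^ (L - K)}"
  proof (rule Set.set_eqI, rule iffI)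
    fix a assume "a \<in> {a \<in> {0..<int p ^ L}. int p ^ K dvd a}"
    then obtain c where c: "a = int p ^ K * c" "0 \<le> int p ^ K * c" "int p ^ K * c < int p ^ K * int p ^ (L - K)"
      using LK by auto
    have "0 \<le> c"
    proof (rule ccontr)
      assume "\<not> 0 \<le> c"
      hence "int p ^ K * c < 0" using p by (intro mult_pos_neg) auto
      thus False using c(2) by linarith
    qed
    hence "c \<in> {0..<int p ^ (L - K)}" using c(3) p by simp
    thus "a \<in> (\<lambda>a. int p ^ K * a) ` {0..<int p ^ (L - K)}" using c(1) by blast
  qed (use LK p in auto)
  moreover have "inj_on (\<lambda>a. int p ^ K * a) {0..<int p ^ (L - K)}" using p by (auto simp: inj_on_def)
  ultimately have c1: "card {a \<in> {0..<int p ^ L}. int p ^ K dvd a} = p ^ (L - K)" by (simp only: card_image card_int_interval)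
  have "card {x :: int ^ 'n. \<forall>j. x $ j \<in> ?A j} = (\<Prod>j\<in>UNIV. card (?A j))"
    by (rule card_vec_set, rule finite_subset[of _ "{0..<int p ^ L}"]) auto
  also have "\<dots> = (\<Prod>j\<in>(UNIV::'n set). if j = i then p ^ (L - K) else p ^ L)"
  proof (intro prod.cong refl)
    fix j
    show "card (?A j) = (if j = i then p ^ (L - K) else p ^ L)"
      by (cases "j = i") (simp_all only: if_True if_False c1 card_int_interval simp_thms)
  qed
  also have "\<dots> = p ^ (L - K) * (\<Prod>j\<in>UNIV - {i}. if j = i then p ^ (L - K) else p ^ L)"
    by (subst prod.remove[of _ i]) auto
  also have "(\<Prod>j\<in>UNIV - {i}. if j = i then p ^ (L - K) else p ^ L) = (\<Prod>j\<in>(UNIV::'n set) - {i}. p ^ L)"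
    by (intro prod.cong refl) auto
  also have "\<dots> = (p ^ L) ^ (CARD('n) - 1)" by (simp add: card_Diff_singleton)
  finally have "card {x :: int ^ 'n. \<forall>j. x $ j \<in> ?A j} * p ^ K = (p ^ (L - K) * p ^ K) * (p ^ L) ^ (CARD('n) - 1)" by simp
  also have "p ^ (L - K) * p ^ K = p ^ L" using K by (simp flip: power_add)
  also have "p ^ L * (p ^ L) ^ (CARD('n) - 1) = (p ^ L) ^ CARD('n)"
    by (simp flip: power_Suc)
  finally show ?thesis unfolding eq by (simp add: power_mult)
qed

text \<open>Points whose coordinates all have valuation below \<open>K\<close> are grouped by these
  valuations. Each of the others has a coordinate divisible by \<open>p^K\<close>, so they fill at
  most \<open>n\<close> sets of density \<open>p^(-K)\<close>, where the trivial bound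
  suffices.\<close>

lemma sum_by_valuation:
  fixes \<phi> :: "int ^ 'n \<Rightarrow> complex"
  assumes p: "prime p" and K: "K \<le> L" and \<phi>: "\<And>x. cmod (\<phi> x) \<le> 1"
  shows "cmod (\<Sum>x\<in>vec_box p (\<lambda>_. L). \<phi> x) \<le>
    (\<Sum>k\<in>{k :: nat ^ 'n. \<forall>i. k $ i \<in> {..<K}}. cmod (\<Sum>u\<in>vec_box p (\<lambda>i. L - k $ i) \<inter> unit_vecs p. \<phi> (\<chi> i. int p ^ (k $ i) * u $ i)))
     + real CARD('n) * (real p ^ (L * CARD('n)) / real p ^ K)"
proof -
  have p1: "p > 1" using p prime_gt_1_nat by blast
  have pp: "prime (int p)" using p by simp
  let ?B = "vec_box p (\<lambda>_::'n. L)"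
  let ?K = "{k :: nat ^ 'n. \<forall>i. k $ i \<in> {..<K}}"
  define G where "G = {x \<in> ?B. \<forall>i. \<not> int p ^ K dvd x $ i}"
  define val :: "int ^ 'n \<Rightarrow> nat ^ 'n" where "val = (\<lambda>x. \<chi> i. multiplicity (int p) (x $ i))"
  have finB: "finite ?B" by (rule finite_vec_box')
  have finG: "finite G" using finB by (simp add: G_def)
  have finK: "finite ?K" by (rule finite_vec_box) simp
  have nz: "x $ i \<noteq> 0" if x: "x \<in> G" for x i
  proof
    assume "x $ i = 0"
    hence "int p ^ K dvd x $ i" by simp
    thus False using x unfolding G_def by blast
  qed
  have val_lt: "val x $ i < K" if x: "x \<in> G" for x i
  proof (rule ccontr)
    assume "\<not> val x $ i < K"
    hence "K \<le> multiplicity (int p) (x $ i)" by (simp add: val_def)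
    hence "int p ^ K dvd x $ i" by (rule multiplicity_dvd')
    thus False using x unfolding G_def by blast
  qed
  hence valK: "val ` G \<subseteq> ?K" by auto
  have inner: "(\<Sum>x\<in>{x \<in> G. val x = k}. \<phi> x) = (\<Sum>u\<in>vec_box p (\<lambda>i. L - k $ i) \<inter> unit_vecs p. \<phi> (\<chi> i. int p ^ (k $ i) * u $ i))"
    if k: "k \<in> ?K" for k
  proof (rule sum.reindex_bij_witness[where i = "\<lambda>u. \<chi> i. int p ^ (k $ i) * u $ i" and j = "\<lambda>x. \<chi> i. x $ i div int p ^ (k $ i)"])
    have kL: "int p ^ L = int p ^ (k $ i) * int p ^ (L - k $ i)" for i
    proof -
      have "k $ i < K" using k by simp
      hence "L = k $ i + (L - k $ i)" using K by simp
      thus ?thesis by (metis power_add)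
    qed
    {
      fix x assume x: "x \<in> {x \<in> G. val x = k}"
      have mk: "multiplicity (int p) (x $ i) = k $ i" for i using x by (auto simp: val_def)
      have dv: "int p ^ (k $ i) * (x $ i div int p ^ (k $ i)) = x $ i" for i
        using multiplicity_dvd[of "int p" "x $ i"] by (simp add: mk)
      thus 1: "(\<chi> i. int p ^ (k $ i) * (\<chi> i. x $ i div int p ^ (k $ i)) $ i) = x" by (simp add: vec_eq_iff)
      thus "\<phi> (\<chi> i. int p ^ (k $ i) * (\<chi> i. x $ i div int p ^ (k $ i)) $ i) = \<phi> x" by simp
      have "\<not> int p dvd x $ i div int p ^ (k $ i)" for i
      proof
        assume "int p dvd x $ i div int p ^ (k $ i)"
        hence "int p ^ (k $ i) * int p dvd int p ^ (k $ i) * (x $ i div int p ^ (k $ i))" by (rule mult_dvd_mono[OF dvd_refl])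
        hence "int p ^ Suc (k $ i) dvd x $ i" unfolding dv by (simp add: mult.commute)
        hence "Suc (k $ i) \<le> multiplicity (int p) (x $ i)"
          using nz[of x i] x p1 by (subst (asm) power_dvd_iff_le_multiplicity) auto
        thus False by (simp add: mk)
      qed
      moreover have "0 \<le> x $ i div int p ^ (k $ i)" "x $ i div int p ^ (k $ i) < int p ^ (L - k $ i)" for i
      proof -
        have "0 \<le> x $ i" "x $ i < int p ^ L" using x by (auto simp: G_def vec_box_def)
        thus "0 \<le> x $ i div int p ^ (k $ i)" using p1 by (simp add: pos_imp_zdiv_nonneg_iff)
        have "int p ^ (k $ i) * (x $ i div int p ^ (k $ i)) < int p ^ (k $ i) * int p ^ (L - k $ i)"
          unfolding dv kL[symmetric] by fact
        thus "x $ i div int p ^ (k $ i) < int p ^ (L - k $ i)" using p1 by simp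
      qed
      ultimately show "(\<chi> i. x $ i div int p ^ (k $ i)) \<in> vec_box p (\<lambda>i. L - k $ i) \<inter> unit_vecs p"
        by (simp add: vec_box_def unit_vecs_def)
    }
    fix u :: "int ^ 'n" assume u: "u \<in> vec_box p (\<lambda>i. L - k $ i) \<inter> unit_vecs p"
    show "(\<chi> i. (\<chi> i. int p ^ (k $ i) * u $ i) $ i div int p ^ (k $ i)) = u" using p1 by (simp add: vec_eq_iff)
    have m0: "multiplicity (int p) (u $ i) = 0" for i using u by (auto simp: unit_vecs_def not_dvd_imp_multiplicity_0)
    have u0: "u $ i \<noteq> 0" for i
    proof
      assume "u $ i = 0"
      hence "int p dvd u $ i" by simp
      thus False using u unfolding unit_vecs_def by blast
    qed
    have mu: "multiplicity (int p) (int p ^ (k $ i) * u $ i) = k $ i" for i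
      using pp u0 p1 m0[of i] by (subst prime_elem_multiplicity_mult_distrib) (auto simp: multiplicity_same_power)
    have "\<not> int p ^ K dvd int p ^ (k $ i) * u $ i" for i
    proof -
      have "k $ i < K" using k by simp
      thus ?thesis using u0 p1 by (subst power_dvd_iff_le_multiplicity) (simp_all add: mu not_le)
    qed
    moreover have "0 \<le> int p ^ (k $ i) * u $ i" "int p ^ (k $ i) * u $ i < int p ^ L" for i
      using u p1 unfolding kL[of i] by (auto simp: vec_box_def)
    ultimately show "(\<chi> i. int p ^ (k $ i) * u $ i) \<in> {x \<in> G. val x = k}"
      by (simp add: G_def vec_box_def val_def mu vec_eq_iff)
  qed
  have "(\<Sum>x\<in>G. \<phi> x) = (\<Sum>k\<in>?K. \<Sum>x\<in>{x \<in> G. val x = k}. \<phi> x)"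
    by (rule sum.group[OF finG finK valK, symmetric])
  also have "\<dots> = (\<Sum>k\<in>?K. \<Sum>u\<in>vec_box p (\<lambda>i. L - k $ i) \<inter> unit_vecs p. \<phi> (\<chi> i. int p ^ (k $ i) * u $ i))"
    by (intro sum.cong refl inner)
  also have "cmod \<dots> \<le> (\<Sum>k\<in>?K. cmod (\<Sum>u\<in>vec_box p (\<lambda>i. L - k $ i) \<inter> unit_vecs p. \<phi> (\<chi> i. int p ^ (k $ i) * u $ i)))"
    by (rule norm_sum)
  finally have bG: "cmod (\<Sum>x\<in>G. \<phi> x) \<le> (\<Sum>k\<in>?K. cmod (\<Sum>u\<in>vec_box p (\<lambda>i. L - k $ i) \<inter> unit_vecs p. \<phi> (\<chi> i. int p ^ (k $ i) * u $ i)))" .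
  have "?B - G \<subseteq> (\<Union>i\<in>UNIV. {x \<in> ?B. int p ^ K dvd x $ i})" by (auto simp: G_def)
  hence "card (?B - G) \<le> card (\<Union>i\<in>UNIV. {x \<in> ?B. int p ^ K dvd x $ i})"
    using finB by (intro card_mono) auto
  also have "\<dots> \<le> (\<Sum>i\<in>UNIV. card {x \<in> ?B. int p ^ K dvd x $ i})" by (rule card_UN_le) simp
  finally have "real (card (?B - G)) \<le> (\<Sum>i\<in>UNIV. real (card {x \<in> ?B. int p ^ K dvd x $ i}))"
    by (simp only: of_nat_sum[symmetric] of_nat_le_iff)
  also have "\<dots> = (\<Sum>i\<in>(UNIV::'n set). real p ^ (L * CARD('n)) / real p ^ K)"
  proof (rule sum.cong[OF refl])
    fix i :: 'n
    have "real (card {x \<in> ?B. int p ^ K dvd x $ i} * p ^ K) = real (p ^ (L * CARD('n)))"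
      using card_box_dvd_le[of p K L i] p1 K by simp
    thus "real (card {x \<in> ?B. int p ^ K dvd x $ i}) = real p ^ (L * CARD('n)) / real p ^ K"
      using p1 by (simp add: field_simps)
  qed
  finally have cB: "real (card (?B - G)) \<le> real CARD('n) * (real p ^ (L * CARD('n)) / real p ^ K)" by simp
  have "(\<Sum>x\<in>?B. \<phi> x) = (\<Sum>x\<in>?B - G. \<phi> x) + (\<Sum>x\<in>G. \<phi> x)"
    by (rule sum.subset_diff) (auto simp: G_def finB)
  hence "cmod (\<Sum>x\<in>?B. \<phi> x) \<le> cmod (\<Sum>x\<in>?B - G. \<phi> x) + cmod (\<Sum>x\<in>G. \<phi> x)"
    by (simp add: norm_triangle_ineq)
  moreover have "cmod (\<Sum>x\<in>?B - G. \<phi> x) \<le> of_nat (card (?B - G)) * 1"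
    by (rule sum_norm_bound) (rule \<phi>)
  ultimately show ?thesis using bG cB by simp
qed

section \<open>Estimating the exponential sum\<close>

text \<open>For \<open>m > l\<close> the truncated difference is \<open>0\<close> and both sides
  equal \<open>1\<close>, so weights above \<open>l\<close> need no separate treatment.\<close>

lemma padic_char_scale:
  assumes "p > 0"
  shows "padic_char p l (int p ^ m * c) = padic_char p (l - m) c"
proof (cases "m \<le> l")
  case False
  have "int p ^ l dvd int p ^ m * c" using False by (intro dvd_mult2 le_imp_power_dvd) simp
  hence "padic_char p l (int p ^ m * c) = 1" using padic_char_eq_1_iff[OF assms] by blast
  moreover have "padic_char p (l - m) c = 1" using False padic_char_eq_1_iff[OF assms, of 0 c] by simp
  ultimately show ?thesis by simp
qed (rule padic_char_shift'[OF assms])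

lemma poly_value_scale:
  "poly_value A g (\<chi> i. c ^ (k $ i) * x $ i) = poly_value A (\<lambda>\<alpha>. c ^ pairing k \<alpha> * g \<alpha>) x"
  by (simp add: poly_value_def power_mult_distrib prod.distrib prime_power_prod mult_ac)

lemma poly_value_cmult: "poly_value A (\<lambda>\<alpha>. c * g \<alpha>) x = c * poly_value A g x"
  by (simp add: poly_value_def sum_distrib_left mult.assoc)

lemma poly_value_cong: "(\<And>\<alpha>. \<alpha> \<in> A \<Longrightarrow> g \<alpha> = h \<alpha>) \<Longrightarrow> poly_value A g x = poly_value A h x"
  by (simp add: poly_value_def)

lemma pairing_add: "pairing (b + k) \<alpha> = pairing b \<alpha> + pairing k \<alpha>"
  by (simp add: pairing_def distrib_right sum.distrib)

lemma total_degree_add: "total_degree (b + k) = total_degree b + total_degree k"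
  by (simp add: total_degree_def sum.distrib)

context series
begin

definition "scaled_sum p b A l =
  (\<Sum>x\<in>vec_box p (\<lambda>_::'n. l). padic_char p l (poly_value A (\<lambda>\<alpha>. int p ^ pairing b \<alpha> * f \<alpha>) x))"

text \<open>Since \<open>n d \<ge> 1\<close>, cutting off valuations at \<open>n l\<close> leaves an
  error no larger than the main rate.\<close>

lemma powr_weight_d: "p > 1 \<Longrightarrow> real p powr (- real CARD('n) * real l) \<le> real p powr (- real l / d)"
proof -
  assume p: "p > 1"
  have "1 / d \<le> real CARD('n)" using distance_ge distance_pos by (simp add: field_simps)
  hence "real l * (1 / d) \<le> real l * real CARD('n)" by (intro mult_left_mono) auto
  thus ?thesis using p by (intro powr_mono) (auto simp: mult.commute)
qed

lemma scaled_sum_estimate: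
  fixes \<beta> :: "nat ^ 'n \<Rightarrow> real"
  assumes p: "prime p" and A: "\<And>\<alpha>. \<alpha> \<in> A \<Longrightarrow> f \<alpha> \<noteq> 0"
    and \<beta>: "\<And>k N. (\<And>i. b $ i \<le> k $ i) \<Longrightarrow> (\<And>i. N i \<ge> (l - weight f k) + s) \<Longrightarrow>
      cmod (\<Sum>u\<in>vec_box p N \<inter> unit_vecs p. padic_char p (l - weight f k) (poly_value A (scaled_coeff p f k) u))
        \<le> \<beta> k * real (card (vec_box p N))"
  shows "\<exists>X. finite X \<and> (\<forall>k\<in>X. \<forall>i. b $ i \<le> k $ i) \<and>
    1 / real p ^ (l * CARD('n)) * cmod (scaled_sum p b A l) \<le>
      real p ^ total_degree b * (\<Sum>k\<in>X. real p powr (- real (total_degree k)) * \<beta> k)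
        + real CARD('n) * real p powr (- real l / d)"
proof -
  have p1: "p > 1" using p prime_gt_1_nat by blast
  define K where "K = CARD('n) * l"
  \<comment> \<open>After up to \<open>K\<close> digits are removed from a coordinate,
    \<open>l + s\<close> of them remain for the sum over units.\<close>
  define L where "L = K + (l + s)"
  have Ll: "L = l + (K + s)" by (simp add: L_def)
  define \<phi> where "\<phi> = (\<lambda>x. padic_char p l (poly_value A (\<lambda>\<alpha>. int p ^ pairing b \<alpha> * f \<alpha>) x))"
  define KK where "KK = {k :: nat ^ 'n. \<forall>i. k $ i \<in> {..<K}}"
  have finKK: "finite KK" unfolding KK_def by (rule finite_vec_box) simp
  have \<phi>_cong: "\<phi> x = \<phi> y" if "\<And>i. int p ^ l dvd x $ i - y $ i" for x y
    unfolding \<phi>_def by (rule padic_char_cong) (use p1 in simp, rule dvd_poly_value_diff, rule that)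
  have avg: "(\<Sum>x\<in>vec_box p (\<lambda>_::'n. L). \<phi> x) = of_nat p ^ ((K + s) * CARD('n)) * scaled_sum p b A l"
    unfolding Ll scaled_sum_def \<phi>_def[symmetric] by (rule sum_vec_box_per) (use p1 \<phi>_cong in auto)
  have inner: "cmod (\<Sum>u\<in>vec_box p (\<lambda>i. L - k $ i) \<inter> unit_vecs p. \<phi> (\<chi> i. int p ^ (k $ i) * u $ i))
      \<le> \<beta> (b + k) * (real p ^ (L * CARD('n)) * real p powr (- real (total_degree k)))" if k: "k \<in> KK" for k
  proof -
    have eq: "\<phi> (\<chi> i. int p ^ (k $ i) * u $ i) =
        padic_char p (l - weight f (b + k)) (poly_value A (scaled_coeff p f (b + k)) u)" for u
    proof -
      have "poly_value A (\<lambda>\<alpha>. int p ^ pairing b \<alpha> * f \<alpha>) (\<chi> i. int p ^ (k $ i) * u $ i)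
        = poly_value A (\<lambda>\<alpha>. int p ^ weight f (b + k) * scaled_coeff p f (b + k) \<alpha>) u"
        unfolding poly_value_scale
      proof (rule poly_value_cong)
        fix \<alpha> assume "\<alpha> \<in> A"
        hence "weight f (b + k) \<le> pairing (b + k) \<alpha>" by (intro weight_le_pairing A)
        hence "int p ^ pairing (b + k) \<alpha> = int p ^ weight f (b + k) * int p ^ (pairing (b + k) \<alpha> - weight f (b + k))"
          by (simp flip: power_add)
        thus "int p ^ pairing k \<alpha> * (int p ^ pairing b \<alpha> * f \<alpha>) = int p ^ weight f (b + k) * scaled_coeff p f (b + k) \<alpha>"
          by (simp add: scaled_coeff_def pairing_add power_add mult_ac)
      qed
      thus ?thesis using p1 by (simp add: \<phi>_def poly_value_cmult padic_char_scale)
    qed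
    have kK: "k $ i < K" for i using k by (simp add: KK_def)
    have "cmod (\<Sum>u\<in>vec_box p (\<lambda>i. L - k $ i) \<inter> unit_vecs p. \<phi> (\<chi> i. int p ^ (k $ i) * u $ i))
       \<le> \<beta> (b + k) * real (card (vec_box p (\<lambda>i. L - k $ i)))"
      unfolding eq
    proof (rule \<beta>)
      fix i show "l - weight f (b + k) + s \<le> L - k $ i" using kK[of i] by (simp add: L_def)
    qed simp
    also have "real (card (vec_box p (\<lambda>i. L - k $ i))) = real p ^ (L * CARD('n)) * real p powr (- real (total_degree k))"
    proof -
      have "(\<Sum>i\<in>UNIV. L - k $ i) + total_degree k = (\<Sum>i\<in>(UNIV::'n set). L)"
        unfolding total_degree_def sum.distrib[symmetric]
      proof (intro sum.cong refl)
        fix i show "L - k $ i + k $ i = L" using kK[of i] by (simp add: L_def)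
      qed
      hence "real p ^ (L * CARD('n)) = real p ^ ((\<Sum>i\<in>UNIV. L - k $ i) + total_degree k)"
        by (simp add: mult.commute)
      hence "real p ^ (L * CARD('n)) = real p ^ (\<Sum>i\<in>UNIV. L - k $ i) * real p ^ total_degree k"
        by (simp only: power_add)
      thus ?thesis using p1 by (simp add: card_vec_box powr_minus powr_realpow)
    qed
    finally show ?thesis .
  qed
  have "cmod (\<Sum>x\<in>vec_box p (\<lambda>_::'n. L). \<phi> x) \<le>
    (\<Sum>k\<in>KK. cmod (\<Sum>u\<in>vec_box p (\<lambda>i. L - k $ i) \<inter> unit_vecs p. \<phi> (\<chi> i. int p ^ (k $ i) * u $ i)))
     + real CARD('n) * (real p ^ (L * CARD('n)) / real p ^ K)"
    unfolding KK_def by (rule sum_by_valuation[OF p]) (auto simp: L_def \<phi>_def)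
  also have "\<dots> \<le> (\<Sum>k\<in>KK. \<beta> (b + k) * (real p ^ (L * CARD('n)) * real p powr (- real (total_degree k))))
     + real CARD('n) * (real p ^ (L * CARD('n)) / real p ^ K)"
    by (intro add_right_mono sum_mono inner)
  also have "\<dots> = real p ^ (L * CARD('n)) * ((\<Sum>k\<in>KK. real p powr (- real (total_degree k)) * \<beta> (b + k)) + real CARD('n) / real p ^ K)"
    by (simp add: distrib_left sum_distrib_left mult_ac)
  finally have fin: "cmod (\<Sum>x\<in>vec_box p (\<lambda>_::'n. L). \<phi> x) \<le>
     real p ^ (L * CARD('n)) * ((\<Sum>k\<in>KK. real p powr (- real (total_degree k)) * \<beta> (b + k)) + real CARD('n) / real p ^ K)" .
  have "real p ^ (L * CARD('n)) = real p ^ ((K + s) * CARD('n)) * real p ^ (l * CARD('n))"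
    by (simp add: Ll distrib_right power_add)
  with fin have "real p ^ ((K + s) * CARD('n)) * cmod (scaled_sum p b A l) \<le>
     real p ^ ((K + s) * CARD('n)) * (real p ^ (l * CARD('n)) * ((\<Sum>k\<in>KK. real p powr (- real (total_degree k)) * \<beta> (b + k)) + real CARD('n) / real p ^ K))"
    unfolding avg by (simp only: norm_mult norm_power norm_of_nat mult.assoc)
  hence "cmod (scaled_sum p b A l) \<le> real p ^ (l * CARD('n)) * ((\<Sum>k\<in>KK. real p powr (- real (total_degree k)) * \<beta> (b + k)) + real CARD('n) / real p ^ K)"
    using p1 by (subst (asm) mult_le_cancel_left_pos) auto
  hence "1 / real p ^ (l * CARD('n)) * cmod (scaled_sum p b A l) \<le>
     (\<Sum>k\<in>KK. real p powr (- real (total_degree k)) * \<beta> (b + k)) + real CARD('n) / real p ^ K"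
    using p1 by (simp add: divide_le_eq mult.commute)
  also have "(\<Sum>k\<in>KK. real p powr (- real (total_degree k)) * \<beta> (b + k)) =
     real p ^ total_degree b * (\<Sum>k\<in>(\<lambda>k. b + k) ` KK. real p powr (- real (total_degree k)) * \<beta> k)"
  proof -
    have td: "real p powr (- real (total_degree k)) = real p ^ total_degree b * real p powr (- real (total_degree (b + k)))" for k
    proof -
      have "real p ^ total_degree b = real p powr real (total_degree b)" using p1 by (simp add: powr_realpow)
      thus ?thesis by (simp add: total_degree_add flip: powr_add)
    qed
    have "(\<Sum>k\<in>KK. real p powr (- real (total_degree k)) * \<beta> (b + k)) =
       (\<Sum>k\<in>KK. real p ^ total_degree b * (real p powr (- real (total_degree (b + k))) * \<beta> (b + k)))"
      by (rule sum.cong[OF refl]) (subst td, rule mult.assoc)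
    also have "\<dots> = real p ^ total_degree b * (\<Sum>k\<in>KK. real p powr (- real (total_degree (b + k))) * \<beta> (b + k))"
      by (rule sum_distrib_left[symmetric])
    also have "(\<Sum>k\<in>KK. real p powr (- real (total_degree (b + k))) * \<beta> (b + k)) =
       (\<Sum>k\<in>(\<lambda>k. b + k) ` KK. real p powr (- real (total_degree k)) * \<beta> k)"
      by (subst sum.reindex) (auto simp: inj_on_def)
    finally show ?thesis .
  qed
  also have "real CARD('n) / real p ^ K \<le> real CARD('n) * real p powr (- real l / d)"
  proof -
    have "1 / real p ^ K = real p powr (- real K)" using p1 by (simp add: powr_minus powr_realpow divide_inverse)
    also have "\<dots> \<le> real p powr (- real l / d)" using powr_weight_d[OF p1, of l] by (simp add: K_def)
    finally have "real CARD('n) * (1 / real p ^ K) \<le> real CARD('n) * real p powr (- real l / d)"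
      by (intro mult_left_mono) auto
    thus ?thesis by simp
  qed
  finally show ?thesis
    by (intro exI[of _ "(\<lambda>k. b + k) ` KK"]) (use finKK in auto)
qed

lemma unit_sum_weight_bound:
  fixes D :: "(real ^ 'n) set"
  assumes e: "e \<ge> 1" and D: "convex D" and \<theta>: "\<theta> \<ge> 0" "e = 1 \<or> \<theta> \<le> 1 / real e"
    and o: "\<And>F. compact_face f F \<Longrightarrow> F \<subseteq> D \<Longrightarrow> max_zero_order TYPE('p::prime_card) f F \<le> e"
  shows "\<exists>T C s. C \<ge> 1 \<and> (\<forall>k A l N. (\<forall>i. k $ i \<ge> T) \<longrightarrow> finite A \<longrightarrow> min_supp f \<subseteq> A \<longrightarrow> (\<forall>\<alpha>\<in>A. f \<alpha> \<noteq> 0) \<longrightarrow>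
    (\<forall>\<alpha>\<in>min_supp f. real_vec \<alpha> \<notin> D \<longrightarrow> pairing k \<alpha> - weight f k > T) \<longrightarrow>
    (\<forall>i. N i \<ge> (l - weight f k) + s) \<longrightarrow>
      cmod (\<Sum>u\<in>vec_box CARD('p) N \<inter> unit_vecs CARD('p). padic_char CARD('p) (l - weight f k) (poly_value A (scaled_coeff CARD('p) f k) u))
        \<le> C * real CARD('p) powr (- \<theta> * real (l - weight f k)) * real (card (vec_box CARD('p) N)))"
proof -
  have "\<exists>T. \<forall>k A u. (\<forall>i. k $ i \<ge> T) \<longrightarrow> finite A \<longrightarrow> min_supp f \<subseteq> A \<longrightarrow> (\<forall>\<alpha>\<in>A. f \<alpha> \<noteq> 0) \<longrightarrow>
    (\<forall>\<alpha>\<in>min_supp f. real_vec \<alpha> \<notin> D \<longrightarrow> pairing k \<alpha> - weight f k > T) \<longrightarrow>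
    (\<forall>i. \<not> int CARD('p) dvd u $ i) \<longrightarrow>
    (\<exists>v. \<exists>i\<in>{1..e}. \<not> int CARD('p) ^ T dvd coeff (shift_poly A (scaled_coeff CARD('p) f k) u v) i)"
    by (rule derivative_lower_bound[where 'p = 'p, OF e D]) (rule o)
  then obtain T where T: "\<forall>k A u. (\<forall>i. k $ i \<ge> T) \<longrightarrow> finite A \<longrightarrow> min_supp f \<subseteq> A \<longrightarrow> (\<forall>\<alpha>\<in>A. f \<alpha> \<noteq> 0) \<longrightarrow>
    (\<forall>\<alpha>\<in>min_supp f. real_vec \<alpha> \<notin> D \<longrightarrow> pairing k \<alpha> - weight f k > T) \<longrightarrow>
    (\<forall>i. \<not> int CARD('p) dvd u $ i) \<longrightarrow>
    (\<exists>v. \<exists>i\<in>{1..e}. \<not> int CARD('p) ^ T dvd coeff (shift_poly A (scaled_coeff CARD('p) f k) u v) i)" ..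
  obtain C s where C: "C \<ge> 1" and Cs: "\<forall>A (g :: nat ^ 'n \<Rightarrow> int) l N.
    (\<forall>u\<in>unit_vecs CARD('p). \<exists>v. \<exists>i\<in>{1..e}. \<not> int CARD('p) ^ T dvd coeff (shift_poly A g u v) i) \<longrightarrow>
    (\<forall>i. N i \<ge> l + s) \<longrightarrow>
    cmod (\<Sum>u\<in>vec_box CARD('p) N \<inter> unit_vecs CARD('p). padic_char CARD('p) l (poly_value A g u))
      \<le> C * real CARD('p) powr (- \<theta> * real l) * real (card (vec_box CARD('p) N))"
    using unit_sum_bound[OF prime_card[where 'a = 'p] e \<theta>, of T, where 'n = 'n] by (elim exE conjE)
  show ?thesis
  proof (rule exI[of _ T], rule exI[of _ C], rule exI[of _ s], intro conjI C allI impI)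
    fix k A l and N :: "'n \<Rightarrow> nat"
    assume k: "\<forall>i. k $ i \<ge> T" "finite A" "min_supp f \<subseteq> A" "\<forall>\<alpha>\<in>A. f \<alpha> \<noteq> 0"
      "\<forall>\<alpha>\<in>min_supp f. real_vec \<alpha> \<notin> D \<longrightarrow> pairing k \<alpha> - weight f k > T"
      and N: "\<forall>i. N i \<ge> (l - weight f k) + s"
    have "\<forall>u\<in>unit_vecs CARD('p). \<exists>v. \<exists>i\<in>{1..e}. \<not> int CARD('p) ^ T dvd coeff (shift_poly A (scaled_coeff CARD('p) f k) u v) i"
      using T k unfolding unit_vecs_def by blast
    thus "cmod (\<Sum>u\<in>vec_box CARD('p) N \<inter> unit_vecs CARD('p). padic_char CARD('p) (l - weight f k) (poly_value A (scaled_coeff CARD('p) f k) u))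
        \<le> C * real CARD('p) powr (- \<theta> * real (l - weight f k)) * real (card (vec_box CARD('p) N))"
      using Cs N by blast
  qed
qed

section \<open>From bounds for each \<open>k\<close> to a bound for the whole sum\<close>

definition unit_bound :: "nat \<Rightarrow> nat \<Rightarrow> nat \<Rightarrow> (nat \<Rightarrow> nat ^ 'n \<Rightarrow> real) \<Rightarrow> bool" where
  "unit_bound p T s \<beta> \<longleftrightarrow> (\<forall>k A l N. (\<forall>i. k $ i \<ge> T) \<longrightarrow> finite A \<longrightarrow> min_supp f \<subseteq> A \<longrightarrow> (\<forall>\<alpha>\<in>A. f \<alpha> \<noteq> 0) \<longrightarrow>
    (\<forall>i. N i \<ge> (l - weight f k) + s) \<longrightarrow>
    cmod (\<Sum>u\<in>vec_box p N \<inter> unit_vecs p. padic_char p (l - weight f k) (poly_value A (scaled_coeff p f k) u))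
      \<le> \<beta> l k * real (card (vec_box p N)))"

text \<open>\<open>R\<close> has to dominate \<open>p^(-l/d)\<close> in order to absorb the points
  of high valuation. The shift of \<open>k\<close> by \<open>b\<close> costs a factor
  \<open>p^|b|\<close>, through which the final constant depends on \<open>a\<close>.\<close>

lemma scaled_sum_bound:
  assumes p: "prime p" and \<beta>: "unit_bound p T s \<beta>"
    and K: "K > 0" "\<And>l X. l > 0 \<Longrightarrow> finite X \<Longrightarrow> (\<And>k i. k \<in> X \<Longrightarrow> T \<le> k $ i) \<Longrightarrow>
      (\<Sum>k\<in>X. real p powr (- real (total_degree k)) * \<beta> l k) \<le> K * R l"
    and R: "\<And>l. l > 0 \<Longrightarrow> real p powr (- real l / d) \<le> R l"
    and b: "\<And>i. b $ i \<ge> T"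
  shows "\<exists>C>0. \<forall>l>0. \<forall>A. finite A \<longrightarrow> min_supp f \<subseteq> A \<longrightarrow> (\<forall>\<alpha>\<in>A. f \<alpha> \<noteq> 0) \<longrightarrow>
    1 / real p ^ (l * CARD('n)) * cmod (scaled_sum p b A l) \<le> C * R l"
proof -
  have p1: "p > 1" using p prime_gt_1_nat by blast
  define C where "C = real p ^ total_degree b * K + real CARD('n)"
  have C: "C > 0" unfolding C_def using p1 K(1) by (intro add_nonneg_pos) auto
  have "1 / real p ^ (l * CARD('n)) * cmod (scaled_sum p b A l) \<le> C * R l"
    if l: "l > 0" and A: "finite A" "min_supp f \<subseteq> A" "\<forall>\<alpha>\<in>A. f \<alpha> \<noteq> 0" for l A
  proof -
    have "\<exists>X. finite X \<and> (\<forall>k\<in>X. \<forall>i. b $ i \<le> k $ i) \<and>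
      1 / real p ^ (l * CARD('n)) * cmod (scaled_sum p b A l) \<le>
        real p ^ total_degree b * (\<Sum>k\<in>X. real p powr (- real (total_degree k)) * \<beta> l k)
          + real CARD('n) * real p powr (- real l / d)"
    proof (rule scaled_sum_estimate[OF p])
      fix k and N :: "'n \<Rightarrow> nat"
      assume k: "\<And>i. b $ i \<le> k $ i" and N: "\<And>i. l - weight f k + s \<le> N i"
      have "\<forall>i. T \<le> k $ i" using k b order_trans by blast
      thus "cmod (\<Sum>u\<in>vec_box p N \<inter> unit_vecs p. padic_char p (l - weight f k) (poly_value A (scaled_coeff p f k) u))
        \<le> \<beta> l k * real (card (vec_box p N))"
        using \<beta> A N unfolding unit_bound_def by blast
    qed (use A in auto)
    then obtain X where X: "finite X" "\<forall>k\<in>X. \<forall>i. b $ i \<le> k $ i"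
      "1 / real p ^ (l * CARD('n)) * cmod (scaled_sum p b A l) \<le>
        real p ^ total_degree b * (\<Sum>k\<in>X. real p powr (- real (total_degree k)) * \<beta> l k)
          + real CARD('n) * real p powr (- real l / d)" by blast
    have "(\<Sum>k\<in>X. real p powr (- real (total_degree k)) * \<beta> l k) \<le> K * R l"
    proof (rule K(2)[OF l X(1)])
      fix k i assume "k \<in> X"
      thus "T \<le> k $ i" using X(2) b[of i] order_trans by blast
    qed
    hence "real p ^ total_degree b * (\<Sum>k\<in>X. real p powr (- real (total_degree k)) * \<beta> l k) \<le> real p ^ total_degree b * (K * R l)"
      by (intro mult_left_mono) auto
    moreover have "real CARD('n) * real p powr (- real l / d) \<le> real CARD('n) * R l"
      by (intro mult_left_mono R l) auto
    moreover have "C * R l = real p ^ total_degree b * (K * R l) + real CARD('n) * R l"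
      by (simp add: C_def distrib_right mult.assoc)
    ultimately show ?thesis using X(3) by linarith
  qed
  thus ?thesis using C by blast
qed

lemma powr_gap:
  assumes "p > 1"
  shows "real p powr (- real (total_degree k)) =
    real p powr (- real l / d) * real p powr (- gap k + (real l - real (weight f k)) / d)"
  unfolding powr_add[symmetric] gap_def by (simp add: diff_divide_distrib)

lemma rate_cancel: "y = x + m \<Longrightarrow> x / d + - (1 / d) * y = - (m / d)"
  by (simp add: add_divide_distrib)

text \<open>The truncated difference equals \<open>l - m(k)\<close> plus the positive part of
  \<open>m(k) - l\<close>. The first term combines with \<open>p^(-|k|)\<close> to
  \<open>p^(-l/d) p^(-gap k)\<close>; the second becomes \<open>\<psi>\<close> and supplies
  convergence for large \<open>k\<close>.\<close>

lemma rate_d_sum: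
  assumes p: "p > 1" and W: "subspace W"
    and \<Phi>: "\<And>w. w \<in> W \<Longrightarrow> \<exists>c>0. \<exists>T. \<forall>k\<in>Q. c * \<bar>real_vec k \<bullet> w\<bar> \<le> gap k + T"
  shows "\<exists>K>0. \<forall>l X. l > 0 \<longrightarrow> finite X \<longrightarrow> X \<subseteq> Q \<longrightarrow>
     (\<Sum>k\<in>X. real p powr (- real (total_degree k)) * real p powr (- (1 / d) * real (l - weight f k)))
       \<le> K * (real l ^ (CARD('n) - dim W) * real p powr (- real l / d))"
proof -
  have d: "d > 0" by (rule distance_pos)
  define \<psi> where "\<psi> = (\<lambda>l k. max (real (weight f k) - real l) 0 / d)"
  have "\<exists>K>0. \<forall>l X. l > 0 \<longrightarrow> finite X \<longrightarrow> X \<subseteq> Q \<longrightarrow>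
     (\<Sum>k\<in>X. real p powr (- (gap k + \<psi> l k))) \<le> K * real l ^ (CARD('n) - dim W)"
  proof (rule weighted_lattice_sum[where \<epsilon> = "1 / d" and Q = "\<lambda>_. Q", OF _ W])
    fix w assume "w \<in> W"
    then obtain c T where cT: "c > 0" "\<forall>k\<in>Q. c * \<bar>real_vec k \<bullet> w\<bar> \<le> gap k + T" using \<Phi> by blast
    have "c * \<bar>real_vec k \<bullet> w + 0\<bar> \<le> gap k + \<psi> l k + T" if "k \<in> Q" for k l
    proof -
      have "\<psi> l k \<ge> 0" using d by (simp add: \<psi>_def)
      thus ?thesis using cT(2) that by fastforce
    qed
    thus "\<exists>c>0. \<exists>T. \<forall>l. \<exists>b. \<forall>k\<in>Q. c * \<bar>real_vec k \<bullet> w + b\<bar> \<le> gap k + \<psi> l k + T" using cT(1) by blast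
  next
    fix l k show "1 / d * (real (weight f k) - real l) \<le> \<psi> l k"
      using d by (simp add: \<psi>_def divide_right_mono)
  qed (use p d in \<open>auto simp: \<psi>_def\<close>)
  then obtain K where K: "K > 0" "\<forall>l X. l > 0 \<longrightarrow> finite X \<longrightarrow> X \<subseteq> Q \<longrightarrow>
     (\<Sum>k\<in>X. real p powr (- (gap k + \<psi> l k))) \<le> K * real l ^ (CARD('n) - dim W)" by blast
  have eq: "real p powr (- real (total_degree k)) * real p powr (- (1 / d) * real (l - weight f k)) =
      real p powr (- real l / d) * real p powr (- (gap k + \<psi> l k))" for l k
  proof -
    have "real (l - weight f k) = (real l - real (weight f k)) + max (real (weight f k) - real l) 0"
      by (simp add: max_def of_nat_diff)
    hence "(real l - real (weight f k)) / d + - (1 / d) * real (l - weight f k) = - \<psi> l k"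
      unfolding \<psi>_def by (rule rate_cancel)
    hence e: "- real l / d + (- gap k + (real l - real (weight f k)) / d) + - (1 / d) * real (l - weight f k)
        = - real l / d + - (gap k + \<psi> l k)" by linarith
    show ?thesis unfolding powr_gap[OF p, of k l] powr_add[symmetric] e ..
  qed
  have "(\<Sum>k\<in>X. real p powr (- real (total_degree k)) * real p powr (- (1 / d) * real (l - weight f k)))
       \<le> K * (real l ^ (CARD('n) - dim W) * real p powr (- real l / d))"
    if "l > 0" "finite X" "X \<subseteq> Q" for l X
  proof -
    have "(\<Sum>k\<in>X. real p powr (- real (total_degree k)) * real p powr (- (1 / d) * real (l - weight f k))) =
      real p powr (- real l / d) * (\<Sum>k\<in>X. real p powr (- (gap k + \<psi> l k)))"
      unfolding eq by (rule sum_distrib_left[symmetric])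
    also have "\<dots> \<le> real p powr (- real l / d) * (K * real l ^ (CARD('n) - dim W))"
      using K(2) that by (intro mult_left_mono) auto
    finally show ?thesis by (simp add: mult_ac)
  qed
  thus ?thesis using K(1) by blast
qed

section \<open>The estimates in the three cases\<close>

lemma gap_V:
  assumes "w \<in> V"
  shows "\<exists>c>0. \<forall>k. \<bar>real_vec k \<bullet> w\<bar> \<le> c * gap k"
proof -
  obtain c where c: "c > 0" "\<And>k. c * \<bar>real_vec k \<bullet> w\<bar> \<le> d * real (total_degree k) - real (weight f k)"
    using gap_bound[OF assms] by blast
  have "\<bar>real_vec k \<bullet> w\<bar> \<le> (d / c) * gap k" for k
    using c(1) c(2)[of k] unfolding d_gap[symmetric] by (simp add: field_simps)
  thus ?thesis using c(1) distance_pos by (intro exI[of _ "d / c"]) auto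
qed

lemma one_le_power_rate: "l > 0 \<Longrightarrow> p > 1 \<Longrightarrow> real p powr (- real l / d) \<le> real l ^ m * real p powr (- real l / d)"
proof -
  assume "l > 0" "p > 1"
  hence "1 * real p powr (- real l / d) \<le> real l ^ m * real p powr (- real l / d)"
    by (intro mult_right_mono one_le_power) auto
  thus ?thesis by simp
qed

text \<open>The strict inequality \<open>e > d\<close> leaves room:
  \<open>|k| - m(k)/e \<ge> (1 - d/e) |k|\<close>, so the sum over \<open>k\<close> converges
  without any power of \<open>l\<close>.\<close>

lemma estimate_c:
  assumes e: "real e > d"
    and o: "\<And>F. compact_face f F \<Longrightarrow> max_zero_order TYPE('p::prime_card) f F \<le> e"
  shows "\<exists>T. \<forall>b. (\<forall>i. b $ i \<ge> T) \<longrightarrow> (\<exists>C>0. \<forall>l>0. \<forall>A. finite A \<longrightarrow> min_supp f \<subseteq> A \<longrightarrow> (\<forall>\<alpha>\<in>A. f \<alpha> \<noteq> 0) \<longrightarrow>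
    1 / real CARD('p) ^ (l * CARD('n)) * cmod (scaled_sum CARD('p) b A l) \<le> C * real CARD('p) powr (- real l / real e))"
proof -
  define p where "p = CARD('p)"
  have pr: "prime p" unfolding p_def by (rule prime_card)
  have p1: "p > 1" using pr prime_gt_1_nat by blast
  have d: "d > 0" by (rule distance_pos)
  have e1: "e \<ge> 1" using e d by (cases e) auto
  define \<theta> where "\<theta> = 1 / real e"
  have \<theta>: "\<theta> > 0" using e1 by (simp add: \<theta>_def)
  have "\<exists>T C s. C \<ge> 1 \<and> (\<forall>k A l N. (\<forall>i. k $ i \<ge> T) \<longrightarrow> finite A \<longrightarrow> min_supp f \<subseteq> A \<longrightarrow> (\<forall>\<alpha>\<in>A. f \<alpha> \<noteq> 0) \<longrightarrow>
    (\<forall>\<alpha>\<in>min_supp f. real_vec \<alpha> \<notin> UNIV \<longrightarrow> pairing k \<alpha> - weight f k > T) \<longrightarrow>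
    (\<forall>i. N i \<ge> (l - weight f k) + s) \<longrightarrow>
      cmod (\<Sum>u\<in>vec_box CARD('p) N \<inter> unit_vecs CARD('p). padic_char CARD('p) (l - weight f k) (poly_value A (scaled_coeff CARD('p) f k) u))
        \<le> C * real CARD('p) powr (- \<theta> * real (l - weight f k)) * real (card (vec_box CARD('p) N)))"
    by (rule unit_sum_weight_bound[where 'p = 'p, OF e1 convex_UNIV]) (use \<theta> o in \<open>auto simp: \<theta>_def\<close>)
  then obtain T C s where C: "C \<ge> 1" and TC: "unit_bound p T s (\<lambda>l k. C * real p powr (- \<theta> * real (l - weight f k)))"
    unfolding unit_bound_def p_def by auto
  define c where "c = 1 - \<theta> * d"
  have c: "c > 0" using e e1 by (simp add: c_def \<theta>_def)
  obtain K where K: "K > 0" "\<And>X. finite (X :: (nat ^ 'n) set) \<Longrightarrow> (\<Sum>k\<in>X. real p powr (- c * real (total_degree k))) \<le> K"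
    using sum_powr_total_degree[of "real p" c, where 'n = 'n] p1 c by auto
  have "(\<Sum>k\<in>X. real p powr (- real (total_degree k)) * (C * real p powr (- \<theta> * real (l - weight f k)))) \<le> (C * K) * real p powr (- real l / real e)"
    if "finite X" for X l
  proof -
    have "(\<Sum>k\<in>X. real p powr (- real (total_degree k)) * (C * real p powr (- \<theta> * real (l - weight f k))))
      \<le> (\<Sum>k\<in>X. C * real p powr (- real l / real e) * real p powr (- c * real (total_degree k)))"
    proof (intro sum_mono)
      fix k
      have "\<theta> * real (weight f k) \<le> \<theta> * (d * real (total_degree k))"
        using weight_le_total[of k] \<theta> by (intro mult_left_mono) auto
      moreover have "\<theta> * (real l - real (weight f k)) \<le> \<theta> * real (l - weight f k)"
        using \<theta> by (intro mult_left_mono) auto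
      ultimately have "- real (total_degree k) + - \<theta> * real (l - weight f k) \<le> - real l / real e + - c * real (total_degree k)"
        by (simp add: c_def \<theta>_def algebra_simps)
      hence "real p powr (- real (total_degree k) + - \<theta> * real (l - weight f k)) \<le> real p powr (- real l / real e + - c * real (total_degree k))"
        using p1 by (intro powr_mono) auto
      hence "C * (real p powr (- real (total_degree k)) * real p powr (- \<theta> * real (l - weight f k))) \<le> C * (real p powr (- real l / real e) * real p powr (- c * real (total_degree k)))"
        unfolding powr_add using C by (intro mult_left_mono) auto
      thus "real p powr (- real (total_degree k)) * (C * real p powr (- \<theta> * real (l - weight f k))) \<le> C * real p powr (- real l / real e) * real p powr (- c * real (total_degree k))"
        by (simp only: mult_ac)
    qed
    also have "\<dots> = C * real p powr (- real l / real e) * (\<Sum>k\<in>X. real p powr (- c * real (total_degree k)))"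
      by (rule sum_distrib_left[symmetric])
    also have "\<dots> \<le> C * real p powr (- real l / real e) * K"
      using C K(2)[OF that] by (intro mult_left_mono) auto
    finally show ?thesis by (simp only: mult_ac)
  qed
  note sum = this
  have R: "real p powr (- real l / d) \<le> real p powr (- real l / real e)" for l
  proof (rule powr_mono)
    have "real l / real e \<le> real l / d" using e d by (intro divide_left_mono) auto
    thus "- real l / d \<le> - real l / real e" by simp
  qed (use p1 in auto)
  have CK: "C * K > 0" using C K(1) by simp
  show ?thesis
    unfolding p_def[symmetric]
  proof (rule exI[of _ T], intro allI impI)
    fix b :: "nat ^ 'n" assume b: "\<forall>i. T \<le> b $ i"
    show "\<exists>C>0. \<forall>l>0. \<forall>A. finite A \<longrightarrow> min_supp f \<subseteq> A \<longrightarrow> (\<forall>\<alpha>\<in>A. f \<alpha> \<noteq> 0) \<longrightarrow>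
      1 / real p ^ (l * CARD('n)) * cmod (scaled_sum p b A l) \<le> C * real p powr (- real l / real e)"
      by (rule scaled_sum_bound[OF pr TC CK sum R spec[OF b]])
  qed
qed

lemma unit_bound_rate_d:
  assumes o: "\<And>F. compact_face f F \<Longrightarrow> real (max_zero_order TYPE('p::prime_card) f F) \<le> d"
  shows "\<exists>T C s. C \<ge> 1 \<and> unit_bound CARD('p) T s (\<lambda>l k. C * real CARD('p) powr (- (1 / d) * real (l - weight f k)))"
proof -
  \<comment> \<open>Orders are integers, so a bound by \<open>d\<close> is one by its floor. If this
    gives \<open>e = 1\<close>, the rate \<open>1/d\<close> is admissible even when
    \<open>d < 1\<close>; otherwise \<open>e \<le> d\<close> makes it admissible.\<close>
  define e where "e = max 1 (nat \<lfloor>d\<rfloor>)"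
  have d: "d > 0" by (rule distance_pos)
  have e1: "e \<ge> 1" by (simp add: e_def)
  have rate: "e = 1 \<or> 1 / d \<le> 1 / real e"
  proof (cases "e = 1")
    case False
    hence "e = nat \<lfloor>d\<rfloor>" by (auto simp: e_def max_def split: if_splits)
    hence "real e \<le> d" using d by simp
    thus ?thesis using e1 d by (intro disjI2 divide_left_mono) auto
  qed simp
  have "\<exists>T C s. C \<ge> 1 \<and> (\<forall>k A l N. (\<forall>i. k $ i \<ge> T) \<longrightarrow> finite A \<longrightarrow> min_supp f \<subseteq> A \<longrightarrow> (\<forall>\<alpha>\<in>A. f \<alpha> \<noteq> 0) \<longrightarrow>
    (\<forall>\<alpha>\<in>min_supp f. real_vec \<alpha> \<notin> UNIV \<longrightarrow> pairing k \<alpha> - weight f k > T) \<longrightarrow>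
    (\<forall>i. N i \<ge> (l - weight f k) + s) \<longrightarrow>
      cmod (\<Sum>u\<in>vec_box CARD('p) N \<inter> unit_vecs CARD('p). padic_char CARD('p) (l - weight f k) (poly_value A (scaled_coeff CARD('p) f k) u))
        \<le> C * real CARD('p) powr (- (1 / d) * real (l - weight f k)) * real (card (vec_box CARD('p) N)))"
  proof (rule unit_sum_weight_bound[where 'p = 'p, OF e1 convex_UNIV])
    fix F assume "compact_face f F"
    hence "int (max_zero_order TYPE('p) f F) \<le> \<lfloor>d\<rfloor>" using o by (simp add: le_floor_iff)
    thus "max_zero_order TYPE('p) f F \<le> e" by (simp add: e_def)
  qed (use d rate in auto)
  thus ?thesis unfolding unit_bound_def by auto
qed

text \<open>The gap controls the pairings of \<open>k\<close> with the directions in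
  \<open>V\<close>, which leaves \<open>n - dim V\<close> coordinates of \<open>k\<close> to range
  over an interval of length of order \<open>l\<close>.\<close>

lemma estimate_b:
  assumes o: "\<And>F. compact_face f F \<Longrightarrow> real (max_zero_order TYPE('p::prime_card) f F) \<le> d"
  shows "\<exists>T. \<forall>b. (\<forall>i. b $ i \<ge> T) \<longrightarrow> (\<exists>C>0. \<forall>l>0. \<forall>A. finite A \<longrightarrow> min_supp f \<subseteq> A \<longrightarrow> (\<forall>\<alpha>\<in>A. f \<alpha> \<noteq> 0) \<longrightarrow>
    1 / real CARD('p) ^ (l * CARD('n)) * cmod (scaled_sum CARD('p) b A l)
      \<le> C * (real l ^ (CARD('n) - dim V) * real CARD('p) powr (- real l / d)))"
proof -
  define p where "p = CARD('p)"
  have pr: "prime p" unfolding p_def by (rule prime_card)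
  have p1: "p > 1" using pr prime_gt_1_nat by blast
  obtain T C s where C: "C \<ge> 1" and TC: "unit_bound p T s (\<lambda>l k. C * real p powr (- (1 / d) * real (l - weight f k)))"
    using unit_bound_rate_d[where 'p = 'p, OF o] unfolding p_def by blast
  have "\<exists>K>0. \<forall>l X. l > 0 \<longrightarrow> finite X \<longrightarrow> X \<subseteq> UNIV \<longrightarrow>
     (\<Sum>k\<in>X. real p powr (- real (total_degree k)) * real p powr (- (1 / d) * real (l - weight f k)))
       \<le> K * (real l ^ (CARD('n) - dim V) * real p powr (- real l / d))"
  proof (rule rate_d_sum[OF p1 subspace_V])
    fix w assume "w \<in> V"
    then obtain c where c: "c > 0" "\<forall>k. \<bar>real_vec k \<bullet> w\<bar> \<le> c * gap k" using gap_V by blast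
    have "1 / c * \<bar>real_vec k \<bullet> w\<bar> \<le> gap k + 0" for k
      using c by (simp add: field_simps)
    thus "\<exists>c>0. \<exists>T. \<forall>k\<in>UNIV. c * \<bar>real_vec k \<bullet> w\<bar> \<le> gap k + T"
      using c(1) by (intro exI[of _ "1 / c"] exI[of _ 0] conjI) auto
  qed
  then obtain K where K: "K > 0" and Kb: "\<forall>l X. l > 0 \<longrightarrow> finite X \<longrightarrow> X \<subseteq> UNIV \<longrightarrow>
     (\<Sum>k\<in>X. real p powr (- real (total_degree k)) * real p powr (- (1 / d) * real (l - weight f k)))
       \<le> K * (real l ^ (CARD('n) - dim V) * real p powr (- real l / d))" by (elim exE conjE)
  have "(\<Sum>k\<in>X. real p powr (- real (total_degree k)) * (C * real p powr (- (1 / d) * real (l - weight f k))))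
      \<le> (C * K) * (real l ^ (CARD('n) - dim V) * real p powr (- real l / d))" if "l > 0" "finite X" for l X
  proof -
    have "(\<Sum>k\<in>X. real p powr (- real (total_degree k)) * (C * real p powr (- (1 / d) * real (l - weight f k)))) =
      C * (\<Sum>k\<in>X. real p powr (- real (total_degree k)) * real p powr (- (1 / d) * real (l - weight f k)))"
      unfolding sum_distrib_left by (simp only: mult_ac)
    also have "\<dots> \<le> C * (K * (real l ^ (CARD('n) - dim V) * real p powr (- real l / d)))"
      by (rule mult_left_mono[OF Kb[rule_format, OF that subset_UNIV]]) (use C in simp)
    finally show ?thesis by (simp only: mult.assoc)
  qed
  note sum = this
  have CK: "C * K > 0" using C K by simp
  show ?thesis
    unfolding p_def[symmetric]
  proof (rule exI[of _ T], intro allI impI)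
    fix b :: "nat ^ 'n" assume b: "\<forall>i. T \<le> b $ i"
    show "\<exists>C>0. \<forall>l>0. \<forall>A. finite A \<longrightarrow> min_supp f \<subseteq> A \<longrightarrow> (\<forall>\<alpha>\<in>A. f \<alpha> \<noteq> 0) \<longrightarrow>
      1 / real p ^ (l * CARD('n)) * cmod (scaled_sum p b A l)
        \<le> C * (real l ^ (CARD('n) - dim V) * real p powr (- real l / d))"
      by (rule scaled_sum_bound[OF pr TC CK sum one_le_power_rate[OF _ p1] spec[OF b]])
  qed
qed

lemma span_V: "span V = V"
  unfolding V_def by (rule span_span)

lemma span_insert_decompose:
  assumes "w \<in> span (insert x V)"
  obtains c v where "v \<in> V" "w = v + c *\<^sub>R x"
proof -
  obtain c where "w - c *\<^sub>R x \<in> span V" using assms unfolding span_insert by blast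
  hence "w - c *\<^sub>R x \<in> V" by (simp only: span_V)
  thus ?thesis using that[of "w - c *\<^sub>R x" c] by simp
qed

lemma dim_span_insert: "x \<notin> V \<Longrightarrow> dim (span (insert x V)) = dim V + 1"
  by (simp add: dim_insert span_V)

text \<open>The lattice points \<open>k\<close> at which an exponent \<open>\<alpha>\<close> outside the central face is nearly minimal lie
  near the hyperplane where \<open>k\<close> takes equal values at \<open>\<alpha>\<close> and at \<open>z\<close>; this saves one power of \<open>l\<close>.\<close>

lemma off_central_sum:
  assumes p: "p > 1" and \<alpha>: "f \<alpha> \<noteq> 0" "real_vec \<alpha> \<notin> C"
  shows "\<exists>K>0. \<forall>l X. l > 0 \<longrightarrow> finite X \<longrightarrow> X \<subseteq> {k. pairing k \<alpha> - weight f k \<le> T} \<longrightarrow>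
     (\<Sum>k\<in>X. real p powr (- real (total_degree k)) * real p powr (- (1 / d) * real (l - weight f k)))
       \<le> K * (real l ^ (CARD('n) - (dim V + 1)) * real p powr (- real l / d))"
proof -
  have d: "d > 0" by (rule distance_pos)
  define x where "x = real_vec \<alpha> - z"
  have hyp: "\<exists>c>0. \<exists>T'. \<forall>k\<in>{k. pairing k \<alpha> - weight f k \<le> T}. c * \<bar>real_vec k \<bullet> w\<bar> \<le> gap k + T'"
    if w: "w \<in> span (insert x V)" for w
  proof -
    obtain c v where v: "v \<in> V" "w = v + c *\<^sub>R x" by (rule span_insert_decompose[OF w])
    obtain c1 where c1: "c1 > 0" "\<forall>k. \<bar>real_vec k \<bullet> v\<bar> \<le> c1 * gap k" using gap_V[OF v(1)] by blast
    define M where "M = c1 + \<bar>c\<bar> * d"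
    have M: "M > 0" unfolding M_def using c1(1) d by (intro add_pos_nonneg) auto
    have "1 / M * \<bar>real_vec k \<bullet> w\<bar> \<le> gap k + \<bar>c\<bar> * real T / M"
      if k: "pairing k \<alpha> - weight f k \<le> T" for k
    proof -
      have le: "weight f k \<le> pairing k \<alpha>" by (rule weight_le_pairing[OF \<alpha>(1)])
      \<comment> \<open>Above the minimum \<open>m(k)\<close>, the vector \<open>k\<close> takes at
        \<open>\<alpha>\<close> an excess of at most \<open>T\<close> and at \<open>z\<close> the
        excess \<open>d * gap k\<close>; the difference of the two is therefore controlled by the
        gap.\<close>
      have "real_vec k \<bullet> x = (real (pairing k \<alpha>) - real (weight f k)) - d * gap k"
        unfolding x_def d_gap by (simp add: inner_diff_right inner_real_vec inner_z)
      moreover have "real (pairing k \<alpha>) - real (weight f k) \<le> real T" using k by simp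
      ultimately have "\<bar>real_vec k \<bullet> x\<bar> \<le> real T + d * gap k"
        using of_nat_mono[OF le, where 'a = real] mult_nonneg_nonneg[OF less_imp_le[OF d] gap_nonneg[of k]] by linarith
      hence "\<bar>c\<bar> * \<bar>real_vec k \<bullet> x\<bar> \<le> \<bar>c\<bar> * (real T + d * gap k)" by (intro mult_left_mono) auto
      moreover have "\<bar>real_vec k \<bullet> w\<bar> \<le> \<bar>real_vec k \<bullet> v\<bar> + \<bar>c\<bar> * \<bar>real_vec k \<bullet> x\<bar>"
        unfolding v(2) by (simp add: inner_add_right flip: abs_mult)
      moreover have "\<bar>real_vec k \<bullet> v\<bar> \<le> c1 * gap k" using c1(2) by blast
      ultimately have "\<bar>real_vec k \<bullet> w\<bar> \<le> c1 * gap k + \<bar>c\<bar> * (real T + d * gap k)" by linarith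
      also have "\<dots> = M * gap k + \<bar>c\<bar> * real T" by (simp add: M_def algebra_simps)
      finally have "\<bar>real_vec k \<bullet> w\<bar> / M \<le> (M * gap k + \<bar>c\<bar> * real T) / M"
        using M by (intro divide_right_mono) auto
      thus ?thesis using M by (simp add: add_divide_distrib)
    qed
    thus ?thesis using M by (intro exI[of _ "1 / M"] conjI exI[of _ "\<bar>c\<bar> * real T / M"]) auto
  qed
  have "dim (span (insert x V)) = dim V + 1"
    unfolding x_def by (rule dim_span_insert[OF off_central_notin_V[OF \<alpha>]])
  moreover have "\<exists>K>0. \<forall>l X. l > 0 \<longrightarrow> finite X \<longrightarrow> X \<subseteq> {k. pairing k \<alpha> - weight f k \<le> T} \<longrightarrow>
     (\<Sum>k\<in>X. real p powr (- real (total_degree k)) * real p powr (- (1 / d) * real (l - weight f k)))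
       \<le> K * (real l ^ (CARD('n) - dim (span (insert x V))) * real p powr (- real l / d))"
    by (rule rate_d_sum[OF p subspace_span hyp])
  ultimately show ?thesis by (simp only:)
qed

text \<open>A rate above \<open>1/d\<close> leaves a surplus \<open>\<epsilon> |l - m(k)|\<close> on
  both sides of \<open>l\<close>: for \<open>m(k) < l\<close> out of \<open>\<theta> - 1/d\<close>,
  for \<open>m(k) > l\<close> out of \<open>1/d\<close>. Together with the gap it controls
  \<open>|k| - l/d\<close>, so the direction \<open>(1, \<dots>, 1)\<close> joins \<open>V\<close>
  and one power of \<open>l\<close> is saved.\<close>

lemma central_sum:
  assumes p: "p > 1" and \<theta>: "\<theta> > 1 / d"
  shows "\<exists>K>0. \<forall>l X. l > 0 \<longrightarrow> finite X \<longrightarrow>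
     (\<Sum>k\<in>X. real p powr (- real (total_degree k)) * real p powr (- \<theta> * real (l - weight f k)))
       \<le> K * (real l ^ (CARD('n) - (dim V + 1)) * real p powr (- real l / d))"
proof -
  have d: "d > 0" by (rule distance_pos)
  define \<epsilon> where "\<epsilon> = min (1 / d) (\<theta> - 1 / d)"
  have \<epsilon>: "\<epsilon> > 0" "\<epsilon> \<le> 1 / d" "\<epsilon> \<le> \<theta> - 1 / d" using d \<theta> by (auto simp: \<epsilon>_def)
  define \<psi> where "\<psi> = (\<lambda>l k. \<epsilon> * \<bar>real l - real (weight f k)\<bar>)"
  define one where "one = (\<chi> i::'n. (1::real))"
  define W where "W = span (insert one V)"
  have one: "real_vec k \<bullet> one = real (total_degree k)" for k
    by (simp add: one_def inner_vec_def total_degree_def)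
  have "\<exists>K>0. \<forall>l X. l > 0 \<longrightarrow> finite X \<longrightarrow> X \<subseteq> UNIV \<longrightarrow>
     (\<Sum>k\<in>X. real p powr (- (gap k + \<psi> l k))) \<le> K * real l ^ (CARD('n) - dim W)"
  proof (rule weighted_lattice_sum[where \<epsilon> = \<epsilon> and Q = "\<lambda>_. UNIV"])
    show "subspace W" by (simp add: W_def)
    show "\<epsilon> * d \<le> 1" using \<epsilon>(2) d by (simp add: field_simps)
    show "\<psi> l k \<ge> \<epsilon> * (real (weight f k) - real l)" for l k
      unfolding \<psi>_def using \<epsilon>(1) by (intro mult_left_mono) auto
    fix w assume "w \<in> W"
    then obtain c v where v: "v \<in> V" "w = v + c *\<^sub>R one" unfolding W_def by (rule span_insert_decompose)
    obtain c1 where c1: "c1 > 0" "\<forall>k. \<bar>real_vec k \<bullet> v\<bar> \<le> c1 * gap k" using gap_V[OF v(1)] by blast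
    define M where "M = c1 + \<bar>c\<bar> * (1 + 1 / (d * \<epsilon>))"
    have M: "M > 0" unfolding M_def using c1(1) d \<epsilon>(1) by (intro add_pos_nonneg) auto
    \<comment> \<open>The form \<open>|k|\<close> concentrates near \<open>l/d\<close> instead of
      \<open>0\<close>, hence a shift that varies with \<open>l\<close>; \<open>lattice_sum\<close>
      allows for it.\<close>
    have "1 / M * \<bar>real_vec k \<bullet> w + - c * real l / d\<bar> \<le> gap k + \<psi> l k + 0" for k l
    proof -
      have \<psi>0: "\<psi> l k \<ge> 0" using \<epsilon>(1) by (simp add: \<psi>_def)
      have td: "real (total_degree k) - real l / d = gap k - (real l - real (weight f k)) / d"
        by (simp add: gap_def diff_divide_distrib)
      have "\<bar>(real l - real (weight f k)) / d\<bar> = 1 / (d * \<epsilon>) * \<psi> l k"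
        using d \<epsilon>(1) by (simp add: \<psi>_def)
      moreover have "\<bar>gap k - t\<bar> \<le> gap k + \<bar>t\<bar>" for t
        using gap_nonneg[of k] by linarith
      ultimately have "\<bar>real (total_degree k) - real l / d\<bar> \<le> gap k + 1 / (d * \<epsilon>) * \<psi> l k"
        unfolding td by metis
      also have "\<dots> \<le> (1 + 1 / (d * \<epsilon>)) * (gap k + \<psi> l k)"
        using \<psi>0 gap_nonneg[of k] d \<epsilon>(1) by (simp add: algebra_simps)
      finally have "\<bar>c\<bar> * \<bar>real (total_degree k) - real l / d\<bar> \<le> \<bar>c\<bar> * ((1 + 1 / (d * \<epsilon>)) * (gap k + \<psi> l k))"
        by (intro mult_left_mono) auto
      moreover have "real_vec k \<bullet> w + - c * real l / d = real_vec k \<bullet> v + c * (real (total_degree k) - real l / d)"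
        unfolding v(2) by (simp add: inner_add_right one algebra_simps)
      moreover have "c1 * gap k \<le> c1 * (gap k + \<psi> l k)" using c1(1) \<psi>0 by (intro mult_left_mono) auto
      moreover have "M * (gap k + \<psi> l k) = c1 * (gap k + \<psi> l k) + \<bar>c\<bar> * ((1 + 1 / (d * \<epsilon>)) * (gap k + \<psi> l k))"
        by (simp add: M_def distrib_right)
      moreover have "\<bar>real_vec k \<bullet> v + c * (real (total_degree k) - real l / d)\<bar>
          \<le> \<bar>real_vec k \<bullet> v\<bar> + \<bar>c\<bar> * \<bar>real (total_degree k) - real l / d\<bar>"
        unfolding abs_mult[symmetric] by (rule abs_triangle_ineq)
      moreover have "\<bar>real_vec k \<bullet> v\<bar> \<le> c1 * gap k" using c1(2) by blast
      ultimately have "\<bar>real_vec k \<bullet> w + - c * real l / d\<bar> \<le> M * (gap k + \<psi> l k)" by linarith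
      hence "\<bar>real_vec k \<bullet> w + - c * real l / d\<bar> / M \<le> M * (gap k + \<psi> l k) / M"
        using M by (intro divide_right_mono) auto
      thus ?thesis using M by simp
    qed
    hence "\<forall>l. \<exists>b. \<forall>k\<in>UNIV. 1 / M * \<bar>real_vec k \<bullet> w + b\<bar> \<le> gap k + \<psi> l k + 0" by blast
    moreover have "1 / M > 0" using M by simp
    ultimately show "\<exists>c>0. \<exists>T. \<forall>l. \<exists>b. \<forall>k\<in>UNIV. c * \<bar>real_vec k \<bullet> w + b\<bar> \<le> gap k + \<psi> l k + T" by blast
  qed (use p \<epsilon> in \<open>auto simp: \<psi>_def\<close>)
  then obtain K where K: "K > 0" and Kb: "\<forall>l X. l > 0 \<longrightarrow> finite X \<longrightarrow> X \<subseteq> UNIV \<longrightarrow>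
     (\<Sum>k\<in>X. real p powr (- (gap k + \<psi> l k))) \<le> K * real l ^ (CARD('n) - dim W)" by (elim exE conjE)
  have dimW: "dim W = dim V + 1"
    unfolding W_def one_def by (rule dim_span_insert[OF ones_notin_V])
  have le: "real p powr (- real (total_degree k)) * real p powr (- \<theta> * real (l - weight f k)) \<le>
      real p powr (- real l / d) * real p powr (- (gap k + \<psi> l k))" for l k
  proof -
    have "(real l - real (weight f k)) / d - \<theta> * real (l - weight f k) \<le> - \<psi> l k"
    proof (cases "weight f k \<le> l")
      case True
      have "\<epsilon> * (real l - real (weight f k)) \<le> (\<theta> - 1 / d) * (real l - real (weight f k))"
        using True \<epsilon>(3) by (intro mult_right_mono) auto
      thus ?thesis using True by (simp add: \<psi>_def of_nat_diff left_diff_distrib)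
    next
      case False
      have "\<epsilon> * (real (weight f k) - real l) \<le> (1 / d) * (real (weight f k) - real l)"
        using False \<epsilon>(2) by (intro mult_right_mono) auto
      thus ?thesis using False by (simp add: \<psi>_def diff_divide_distrib)
    qed
    hence "- real l / d + (- gap k + (real l - real (weight f k)) / d) + - \<theta> * real (l - weight f k)
       \<le> - real l / d + - (gap k + \<psi> l k)" by simp
    thus ?thesis unfolding powr_gap[OF p, of k l] powr_add[symmetric] using p by (intro powr_mono) auto
  qed
  have "(\<Sum>k\<in>X. real p powr (- real (total_degree k)) * real p powr (- \<theta> * real (l - weight f k)))
       \<le> K * (real l ^ (CARD('n) - (dim V + 1)) * real p powr (- real l / d))" if "l > 0" "finite X" for l X
  proof -
    have "(\<Sum>k\<in>X. real p powr (- real (total_degree k)) * real p powr (- \<theta> * real (l - weight f k)))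
       \<le> (\<Sum>k\<in>X. real p powr (- real l / d) * real p powr (- (gap k + \<psi> l k)))"
      by (intro sum_mono le)
    also have "\<dots> = real p powr (- real l / d) * (\<Sum>k\<in>X. real p powr (- (gap k + \<psi> l k)))"
      by (rule sum_distrib_left[symmetric])
    also have "\<dots> \<le> real p powr (- real l / d) * (K * real l ^ (CARD('n) - dim W))"
      by (rule mult_left_mono[OF Kb[rule_format, OF that subset_UNIV]]) simp
    finally show ?thesis unfolding dimW by (simp only: mult_ac)
  qed
  thus ?thesis using K by (intro exI[of _ K] conjI allI impI)
qed

text \<open>Call \<open>k\<close> good if every minimal exponent outside the central face exceeds
  \<open>m(k)\<close> by more than a threshold. For good \<open>k\<close> only faces inside the
  central face matter, and these admit a rate above \<open>1/d\<close>. Every other \<open>k\<close>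
  nearly attains its minimum at one of finitely many exponents outside the central face; the rate
  \<open>1/d\<close> then suffices, as \<open>off_central_sum\<close> saves the same power of
  \<open>l\<close>.\<close>

lemma estimate_a:
  assumes o: "\<And>F. compact_face f F \<Longrightarrow> real (max_zero_order TYPE('p::prime_card) f F) \<le> d"
    and oC: "\<And>F. compact_face f F \<Longrightarrow> F \<subseteq> C \<Longrightarrow> real (max_zero_order TYPE('p) f F) < d"
  shows "\<exists>T. \<forall>b. (\<forall>i. b $ i \<ge> T) \<longrightarrow> (\<exists>K>0. \<forall>l>0. \<forall>A. finite A \<longrightarrow> min_supp f \<subseteq> A \<longrightarrow> (\<forall>\<alpha>\<in>A. f \<alpha> \<noteq> 0) \<longrightarrow>
    1 / real CARD('p) ^ (l * CARD('n)) * cmod (scaled_sum CARD('p) b A l)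
      \<le> K * (real l ^ (CARD('n) - (dim V + 1)) * real CARD('p) powr (- real l / d)))"
proof -
  define p where "p = CARD('p)"
  have pr: "prime p" unfolding p_def by (rule prime_card)
  have p1: "p > 1" using pr prime_gt_1_nat by blast
  have d: "d > 0" by (rule distance_pos)
  \<comment> \<open>For \<open>d > 1\<close> this is the largest integer below \<open>d\<close>, and
    \<open>1/e > 1/d\<close>. For \<open>d \<le> 1\<close> the orders inside the central face are
    \<open>0\<close>, so \<open>e = 1\<close>, where every rate is admissible and
    \<open>\<theta>\<close> may be put above \<open>1/d\<close> at will.\<close>
  define e where "e = max 1 (nat (\<lceil>d\<rceil> - 1))"
  have e1: "e \<ge> 1" by (simp add: e_def)
  define \<theta> where "\<theta> = (if d \<le> 1 then 1 / d + 1 else 1 / real e)"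
  have \<theta>: "\<theta> > 1 / d" "e = 1 \<or> \<theta> \<le> 1 / real e"
  proof -
    have "\<theta> > 1 / d \<and> (e = 1 \<or> \<theta> \<le> 1 / real e)"
    proof (cases "d \<le> 1")
      case True
      hence "e = 1" using d by (simp add: e_def ceiling_le_iff)
      thus ?thesis using True by (simp add: \<theta>_def)
    next
      case False
      hence c2: "\<lceil>d\<rceil> \<ge> 2" by linarith
      hence "e = nat (\<lceil>d\<rceil> - 1)" unfolding e_def by linarith
      hence "real e = real_of_int \<lceil>d\<rceil> - 1" using c2 by simp
      hence "real e < d" by linarith
      hence "1 / d < 1 / real e" using e1 by (intro divide_strict_left_mono) auto
      thus ?thesis using False by (simp add: \<theta>_def)
    qed
    thus "\<theta> > 1 / d" "e = 1 \<or> \<theta> \<le> 1 / real e" by auto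
  qed
  have \<theta>0: "\<theta> \<ge> 0" using \<theta>(1) d by (meson less_imp_le order.trans zero_le_divide_1_iff)
  have convC: "convex C" using central_face_of face_of_imp_convex by blast
  have "\<exists>T C' s. C' \<ge> 1 \<and> (\<forall>k A l N. (\<forall>i. k $ i \<ge> T) \<longrightarrow> finite A \<longrightarrow> min_supp f \<subseteq> A \<longrightarrow> (\<forall>\<alpha>\<in>A. f \<alpha> \<noteq> 0) \<longrightarrow>
    (\<forall>\<alpha>\<in>min_supp f. real_vec \<alpha> \<notin> C \<longrightarrow> pairing k \<alpha> - weight f k > T) \<longrightarrow>
    (\<forall>i. N i \<ge> (l - weight f k) + s) \<longrightarrow>
      cmod (\<Sum>u\<in>vec_box CARD('p) N \<inter> unit_vecs CARD('p). padic_char CARD('p) (l - weight f k) (poly_value A (scaled_coeff CARD('p) f k) u))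
        \<le> C' * real CARD('p) powr (- \<theta> * real (l - weight f k)) * real (card (vec_box CARD('p) N)))"
  proof (rule unit_sum_weight_bound[where 'p = 'p, OF e1 convC \<theta>0 \<theta>(2)])
    fix F assume "compact_face f F" "F \<subseteq> C"
    hence "int (max_zero_order TYPE('p) f F) < \<lceil>d\<rceil>" using oC by (simp add: less_ceiling_iff)
    thus "max_zero_order TYPE('p) f F \<le> e" by (simp add: e_def)
  qed
  then obtain Tg Cg sg where Cg: "Cg \<ge> 1" and Bg: "\<forall>k A l N. (\<forall>i. k $ i \<ge> Tg) \<longrightarrow> finite A \<longrightarrow> min_supp f \<subseteq> A \<longrightarrow> (\<forall>\<alpha>\<in>A. f \<alpha> \<noteq> 0) \<longrightarrow>
    (\<forall>\<alpha>\<in>min_supp f. real_vec \<alpha> \<notin> C \<longrightarrow> pairing k \<alpha> - weight f k > Tg) \<longrightarrow>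
    (\<forall>i. N i \<ge> (l - weight f k) + sg) \<longrightarrow>
      cmod (\<Sum>u\<in>vec_box p N \<inter> unit_vecs p. padic_char p (l - weight f k) (poly_value A (scaled_coeff p f k) u))
        \<le> Cg * real p powr (- \<theta> * real (l - weight f k)) * real (card (vec_box p N))"
    unfolding p_def by (elim exE conjE)
  have "\<exists>T C' s. C' \<ge> 1 \<and> unit_bound p T s (\<lambda>l k. C' * real p powr (- (1 / d) * real (l - weight f k)))"
    unfolding p_def by (rule unit_bound_rate_d[where 'p = 'p]) (rule o)
  then obtain Tb Cb sb where Cb: "Cb \<ge> 1" and Bb: "unit_bound p Tb sb (\<lambda>l k. Cb * real p powr (- (1 / d) * real (l - weight f k)))"
    by (elim exE conjE)
  define good where "good = (\<lambda>k. \<forall>\<alpha>\<in>min_supp f. real_vec \<alpha> \<notin> C \<longrightarrow> pairing k \<alpha> - weight f k > Tg)"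
  define gg where "gg = (\<lambda>l k. real p powr (- real (total_degree k)) * real p powr (- \<theta> * real (l - weight f k)))"
  define gb where "gb = (\<lambda>l k. real p powr (- real (total_degree k)) * real p powr (- (1 / d) * real (l - weight f k)))"
  have gnn: "gg l k \<ge> 0" "gb l k \<ge> 0" for l k by (simp_all add: gg_def gb_def)
  define R where "R = (\<lambda>l::nat. real l ^ (CARD('n) - (dim V + 1)) * real p powr (- real l / d))"
  have Rnn: "R l \<ge> 0" for l by (simp add: R_def)
  define \<beta> where "\<beta> = (\<lambda>l k. if good k then Cg * real p powr (- \<theta> * real (l - weight f k))
     else Cb * real p powr (- (1 / d) * real (l - weight f k)))"
  have U: "unit_bound p (max Tg Tb) (sg + sb) \<beta>"
    unfolding unit_bound_def
  proof (intro allI impI)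
    fix k A l and N :: "'n \<Rightarrow> nat"
    assume k: "\<forall>i. max Tg Tb \<le> k $ i" and A: "finite A" "min_supp f \<subseteq> A" "\<forall>\<alpha>\<in>A. f \<alpha> \<noteq> 0"
      and N: "\<forall>i. l - weight f k + (sg + sb) \<le> N i"
    have k': "\<forall>i. Tg \<le> k $ i" "\<forall>i. Tb \<le> k $ i" using k by auto
    have N': "l - weight f k + sg \<le> N i" "l - weight f k + sb \<le> N i" for i
      using spec[OF N, of i] by linarith+
    show "cmod (\<Sum>u\<in>vec_box p N \<inter> unit_vecs p. padic_char p (l - weight f k) (poly_value A (scaled_coeff p f k) u))
      \<le> \<beta> l k * real (card (vec_box p N))"
    proof (cases "good k")
      case True
      thus ?thesis using Bg[rule_format, of k A, OF _ A(1) _ _ _ N'(1)] k'(1) A by (simp add: \<beta>_def good_def subset_iff)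
    next
      case False
      thus ?thesis using Bb[unfolded unit_bound_def, rule_format, of k A, OF _ A(1) _ _ N'(2)] k'(2) A by (simp add: \<beta>_def subset_iff)
    qed
  qed
  obtain Kc where Kc: "Kc > 0" and Kcb: "\<forall>l X. l > 0 \<longrightarrow> finite X \<longrightarrow> (\<Sum>k\<in>X. gg l k) \<le> Kc * R l"
    using central_sum[OF p1 \<theta>(1)] unfolding gg_def R_def by (elim exE conjE)
  define S where "S = {\<alpha> \<in> min_supp f. real_vec \<alpha> \<notin> C}"
  have finS: "finite S" using finite_min_supp[of f] by (simp add: S_def)
  define Q where "Q = (\<lambda>\<alpha>. {k. pairing k \<alpha> - weight f k \<le> Tg})"
  have "\<forall>\<alpha>\<in>S. \<exists>K>0. \<forall>l X. l > 0 \<longrightarrow> finite X \<longrightarrow> X \<subseteq> Q \<alpha> \<longrightarrow> (\<Sum>k\<in>X. gb l k) \<le> K * R l"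
  proof
    fix \<alpha> assume "\<alpha> \<in> S"
    hence "f \<alpha> \<noteq> 0" "real_vec \<alpha> \<notin> C" by (auto simp: S_def min_supp_def)
    thus "\<exists>K>0. \<forall>l X. l > 0 \<longrightarrow> finite X \<longrightarrow> X \<subseteq> Q \<alpha> \<longrightarrow> (\<Sum>k\<in>X. gb l k) \<le> K * R l"
      unfolding gb_def R_def Q_def by (rule off_central_sum[OF p1])
  qed
  from bchoice[OF this] obtain Kb where Kb: "\<And>\<alpha>. \<alpha> \<in> S \<Longrightarrow> Kb \<alpha> > 0"
    "\<And>\<alpha> l X. \<alpha> \<in> S \<Longrightarrow> l > 0 \<Longrightarrow> finite X \<Longrightarrow> X \<subseteq> Q \<alpha> \<Longrightarrow> (\<Sum>k\<in>X. gb l k) \<le> Kb \<alpha> * R l" by metis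
  define K where "K = Cg * Kc + Cb * (\<Sum>\<alpha>\<in>S. Kb \<alpha>)"
  have K: "K > 0" unfolding K_def
    using Cg Cb Kc Kb(1) by (intro add_pos_nonneg mult_pos_pos mult_nonneg_nonneg sum_nonneg) (auto intro: less_imp_le)
  have sum: "(\<Sum>k\<in>X. real p powr (- real (total_degree k)) * \<beta> l k) \<le> K * R l" if l: "l > 0" and X: "finite X" for l X
  proof -
    define X1 where "X1 = {k \<in> X. good k}"
    define X2 where "X2 = {k \<in> X. \<not> good k}"
    have fin: "finite X1" "finite X2" using X by (auto simp: X1_def X2_def)
    have "(\<Sum>k\<in>X. real p powr (- real (total_degree k)) * \<beta> l k) =
       (\<Sum>k\<in>X1. real p powr (- real (total_degree k)) * \<beta> l k) + (\<Sum>k\<in>X2. real p powr (- real (total_degree k)) * \<beta> l k)"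
    proof -
      have "X = X1 \<union> X2" "X1 \<inter> X2 = {}" by (auto simp: X1_def X2_def)
      thus ?thesis using fin by (simp add: sum.union_disjoint)
    qed
    also have "(\<Sum>k\<in>X1. real p powr (- real (total_degree k)) * \<beta> l k) = (\<Sum>k\<in>X1. Cg * gg l k)"
      by (intro sum.cong refl) (simp add: X1_def \<beta>_def gg_def)
    also have "\<dots> = Cg * (\<Sum>k\<in>X1. gg l k)" by (rule sum_distrib_left[symmetric])
    also have "(\<Sum>k\<in>X2. real p powr (- real (total_degree k)) * \<beta> l k) = (\<Sum>k\<in>X2. Cb * gb l k)"
      by (intro sum.cong refl) (simp add: X2_def \<beta>_def gb_def)
    also have "\<dots> = Cb * (\<Sum>k\<in>X2. gb l k)" by (rule sum_distrib_left[symmetric])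
    finally have eq: "(\<Sum>k\<in>X. real p powr (- real (total_degree k)) * \<beta> l k) = Cg * (\<Sum>k\<in>X1. gg l k) + Cb * (\<Sum>k\<in>X2. gb l k)" .
    have "(\<Sum>k\<in>X2. gb l k) \<le> (\<Sum>k\<in>X2. \<Sum>\<alpha>\<in>S. if k \<in> Q \<alpha> then gb l k else 0)"
    proof (rule sum_mono)
      fix k assume "k \<in> X2"
      then obtain \<alpha> where \<alpha>: "\<alpha> \<in> S" "k \<in> Q \<alpha>" by (auto simp: X2_def good_def S_def Q_def not_less)
      have "gb l k = (if k \<in> Q \<alpha> then gb l k else 0)" using \<alpha>(2) by simp
      also have "\<dots> \<le> (\<Sum>\<alpha>\<in>S. if k \<in> Q \<alpha> then gb l k else 0)"
        by (rule member_le_sum[OF \<alpha>(1)]) (use finS gnn in auto)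
      finally show "gb l k \<le> (\<Sum>\<alpha>\<in>S. if k \<in> Q \<alpha> then gb l k else 0)" .
    qed
    also have "\<dots> = (\<Sum>\<alpha>\<in>S. \<Sum>k\<in>X2. if k \<in> Q \<alpha> then gb l k else 0)" by (rule sum.swap)
    also have "\<dots> = (\<Sum>\<alpha>\<in>S. \<Sum>k\<in>X2 \<inter> Q \<alpha>. gb l k)"
      by (intro sum.cong refl sum.inter_restrict[symmetric] fin)
    also have "\<dots> \<le> (\<Sum>\<alpha>\<in>S. Kb \<alpha> * R l)"
      by (intro sum_mono Kb(2) l) (use fin in auto)
    also have "\<dots> = (\<Sum>\<alpha>\<in>S. Kb \<alpha>) * R l" by (rule sum_distrib_right[symmetric])
    finally have "Cb * (\<Sum>k\<in>X2. gb l k) \<le> Cb * ((\<Sum>\<alpha>\<in>S. Kb \<alpha>) * R l)" using Cb by (intro mult_left_mono) auto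
    moreover have "Cg * (\<Sum>k\<in>X1. gg l k) \<le> Cg * (Kc * R l)"
      using Kcb l fin(1) Cg by (intro mult_left_mono) auto
    moreover have "K * R l = Cg * (Kc * R l) + Cb * ((\<Sum>\<alpha>\<in>S. Kb \<alpha>) * R l)" by (simp add: K_def algebra_simps)
    ultimately show ?thesis unfolding eq by linarith
  qed
  have RR: "real p powr (- real l / d) \<le> R l" if "l > 0" for l
    unfolding R_def by (rule one_le_power_rate[OF that p1])
  show ?thesis
    unfolding p_def[symmetric]
  proof (rule exI[of _ "max Tg Tb"], intro allI impI)
    fix b :: "nat ^ 'n" assume b: "\<forall>i. max Tg Tb \<le> b $ i"
    have "\<exists>K>0. \<forall>l>0. \<forall>A. finite A \<longrightarrow> min_supp f \<subseteq> A \<longrightarrow> (\<forall>\<alpha>\<in>A. f \<alpha> \<noteq> 0) \<longrightarrow>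
      1 / real p ^ (l * CARD('n)) * cmod (scaled_sum p b A l) \<le> K * R l"
      by (rule scaled_sum_bound[OF pr U K sum RR spec[OF b]])
    thus "\<exists>K>0. \<forall>l>0. \<forall>A. finite A \<longrightarrow> min_supp f \<subseteq> A \<longrightarrow> (\<forall>\<alpha>\<in>A. f \<alpha> \<noteq> 0) \<longrightarrow>
      1 / real p ^ (l * CARD('n)) * cmod (scaled_sum p b A l)
        \<le> K * (real l ^ (CARD('n) - (dim V + 1)) * real p powr (- real l / d))" unfolding R_def .
  qed
qed

text \<open>The diagonal is a direction outside \<open>V\<close>; hence the natural subtractions in
  the exponents of \<open>l\<close> are not truncated and agree with the integer exponents of the
  theorem.\<close>

lemma dim_V_less: "dim V + 1 \<le> CARD('n)"
proof -
  have "dim (span (insert (\<chi> i. 1) V)) = dim V + 1" by (rule dim_span_insert[OF ones_notin_V])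
  moreover have "dim (span (insert (\<chi> i. 1) V)) \<le> DIM(real ^ 'n)" by (rule dim_subset_UNIV)
  ultimately show ?thesis by simp
qed

text \<open>The supremum of naturals needs boundedness. A compact face contains only minimal
  exponents: an exponent \<open>\<alpha>\<close> on it above some other \<open>\<gamma>\<close>
  would be interior to the segments from \<open>\<gamma>\<close> to points beyond
  \<open>\<alpha>\<close>, so the face would contain a whole ray. Hence there are only finitely many
  face polynomials.\<close>

lemma max_zero_order_le_sup:
  fixes P :: "'p::prime_card itself"
  assumes "compact_face f F"
  shows "max_zero_order P f F \<le> sup_zero_order P f"
proof -
  define G where "G = (\<lambda>A \<alpha>. if \<alpha> \<in> A then f \<alpha> else 0)"
  define m where "m = (\<lambda>g. Max (insert 0
     {zero_order g x | x :: 'p padic ^ 'n. (\<forall>i. x $ i \<noteq> 0) \<and> series_value g x = 0}))"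
  have face: "\<exists>A\<subseteq>min_supp f. face_polynomial f F = G A" if F: "compact_face f F" for F
  proof -
    define A where "A = {\<alpha>. f \<alpha> \<noteq> 0 \<and> real_vec \<alpha> \<in> F}"
    have "A \<subseteq> min_supp f"
    proof
      fix \<alpha> assume \<alpha>: "\<alpha> \<in> A"
      obtain \<gamma> where \<gamma>: "\<gamma> \<in> min_supp f" "\<And>i. \<gamma> $ i \<le> \<alpha> $ i" using exists_min_supp[of f \<alpha>] \<alpha> by (auto simp: A_def)
      have "\<gamma> = \<alpha>"
      proof (rule ccontr)
        assume ne: "\<gamma> \<noteq> \<alpha>"
        define v where "v = real_vec \<alpha> - real_vec \<gamma>"
        obtain i where "\<gamma> $ i \<noteq> \<alpha> $ i" using ne by (auto simp: vec_eq_iff)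
        hence "v $ i \<noteq> 0" by (simp add: v_def)
        hence v: "v \<noteq> 0" by auto
        have face: "F face_of N" "bounded F" using F by (auto simp: compact_face_def compact_imp_bounded)
        have "real_vec \<alpha> + t *\<^sub>R v \<in> F" if t: "t > 0" for t
        proof -
          have N1: "real_vec \<gamma> \<in> N" by (rule supp_in_N[OF min_supp_subset[OF \<gamma>(1)]])
          have N2: "real_vec \<alpha> + t *\<^sub>R v \<in> N"
          proof (rule N_up)
            show "real_vec \<alpha> \<in> N" using \<alpha> supp_in_N by (auto simp: A_def)
            fix i show "real_vec \<alpha> $ i \<le> (real_vec \<alpha> + t *\<^sub>R v) $ i"
              using \<gamma>(2)[of i] t by (simp add: v_def)
          qed
          have "real_vec \<alpha> = (1 - 1 / (1 + t)) *\<^sub>R real_vec \<gamma> + (1 / (1 + t)) *\<^sub>R (real_vec \<alpha> + t *\<^sub>R v)"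
          proof -
            have "(1 - 1 / (1 + t)) = t / (1 + t)" using t by (simp add: field_simps)
            hence "(1 - 1 / (1 + t)) *\<^sub>R real_vec \<gamma> + (1 / (1 + t)) *\<^sub>R (real_vec \<alpha> + t *\<^sub>R v)
              = (1 / (1 + t)) *\<^sub>R (t *\<^sub>R real_vec \<gamma> + (real_vec \<alpha> + t *\<^sub>R v))" by (simp add: scaleR_add_right)
            also have "t *\<^sub>R real_vec \<gamma> + (real_vec \<alpha> + t *\<^sub>R v) = (1 + t) *\<^sub>R real_vec \<alpha>"
              by (simp add: v_def scaleR_diff_right scaleR_add_left)
            finally show ?thesis using t by simp
          qed
          moreover have "real_vec \<gamma> \<noteq> real_vec \<alpha> + t *\<^sub>R v"
          proof
            assume "real_vec \<gamma> = real_vec \<alpha> + t *\<^sub>R v"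
            hence "(1 + t) *\<^sub>R v = 0" by (simp add: v_def scaleR_add_left algebra_simps)
            thus False using v t by simp
          qed
          ultimately have "real_vec \<alpha> \<in> open_segment (real_vec \<gamma>) (real_vec \<alpha> + t *\<^sub>R v)"
            unfolding in_segment using t by (intro conjI exI[of _ "1 / (1 + t)"]) auto
          thus ?thesis using face_ofD[OF face(1) _ N1 N2] \<alpha> by (auto simp: A_def)
        qed
        note ray = this
        obtain B where B: "\<And>x. x \<in> F \<Longrightarrow> norm x \<le> B" using face(2) by (auto simp: bounded_iff)
        define t where "t = (B + norm (real_vec \<alpha>) + 1) / norm v"
        have "norm (real_vec \<alpha>) \<le> B" using B \<alpha> by (auto simp: A_def)
        hence B0: "B \<ge> 0" by (rule order_trans[OF norm_ge_zero])
        have t: "t > 0" unfolding t_def using v B0 by (intro divide_pos_pos add_nonneg_pos) auto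
        have "norm (t *\<^sub>R v) = B + norm (real_vec \<alpha>) + 1" using t v B0 by (simp add: t_def)
        moreover have "norm (t *\<^sub>R v) \<le> norm (real_vec \<alpha> + t *\<^sub>R v) + norm (real_vec \<alpha>)"
          using norm_triangle_ineq4[of "real_vec \<alpha> + t *\<^sub>R v" "real_vec \<alpha>"] by simp
        ultimately show False using B[OF ray[OF t]] by linarith
      qed
      thus "\<alpha> \<in> min_supp f" using \<gamma>(1) by simp
    qed
    moreover have "face_polynomial f F = G A"
      by (auto simp: fun_eq_iff face_polynomial_def G_def A_def real_vec_def)
    ultimately show ?thesis by blast
  qed
  have mm: "max_zero_order P f F = m (face_polynomial f F)" for F
    by (simp add: max_zero_order_def m_def)
  have "(\<lambda>F. max_zero_order P f F) ` {F. compact_face f F} \<subseteq> (\<lambda>A. m (G A)) ` Pow (min_supp f)"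
    using face unfolding mm by fastforce
  hence "finite ((\<lambda>F. max_zero_order P f F) ` {F. compact_face f F})"
    by (rule finite_subset) (simp add: finite_min_supp)
  hence "bdd_above ((\<lambda>F. max_zero_order P f F) ` {F. compact_face f F})" by (rule bdd_above_finite)
  thus ?thesis unfolding sup_zero_order_def using assms by (intro cSUP_upper) auto
qed

end

section \<open>Values of the series at integer points\<close>

text \<open>By the ultrametric inequality a tail is no larger than the bound for its terms, however
  many there are.\<close>

lemma infsum_padic_approx:
  fixes g :: "'i \<Rightarrow> 'p::prime_card padic"
  assumes g: "g summable_on UNIV" and A: "finite A"
    and small: "\<And>\<alpha>. \<alpha> \<notin> A \<Longrightarrow> padic_norm (g \<alpha>) \<le> e" and e: "e > 0"
  shows "padic_norm (infsum g UNIV - sum g A) \<le> e"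
proof -
  have "(g has_sum infsum g UNIV) UNIV" using g by (rule has_sum_infsum)
  hence "(sum g \<longlongrightarrow> infsum g UNIV) (finite_subsets_at_top UNIV)" by (simp add: has_sum_def)
  hence "eventually (\<lambda>X. dist (sum g X) (infsum g UNIV) < e) (finite_subsets_at_top UNIV)"
    using e by (rule tendstoD)
  then obtain X where X: "finite X" "\<And>Y. finite Y \<Longrightarrow> X \<subseteq> Y \<Longrightarrow> dist (sum g Y) (infsum g UNIV) < e"
    unfolding eventually_finite_subsets_at_top by auto
  have "sum g (X \<union> A) = sum g (X \<union> A - A) + sum g A"
    by (rule sum.subset_diff) (use X A in auto)
  hence eq: "infsum g UNIV - sum g A = sum g (X \<union> A - A) - (sum g (X \<union> A) - infsum g UNIV)" by simp
  have "padic_norm (sum g (X \<union> A - A)) \<le> e"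
    by (rule padic_norm_sum_le) (use small e in auto)
  moreover have "padic_norm (sum g (X \<union> A) - infsum g UNIV) \<le> e"
    using X(2)[of "X \<union> A"] X(1) A by (simp add: dist_padic_def)
  ultimately have "max (padic_norm (sum g (X \<union> A - A))) (padic_norm (sum g (X \<union> A) - infsum g UNIV)) \<le> e" by simp
  with padic_norm_diff show ?thesis unfolding eq by (rule order_trans)
qed

lemma summable_near_origin:
  fixes f :: "nat ^ 'n \<Rightarrow> int"
  assumes "converges_near_origin TYPE('p::prime_card) f"
  shows "\<exists>m. \<forall>x :: 'p padic ^ 'n. (\<forall>i. padic_norm (x $ i) \<le> 1 / real CARD('p) ^ m) \<longrightarrow> series_term f x summable_on UNIV"
proof -
  obtain U :: "('p padic ^ 'n) set" where U: "open U" "0 \<in> U" "\<And>x. x \<in> U \<Longrightarrow> series_term f x summable_on UNIV"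
    using assms unfolding converges_near_origin_def by blast
  obtain e where e: "e > 0" "ball 0 e \<subseteq> U" using U(1,2) open_contains_ball by blast
  have "e / real CARD('n) > 0" using e(1) by simp
  then obtain m where m: "1 / real CARD('p) ^ m < e / real CARD('n)" by (rule padic_small[where 'p = 'p])
  have "series_term f x summable_on UNIV" if x: "\<And>i. padic_norm (x $ i) \<le> 1 / real CARD('p) ^ m" for x :: "'p padic ^ 'n"
  proof -
    have "dist 0 x \<le> (\<Sum>i\<in>UNIV. dist ((0 :: 'p padic ^ 'n) $ i) (x $ i))"
      unfolding dist_vec_def by (rule L2_set_le_sum) simp
    also have "\<dots> = (\<Sum>i\<in>UNIV. padic_norm (x $ i))"
      by (simp add: dist_padic_def padic_norm_minus)
    also have "\<dots> \<le> (\<Sum>i\<in>(UNIV :: 'n set). 1 / real CARD('p) ^ m)" by (intro sum_mono x)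
    also have "\<dots> = real CARD('n) * (1 / real CARD('p) ^ m)" by simp
    also have "\<dots> < real CARD('n) * (e / real CARD('n))" using m by (intro mult_strict_left_mono) auto
    finally have "x \<in> ball 0 e" by simp
    thus ?thesis using e(2) U(3) by blast
  qed
  thus ?thesis by blast
qed

context series
begin

text \<open>Terms of total degree at least \<open>l\<close> are divisible by \<open>p^l\<close> once
  every \<open>a_i\<close> is at least \<open>1\<close>. Minimal exponents of high degree are
  retained all the same, so that the weights are those of \<open>f\<close> for every
  \<open>l\<close>.\<close>

definition truncation :: "nat \<Rightarrow> (nat ^ 'n) set" where
  "truncation l = {\<alpha>. f \<alpha> \<noteq> 0 \<and> (total_degree \<alpha> < l \<or> \<alpha> \<in> min_supp f)}"

lemma truncation_facts:
  "finite (truncation l)" "min_supp f \<subseteq> truncation l" "\<forall>\<alpha>\<in>truncation l. f \<alpha> \<noteq> 0"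
proof -
  have "finite {\<alpha> :: nat ^ 'n. \<forall>i. \<alpha> $ i \<in> {..<l}}" by (rule finite_vec_box) simp
  moreover have "\<alpha> $ i < l" if "total_degree \<alpha> < l" for \<alpha> :: "nat ^ 'n" and i
    using vec_component_le_sum[of \<alpha> i] that by (simp add: total_degree_def)
  hence "truncation l \<subseteq> {\<alpha>. \<forall>i. \<alpha> $ i \<in> {..<l}} \<union> min_supp f" by (auto simp: truncation_def)
  ultimately show "finite (truncation l)" using finite_min_supp[of f] finite_subset by blast
qed (auto simp: truncation_def min_supp_def)

lemma scaled_exp_sum_eq:
  assumes conv: "\<And>x :: 'p::prime_card padic ^ 'n. (\<And>i. padic_norm (x $ i) \<le> 1 / real CARD('p) ^ m) \<Longrightarrow> series_term f x summable_on UNIV"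
    and a: "\<And>i. a $ i \<ge> 1" "\<And>i. a $ i \<ge> int m"
  shows "scaled_exp_sum TYPE('p) f a l = scaled_sum CARD('p) (\<chi> i. nat (a $ i)) (truncation l) l"
proof -
  define p where "p = CARD('p)"
  have p1: "p > 1" unfolding p_def using prime_gt_1_nat[OF prime_card[where 'a = 'p]] .
  define b where "b = (\<chi> i. nat (a $ i))"
  define A where "A = truncation l"
  have "padic_exp l (scaled_value f a x :: 'p padic) =
      padic_char p l (poly_value A (\<lambda>\<alpha>. int p ^ pairing b \<alpha> * f \<alpha>) x)" for x
  proof -
    define y :: "'p padic ^ 'n" where "y = (\<chi> i. of_nat CARD('p) powi (a $ i) * of_int (x $ i))"
    have yi: "y $ i = of_nat p ^ (b $ i) * of_int (x $ i)" for i
      using a(1)[of i] by (simp add: y_def b_def p_def power_int_def)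
    have ny: "padic_norm (y $ i) \<le> 1 / real p ^ m" for i
    proof -
      have "m \<le> b $ i" using a(2)[of i] by (simp add: b_def)
      hence "1 / real p ^ (b $ i) \<le> 1 / real p ^ m" using p1 by (intro divide_left_mono power_increasing) auto
      thus ?thesis using padic_norm_mult_le_1[OF padic_norm_of_int_le_1[of "x $ i", where 'p = 'p], of "of_nat p ^ (b $ i)"]
        unfolding yi by (simp add: mult.commute p_def padic_norm_prime_power)
    qed
    have term_eq: "series_term f y \<alpha> = of_int (int p ^ pairing b \<alpha> * f \<alpha> * (\<Prod>i\<in>UNIV. x $ i ^ (\<alpha> $ i)))" for \<alpha>
      by (simp add: series_term_def yi power_mult_distrib prod.distrib prime_power_prod mult_ac)
    have small: "padic_norm (series_term f y \<alpha>) \<le> 1 / real p ^ l" if "\<alpha> \<notin> A" for \<alpha>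
    proof (cases "f \<alpha> = 0")
      case True
      thus ?thesis by (simp add: series_term_def)
    next
      case False
      hence "l \<le> total_degree \<alpha>" using that by (auto simp: A_def truncation_def)
      also have "\<dots> \<le> pairing b \<alpha>"
        unfolding total_degree_def pairing_def
      proof (rule sum_mono)
        fix i
        have "1 \<le> b $ i" using a(1)[of i] by (simp add: b_def)
        thus "\<alpha> $ i \<le> b $ i * \<alpha> $ i" by simp
      qed
      finally have "int p ^ l dvd int p ^ pairing b \<alpha> * f \<alpha> * (\<Prod>i\<in>UNIV. x $ i ^ (\<alpha> $ i))"
        by (intro dvd_mult2 le_imp_power_dvd)
      thus ?thesis unfolding term_eq p_def by (simp only: padic_norm_of_int_le_iff)
    qed
    have "padic_norm (series_value f y - (\<Sum>\<alpha>\<in>A. series_term f y \<alpha>)) \<le> 1 / real p ^ l"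
      unfolding series_value_def
    proof (rule infsum_padic_approx)
      show "series_term f y summable_on UNIV" by (rule conv) (use ny in \<open>simp add: p_def\<close>)
    qed (use small p1 truncation_facts in \<open>auto simp: A_def\<close>)
    moreover have "(\<Sum>\<alpha>\<in>A. series_term f y \<alpha>) = of_int (poly_value A (\<lambda>\<alpha>. int p ^ pairing b \<alpha> * f \<alpha>) x)"
      by (simp only: term_eq poly_value_def of_int_sum)
    ultimately have "padic_cong_int l (scaled_value f a x :: 'p padic) (poly_value A (\<lambda>\<alpha>. int p ^ pairing b \<alpha> * f \<alpha>) x)"
      unfolding padic_cong_int_altdef scaled_value_def y_def[symmetric] p_def by simp
    from padic_exp_eq[OF this] show ?thesis
      by (simp add: padic_char_def cis_conv_exp p_def mult_ac)
  qed
  moreover have "{x :: int ^ 'n. \<forall>i. x $ i \<in> {0..int CARD('p) ^ l - 1}} = vec_box p (\<lambda>_. l)"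
    by (auto simp: vec_box_def p_def)
  ultimately show ?thesis unfolding scaled_exp_sum_def scaled_sum_def p_def[symmetric] b_def[symmetric] A_def[symmetric] by simp
qed

end

theorem theorem1p4:
  fixes f :: "nat ^ 'n \<Rightarrow> int"
  assumes "\<exists>\<alpha>. f \<alpha> \<noteq> 0"
    and "f 0 = 0"
    and "converges_near_origin TYPE('p::prime_card) f"
  shows "\<exists>M>0::real. \<forall>a :: int ^ 'n. (\<forall>i. real_of_int (a $ i) > M) \<longrightarrow> (\<exists>C>0::real. \<forall>l>0.
    (((\<forall>F. compact_face f F \<longrightarrow> real (max_zero_order TYPE('p) f F) \<le> newton_distance f) \<and>
      (\<forall>F. compact_face f F \<and> F \<subseteq> central_face f \<longrightarrow>
         real (max_zero_order TYPE('p) f F) < newton_distance f)) \<longrightarrow>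
      1 / real CARD('p) ^ (l * CARD('n)) * cmod (scaled_exp_sum TYPE('p) f a l)
        \<le> C * real l powi (int CARD('n) - aff_dim (central_face f) - 1)
            * real CARD('p) powr (- real l / newton_distance f)) \<and>
    (((\<forall>F. compact_face f F \<longrightarrow> real (max_zero_order TYPE('p) f F) \<le> newton_distance f) \<and>
      (\<exists>F. compact_face f F \<and> F \<subseteq> central_face f \<and>
         real (max_zero_order TYPE('p) f F) = newton_distance f)) \<longrightarrow>
      1 / real CARD('p) ^ (l * CARD('n)) * cmod (scaled_exp_sum TYPE('p) f a l)
        \<le> C * real l powi (int CARD('n) - aff_dim (central_face f))
            * real CARD('p) powr (- real l / newton_distance f)) \<and>
    ((\<exists>F. compact_face f F \<and> real (max_zero_order TYPE('p) f F) > newton_distance f) \<longrightarrow>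
      1 / real CARD('p) ^ (l * CARD('n)) * cmod (scaled_exp_sum TYPE('p) f a l)
        \<le> C * real CARD('p) powr (- real l / real (sup_zero_order TYPE('p) f))))"
proof -
  interpret series f by unfold_locales (fact assms(1), fact assms(2))
  define p where "p = CARD('p)"
  define s where "s = sup_zero_order TYPE('p) f"
  define E where "E = (\<lambda>b l. 1 / real p ^ (l * CARD('n)) * cmod (scaled_sum p b (truncation l) l))"
  define Ha where "Ha = ((\<forall>F. compact_face f F \<longrightarrow> real (max_zero_order TYPE('p) f F) \<le> d) \<and>
      (\<forall>F. compact_face f F \<and> F \<subseteq> C \<longrightarrow> real (max_zero_order TYPE('p) f F) < d))"
  define Hb where "Hb = ((\<forall>F. compact_face f F \<longrightarrow> real (max_zero_order TYPE('p) f F) \<le> d) \<and>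
      (\<exists>F. compact_face f F \<and> F \<subseteq> C \<and> real (max_zero_order TYPE('p) f F) = d))"
  define Hc where "Hc = (\<exists>F. compact_face f F \<and> real (max_zero_order TYPE('p) f F) > d)"
  define Ra where "Ra = (\<lambda>l::nat. real l ^ (CARD('n) - (dim V + 1)) * real p powr (- real l / d))"
  define Rb where "Rb = (\<lambda>l::nat. real l ^ (CARD('n) - dim V) * real p powr (- real l / d))"
  define Rc where "Rc = (\<lambda>l::nat. real p powr (- real l / real s))"
  have restrict: "\<exists>T. \<forall>b. (\<forall>i. b $ i \<ge> T) \<longrightarrow> (\<exists>K>0. \<forall>l>0. E b l \<le> K * R l)"
    if ex: "\<exists>T. \<forall>b. (\<forall>i. b $ i \<ge> T) \<longrightarrow> (\<exists>K>0. \<forall>l>0. \<forall>A. finite A \<longrightarrow> min_supp f \<subseteq> A \<longrightarrow> (\<forall>\<alpha>\<in>A. f \<alpha> \<noteq> 0) \<longrightarrow>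
    1 / real CARD('p) ^ (l * CARD('n)) * cmod (scaled_sum CARD('p) b A l) \<le> K * R l)" for R
  proof -
    obtain T where T: "\<forall>b. (\<forall>i. b $ i \<ge> T) \<longrightarrow> (\<exists>K>0. \<forall>l>0. \<forall>A. finite A \<longrightarrow> min_supp f \<subseteq> A \<longrightarrow> (\<forall>\<alpha>\<in>A. f \<alpha> \<noteq> 0) \<longrightarrow>
    1 / real CARD('p) ^ (l * CARD('n)) * cmod (scaled_sum CARD('p) b A l) \<le> K * R l)" using ex ..
    have "\<exists>K>0. \<forall>l>0. E b l \<le> K * R l" if b: "\<forall>i. b $ i \<ge> T" for b
    proof -
      obtain K where K: "K > 0" "\<forall>l>0. \<forall>A. finite A \<longrightarrow> min_supp f \<subseteq> A \<longrightarrow> (\<forall>\<alpha>\<in>A. f \<alpha> \<noteq> 0) \<longrightarrow>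
        1 / real CARD('p) ^ (l * CARD('n)) * cmod (scaled_sum CARD('p) b A l) \<le> K * R l"
        using T[rule_format, OF spec[OF b]] by (elim exE conjE)
      have "E b l \<le> K * R l" if "l > 0" for l
        unfolding E_def p_def by (rule K(2)[rule_format, OF that]) (use truncation_facts in auto)
      thus ?thesis using K(1) by blast
    qed
    thus ?thesis by blast
  qed
  have "\<exists>T. \<forall>b. (\<forall>i. b $ i \<ge> T) \<longrightarrow> (\<exists>K>0. \<forall>l>0. E b l \<le> K * Ra l)" if Ha
    unfolding Ra_def p_def by (rule restrict, rule estimate_a[where 'p = 'p]) (use that in \<open>auto simp: Ha_def\<close>)
  \<comment> \<open>The threshold is fixed before it is known which hypothesis holds; if that of (a)
    fails, any value will do. This allows a single \<open>M\<close> for the three cases.\<close>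
  then obtain Ta where Ta: "\<And>b. Ha \<Longrightarrow> (\<forall>i. b $ i \<ge> Ta) \<Longrightarrow> \<exists>K>0. \<forall>l>0. E b l \<le> K * Ra l" by metis
  have "\<exists>T. \<forall>b. (\<forall>i. b $ i \<ge> T) \<longrightarrow> (\<exists>K>0. \<forall>l>0. E b l \<le> K * Rb l)" if Hb
    unfolding Rb_def p_def by (rule restrict, rule estimate_b[where 'p = 'p]) (use that in \<open>auto simp: Hb_def\<close>)
  then obtain Tb where Tb: "\<And>b. Hb \<Longrightarrow> (\<forall>i. b $ i \<ge> Tb) \<Longrightarrow> \<exists>K>0. \<forall>l>0. E b l \<le> K * Rb l" by metis
  have "\<exists>T. \<forall>b. (\<forall>i. b $ i \<ge> T) \<longrightarrow> (\<exists>K>0. \<forall>l>0. E b l \<le> K * Rc l)" if Hc: Hc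
    unfolding Rc_def p_def
  proof (rule restrict, rule estimate_c[where 'p = 'p])
    obtain F where F: "compact_face f F" "real (max_zero_order TYPE('p) f F) > d" using Hc by (auto simp: Hc_def)
    have "real (max_zero_order TYPE('p) f F) \<le> real s"
      unfolding s_def by (intro of_nat_mono max_zero_order_le_sup F(1))
    thus "d < real s" using F(2) by linarith
  qed (simp add: s_def max_zero_order_le_sup)
  then obtain Tc where Tc: "\<And>b. Hc \<Longrightarrow> (\<forall>i. b $ i \<ge> Tc) \<Longrightarrow> \<exists>K>0. \<forall>l>0. E b l \<le> K * Rc l" by metis
  obtain m where m: "\<forall>x :: 'p padic ^ 'n. (\<forall>i. padic_norm (x $ i) \<le> 1 / real CARD('p) ^ m) \<longrightarrow> series_term f x summable_on UNIV"
    using summable_near_origin[OF assms(3)] ..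
  \<comment> \<open>The three thresholds, the exponent \<open>m\<close> that places the scaled
    points in the region of convergence, and \<open>1\<close> to make every \<open>a_i\<close>
    positive.\<close>
  define M where "M = real (Ta + Tb + Tc + m + 1)"
  show ?thesis
    unfolding Ha_def[symmetric] Hb_def[symmetric] Hc_def[symmetric] s_def[symmetric] p_def[symmetric]
  proof (rule exI[of _ M], intro conjI allI impI)
    show "M > 0" by (simp add: M_def)
    fix a :: "int ^ 'n" assume "\<forall>i. M < real_of_int (a $ i)"
    hence a: "int (Ta + Tb + Tc + m + 1) < a $ i" for i
      unfolding M_def by (metis of_int_less_iff of_int_of_nat_eq)
    define b where "b = (\<chi> i. nat (a $ i))"
    have b: "\<forall>i. b $ i \<ge> Ta" "\<forall>i. b $ i \<ge> Tb" "\<forall>i. b $ i \<ge> Tc"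
    proof -
      have "b $ i \<ge> Ta + Tb + Tc" for i using a[of i] by (simp add: b_def)
      thus "\<forall>i. b $ i \<ge> Ta" "\<forall>i. b $ i \<ge> Tb" "\<forall>i. b $ i \<ge> Tc" by (meson le_trans le_add1 le_add2)+
    qed
    have E: "1 / real p ^ (l * CARD('n)) * cmod (scaled_exp_sum TYPE('p) f a l) = E b l" for l
    proof -
      have "a $ i \<ge> 1" "a $ i \<ge> int m" for i using a[of i] by auto
      thus ?thesis unfolding E_def b_def p_def by (subst scaled_exp_sum_eq[where m = m]) (use m in auto)
    qed
    obtain Ka where Ka: "Ka > 0" "\<And>l. Ha \<Longrightarrow> l > 0 \<Longrightarrow> E b l \<le> Ka * Ra l"
      using Ta[OF _ b(1)] by (metis zero_less_one)
    obtain Kb where Kb: "Kb > 0" "\<And>l. Hb \<Longrightarrow> l > 0 \<Longrightarrow> E b l \<le> Kb * Rb l"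
      using Tb[OF _ b(2)] by (metis zero_less_one)
    obtain Kc where Kc: "Kc > 0" "\<And>l. Hc \<Longrightarrow> l > 0 \<Longrightarrow> E b l \<le> Kc * Rc l"
      using Tc[OF _ b(3)] by (metis zero_less_one)
    define K where "K = Ka + Kb + Kc"
    have K: "K > 0" "Ka \<le> K" "Kb \<le> K" "Kc \<le> K" using Ka(1) Kb(1) Kc(1) by (auto simp: K_def)
    have nn: "Ra l \<ge> 0" "Rb l \<ge> 0" "Rc l \<ge> 0" for l by (simp_all add: Ra_def Rb_def Rc_def)
    have ea: "int CARD('n) - aff_dim C - 1 = int (CARD('n) - (dim V + 1))"
      using dim_V_less by (simp add: dim_V of_nat_diff)
    have eb: "int CARD('n) - aff_dim C = int (CARD('n) - dim V)"
      using dim_V_less by (simp add: dim_V of_nat_diff)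
    show "\<exists>Ca>0. \<forall>l>0.
       (Ha \<longrightarrow> 1 / real p ^ (l * CARD('n)) * cmod (scaled_exp_sum TYPE('p) f a l)
          \<le> Ca * real l powi (int CARD('n) - aff_dim C - 1) * real p powr (- real l / d)) \<and>
       (Hb \<longrightarrow> 1 / real p ^ (l * CARD('n)) * cmod (scaled_exp_sum TYPE('p) f a l)
          \<le> Ca * real l powi (int CARD('n) - aff_dim C) * real p powr (- real l / d)) \<and>
       (Hc \<longrightarrow> 1 / real p ^ (l * CARD('n)) * cmod (scaled_exp_sum TYPE('p) f a l) \<le> Ca * real p powr (- real l / real s))"
      unfolding E ea unfolding eb power_int_of_nat
    proof (rule exI[of _ K], rule conjI[OF K(1)], intro allI impI)
      fix l :: nat assume l: "l > 0"
      have 1: "E b l \<le> K * real l ^ (CARD('n) - (dim V + 1)) * real p powr (- real l / d)" if Ha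
      proof -
        have "E b l \<le> K * Ra l" using Ka(2)[OF that l] mult_right_mono[OF K(2) nn(1)] by (rule order_trans)
        thus ?thesis by (simp add: Ra_def mult.assoc)
      qed
      have 2: "E b l \<le> K * real l ^ (CARD('n) - dim V) * real p powr (- real l / d)" if Hb
      proof -
        have "E b l \<le> K * Rb l" using Kb(2)[OF that l] mult_right_mono[OF K(3) nn(2)] by (rule order_trans)
        thus ?thesis by (simp add: Rb_def mult.assoc)
      qed
      have 3: "E b l \<le> K * real p powr (- real l / real s)" if Hc
      proof -
        have "E b l \<le> K * Rc l" using Kc(2)[OF that l] mult_right_mono[OF K(4) nn(3)] by (rule order_trans)
        thus ?thesis by (simp add: Rc_def)
      qed
      show "(Ha \<longrightarrow> E b l \<le> K * real l ^ (CARD('n) - (dim V + 1)) * real p powr (- real l / d)) \<and>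
        (Hb \<longrightarrow> E b l \<le> K * real l ^ (CARD('n) - dim V) * real p powr (- real l / d)) \<and>
        (Hc \<longrightarrow> E b l \<le> K * real p powr (- real l / real s))"
        using 1 2 3 by blast
    qed
  qed
qed

end
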